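(* Suppose the standing Assumptions A, B, C, D listed in the context hold. For $\delta>0$ let $\overline{\mathcal B}(\vartheta_1^0,\delta):=\{\vartheta_1\in\Theta_1:\|\vartheta_1-\vartheta_1^0\|>\delta\}$. Then for any $\delta>0$ $$\lim_{n\to\infty}\mathbb P\Big(\inf_{\vartheta\in\overline{\mathcal B}(\vartheta_1^0,\delta)\times\Theta_2}\widehat{\mathcal L}_n(\vartheta)-\widehat{\mathcal L}_n(\vartheta^0)>0\Big)=1 .$$
   Context: Norms: Euclidean for vectors, Frobenius for matrices. Model. Fix $h>0$, integers $c\le\min(d,m)\le N$, and $\Theta=\Theta_1\times\Theta_2$ with $\Theta_i\subset\mathbb R^{s_i}$, $s=s_1+s_2$; write $\vartheta=(\vartheta_1^{\mathsf T},\vartheta_2^{\mathsf T})^{\mathsf T}$ ($\vartheta_1$: long-run, $\vartheta_2$: short-run parameters). For $\vartheta\in\Theta$ the matrix $C_{1,\vartheta}=C_{1,\vartheta_1}\in\mathbb R^{d\times c}$ depends only on $\vartheta_1$, while $A_{2,\vartheta}\in\mathbb R^{(N-c)\times(N-c)}$, $B_{1,\vartheta}\in\mathbb R^{c\times m}$, $B_{2,\vartheta}\in\mathbb R^{(N-c)\times m}$, $C_{2,\vartheta}\in\mathbb R^{d\times(N-c)}$ and the two-sided $\mathbb R^m$-valued Lévy process $L_\vartheta=(L_\vartheta(t))_{t\in\mathbb R}$ ($L_\vartheta(0)=0$, stationary independent increments, càdlàg paths; only its covariance matrix is parametrized) depend only on $\vartheta_2$. With a $c$-dimensional random vector $Z$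 put $Y_{st,\vartheta}(t)=\int_{-\infty}^tC_{2,\vartheta}e^{A_{2,\vartheta}(t-u)}B_{2,\vartheta}\,dL_\vartheta(u)$ and $Y_\vartheta(t)=C_{1,\vartheta}Z+C_{1,\vartheta}B_{1,\vartheta}L_\vartheta(t)+Y_{st,\vartheta}(t)$, $t\in\mathbb R$. The true parameter is $\vartheta^0=(\vartheta_1^0,\vartheta_2^0)$; matrices and processes without index $\vartheta$ are taken at $\vartheta^0$. Put $Y_k=Y(kh)$, $k\in\mathbb Z$; observed are $Y_1,\dots,Y_n$. Assumption A. For every $\vartheta\in\Theta$: (A1) $\Theta$ is compact. (A2) $\vartheta^0$ lies in the interior of $\Theta$. (A3) $L_\vartheta$ has mean zero and non-singular covariance matrix $\Sigma^L_\vartheta=\mathbb E[L_\vartheta(1)L_\vartheta(1)^{\mathsf T}]$, and there is $\delta>0$ with $\mathbb E\|L_\vartheta(1)\|^{4+\delta}<\infty$ for all $\vartheta$. (A4) The eigenvalues of $A_{2,\vartheta}$ have strictly negative real parts. (A5) $(A_{2,\vartheta},B_{2,\vartheta},C_{2,\vartheta})$ is minimal with McMillan degree $N-c$. (A6) $B_{1,\vartheta}$ and $C_{1,\vartheta}$ have full rank $c$. (A7) $Z$ does not depend on $\vartheta$, $\mathbb E\|Z\|^2<\infty$, $Z$ is independent of $L_\vartheta$. (A8) $\vartheta\mapsto A_{2,\vartheta},B_{i,\vartheta},C_{i,\vartheta}$ ($i=1,2$), $\Sigma^L_\vartheta$ and $\vartheta_1\mapsto C_{1,\vartheta_1}^{\perp}$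 are three times continuously differentiable, where $C_{1,\vartheta_1}^\perp\in\mathbb R^{d\times(d-c)}$ is the uniquely chosen lower triangular matrix with $C_{1,\vartheta_1}^{\perp\mathsf T}C_{1,\vartheta_1}^\perp=I_{d-c}$ and $C_{1,\vartheta_1}^{\perp\mathsf T}C_{1,\vartheta_1}=0$. (A9) With $A_\vartheta:=\mathrm{diag}(0_{c\times c},A_{2,\vartheta})$, $B_\vartheta:=(B_{1,\vartheta}^{\mathsf T},B_{2,\vartheta}^{\mathsf T})^{\mathsf T}$, $C_\vartheta:=(C_{1,\vartheta},C_{2,\vartheta})$, the matrix $C_\vartheta$ has full rank $d\le N$. (A10) $\lambda-\lambda'\ne 2\pi i k/h$ for all eigenvalues $\lambda,\lambda'$ of $A_\vartheta$ and all $k\in\mathbb Z\setminus\{0\}$. Likelihood. Let $\Sigma_\vartheta:=\int_0^he^{A_\vartheta u}B_\vartheta\Sigma^L_\vartheta B_\vartheta^{\mathsf T}e^{A_\vartheta^{\mathsf T}u}du$, let $\Omega_\vartheta$ be the unique positive semidefinite solution of $\Omega=e^{A_\vartheta h}\Omega e^{A_\vartheta^{\mathsf T}h}-e^{A_\vartheta h}\Omega C_\vartheta^{\mathsf T}(C_\vartheta\Omega C_\vartheta^{\mathsf T})^{-1}C_\vartheta\Omega e^{A_\vartheta^{\mathsf T}h}+\Sigma_\vartheta$, and put $V_\vartheta:=C_\vartheta\Omega_\vartheta C_\vartheta^{\mathsf T}$, $K_\vartheta:=e^{A_\vartheta h}\Omega_\vartheta C_\vartheta^{\mathsf T}V_\vartheta^{-1}$,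 $F_\vartheta:=e^{A_\vartheta h}-K_\vartheta C_\vartheta$ (all eigenvalues of $F_\vartheta$ lie in the open unit disc). For given starting values $\widehat X_1(\vartheta)$ define recursively $\widehat X_k(\vartheta)=F_\vartheta\widehat X_{k-1}(\vartheta)+K_\vartheta Y_{k-1}$, $\widehat\varepsilon_k(\vartheta)=Y_k-C_\vartheta\widehat X_k(\vartheta)$ and $$\widehat{\mathcal L}_n(\vartheta)=\frac1n\sum_{k=1}^n\big[d\log2\pi+\log\det V_\vartheta+\widehat\varepsilon_k(\vartheta)^{\mathsf T}V_\vartheta^{-1}\widehat\varepsilon_k(\vartheta)\big].$$ Assumption B. $\mathbb E\sup_{\vartheta\in\Theta}\|\widehat X_1(\vartheta)\|^2$, $\mathbb E\sup_\vartheta\|\partial_u\widehat X_1(\vartheta)\|^2$, $\mathbb E\sup_\vartheta\|\partial_{u,v}\widehat X_1(\vartheta)\|^2$ are finite for all $u,v\in\{1,\dots,s\}$, and $\widehat X_1(\vartheta)$ is independent of $(L_\vartheta(t))_{t\ge0}$. Assumption C. There is $\mathfrak C^*>0$ with $\|C_{1,\vartheta_1}^{\perp\mathsf T}C_1\|\ge\mathfrak C^*\|\vartheta_1-\vartheta_1^0\|$ for all $\vartheta\in\Theta$. Assumption D. For every $\vartheta_2\in\Theta_2$, $\vartheta_2\neq\vartheta_2^0$, with $\tilde\vartheta=(\vartheta_1^0,\vartheta_2)$, there is $z\in\mathbb C$ such that $C_{\tilde\vartheta}[I_N-F_{\tilde\vartheta}z]^{-1}K_{\tilde\vartheta}\ne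 C_{\vartheta^0}[I_N-F_{\vartheta^0}z]^{-1}K_{\vartheta^0}$ or $V_{\tilde\vartheta}\neq V_{\vartheta^0}$. *)

theory Defs
  imports "HOL-Probability.Probability"
begin

text \<open>
  Matrices have type \<open>real^'n^'m\<close> (\<open>m\<close> rows, \<open>n\<close> columns); the library norm on this type is the
  Frobenius norm. The library operations \<open>*\<close> and \<open>^\<close> on \<open>real^'n^'n\<close> are componentwise, hence the
  explicit iteration of \<open>**\<close> in the exponential series.
\<close>

definition mat_exp :: "real^'n::finite^'n \<Rightarrow> real^'n^'n" where
  "mat_exp A = (\<Sum>k. (1 / fact k) *\<^sub>R ((\<lambda>X. A ** X) ^^ k) (mat 1))"

definition cmat :: "real^'n::finite^'m::finite \<Rightarrow> complex^'n^'m" where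
  "cmat A = map_matrix complex_of_real A"

definition complex_eigenvalue :: "real^'n::finite^'n \<Rightarrow> complex \<Rightarrow> bool" where
  "complex_eigenvalue A z \<longleftrightarrow> (\<exists>v. v \<noteq> 0 \<and> cmat A *v v = z *s v)"

definition pos_semidef :: "real^'n::finite^'n \<Rightarrow> bool" where
  "pos_semidef A \<longleftrightarrow> transpose A = A \<and> (\<forall>x. 0 \<le> x \<bullet> (A *v x))"

text \<open>
  Lower triangularity of a rectangular matrix: rows and columns are indexed by finite linear orders,
  and the position of an index is the number of its predecessors.
\<close>

definition index_pos :: "'i::{finite,linorder} \<Rightarrow> nat" where
  "index_pos i = card {..<i}"

definition lower_triangular :: "real^'n::{finite,linorder}^'m::{finite,linorder} \<Rightarrow> bool" where
  "lower_triangular A \<longleftrightarrow> (\<forall>i j. index_pos i < index_pos j \<longrightarrow> A $ i $ j = 0)"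

section \<open>Minimal realizations\<close>

text \<open>The transfer function \<open>z \<mapsto> C (z I - A)\<^sup>-\<^sup>1 B\<close>; \<open>mat z\<close> is \<open>z\<close> times the identity.\<close>

definition transfer_fun ::
  "real^'n::finite^'n \<Rightarrow> real^'m::finite^'n \<Rightarrow> real^'n^'d::finite \<Rightarrow> complex \<Rightarrow> complex^'m^'d" where
  "transfer_fun A B C z = cmat C ** matrix_inv (mat z - cmat A) ** cmat B"

text \<open>
  A triple with state space \<open>\<real>\<^sup>S\<close> for \<open>S \<subseteq> 'n\<close>, padded with zeros outside \<open>S\<close>. Letting \<open>S\<close> range over
  the proper subsets of \<open>'n\<close> gives all triples with state dimension \<open>0, \<dots>, CARD('n) - 1\<close>; the padding
  does not change the transfer function, except that \<open>z = 0\<close> becomes a singular point.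
\<close>

definition state_supported_on ::
  "'n set \<Rightarrow> real^'n::finite^'n \<Rightarrow> real^'m::finite^'n \<Rightarrow> real^'n^'d::finite \<Rightarrow> bool" where
  "state_supported_on S A B C \<longleftrightarrow>
     (\<forall>i j. i \<notin> S \<or> j \<notin> S \<longrightarrow> A $ i $ j = 0) \<and>
     (\<forall>i j. i \<notin> S \<longrightarrow> B $ i $ j = 0) \<and>
     (\<forall>i j. j \<notin> S \<longrightarrow> C $ i $ j = 0)"

text \<open>
  Minimality: no triple with a smaller state space has the same transfer function. The McMillan degree
  of the transfer function is then \<open>CARD('n)\<close>. Two transfer functions are rational and are
  compared wherever both resolvents exist (all but finitely many points).
\<close>

definition minimal_triple ::
  "real^'n::finite^'n \<Rightarrow> real^'m::finite^'n \<Rightarrow> real^'n^'d::finite \<Rightarrow> bool" where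
  "minimal_triple A B C \<longleftrightarrow>
     \<not> (\<exists>S A' (B' :: real^'m^'n) (C' :: real^'n^'d). S \<subset> UNIV \<and> state_supported_on S A' B' C' \<and>
          (\<forall>z. invertible (mat z - cmat A) \<and> invertible (mat z - cmat A') \<longrightarrow>
               transfer_fun A B C z = transfer_fun A' B' C' z))"

section \<open>Smoothness in the parameter\<close>

primrec ktimes_cont_diff_on ::
  "nat \<Rightarrow> 'a::real_normed_vector set \<Rightarrow> ('a \<Rightarrow> 'b::real_normed_vector) \<Rightarrow> bool" where
  "ktimes_cont_diff_on 0 U f \<longleftrightarrow> continuous_on U f"
| "ktimes_cont_diff_on (Suc k) U f \<longleftrightarrow>
     (\<forall>x\<in>U. f differentiable (at x)) \<and>
     (\<forall>v. ktimes_cont_diff_on k U (\<lambda>x. frechet_derivative f (at x) v))"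

text \<open>On the (compact) parameter set, smoothness means smoothness of an extension to an open neighbourhood.\<close>

definition smooth3_on ::
  "'a::real_normed_vector set \<Rightarrow> ('a \<Rightarrow> 'b::real_normed_vector) \<Rightarrow> bool" where
  "smooth3_on S f \<longleftrightarrow>
     (\<exists>U g. open U \<and> S \<subseteq> U \<and> (\<forall>x\<in>S. g x = f x) \<and> ktimes_cont_diff_on 3 U g)"

section \<open>Two-sided Levy processes and Wiener integrals with respect to them\<close>

definition cadlag :: "(real \<Rightarrow> 'b::topological_space) \<Rightarrow> bool" where
  "cadlag x \<longleftrightarrow> (\<forall>t. (x \<longlongrightarrow> x t) (at_right t) \<and> (\<exists>l. (x \<longlongrightarrow> l) (at_left t)))"

definition two_sided_levy :: "'w measure \<Rightarrow> (real \<Rightarrow> 'w \<Rightarrow> 'b::euclidean_space) \<Rightarrow> bool" where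
  "two_sided_levy M X \<longleftrightarrow>
     (\<forall>t. X t \<in> borel_measurable M) \<and>
     (AE \<omega> in M. X 0 \<omega> = 0) \<and>
     (AE \<omega> in M. cadlag (\<lambda>t. X t \<omega>)) \<and>
     (\<forall>s t r. distr M borel (\<lambda>\<omega>. X (t + r) \<omega> - X (s + r) \<omega>) = distr M borel (\<lambda>\<omega>. X t \<omega> - X s \<omega>)) \<and>
     (\<forall>n (\<tau> :: nat \<Rightarrow> real). (\<forall>i<n. \<tau> i < \<tau> (Suc i)) \<longrightarrow>
        prob_space.indep_vars M (\<lambda>_. borel) (\<lambda>i \<omega>. X (\<tau> (Suc i)) \<omega> - X (\<tau> i) \<omega>) {..<n})"

definition indep_of_process ::
  "'w measure \<Rightarrow> ('w \<Rightarrow> 'a::topological_space) \<Rightarrow> real set \<Rightarrow> (real \<Rightarrow> 'w \<Rightarrow> 'b::topological_space) \<Rightarrow> bool" where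
  "indep_of_process M \<xi> T X \<longleftrightarrow>
     prob_space.indep_set M
       (sets (vimage_algebra (space M) \<xi> borel))
       (sets (vimage_algebra (space M) (\<lambda>\<omega>. \<lambda>t\<in>T. X t \<omega>) (PiM T (\<lambda>_. borel))))"

text \<open>
  A list of triples \<open>(a, b, G)\<close> stands for the matrix-valued step function \<open>\<Sum> G 1\<^bsub>(a,b]\<^esub>\<close>,
  whose integral with respect to \<open>X\<close> is \<open>\<Sum> G (X b - X a)\<close>.
\<close>

definition step_fun :: "(real \<times> real \<times> (real^'m::finite^'d::finite)) list \<Rightarrow> real \<Rightarrow> real^'m^'d" where
  "step_fun gs u = (\<Sum>(a, b, G)\<leftarrow>gs. indicator {a<..b} u *\<^sub>R G)"

definition step_integral ::
  "(real \<Rightarrow> 'w \<Rightarrow> real^'m::finite) \<Rightarrow> (real \<times> real \<times> (real^'m^'d::finite)) list \<Rightarrow> 'w \<Rightarrow> real^'d" where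
  "step_integral X gs \<omega> = (\<Sum>(a, b, G)\<leftarrow>gs. G *v (X b \<omega> - X a \<omega>))"

text \<open>
  \<open>I\<close> is (a version of) \<open>\<integral> f(u) dX(u)\<close> over the whole real line: the \<open>L\<^sup>2\<close>-limit of integrals of step
  functions converging to \<open>f\<close> in \<open>L\<^sup>2\<close>. For a centred square-integrable Levy process \<open>X\<close> the limit
  does not depend, up to null sets, on the approximating sequence.
\<close>

definition has_levy_integral ::
  "'w measure \<Rightarrow> (real \<Rightarrow> 'w \<Rightarrow> real^'m::finite) \<Rightarrow> (real \<Rightarrow> real^'m^'d::finite) \<Rightarrow> ('w \<Rightarrow> real^'d) \<Rightarrow> bool" where
  "has_levy_integral M X f I \<longleftrightarrow>
     I \<in> borel_measurable M \<and>
     (\<exists>gs. (\<forall>n. \<forall>(a, b, G)\<in>set (gs n). a \<le> b) \<and>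
        ((\<lambda>n. \<integral>\<^sup>+u. ennreal ((norm (f u - step_fun (gs n) u))\<^sup>2) \<partial>lborel) \<longlonglongrightarrow> 0) \<and>
        ((\<lambda>n. \<integral>\<^sup>+\<omega>. ennreal ((norm (I \<omega> - step_integral X (gs n) \<omega>))\<^sup>2) \<partial>M) \<longlonglongrightarrow> 0))"

section \<open>The parametric family of cointegrated state space models\<close>

text \<open>
  Dimensions are cardinalities of index types: \<open>'s1\<close>, \<open>'s2\<close> for the long-run and short-run
  parameters, \<open>'c\<close> for \<open>c\<close>, \<open>'k\<close> for \<open>N - c\<close>, \<open>'d\<close> for \<open>d\<close>, \<open>'e\<close> for \<open>d - c\<close> and \<open>'m\<close> for \<open>m\<close>;
  the state space \<open>\<real>\<^sup>N\<close> is \<open>real^('c + 'k)\<close>. Index types are nonempty, so parameter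
  dimensions are positive; if \<open>c = 0\<close>, \<open>c = d\<close> or
  \<open>N = c\<close> were allowed, the long-run identifiability condition would force \<open>\<Theta>\<^sub>1 = {\<theta>\<^sub>1\<^sup>0}\<close>,
  contradicting that \<open>\<theta>\<^sup>0\<close> is an interior point.

  Functions of the parameter are total; only their values on \<open>\<Theta>\<close> matter (for the starting
  values \<open>Xhat1\<close>: on a neighbourhood of \<open>\<Theta>\<close>, where they are differentiated).
  \<open>C1perp\<close> is the chosen orthonormal lower triangular complement of \<open>C1\<close>. \<open>Yst \<theta>\<^sub>2 t\<close> is a
  version of the stochastic integral defining the stationary part of the output process.
\<close>

record ('w, 's1, 's2, 'c, 'k, 'd, 'e, 'm) coint_model =
  Pr :: "'w measure"
  mesh :: real
  Theta1 :: "(real^'s1) set"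
  Theta2 :: "(real^'s2) set"
  true1 :: "real^'s1"
  true2 :: "real^'s2"
  A2 :: "real^'s2 \<Rightarrow> real^'k^'k"
  B1 :: "real^'s2 \<Rightarrow> real^'m^'c"
  B2 :: "real^'s2 \<Rightarrow> real^'m^'k"
  C1 :: "real^'s1 \<Rightarrow> real^'c^'d"
  C2 :: "real^'s2 \<Rightarrow> real^'k^'d"
  C1perp :: "real^'s1 \<Rightarrow> real^'e^'d"
  Levy :: "real^'s2 \<Rightarrow> real \<Rightarrow> 'w \<Rightarrow> real^'m"
  Zinit :: "'w \<Rightarrow> real^'c"
  Yst :: "real^'s2 \<Rightarrow> real \<Rightarrow> 'w \<Rightarrow> real^'d"
  Xhat1 :: "(real^'s1) \<times> (real^'s2) \<Rightarrow> 'w \<Rightarrow> real^('c + 'k)"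

definition Theta ::
  "('w, 's1::finite, 's2::finite, 'c::finite, 'k::finite, 'd::finite, 'e::finite, 'm::finite) coint_model
    \<Rightarrow> ((real^'s1) \<times> (real^'s2)) set" where
  "Theta \<M> = Theta1 \<M> \<times> Theta2 \<M>"

definition true_par ::
  "('w, 's1::finite, 's2::finite, 'c::finite, 'k::finite, 'd::finite, 'e::finite, 'm::finite) coint_model
    \<Rightarrow> (real^'s1) \<times> (real^'s2)" where
  "true_par \<M> = (true1 \<M>, true2 \<M>)"

definition SigmaL ::
  "('w, 's1::finite, 's2::finite, 'c::finite, 'k::finite, 'd::finite, 'e::finite, 'm::finite) coint_model
    \<Rightarrow> (real^'s1) \<times> (real^'s2) \<Rightarrow> real^'m^'m" where
  "SigmaL \<M> \<theta> = (\<chi> i j. \<integral>\<omega>. Levy \<M> (snd \<theta>) 1 \<omega> $ i * Levy \<M> (snd \<theta>) 1 \<omega> $ j \<partial>Pr \<M>)"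

definition A_mat ::
  "('w, 's1::finite, 's2::finite, 'c::finite, 'k::finite, 'd::finite, 'e::finite, 'm::finite) coint_model
    \<Rightarrow> (real^'s1) \<times> (real^'s2) \<Rightarrow> real^('c + 'k)^('c + 'k)" where
  "A_mat \<M> \<theta> = (\<chi> i j. case (i, j) of (Inr a, Inr b) \<Rightarrow> A2 \<M> (snd \<theta>) $ a $ b | _ \<Rightarrow> 0)"

definition B_mat ::
  "('w, 's1::finite, 's2::finite, 'c::finite, 'k::finite, 'd::finite, 'e::finite, 'm::finite) coint_model
    \<Rightarrow> (real^'s1) \<times> (real^'s2) \<Rightarrow> real^'m^('c + 'k)" where
  "B_mat \<M> \<theta> = (\<chi> i. case i of Inl a \<Rightarrow> B1 \<M> (snd \<theta>) $ a | Inr b \<Rightarrow> B2 \<M> (snd \<theta>) $ b)"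

definition C_mat ::
  "('w, 's1::finite, 's2::finite, 'c::finite, 'k::finite, 'd::finite, 'e::finite, 'm::finite) coint_model
    \<Rightarrow> (real^'s1) \<times> (real^'s2) \<Rightarrow> real^('c + 'k)^'d" where
  "C_mat \<M> \<theta> = (\<chi> i j. case j of Inl a \<Rightarrow> C1 \<M> (fst \<theta>) $ i $ a | Inr b \<Rightarrow> C2 \<M> (snd \<theta>) $ i $ b)"

definition Y_proc ::
  "('w, 's1::finite, 's2::finite, 'c::finite, 'k::finite, 'd::finite, 'e::finite, 'm::finite) coint_model
    \<Rightarrow> (real^'s1) \<times> (real^'s2) \<Rightarrow> real \<Rightarrow> 'w \<Rightarrow> real^'d" where
  "Y_proc \<M> \<theta> t \<omega> =
     C1 \<M> (fst \<theta>) *v Zinit \<M> \<omega> +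
     (C1 \<M> (fst \<theta>) ** B1 \<M> (snd \<theta>)) *v Levy \<M> (snd \<theta>) t \<omega> +
     Yst \<M> (snd \<theta>) t \<omega>"

definition Yobs ::
  "('w, 's1::finite, 's2::finite, 'c::finite, 'k::finite, 'd::finite, 'e::finite, 'm::finite) coint_model
    \<Rightarrow> nat \<Rightarrow> 'w \<Rightarrow> real^'d" where
  "Yobs \<M> k \<omega> = Y_proc \<M> (true_par \<M>) (real k * mesh \<M>) \<omega>"

definition model_setting ::
  "('w, 's1::finite, 's2::finite, 'c::finite, 'k::finite, 'd::finite,
    'e::finite, 'm::finite) coint_model \<Rightarrow> bool" where
  "model_setting \<M> \<longleftrightarrow>
     prob_space (Pr \<M>) \<and> 0 < mesh \<M> \<and>
     (let c = CARD('c); d = CARD('d); m = CARD('m); N = CARD('c + 'k)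
      in c \<le> min d m \<and> min d m \<le> N \<and> CARD('e) = d - c) \<and>
     (\<forall>\<theta>\<^sub>2\<in>Theta2 \<M>. two_sided_levy (Pr \<M>) (Levy \<M> \<theta>\<^sub>2)) \<and>
     Zinit \<M> \<in> borel_measurable (Pr \<M>) \<and>
     (\<forall>\<theta>\<^sub>2\<in>Theta2 \<M>. \<forall>t. has_levy_integral (Pr \<M>) (Levy \<M> \<theta>\<^sub>2)
        (\<lambda>u. indicator {..t} u *\<^sub>R (C2 \<M> \<theta>\<^sub>2 ** mat_exp ((t - u) *\<^sub>R A2 \<M> \<theta>\<^sub>2) ** B2 \<M> \<theta>\<^sub>2))
        (Yst \<M> \<theta>\<^sub>2 t)) \<and>
     (\<forall>\<theta>\<in>Theta \<M>. Xhat1 \<M> \<theta> \<in> borel_measurable (Pr \<M>))"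

definition assumption_A ::
  "('w, 's1::finite, 's2::finite, 'c::finite, 'k::finite, 'd::{finite,linorder},
    'e::{finite,linorder}, 'm::finite) coint_model \<Rightarrow> bool" where
  "assumption_A \<M> \<longleftrightarrow>
     (compact (Theta \<M>)) \<and>
     (true_par \<M> \<in> interior (Theta \<M>)) \<and>
     ((\<forall>\<theta>\<in>Theta \<M>. (\<integral>\<omega>. Levy \<M> (snd \<theta>) 1 \<omega> \<partial>Pr \<M>) = 0 \<and> invertible (SigmaL \<M> \<theta>)) \<and>
      (\<exists>\<delta>>0. \<forall>\<theta>\<in>Theta \<M>. integrable (Pr \<M>) (\<lambda>\<omega>. norm (Levy \<M> (snd \<theta>) 1 \<omega>) powr (4 + \<delta>)))) \<and>
     (\<forall>\<theta>\<in>Theta \<M>. \<forall>z. complex_eigenvalue (A2 \<M> (snd \<theta>)) z \<longrightarrow> Re z < 0) \<and>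
     (\<forall>\<theta>\<in>Theta \<M>. minimal_triple (A2 \<M> (snd \<theta>)) (B2 \<M> (snd \<theta>)) (C2 \<M> (snd \<theta>))) \<and>
     (\<forall>\<theta>\<in>Theta \<M>. rank (B1 \<M> (snd \<theta>)) = CARD('c) \<and> rank (C1 \<M> (fst \<theta>)) = CARD('c)) \<and>
     (integrable (Pr \<M>) (\<lambda>\<omega>. (norm (Zinit \<M> \<omega>))\<^sup>2) \<and>
      (\<forall>\<theta>\<in>Theta \<M>. indep_of_process (Pr \<M>) (Zinit \<M>) UNIV (Levy \<M> (snd \<theta>)))) \<and>
     (smooth3_on (Theta \<M>) (\<lambda>\<theta>. A2 \<M> (snd \<theta>)) \<and>
      smooth3_on (Theta \<M>) (\<lambda>\<theta>. B1 \<M> (snd \<theta>)) \<and>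
      smooth3_on (Theta \<M>) (\<lambda>\<theta>. B2 \<M> (snd \<theta>)) \<and>
      smooth3_on (Theta \<M>) (\<lambda>\<theta>. C1 \<M> (fst \<theta>)) \<and>
      smooth3_on (Theta \<M>) (\<lambda>\<theta>. C2 \<M> (snd \<theta>)) \<and>
      smooth3_on (Theta \<M>) (SigmaL \<M>) \<and>
      smooth3_on (Theta1 \<M>) (C1perp \<M>) \<and>
      (\<forall>\<theta>\<^sub>1\<in>Theta1 \<M>. lower_triangular (C1perp \<M> \<theta>\<^sub>1) \<and>
         transpose (C1perp \<M> \<theta>\<^sub>1) ** C1perp \<M> \<theta>\<^sub>1 = mat 1 \<and>
         transpose (C1perp \<M> \<theta>\<^sub>1) ** C1 \<M> \<theta>\<^sub>1 = 0)) \<and>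
     (CARD('d) \<le> CARD('c + 'k) \<and> (\<forall>\<theta>\<in>Theta \<M>. rank (C_mat \<M> \<theta>) = CARD('d))) \<and>
     (\<forall>\<theta>\<in>Theta \<M>. \<forall>z z'. complex_eigenvalue (A_mat \<M> \<theta>) z \<and> complex_eigenvalue (A_mat \<M> \<theta>) z' \<longrightarrow>
        (\<forall>k::int. k \<noteq> 0 \<longrightarrow> z - z' \<noteq> 2 * of_real pi * \<i> * of_int k / of_real (mesh \<M>)))"

section \<open>Kalman filter and quasi-likelihood\<close>

definition Sigma_h ::
  "('w, 's1::finite, 's2::finite, 'c::finite, 'k::finite, 'd::finite, 'e::finite, 'm::finite) coint_model
    \<Rightarrow> (real^'s1) \<times> (real^'s2) \<Rightarrow> real^('c + 'k)^('c + 'k)" where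
  "Sigma_h \<M> \<theta> = integral {0..mesh \<M>}
     (\<lambda>u. mat_exp (u *\<^sub>R A_mat \<M> \<theta>) ** B_mat \<M> \<theta> ** SigmaL \<M> \<theta> ** transpose (B_mat \<M> \<theta>) **
          mat_exp (u *\<^sub>R transpose (A_mat \<M> \<theta>)))"

definition eAh ::
  "('w, 's1::finite, 's2::finite, 'c::finite, 'k::finite, 'd::finite, 'e::finite, 'm::finite) coint_model
    \<Rightarrow> (real^'s1) \<times> (real^'s2) \<Rightarrow> real^('c + 'k)^('c + 'k)" where
  "eAh \<M> \<theta> = mat_exp (mesh \<M> *\<^sub>R A_mat \<M> \<theta>)"

text \<open>
  Invertibility of \<open>C \<Omega> C\<^sup>T\<close> is part of being a solution, because \<open>matrix_inv\<close> is unspecified on singular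
  matrices.
\<close>

definition riccati_solution ::
  "('w, 's1::finite, 's2::finite, 'c::finite, 'k::finite, 'd::finite, 'e::finite, 'm::finite) coint_model
    \<Rightarrow> (real^'s1) \<times> (real^'s2) \<Rightarrow> real^('c + 'k)^('c + 'k) \<Rightarrow> bool" where
  "riccati_solution \<M> \<theta> \<Omega> \<longleftrightarrow>
     (let E = eAh \<M> \<theta>; E' = mat_exp (mesh \<M> *\<^sub>R transpose (A_mat \<M> \<theta>)); C = C_mat \<M> \<theta>
      in invertible (C ** \<Omega> ** transpose C) \<and>
         \<Omega> = E ** \<Omega> ** E' -
             E ** \<Omega> ** transpose C ** matrix_inv (C ** \<Omega> ** transpose C) ** C ** \<Omega> ** E' +
             Sigma_h \<M> \<theta>)"

definition Omega ::
  "('w, 's1::finite, 's2::finite, 'c::finite, 'k::finite, 'd::finite, 'e::finite, 'm::finite) coint_model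
    \<Rightarrow> (real^'s1) \<times> (real^'s2) \<Rightarrow> real^('c + 'k)^('c + 'k)" where
  "Omega \<M> \<theta> = (THE \<Omega>. pos_semidef \<Omega> \<and> riccati_solution \<M> \<theta> \<Omega>)"

definition V_mat ::
  "('w, 's1::finite, 's2::finite, 'c::finite, 'k::finite, 'd::finite, 'e::finite, 'm::finite) coint_model
    \<Rightarrow> (real^'s1) \<times> (real^'s2) \<Rightarrow> real^'d^'d" where
  "V_mat \<M> \<theta> = C_mat \<M> \<theta> ** Omega \<M> \<theta> ** transpose (C_mat \<M> \<theta>)"

definition K_mat ::
  "('w, 's1::finite, 's2::finite, 'c::finite, 'k::finite, 'd::finite, 'e::finite, 'm::finite) coint_model
    \<Rightarrow> (real^'s1) \<times> (real^'s2) \<Rightarrow> real^'d^('c + 'k)" where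
  "K_mat \<M> \<theta> = eAh \<M> \<theta> ** Omega \<M> \<theta> ** transpose (C_mat \<M> \<theta>) ** matrix_inv (V_mat \<M> \<theta>)"

definition F_mat ::
  "('w, 's1::finite, 's2::finite, 'c::finite, 'k::finite, 'd::finite, 'e::finite, 'm::finite) coint_model
    \<Rightarrow> (real^'s1) \<times> (real^'s2) \<Rightarrow> real^('c + 'k)^('c + 'k)" where
  "F_mat \<M> \<theta> = eAh \<M> \<theta> - K_mat \<M> \<theta> ** C_mat \<M> \<theta>"

text \<open>Time starts at \<open>1\<close>; the value at index \<open>0\<close> is never used.\<close>

fun Xhat ::
  "('w, 's1::finite, 's2::finite, 'c::finite, 'k::finite, 'd::finite, 'e::finite, 'm::finite) coint_model
    \<Rightarrow> (real^'s1) \<times> (real^'s2) \<Rightarrow> 'w \<Rightarrow> nat \<Rightarrow> real^('c + 'k)" where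
  "Xhat \<M> \<theta> \<omega> 0 = 0"
| "Xhat \<M> \<theta> \<omega> (Suc 0) = Xhat1 \<M> \<theta> \<omega>"
| "Xhat \<M> \<theta> \<omega> (Suc (Suc k)) = F_mat \<M> \<theta> *v Xhat \<M> \<theta> \<omega> (Suc k) + K_mat \<M> \<theta> *v Yobs \<M> (Suc k) \<omega>"

definition eps_hat ::
  "('w, 's1::finite, 's2::finite, 'c::finite, 'k::finite, 'd::finite, 'e::finite, 'm::finite) coint_model
    \<Rightarrow> (real^'s1) \<times> (real^'s2) \<Rightarrow> 'w \<Rightarrow> nat \<Rightarrow> real^'d" where
  "eps_hat \<M> \<theta> \<omega> k = Yobs \<M> k \<omega> - C_mat \<M> \<theta> *v Xhat \<M> \<theta> \<omega> k"

definition Lhat ::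
  "('w, 's1::finite, 's2::finite, 'c::finite, 'k::finite, 'd::finite,
    'e::finite, 'm::finite) coint_model \<Rightarrow> nat \<Rightarrow> (real^'s1) \<times> (real^'s2) \<Rightarrow> 'w \<Rightarrow> real" where
  "Lhat \<M> n \<theta> \<omega> = (1 / real n) * (\<Sum>k=1..n.
     real CARD('d) * ln (2 * pi) + ln (det (V_mat \<M> \<theta>)) +
     eps_hat \<M> \<theta> \<omega> k \<bullet> (matrix_inv (V_mat \<M> \<theta>) *v eps_hat \<M> \<theta> \<omega> k))"

section \<open>Assumptions on the starting values and identifiability\<close>

text \<open>
  The expectation of \<open>sup\<^bsub>\<theta> \<in> \<Theta>\<^esub> \<parallel>\<xi>\<^sub>\<theta>\<parallel>\<^sup>2\<close> exists and is finite; the supremum is taken in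
  \<open>[0, \<infinity>]\<close> and its measurability is part of the condition.
\<close>

definition finite_mean_sup_sq ::
  "'w measure \<Rightarrow> 'p set \<Rightarrow> ('p \<Rightarrow> 'w \<Rightarrow> 'b::real_normed_vector) \<Rightarrow> bool" where
  "finite_mean_sup_sq M T \<xi> \<longleftrightarrow>
     (\<lambda>\<omega>. \<Squnion>\<theta>\<in>T. ennreal ((norm (\<xi> \<theta> \<omega>))\<^sup>2)) \<in> borel_measurable M \<and>
     (\<integral>\<^sup>+\<omega>. (\<Squnion>\<theta>\<in>T. ennreal ((norm (\<xi> \<theta> \<omega>))\<^sup>2)) \<partial>M) < \<infinity>"

text \<open>Partial derivative in the coordinate direction \<open>u\<close>, an element of \<open>Basis\<close>.\<close>

definition pderiv_at :: "'a::euclidean_space \<Rightarrow> ('a \<Rightarrow> 'b::real_normed_vector) \<Rightarrow> 'a \<Rightarrow> 'b" where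
  "pderiv_at u f x = frechet_derivative f (at x) u"

definition assumption_B ::
  "('w, 's1::finite, 's2::finite, 'c::finite, 'k::finite, 'd::finite, 'e::finite, 'm::finite) coint_model
    \<Rightarrow> bool" where
  "assumption_B \<M> \<longleftrightarrow>
     (\<forall>\<omega>\<in>space (Pr \<M>). \<exists>U. open U \<and> Theta \<M> \<subseteq> U \<and>
        (\<forall>\<theta>\<in>U. (\<lambda>\<eta>. Xhat1 \<M> \<eta> \<omega>) differentiable (at \<theta>) \<and>
           (\<forall>v\<in>Basis. pderiv_at v (\<lambda>\<eta>. Xhat1 \<M> \<eta> \<omega>) differentiable (at \<theta>)))) \<and>
     finite_mean_sup_sq (Pr \<M>) (Theta \<M>) (Xhat1 \<M>) \<and>
     (\<forall>u\<in>Basis. finite_mean_sup_sq (Pr \<M>) (Theta \<M>) (\<lambda>\<theta> \<omega>. pderiv_at u (\<lambda>\<eta>. Xhat1 \<M> \<eta> \<omega>) \<theta>)) \<and>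
     (\<forall>u\<in>Basis. \<forall>v\<in>Basis. finite_mean_sup_sq (Pr \<M>) (Theta \<M>)
        (\<lambda>\<theta> \<omega>. pderiv_at u (pderiv_at v (\<lambda>\<eta>. Xhat1 \<M> \<eta> \<omega>)) \<theta>)) \<and>
     (\<forall>\<theta>\<in>Theta \<M>. indep_of_process (Pr \<M>) (Xhat1 \<M> \<theta>) {0..} (Levy \<M> (snd \<theta>)))"

definition assumption_C ::
  "('w, 's1::finite, 's2::finite, 'c::finite, 'k::finite, 'd::finite, 'e::finite, 'm::finite) coint_model
    \<Rightarrow> bool" where
  "assumption_C \<M> \<longleftrightarrow>
     (\<exists>c>0. \<forall>\<theta>\<^sub>1\<in>Theta1 \<M>.
        norm (transpose (C1perp \<M> \<theta>\<^sub>1) ** C1 \<M> (true1 \<M>)) \<ge> c * norm (\<theta>\<^sub>1 - true1 \<M>))"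

text \<open>The transfer functions are compared at points where both inverses exist.\<close>

definition assumption_D ::
  "('w, 's1::finite, 's2::finite, 'c::finite, 'k::finite, 'd::finite, 'e::finite, 'm::finite) coint_model
    \<Rightarrow> bool" where
  "assumption_D \<M> \<longleftrightarrow>
     (\<forall>\<theta>\<^sub>2\<in>Theta2 \<M>. \<theta>\<^sub>2 \<noteq> true2 \<M> \<longrightarrow>
        (let \<eta> = (true1 \<M>, \<theta>\<^sub>2); \<eta>\<^sub>0 = true_par \<M>;
             I_Fz = (\<lambda>\<theta> z. mat 1 - mat z ** cmat (F_mat \<M> \<theta>));
             G = (\<lambda>\<theta> z. cmat (C_mat \<M> \<theta>) ** matrix_inv (I_Fz \<theta> z) ** cmat (K_mat \<M> \<theta>))
         in (\<exists>z. invertible (I_Fz \<eta> z) \<and> invertible (I_Fz \<eta>\<^sub>0 z) \<and> G \<eta> z \<noteq> G \<eta>\<^sub>0 z) \<or>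
            V_mat \<M> \<eta> \<noteq> V_mat \<M> \<eta>\<^sub>0))"

definition Bbar ::
  "('w, 's1::finite, 's2::finite, 'c::finite, 'k::finite, 'd::finite, 'e::finite, 'm::finite) coint_model
    \<Rightarrow> real \<Rightarrow> (real^'s1) set" where
  "Bbar \<M> \<delta> = {\<theta>\<^sub>1 \<in> Theta1 \<M>. norm (\<theta>\<^sub>1 - true1 \<M>) > \<delta>}"

end

theory Submission
  imports Defs "HOL-Computational_Algebra.Fundamental_Theorem_Algebra"
begin

text \<open>
  The innovations split as \<open>\<epsilon>\<^sub>k(\<theta>) = G(\<theta>) L(k h) + r\<^sub>k(\<theta>)\<close>, where \<open>G(\<theta>)\<close> is the static gain
  \<open>I - C (I - F)\<^sup>-\<^sup>1 K\<close> of the filter applied to the loading of the random walk part of the observations.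
  The filter is stable uniformly in \<open>\<theta>\<close>, so the energy of the remainder \<open>r\<close> is bounded, up to a constant,
  by the energy of the stationary part and of the increments of \<open>L\<close>, whose mean is of order \<open>n\<close>; hence the
  remainder contributes only a bounded amount to the likelihood, with probability close to one and for all
  \<open>\<theta>\<close> at once. The gain annihilates exactly the column space of \<open>C\<^sub>1\<^sub>,\<^sub>\<theta>\<close>, so \<open>G\<close> vanishes at the true
  parameter, while Assumption C and compactness keep \<open>\<parallel>G(\<theta>)\<parallel>\<close> away from zero when the long-run parameter
  is wrong. There the trend term dominates: a sum \<open>\<Sum>\<^sub>k\<^sub>\<le>\<^sub>n \<parallel>P L(k h)\<parallel>\<^sup>2\<close> controls its differences at any
  fixed lag \<open>b\<close>, for which the law of large numbers gives at least \<open>\<kappa> b n \<parallel>P\<parallel>\<^sup>2\<close> with probability tending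
  to one, and \<open>b\<close> is arbitrary. No functional limit theorem is needed. Uniformity in \<open>\<theta>\<close> rests on the
  continuity in the parameter of the solution of the Riccati equation.
\<close>

section \<open>Matrices and the matrix exponential\<close>

text \<open>Randomness enters through two families of events only: one bounds an energy that depends
  on the parameter through the starting value alone, the other bounds the trend energies for all
  matrices P at once. Every other constant is deterministic and uniform by compactness. The
  constants are fixed in the order \<open>\<epsilon>\<close>, energy bound K, required growth
  \<open>\<kappa>\<close>, lag b: as b comes last, \<open>\<kappa>\<close> may be as large as K
  demands, and a margin of 1 between the likelihoods suffices. Two obstacles shape the rest.
  \<open>Omega\<close> is a definite description, so the Riccati equation has to be solved:
  existence rests on a gain that stabilizes the integrators, uniqueness on a positive definite noise
  covariance, and this on minimality. Mean zero and finite moments are given at time 1 only, so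
  moments of increments of other lengths are deduced from independence, stationarity and right
  continuity.\<close>

lemma norm_matrix_vector_le: "norm (A *v x) \<le> norm A * norm x" for A :: "real^'n^'m"
proof -
  have "(norm (A *v x))\<^sup>2 = (\<Sum>i\<in>UNIV. (A $ i \<bullet> x)\<^sup>2)"
    by (simp add: norm_vec_def L2_set_def sum_nonneg matrix_vector_mul_component)
  also have "\<dots> \<le> (\<Sum>i\<in>UNIV. (norm (A $ i))\<^sup>2 * (norm x)\<^sup>2)"
    by (intro sum_mono) (metis Cauchy_Schwarz_ineq power2_norm_eq_inner)
  also have "\<dots> = (norm A * norm x)\<^sup>2"
    by (simp add: norm_vec_def[of A] L2_set_def sum_nonneg power_mult_distrib sum_distrib_right)
  finally show ?thesis by (simp add: power2_le_iff_abs_le)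
qed

lemma norm_transpose [simp]: "norm (transpose A) = norm A" for A :: "real^'n^'m"
proof -
  have "(\<Sum>i\<in>UNIV. (norm (transpose A $ i))\<^sup>2) = (\<Sum>i\<in>UNIV. (norm (A $ i))\<^sup>2)"
    by (simp add: norm_vec_def L2_set_def sum_nonneg transpose_def) (rule sum.swap)
  then show ?thesis by (simp add: norm_vec_def[of A] norm_vec_def[of "transpose A"] L2_set_def)
qed

lemma norm_vector_matrix_le: "norm (x v* A) \<le> norm A * norm x" for A :: "real^'n^'m"
  by (metis norm_matrix_vector_le norm_transpose transpose_matrix_vector)

lemma matrix_mult_row: "(A ** B) $ i = A $ i v* B" for A :: "real^'n^'m"
  by (simp add: matrix_matrix_mult_def vector_matrix_mult_def vec_eq_iff mult.commute)

lemma norm_matrix_mult_le: "norm (A ** B) \<le> norm A * norm B" for A :: "real^'n^'m" and B :: "real^'p^'n"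
proof -
  have "(norm (A ** B))\<^sup>2 = (\<Sum>i\<in>UNIV. (norm (A $ i v* B))\<^sup>2)"
    by (simp add: norm_vec_def[of "A ** B"] L2_set_def sum_nonneg matrix_mult_row)
  also have "\<dots> \<le> (\<Sum>i\<in>UNIV. (norm (A $ i))\<^sup>2 * (norm B)\<^sup>2)"
    by (intro sum_mono) (metis norm_vector_matrix_le norm_ge_zero power_mono power_mult_distrib mult.commute)
  also have "\<dots> = (norm A * norm B)\<^sup>2"
    by (simp add: norm_vec_def[of A] L2_set_def sum_nonneg power_mult_distrib sum_distrib_right)
  finally show ?thesis by (simp add: power2_le_iff_abs_le)
qed

lemma matrix_mult_add_rdistrib: "(A + B) ** C = A ** C + B ** C" for A :: "real^'n^'m"
  by (vector matrix_matrix_mult_def sum.distrib[symmetric] field_simps)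

lemma matrix_mult_diff_rdistrib: "(A - B) ** C = A ** C - B ** C" for A :: "real^'n^'m"
  by (vector matrix_matrix_mult_def sum_subtractf[symmetric] field_simps)

lemma matrix_mult_diff_ldistrib: "A ** (B - C) = A ** B - A ** C" for A :: "real^'n^'m"
  by (vector matrix_matrix_mult_def sum_subtractf[symmetric] field_simps)

text \<open>Lets limits, continuity and convergent series pass through matrix products by the theory
  of bounded bilinear maps; the constant is 1 because the Frobenius norm is
  submultiplicative.\<close>

lemma bounded_bilinear_matrix_mult: "bounded_bilinear ((**) :: real^'n^'m \<Rightarrow> real^'p^'n \<Rightarrow> real^'p^'m)"
proof (rule bounded_bilinear.intro)
  show "\<exists>K. \<forall>a b. norm ((a :: real^'n^'m) ** (b :: real^'p^'n)) \<le> norm a * norm b * K"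
    by (rule exI[of _ 1]) (simp add: norm_matrix_mult_le)
qed (simp_all add: matrix_mult_add_rdistrib matrix_add_ldistrib scalar_matrix_assoc matrix_scalar_ac)

lemma bounded_bilinear_matrix_vector: "bounded_bilinear ((*v) :: real^'n^'m \<Rightarrow> real^'n \<Rightarrow> real^'m)"
proof (rule bounded_bilinear.intro)
  show "\<exists>K. \<forall>a b. norm ((a :: real^'n^'m) *v b) \<le> norm a * norm b * K"
    by (rule exI[of _ 1]) (simp add: norm_matrix_vector_le)
qed (simp_all add: algebra_simps matrix_vector_mult_scaleR scaleR_matrix_vector_assoc)

lemma bounded_linear_transpose: "bounded_linear (transpose :: real^'n^'m \<Rightarrow> real^'m^'n)"
  by (rule bounded_linear_intro[of _ 1]) (simp_all add: transpose_def vec_eq_iff norm_transpose[unfolded transpose_def])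

lemmas continuous_on_matrix_mult = bounded_bilinear.continuous_on[OF bounded_bilinear_matrix_mult]
lemmas continuous_on_matrix_vector = bounded_bilinear.continuous_on[OF bounded_bilinear_matrix_vector]
lemmas continuous_on_transpose = bounded_linear.continuous_on[OF bounded_linear_transpose]
lemmas tendsto_matrix_mult = bounded_bilinear.tendsto[OF bounded_bilinear_matrix_mult]
lemmas tendsto_matrix_vector = bounded_bilinear.tendsto[OF bounded_bilinear_matrix_vector]
lemmas tendsto_transpose = bounded_linear.tendsto[OF bounded_linear_transpose]

lemma vector_matrix_diff_rdistrib: "x v* (A - B) = x v* A - x v* B" for A :: "real^'n^'m"
  by (simp add: vector_matrix_mult_def vec_eq_iff algebra_simps sum_subtractf)

lemma vector_matrix_add_rdistrib: "x v* (A + B) = x v* A + x v* B" for A :: "real^'n^'m"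
  by (simp add: vector_matrix_mult_def vec_eq_iff algebra_simps sum.distrib)

lemma vector_matrix_add_ldistrib: "(x + y) v* A = x v* A + y v* A" for A :: "real^'n^'m"
  by (simp add: vector_matrix_mult_def vec_eq_iff algebra_simps sum.distrib)

lemma vector_matrix_mul_assoc2: "x v* (A ** B) = (x v* A) v* B" for A :: "real^'n^'m"
  by (metis matrix_transpose_mul matrix_vector_mul_assoc transpose_matrix_vector)

section \<open>Inverses and determinants: continuity and criteria for invertibility\<close>

lemma matrix_inv_inverse:
  assumes "invertible A"
  shows "A ** matrix_inv A = mat 1" "matrix_inv A ** A = mat 1"
proof -
  have "A ** matrix_inv A = mat 1 \<and> matrix_inv A ** A = mat 1"
    unfolding matrix_inv_def by (rule someI_ex) (use assms in \<open>simp add: invertible_def\<close>)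
  then show "A ** matrix_inv A = mat 1" "matrix_inv A ** A = mat 1" by auto
qed

lemma matrix_inv_unique:
  fixes A :: "'a::comm_semiring_1^'n^'n"
  assumes "A ** B = mat 1" "B ** A = mat 1"
  shows "matrix_inv A = B"
  by (metis assms invertible_def matrix_inv_inverse(1) matrix_mul_assoc matrix_mul_lid matrix_mul_rid)

text \<open>Cramer's rule applied to the unit vector \<open>axis l 1\<close>. Every entry of the
  inverse is a quotient of determinants, so continuity of inversion reduces to continuity of
  polynomials.\<close>

lemma matrix_inv_entry:
  fixes A :: "real^'n^'n"
  assumes "det A \<noteq> 0"
  shows "matrix_inv A $ k $ l = det (\<chi> i j. if j = k then axis l 1 $ i else A $ i $ j) / det A"
proof -
  have "A *v (matrix_inv A *v axis l 1) = axis l 1"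
    using assms by (simp add: matrix_vector_mul_assoc invertible_det_nz matrix_inv_inverse)
  then have "matrix_inv A *v axis l 1 = (\<chi> k. det (\<chi> i j. if j = k then axis l 1 $ i else A $ i $ j) / det A)"
    using cramer[OF assms] by blast
  moreover have "(matrix_inv A *v axis l 1) $ k = matrix_inv A $ k $ l"
    by (simp add: matrix_vector_mult_basis column_def)
  ultimately show ?thesis by simp
qed

lemma tendsto_det:
  fixes A :: "'a \<Rightarrow> real^'n^'n"
  assumes "(A \<longlongrightarrow> B) F" shows "((\<lambda>x. det (A x)) \<longlongrightarrow> det B) F"
  unfolding det_def by (intro tendsto_intros assms)

lemma tendsto_matrix_inv:
  fixes A :: "'a \<Rightarrow> real^'n^'n"
  assumes A: "(A \<longlongrightarrow> B) F" and B: "invertible B"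
  shows "((\<lambda>x. matrix_inv (A x)) \<longlongrightarrow> matrix_inv B) F"
proof -
  have dB: "det B \<noteq> 0" using B by (simp add: invertible_det_nz)
  \<comment> \<open>The nonzero determinant of the limit persists along the filter, so Cramer's
    formula is eventually available; at singular matrices \<open>matrix_inv\<close> has no usable
    value.\<close>
  have ev: "\<forall>\<^sub>F x in F. det (A x) \<noteq> 0"
    using tendsto_imp_eventually_ne[OF tendsto_det[OF A] dB] .
  have "((\<lambda>x. matrix_inv (A x) $ k $ l) \<longlongrightarrow> matrix_inv B $ k $ l) F" for k l
  proof -
    have ent: "((\<lambda>x. A x $ i $ j) \<longlongrightarrow> B $ i $ j) F" for i j
      by (intro tendsto_vec_nth A)
    have "((\<lambda>x. (\<chi> i j. if j = k then axis l 1 $ i else A x $ i $ j))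
        \<longlongrightarrow> (\<chi> i j. if j = k then axis l 1 $ i else B $ i $ j :: real^'n^'n)) F"
      by (intro tendsto_vec_lambda) (auto intro: ent)
    then have "((\<lambda>x. det (\<chi> i j. if j = k then axis l 1 $ i else A x $ i $ j) / det (A x))
        \<longlongrightarrow> det (\<chi> i j. if j = k then axis l 1 $ i else B $ i $ j) / det B) F"
      by (intro tendsto_divide tendsto_det A dB)
    then show ?thesis
      unfolding matrix_inv_entry[OF dB]
      by (rule Lim_transform_eventually) (use ev in eventually_elim, simp add: matrix_inv_entry)
  qed
  then show ?thesis by (intro vec_tendstoI)
qed

lemma continuous_on_matrix_inv:
  fixes A :: "'a::topological_space \<Rightarrow> real^'n^'n"
  assumes "continuous_on S A" "\<And>x. x \<in> S \<Longrightarrow> invertible (A x)"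
  shows "continuous_on S (\<lambda>x. matrix_inv (A x))"
  using assms by (auto simp: continuous_on_def intro!: tendsto_matrix_inv)

lemma continuous_on_det:
  fixes A :: "'a::topological_space \<Rightarrow> real^'n^'n"
  assumes "continuous_on S A" shows "continuous_on S (\<lambda>x. det (A x))"
  using assms by (auto simp: continuous_on_def intro!: tendsto_det)

lemma invertible_if_injective:
  fixes A :: "real^'n^'n"
  assumes "\<And>x. A *v x = 0 \<Longrightarrow> x = 0"
  shows "invertible A"
  using assms invertible_left_inverse matrix_left_invertible_ker by blast

section \<open>Matrix powers and the exponential series\<close>

definition mat_pow :: "real^'n^'n \<Rightarrow> nat \<Rightarrow> real^'n^'n" where
  "mat_pow A k = ((\<lambda>X. A ** X) ^^ k) (mat 1)"

lemma mat_pow_0 [simp]: "mat_pow A 0 = mat 1"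
  by (simp add: mat_pow_def)

lemma mat_pow_Suc: "mat_pow A (Suc k) = A ** mat_pow A k"
  by (simp add: mat_pow_def)

text \<open>Source of the commutation facts: with P = A it commutes powers, with P a block
  projection it restricts powers of a block matrix to one block.\<close>

lemma mat_pow_intertwine:
  fixes P :: "real^'n^'m"
  assumes "P ** A = B ** P"
  shows "P ** mat_pow A k = mat_pow B k ** P"
proof (induction k)
  case (Suc k)
  then show ?case by (metis assms mat_pow_Suc matrix_mul_assoc)
qed simp

lemma mat_pow_Suc2: "mat_pow A (Suc k) = mat_pow A k ** A"
  using mat_pow_intertwine[of A A A k] by (simp add: mat_pow_Suc)

lemma transpose_mat_pow: "transpose (mat_pow A k) = mat_pow (transpose A) k"
proof (induction k)
  case (Suc k)
  have "transpose (mat_pow A (Suc k)) = mat_pow (transpose A) k ** transpose A"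
    by (simp only: mat_pow_Suc matrix_transpose_mul Suc)
  then show ?case by (simp only: mat_pow_Suc2)
qed (simp add: transpose_mat)

lemma mat_pow_scaleR: "mat_pow (t *\<^sub>R A) k = t ^ k *\<^sub>R mat_pow A k"
  by (induction k) (simp_all add: mat_pow_Suc scalar_matrix_assoc[symmetric] matrix_scalar_ac)

lemma norm_mat_pow_le: "norm (mat_pow A k) \<le> norm A ^ k * norm (mat 1 :: real^'n^'n)" for A :: "real^'n^'n"
proof (induction k)
  case (Suc k)
  have "norm (mat_pow A (Suc k)) \<le> norm A * norm (mat_pow A k)"
    by (simp add: mat_pow_Suc norm_matrix_mult_le)
  also have "\<dots> \<le> norm A * (norm A ^ k * norm (mat 1 :: real^'n^'n))"
    by (intro mult_left_mono Suc) simp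
  finally show ?case by (simp add: mult.assoc)
qed simp

lemma mat_exp_alt: "mat_exp A = (\<Sum>k. (1 / fact k) *\<^sub>R mat_pow A k)"
  by (simp add: mat_exp_def mat_pow_def)

lemma summable_norm_mat_exp: "summable (\<lambda>k. norm ((1 / fact k) *\<^sub>R mat_pow A k))" for A :: "real^'n^'n"
proof (rule summable_comparison_test)
  show "\<exists>N. \<forall>k\<ge>N. norm (norm ((1 / fact k) *\<^sub>R mat_pow A k))
      \<le> (inverse (fact k) * norm A ^ k) * norm (mat 1 :: real^'n^'n)"
    by (intro exI[of _ 0] allI impI) (simp add: divide_inverse mult.assoc mult_left_mono norm_mat_pow_le)
  show "summable (\<lambda>k. (inverse (fact k) * norm A ^ k) * norm (mat 1 :: real^'n^'n))"
    by (intro summable_mult2 summable_exp)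
qed

lemma mat_exp_sums: "(\<lambda>k. (1 / fact k) *\<^sub>R mat_pow A k) sums mat_exp A"
  unfolding mat_exp_alt by (rule summable_sums[OF summable_norm_cancel[OF summable_norm_mat_exp]])

text \<open>The relation holds term by term in the series. It yields the action of the exponential
  on invariant blocks without computing a block exponential.\<close>

lemma mat_exp_intertwine:
  fixes P :: "real^'n^'m"
  assumes "P ** A = B ** P"
  shows "P ** mat_exp A = mat_exp B ** P"
proof -
  have 1: "(\<lambda>k. P ** ((1 / fact k) *\<^sub>R mat_pow A k)) sums (P ** mat_exp A)"
    using bounded_linear.sums[OF bounded_bilinear.bounded_linear_right[OF bounded_bilinear_matrix_mult] mat_exp_sums] .
  have 2: "(\<lambda>k. ((1 / fact k) *\<^sub>R mat_pow B k) ** P) sums (mat_exp B ** P)"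
    using bounded_linear.sums[OF bounded_bilinear.bounded_linear_left[OF bounded_bilinear_matrix_mult] mat_exp_sums] .
  have 3: "(\<lambda>k. P ** ((1 / fact k) *\<^sub>R mat_pow A k)) = (\<lambda>k. ((1 / fact k) *\<^sub>R mat_pow B k) ** P)"
    by (simp add: matrix_scalar_ac scalar_matrix_assoc[symmetric] mat_pow_intertwine[OF assms])
  show ?thesis by (rule sums_unique2[OF 1[unfolded 3] 2])
qed

lemma transpose_mat_exp: "transpose (mat_exp A) = mat_exp (transpose A)"
proof -
  have "(\<lambda>k. transpose ((1 / fact k) *\<^sub>R mat_pow A k)) sums (transpose (mat_exp A))"
    using bounded_linear.sums[OF bounded_linear_transpose mat_exp_sums] .
  also have "(\<lambda>k. transpose ((1 / fact k) *\<^sub>R mat_pow A k)) = (\<lambda>k. (1 / fact k) *\<^sub>R mat_pow (transpose A) k)"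
    by (simp add: transpose_mat_pow linear_scale[OF bounded_linear.linear[OF bounded_linear_transpose]])
  finally show ?thesis by (rule sums_unique2[OF _ mat_exp_sums])
qed

lemma mat_exp_0 [simp]: "mat_exp (0 :: real^'n^'n) = mat 1"
proof -
  have "mat_pow (0 :: real^'n^'n) k = (if k = 0 then mat 1 else 0)" for k
    by (cases k) (simp_all add: mat_pow_Suc)
  then have "(\<lambda>k. (1 / fact k) *\<^sub>R mat_pow (0 :: real^'n^'n) k) = (\<lambda>k. if k = 0 then mat 1 else 0)"
    by (auto simp: fun_eq_iff)
  then have "(\<lambda>k. if k = 0 then mat 1 else 0) sums mat_exp (0 :: real^'n^'n)"
    using mat_exp_sums[of "0::real^'n^'n"] by simp
  then show ?thesis by (rule sums_unique2[OF _ sums_single])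
qed

lemma mat_exp_commute: "A ** mat_exp (t *\<^sub>R A) = mat_exp (t *\<^sub>R A) ** A"
  by (rule mat_exp_intertwine) (simp add: matrix_scalar_ac scalar_matrix_assoc[symmetric])

lemma mat_exp_entry_sums:
  "(\<lambda>k. mat_pow A k $ i $ j / fact k * t ^ k) sums (mat_exp (t *\<^sub>R A) $ i $ j)"
proof -
  have "(\<lambda>k. ((1 / fact k) *\<^sub>R mat_pow (t *\<^sub>R A) k) $ i $ j) sums (mat_exp (t *\<^sub>R A) $ i $ j)"
    using bounded_linear.sums[OF bounded_linear_compose[OF bounded_linear_vec_nth[of j] bounded_linear_vec_nth[of i]] mat_exp_sums] .
  then show ?thesis by (simp add: mat_pow_scaleR mult.commute)
qed

text \<open>Each entry is an everywhere convergent scalar power series in t, so the scalar theorem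
  on termwise differentiation applies.\<close>

lemma mat_exp_entry_derivative:
  "((\<lambda>t. mat_exp (t *\<^sub>R A) $ i $ j) has_field_derivative (A ** mat_exp (t *\<^sub>R A)) $ i $ j) (at t)"
proof -
  define c where "c k = mat_pow A k $ i $ j / fact k" for k
  have s: "(\<lambda>k. c k * y ^ k) sums (mat_exp (y *\<^sub>R A) $ i $ j)" for y
    using mat_exp_entry_sums[of A i j y] by (simp add: c_def)
  have "(\<lambda>t. mat_exp (t *\<^sub>R A) $ i $ j) = (\<lambda>t. \<Sum>k. c k * t ^ k)"
    using s by (auto simp: sums_iff)
  moreover have "((\<lambda>t. \<Sum>k. c k * t ^ k) has_field_derivative (\<Sum>k. diffs c k * t ^ k)) (at t)"
    by (rule termdiffs_strong_converges_everywhere) (use s sums_summable in blast)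
  moreover have "(\<lambda>k. diffs c k * t ^ k) sums ((A ** mat_exp (t *\<^sub>R A)) $ i $ j)"
  proof -
    have "(\<lambda>k. (A ** ((1 / fact k) *\<^sub>R mat_pow (t *\<^sub>R A) k)) $ i $ j) sums ((A ** mat_exp (t *\<^sub>R A)) $ i $ j)"
      using bounded_linear.sums[OF bounded_linear_compose[OF bounded_linear_compose[OF
        bounded_linear_vec_nth[of j] bounded_linear_vec_nth[of i]]
         bounded_bilinear.bounded_linear_right[OF bounded_bilinear_matrix_mult[where 'p='a and 'n='a and 'm='a]]] mat_exp_sums] .
    moreover have "(\<lambda>k. (A ** ((1 / fact k) *\<^sub>R mat_pow (t *\<^sub>R A) k)) $ i $ j) = (\<lambda>k. diffs c k * t ^ k)"
      by (simp add: fun_eq_iff diffs_def c_def mat_pow_scaleR matrix_scalar_ac scalar_matrix_assoc[symmetric] mat_pow_Suc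
        del: of_nat_Suc)
    ultimately show ?thesis by simp
  qed
  ultimately show ?thesis by (simp add: sums_iff)
qed

text \<open>The product of the exponentials at \<open>t + s - r\<close> and at \<open>r\<close> has
  derivative zero in r, because A commutes with its exponential. Comparing r = 0 with r = t gives
  the semigroup law without a Cauchy product of matrix series.\<close>

lemma mat_exp_add: "mat_exp ((s + t) *\<^sub>R A) = mat_exp (s *\<^sub>R A) ** mat_exp (t *\<^sub>R A)"
proof -
  have "(mat_exp ((t + s - r) *\<^sub>R A) ** mat_exp (r *\<^sub>R A)) $ i $ j = mat_exp ((t + s) *\<^sub>R A) $ i $ j" for r i j
  proof -
    define g where "g r = (\<Sum>k\<in>UNIV. mat_exp ((t + s - r) *\<^sub>R A) $ i $ k * mat_exp (r *\<^sub>R A) $ k $ j)" for r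
    have "(g has_field_derivative 0) (at r)" for r
    proof -
      have e: "((\<lambda>r. mat_exp ((t + s - r) *\<^sub>R A) $ i $ k) has_field_derivative
          - (A ** mat_exp ((t + s - r) *\<^sub>R A)) $ i $ k) (at r)" for k
      proof -
        have "((\<lambda>r. t + s - r) has_field_derivative -1) (at r)" by (auto intro!: derivative_eq_intros)
        from DERIV_chain2[where f="\<lambda>t. mat_exp (t *\<^sub>R A) $ i $ k" and g="\<lambda>r. t + s - r", OF mat_exp_entry_derivative this]
        show ?thesis by simp
      qed
      have "(g has_field_derivative (\<Sum>k\<in>UNIV. - (A ** mat_exp ((t + s - r) *\<^sub>R A)) $ i $ k * mat_exp (r *\<^sub>R A) $ k $ j
          + (A ** mat_exp (r *\<^sub>R A)) $ k $ j * mat_exp ((t + s - r) *\<^sub>R A) $ i $ k)) (at r)"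
        unfolding g_def by (intro DERIV_sum DERIV_mult e mat_exp_entry_derivative)
      also have "(\<Sum>k\<in>UNIV. - (A ** mat_exp ((t + s - r) *\<^sub>R A)) $ i $ k * mat_exp (r *\<^sub>R A) $ k $ j
          + (A ** mat_exp (r *\<^sub>R A)) $ k $ j * mat_exp ((t + s - r) *\<^sub>R A) $ i $ k)
        = - ((A ** mat_exp ((t + s - r) *\<^sub>R A)) ** mat_exp (r *\<^sub>R A)) $ i $ j
          + (mat_exp ((t + s - r) *\<^sub>R A) ** (A ** mat_exp (r *\<^sub>R A))) $ i $ j"
        by (simp add: matrix_matrix_mult_def[of "A ** mat_exp _"]
            matrix_matrix_mult_def[of "mat_exp ((t + s - r) *\<^sub>R A)"] sum.distrib sum_negf sum_subtractf mult.commute)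
      also have "\<dots> = 0"
      proof -
        have "A ** mat_exp ((t + s - r) *\<^sub>R A) ** mat_exp (r *\<^sub>R A) = mat_exp ((t + s - r) *\<^sub>R A) ** (A ** mat_exp (r *\<^sub>R A))"
          using mat_exp_commute[of A "t + s - r"] by (simp only: matrix_mul_assoc)
        then show ?thesis by simp
      qed
      finally show ?thesis .
    qed
    then have "g r = g 0" by (intro DERIV_isconst_all allI)
    then show ?thesis by (simp add: g_def matrix_matrix_mult_def[of "mat_exp _"] mat_def if_distrib cong: if_cong)
  qed
  from this[of t] show ?thesis by (simp add: vec_eq_iff add.commute)
qed

lemma mat_pow_mat_exp: "mat_pow (mat_exp (h *\<^sub>R A)) k = mat_exp ((real k * h) *\<^sub>R A)"
proof (induction k)
  case (Suc k)
  have "mat_exp ((real (Suc k) * h) *\<^sub>R A) = mat_exp ((h + real k * h) *\<^sub>R A)" by (simp add: algebra_simps)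
  also have "\<dots> = mat_exp (h *\<^sub>R A) ** mat_exp ((real k * h) *\<^sub>R A)" by (rule mat_exp_add)
  finally show ?case by (simp only: mat_pow_Suc Suc)
qed simp

text \<open>The series converges uniformly on each ball by the Weierstrass test with the scalar
  exponential series as majorant; the balls are open and cover the space.\<close>

lemma continuous_on_mat_exp: "continuous_on S (mat_exp :: real^'n^'n \<Rightarrow> _)"
proof -
  have "continuous_on (ball 0 r) (mat_exp :: real^'n^'n \<Rightarrow> _)" for r
  proof (rule uniform_limit_theorem[where F=sequentially])
    have "uniform_limit (ball 0 r) (\<lambda>n A. \<Sum>k<n. (1 / fact k) *\<^sub>R mat_pow A k)
        (\<lambda>A :: real^'n^'n. \<Sum>k. (1 / fact k) *\<^sub>R mat_pow A k) sequentially"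
    proof (rule Weierstrass_m_test)
      show "summable (\<lambda>k. (inverse (fact k) * r ^ k) * norm (mat 1 :: real^'n^'n))"
        by (intro summable_mult2 summable_exp)
      show "norm ((1 / fact k) *\<^sub>R mat_pow A k) \<le> (inverse (fact k) * r ^ k) * norm (mat 1 :: real^'n^'n)"
        if "A \<in> ball 0 r" for k and A :: "real^'n^'n"
      proof -
        have "norm (mat_pow A k) \<le> norm A ^ k * norm (mat 1 :: real^'n^'n)" by (rule norm_mat_pow_le)
        also have "\<dots> \<le> r ^ k * norm (mat 1 :: real^'n^'n)"
          using that by (intro mult_right_mono power_mono) auto
        finally show ?thesis by (simp add: divide_inverse mult.assoc mult_left_mono)
      qed
    qed
    then show "uniform_limit (ball 0 r) (\<lambda>n A. \<Sum>k<n. (1 / fact k) *\<^sub>R mat_pow A k) (mat_exp :: real^'n^'n \<Rightarrow> _) sequentially"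
      by (simp add: mat_exp_alt[abs_def])
    have "continuous_on (ball 0 r) (\<lambda>A :: real^'n^'n. mat_pow A k)" for k
      by (induction k) (auto simp: mat_pow_Suc intro!: continuous_on_matrix_mult continuous_intros)
    then show "\<forall>\<^sub>F n in sequentially. continuous_on (ball 0 r) (\<lambda>A :: real^'n^'n. \<Sum>k<n. (1 / fact k) *\<^sub>R mat_pow A k)"
      by (intro always_eventually allI continuous_intros)
  qed simp
  then have "continuous_on (\<Union>r. ball 0 r) (mat_exp :: real^'n^'n \<Rightarrow> _)"
    by (intro continuous_on_open_UN) auto
  moreover have "(\<Union>r. ball 0 r) = (UNIV :: (real^'n^'n) set)"
    using gt_ex by auto
  ultimately show ?thesis by (metis continuous_on_subset subset_UNIV)
qed

section \<open>Exponential decay of the semigroup of a stable matrix\<close>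

text \<open>Variation of constants: multiplying y by \<open>exp (- (of_real s * l))\<close> removes
  the linear term and leaves an integral of the forcing alone.\<close>

lemma scalar_ode_decay:
  fixes y g :: "real \<Rightarrow> complex"
  assumes d: "\<And>t. (y has_vector_derivative l * y t + g t) (at t)"
    and l: "Re l < 0" and a: "a > 0"
    and g: "\<And>t. t \<ge> 0 \<Longrightarrow> norm (g t) \<le> K * exp (- a * t)"
  shows "\<exists>K' b. b > 0 \<and> (\<forall>t\<ge>0. norm (y t) \<le> K' * exp (- b * t))"
proof -
  \<comment> \<open>Taking at most half of |Re l| leaves \<open>\<beta>\<close> positive. In the
    resonant case a = - Re l the integral of the forcing would otherwise grow linearly.\<close>
  define b where "b = min a (- Re l / 2)"
  define \<beta> where "\<beta> = - Re l - b"
  have b: "b > 0" "b \<le> a" "b \<le> - Re l" and \<beta>: "\<beta> > 0" using a l by (auto simp: b_def \<beta>_def)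
  have K: "K \<ge> 0" using order_trans[OF norm_ge_zero g[of 0]] by simp
  have "norm (y t) \<le> (norm (y 0) + K / \<beta>) * exp (- b * t)" if t: "t \<ge> 0" for t
  proof (cases "t = 0")
    case True
    then show ?thesis using K \<beta> by simp
  next
    case False
    define u where "u s = exp (- (of_real s * l)) * y s" for s
    have du: "(u has_vector_derivative exp (- (of_real s * l)) * g s) (at s)" for s
    proof -
      have "((\<lambda>s. exp (- (of_real s * l))) has_vector_derivative - l * exp (- (of_real s * l))) (at s)"
        by (rule has_vector_derivative_real_field[of _ _ s UNIV, simplified])
          (auto intro!: derivative_eq_intros)
      from has_vector_derivative_mult[OF this d]
      show ?thesis unfolding u_def by (simp add: algebra_simps)
    qed
    have dphi: "((\<lambda>s. K / \<beta> * exp (\<beta> * s)) has_vector_derivative K * exp (\<beta> * s)) (at s)" for s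
      using \<beta> by (auto simp: has_real_derivative_iff_has_vector_derivative[symmetric] intro!: derivative_eq_intros)
    have "norm (u t - u 0) \<le> K / \<beta> * exp (\<beta> * t) - K / \<beta> * exp (\<beta> * 0)"
    proof (rule differentiable_bound_general[of 0 t u "\<lambda>s. K / \<beta> * exp (\<beta> * s)"])
      show "0 < t" using t False by simp
      show "continuous_on {0..t} u"
        using du by (meson has_vector_derivative_continuous continuous_at_imp_continuous_on)
      show "norm (exp (- (of_real s * l)) * g s) \<le> K * exp (\<beta> * s)" if "0 < s" for s
      proof -
        have "norm (exp (- (of_real s * l)) * g s) \<le> exp (- (s * Re l)) * (K * exp (- a * s))"
          using g[of s] that by (simp add: norm_mult)
        also have "\<dots> \<le> exp (- (s * Re l)) * (K * exp (- b * s))"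
          using K b that by (intro mult_left_mono) auto
        also have "\<dots> = K * exp (\<beta> * s)"
          by (simp add: \<beta>_def exp_add[symmetric] algebra_simps)
        finally show ?thesis .
      qed
      show "continuous_on {0..t} (\<lambda>s. K / \<beta> * exp (\<beta> * s))"
        using dphi by (meson has_vector_derivative_continuous continuous_at_imp_continuous_on)
    qed (rule du dphi)+
    also have "\<dots> \<le> K / \<beta> * exp (\<beta> * t)" using K \<beta> by simp
    finally have "norm (u t) \<le> norm (y 0) + K / \<beta> * exp (\<beta> * t)"
      using norm_triangle_sub[of "u t" "u 0"] by (simp add: u_def)
    moreover have "norm (u t) = exp (- (t * Re l)) * norm (y t)" by (simp add: u_def norm_mult)
    ultimately have "exp (- (t * Re l)) * norm (y t) \<le> norm (y 0) + K / \<beta> * exp (\<beta> * t)" by simp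
    then have "exp (t * Re l) * (exp (- (t * Re l)) * norm (y t)) \<le> exp (t * Re l) * (norm (y 0) + K / \<beta> * exp (\<beta> * t))"
      by (intro mult_left_mono) auto
    then have "norm (y t) \<le> exp (t * Re l) * norm (y 0) + K / \<beta> * exp (t * Re l + \<beta> * t)"
      by (simp add: mult.assoc[symmetric] exp_add[symmetric] ring_distribs mult.commute[of _ "K / \<beta>"])
        (simp add: exp_add mult_ac)
    also have "t * Re l + \<beta> * t = - b * t" by (simp add: \<beta>_def algebra_simps)
    also have "exp (t * Re l) * norm (y 0) \<le> exp (- b * t) * norm (y 0)"
    proof (intro mult_right_mono)
      have "b * t \<le> - Re l * t" using b t by (intro mult_right_mono) auto
      then show "exp (t * Re l) \<le> exp (- b * t)" by (simp add: mult.commute)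
    qed simp
    finally show ?thesis by (simp add: algebra_simps)
  qed
  then show ?thesis using b by blast
qed

lemma cmat_mult: "cmat (A ** B) = cmat A ** cmat B"
  by (simp add: cmat_def map_matrix_def matrix_matrix_mult_def vec_eq_iff)

lemma cmat_mat1 [simp]: "cmat (mat 1) = mat 1"
  by (simp add: cmat_def map_matrix_def mat_def vec_eq_iff)

lemma cmat_nth: "cmat A $ i $ j = of_real (A $ i $ j)"
  by (simp add: cmat_def map_matrix_def)

text \<open>The vector p(M) z. Working with the orbit of one vector avoids a separate theory of
  powers of complex matrices.\<close>

definition mpoly_apply :: "complex^'n^'n \<Rightarrow> complex poly \<Rightarrow> complex^'n \<Rightarrow> complex^'n" where
  "mpoly_apply M p z = (\<Sum>i\<le>degree p. coeff p i *s (((*v) M) ^^ i) z)"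

lemma mpoly_apply_atMost:
  assumes "degree p \<le> N"
  shows "mpoly_apply M p z = (\<Sum>i\<le>N. coeff p i *s (((*v) M) ^^ i) z)"
  unfolding mpoly_apply_def using assms
  by (intro sum.mono_neutral_left) (auto simp: coeff_eq_0)

lemma matrix_vector_sum_distrib: "M *v (\<Sum>i\<in>I. f i) = (\<Sum>i\<in>I. M *v f i)" for M :: "complex^'n^'m"
  by (induction I rule: infinite_finite_induct) (simp_all add: matrix_vector_right_distrib)

lemma funpow_matrix_vector_diff:
  "(((*v) M) ^^ i) (x - c *s y) = (((*v) M) ^^ i) x - c *s (((*v) M) ^^ i) y" for M :: "complex^'n^'n"
  by (induction i) (simp_all add: matrix_vector_mult_diff_distrib vector_scalar_commute)

text \<open>The factor M - l commutes with q(M), and both orders are needed: one moves the factor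
  onto the vector, the other exhibits q(M) z as a candidate eigenvector.\<close>

lemma mpoly_apply_linear_factor:
  fixes M :: "complex^'n^'n"
  shows "mpoly_apply M ([:- l, 1:] * q) z = mpoly_apply M q (M *v z - l *s z)" (is ?A)
    and "mpoly_apply M ([:- l, 1:] * q) z = M *v mpoly_apply M q z - l *s mpoly_apply M q z" (is ?B)
proof -
  define N where "N = degree q"
  have c: "coeff ([:- l, 1:] * q) i = (case i of 0 \<Rightarrow> 0 | Suc j \<Rightarrow> coeff q j) - l * coeff q i" for i
    by (cases i) simp_all
  have "degree ([:- l, 1:] * q) \<le> Suc N"
    unfolding N_def by (rule order.trans[OF degree_mult_le]) simp
  then have "mpoly_apply M ([:- l, 1:] * q) z = (\<Sum>i\<le>Suc N. coeff ([:- l, 1:] * q) i *s (((*v) M) ^^ i) z)"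
    by (rule mpoly_apply_atMost)
  also have "\<dots> = (\<Sum>i\<le>Suc N. (case i of 0 \<Rightarrow> 0 | Suc j \<Rightarrow> coeff q j) *s (((*v) M) ^^ i) z)
      - (\<Sum>i\<le>Suc N. (l * coeff q i) *s (((*v) M) ^^ i) z)"
    by (simp only: c sum_subtractf[symmetric] vector_sub_rdistrib)
  also have "(\<Sum>i\<le>Suc N. (case i of 0 \<Rightarrow> 0 | Suc j \<Rightarrow> coeff q j) *s (((*v) M) ^^ i) z)
      = (\<Sum>i\<le>N. coeff q i *s (((*v) M) ^^ Suc i) z)"
    by (simp only: sum.atMost_Suc_shift) simp
  also have "(\<Sum>i\<le>Suc N. (l * coeff q i) *s (((*v) M) ^^ i) z) = (\<Sum>i\<le>N. (l * coeff q i) *s (((*v) M) ^^ i) z)"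
    by (simp add: N_def coeff_eq_0)
  finally have *: "mpoly_apply M ([:- l, 1:] * q) z = (\<Sum>i\<le>N. coeff q i *s (((*v) M) ^^ Suc i) z)
      - (\<Sum>i\<le>N. (l * coeff q i) *s (((*v) M) ^^ i) z)" .
  show ?A
    unfolding * mpoly_apply_def[of M q] N_def[symmetric] funpow_matrix_vector_diff
    by (simp add: sum_subtractf[symmetric] vector_ssub_ldistrib funpow_swap1 mult.commute)
  show ?B
    unfolding * mpoly_apply_def[of M q] N_def[symmetric]
    by (simp add: matrix_vector_sum_distrib vector_scalar_commute vec_eq_iff sum_distrib_left mult.assoc)
qed

lemma funpow_cmat: "(((*v) (cmat A)) ^^ i) z = cmat (mat_pow A i) *v z"
  by (induction i) (simp_all add: mat_pow_Suc cmat_mult matrix_vector_mul_assoc)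

text \<open>A dimension count in place of the Cayley-Hamilton theorem: the powers 0 to N, with N the
  dimension of the matrix space, are too many to be independent.\<close>

lemma ex_annihilating_poly:
  fixes A :: "real^'n^'n"
  shows "\<exists>p. p \<noteq> 0 \<and> (\<forall>z. mpoly_apply (cmat A) p z = 0)"
proof -
  define N where "N = DIM(real^'n^'n)"
  have "\<exists>c :: nat \<Rightarrow> real. (\<exists>i\<le>N. c i \<noteq> 0) \<and> (\<Sum>i\<le>N. c i *\<^sub>R mat_pow A i) = 0"
  \<comment> \<open>Distinct powers form a set with more than N elements, hence a dependent one; a
    repeated power gives a relation directly.\<close>
  proof (cases "inj_on (mat_pow A) {..N}")
    case True
    have "card (mat_pow A ` {..N}) > DIM(real^'n^'n)" using True by (simp add: card_image N_def)
    then have "dependent (mat_pow A ` {..N})" by (intro dependent_biggerset) auto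
    then obtain u where u: "\<exists>v\<in>mat_pow A ` {..N}. u v \<noteq> 0" "(\<Sum>v\<in>mat_pow A ` {..N}. u v *\<^sub>R v) = 0"
      by (subst (asm) dependent_finite) auto
    then show ?thesis using True by (intro exI[of _ "u \<circ> mat_pow A"]) (auto simp: sum.reindex)
  next
    case False
    then obtain i j where ij: "i \<le> N" "j \<le> N" "i \<noteq> j" "mat_pow A i = mat_pow A j"
      by (auto simp: inj_on_def)
    have "(\<Sum>k\<le>N. ((if k = i then 1 else 0) - (if k = j then 1 else 0)) *\<^sub>R mat_pow A k) = mat_pow A i - mat_pow A j"
      using ij by (simp add: algebra_simps sum_subtractf if_distrib[of "\<lambda>x. x *\<^sub>R _"] cong: if_cong)
    then show ?thesis
      using ij by (intro exI[of _ "\<lambda>k. (if k = i then 1 else 0) - (if k = j then 1 else 0)"]) auto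
  qed
  then obtain c :: "nat \<Rightarrow> real" and i where i: "i \<le> N" "c i \<noteq> 0" and c: "(\<Sum>i\<le>N. c i *\<^sub>R mat_pow A i) = 0"
    by blast
  define p where "p = (\<Sum>i\<le>N. monom (complex_of_real (c i)) i)"
  have cp: "coeff p k = (if k \<le> N then of_real (c k) else 0)" for k
    by (simp add: p_def coeff_sum)
  have "p \<noteq> 0" using cp[of i] i by auto
  moreover have "mpoly_apply (cmat A) p z = 0" for z
  proof -
    have "degree p \<le> N" by (rule degree_le) (simp add: cp)
    then have "mpoly_apply (cmat A) p z = (\<Sum>i\<le>N. of_real (c i) *s (cmat (mat_pow A i) *v z))"
      by (simp add: mpoly_apply_atMost funpow_cmat cp)
    also have "\<dots> = cmat (\<Sum>i\<le>N. c i *\<^sub>R mat_pow A i) *v z"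
      by (simp add: vec_eq_iff matrix_vector_mult_def cmat_nth sum_distrib_left sum_distrib_right mult.assoc)
        (subst sum.swap, simp)
    also have "\<dots> = 0" unfolding c by (simp add: vec_eq_iff matrix_vector_mult_def cmat_nth)
    finally show ?thesis .
  qed
  ultimately show ?thesis by blast
qed

text \<open>Induction on the degree of a polynomial annihilating z, in place of the Jordan form.
  Split off a root l. If l is an eigenvalue, w = (A - l) z is annihilated by the cofactor, and each
  coordinate of the orbit of z solves a scalar equation with rate l, forced by the decaying orbit of
  w. Otherwise the cofactor already annihilates z.\<close>

lemma mat_exp_orbit_decay:
  fixes A :: "real^'n^'n"
  assumes ev: "\<And>z. complex_eigenvalue A z \<Longrightarrow> Re z < 0"
  assumes "p \<noteq> 0" "mpoly_apply (cmat A) p z = 0"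
  shows "\<exists>K a. a > 0 \<and> (\<forall>i. \<forall>t\<ge>0. norm ((cmat (mat_exp (t *\<^sub>R A)) *v z) $ i) \<le> K * exp (- a * t))"
  using assms(2-)
proof (induction "degree p" arbitrary: p z)
  case 0
  then obtain c where "p = [:c:]" "c \<noteq> 0" by (metis degree_0_id pCons_0_0)
  with 0 have "z = 0" by (simp add: mpoly_apply_def)
  then show ?case by (intro exI[of _ 0] exI[of _ 1]) simp
next
  case (Suc n)
  have "\<not> constant (poly p)"
    using Suc(2) by (simp add: constant_degree)
  then obtain l where "poly p l = 0" using fundamental_theorem_of_algebra by blast
  then obtain q where q: "p = [:- l, 1:] * q" by (metis poly_eq_0_iff_dvd dvdE)
  have q0: "q \<noteq> 0" using Suc.prems q by auto
  then have deg: "n = degree q" using Suc(2) q degree_mult_eq[of "[:- l, 1:]" q] by simp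
  show ?case
  proof (cases "complex_eigenvalue A l")
    case True
    define w where "w = cmat A *v z - l *s z"
    have "mpoly_apply (cmat A) q w = 0"
      using Suc.prems(2) mpoly_apply_linear_factor(1)[of "cmat A" l q z] q by (simp add: w_def)
    from Suc(1)[OF deg q0 this] obtain K a where a: "a > 0"
      and K: "\<And>i t. t \<ge> 0 \<Longrightarrow> norm ((cmat (mat_exp (t *\<^sub>R A)) *v w) $ i) \<le> K * exp (- a * t)" by blast
    have "\<exists>K' b. b > 0 \<and> (\<forall>t\<ge>0. norm ((cmat (mat_exp (t *\<^sub>R A)) *v z) $ i) \<le> K' * exp (- b * t))" for i
    proof (rule scalar_ode_decay[OF _ ev[OF True] a K])
      fix t
      have "((\<lambda>t. of_real (mat_exp (t *\<^sub>R A) $ i $ j)) has_vector_derivative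
          complex_of_real ((A ** mat_exp (t *\<^sub>R A)) $ i $ j)) (at t)" for j
        using mat_exp_entry_derivative[of A i j t]
        by (simp add: has_real_derivative_iff_has_vector_derivative has_vector_derivative_of_real)
      then have "((\<lambda>t. \<Sum>j\<in>UNIV. of_real (mat_exp (t *\<^sub>R A) $ i $ j) * z $ j) has_vector_derivative
          (\<Sum>j\<in>UNIV. complex_of_real ((A ** mat_exp (t *\<^sub>R A)) $ i $ j) * z $ j)) (at t)"
        by (intro has_vector_derivative_sum has_vector_derivative_mult_left) auto
      moreover have "(\<Sum>j\<in>UNIV. complex_of_real ((A ** mat_exp (t *\<^sub>R A)) $ i $ j) * z $ j)
          = (cmat (mat_exp (t *\<^sub>R A) ** A) *v z) $ i"
        by (simp add: matrix_vector_mult_def cmat_nth mat_exp_commute)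
      moreover have "cmat (mat_exp (t *\<^sub>R A) ** A) *v z = cmat (mat_exp (t *\<^sub>R A)) *v (w + l *s z)"
        by (simp add: cmat_mult w_def matrix_vector_mul_assoc)
      ultimately show "((\<lambda>t. (cmat (mat_exp (t *\<^sub>R A)) *v z) $ i) has_vector_derivative
          l * (cmat (mat_exp (t *\<^sub>R A)) *v z) $ i + (cmat (mat_exp (t *\<^sub>R A)) *v w) $ i) (at t)"
        by (simp add: matrix_vector_mult_def[of "cmat (mat_exp (_ *\<^sub>R A))" z] cmat_nth
            matrix_vector_right_distrib vector_scalar_commute add.commute)
    qed
    then obtain K' b where b: "\<And>i. b i > 0"
      and K': "\<And>i t. t \<ge> 0 \<Longrightarrow> norm ((cmat (mat_exp (t *\<^sub>R A)) *v z) $ i) \<le> K' i * exp (- b i * t)"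
      by metis
    show ?thesis
    proof (intro exI conjI allI impI)
      show "Min (range b) > 0" using b by simp
      fix i and t :: real assume t: "0 \<le> t"
      have "norm ((cmat (mat_exp (t *\<^sub>R A)) *v z) $ i) \<le> K' i * exp (- b i * t)" by (rule K'[OF t])
      also have "\<dots> \<le> Max (range K') * exp (- b i * t)" by (intro mult_right_mono) auto
      also have "\<dots> \<le> Max (range K') * exp (- Min (range b) * t)"
      proof (intro mult_left_mono)
        have "Min (range b) * t \<le> b i * t" using t by (intro mult_right_mono) auto
        then show "exp (- b i * t) \<le> exp (- Min (range b) * t)" by (simp only: exp_le_cancel_iff mult_minus_left neg_le_iff_le)
        have "0 \<le> K' i" using K'[of 0 i] norm_ge_zero order_trans by (metis exp_zero mult_1_right mult_zero_right order_refl)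
        also have "\<dots> \<le> Max (range K')" by simp
        finally show "0 \<le> Max (range K')" .
      qed
      finally show "norm ((cmat (mat_exp (t *\<^sub>R A)) *v z) $ i) \<le> Max (range K') * exp (- Min (range b) * t)" .
    qed
  next
    case False
    have "cmat A *v mpoly_apply (cmat A) q z = l *s mpoly_apply (cmat A) q z"
      using Suc.prems(2) mpoly_apply_linear_factor(2)[of "cmat A" l q z] q by simp
    then have "mpoly_apply (cmat A) q z = 0" using False unfolding complex_eigenvalue_def by blast
    from Suc(1)[OF deg q0 this] show ?thesis .
  qed
qed

lemma norm_le_entries:
  fixes A :: "real^'n^'m"
  assumes "\<And>i j. \<bar>A $ i $ j\<bar> \<le> K"
  shows "norm A \<le> real CARD('m) * (real CARD('n) * K)"
proof -
  have "norm A \<le> (\<Sum>i\<in>UNIV. norm (A $ i))" by (simp add: norm_vec_def[of A] L2_set_le_sum)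
  also have "\<dots> \<le> (\<Sum>i\<in>(UNIV :: 'm set). \<Sum>j\<in>(UNIV :: 'n set). \<bar>A $ i $ j\<bar>)"
    by (intro sum_mono norm_le_l1_cart)
  also have "\<dots> \<le> (\<Sum>i\<in>(UNIV :: 'm set). \<Sum>j\<in>(UNIV :: 'n set). K)" by (intro sum_mono assms)
  finally show ?thesis by simp
qed

text \<open>Orbits of the unit vectors are the columns; the largest constant and the smallest rate
  serve all entries.\<close>

lemma mat_exp_decay:
  fixes A :: "real^'n^'n"
  assumes ev: "\<And>z. complex_eigenvalue A z \<Longrightarrow> Re z < 0"
  shows "\<exists>K a. a > 0 \<and> (\<forall>t\<ge>0. norm (mat_exp (t *\<^sub>R A)) \<le> K * exp (- a * t))"
proof -
  obtain p where p: "p \<noteq> 0" "\<And>z. mpoly_apply (cmat A) p z = 0" using ex_annihilating_poly by blast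
  have "\<exists>K a. a > 0 \<and> (\<forall>i. \<forall>t\<ge>0. \<bar>mat_exp (t *\<^sub>R A) $ i $ j\<bar> \<le> K * exp (- a * t))" for j
  proof -
    have "(cmat M *v axis j 1) $ i = of_real (M $ i $ j)" for M :: "real^'n^'n" and i
      by (simp add: matrix_vector_mult_def axis_def cmat_nth if_distrib cong: if_cong)
    then show ?thesis
      using mat_exp_orbit_decay[OF ev p(1) p(2)[of "axis j 1"]] by simp
  qed
  then obtain K a where a: "\<And>j. a j > 0"
    and K: "\<And>i j t. t \<ge> 0 \<Longrightarrow> \<bar>mat_exp (t *\<^sub>R A) $ i $ j\<bar> \<le> K j * exp (- a j * t)" by metis
  have "norm (mat_exp (t *\<^sub>R A)) \<le> (real CARD('n) * (real CARD('n) * Max (range K))) * exp (- Min (range a) * t)"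
    if t: "t \<ge> 0" for t
  proof -
    have "\<bar>mat_exp (t *\<^sub>R A) $ i $ j\<bar> \<le> Max (range K) * exp (- Min (range a) * t)" for i j
    proof -
      have K0: "0 \<le> K j" using order_trans[OF abs_ge_zero K[of 0 i j]] by simp
      have "\<bar>mat_exp (t *\<^sub>R A) $ i $ j\<bar> \<le> K j * exp (- a j * t)" by (rule K[OF t])
      also have "\<dots> \<le> K j * exp (- Min (range a) * t)"
      proof (intro mult_left_mono K0)
        have "Min (range a) * t \<le> a j * t" using t by (intro mult_right_mono) auto
        then show "exp (- a j * t) \<le> exp (- Min (range a) * t)" by (simp only: exp_le_cancel_iff mult_minus_left neg_le_iff_le)
      qed
      also have "\<dots> \<le> Max (range K) * exp (- Min (range a) * t)" by (intro mult_right_mono) auto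
      finally show ?thesis .
    qed
    from norm_le_entries[OF this] show ?thesis by (simp add: mult.assoc)
  qed
  moreover have "Min (range a) > 0" using a by simp
  ultimately show ?thesis by blast
qed

lemma mat_mult_nth: "(mat z ** X) $ i $ j = z * X $ i $ j" for X :: "'a::comm_ring_1^'m^'n"
  by (simp add: matrix_matrix_mult_def mat_def if_distrib[of "\<lambda>x. x * _"] cong: if_cong)

lemma mult_mat_nth: "(X ** mat z) $ i $ j = z * X $ i $ j" for X :: "'a::comm_ring_1^'n^'m"
  by (simp add: matrix_matrix_mult_def mat_def if_distrib[of "\<lambda>x. _ * x"] mult.commute cong: if_cong)

lemma diff_matrix_mult: "(A - B) ** C = A ** C - B ** C" for A :: "complex^'n^'m"
  by (vector matrix_matrix_mult_def sum_subtractf[symmetric] field_simps)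

lemma mult_diff_matrix: "A ** (B - C) = A ** B - A ** C" for A :: "complex^'n^'m"
  by (vector matrix_matrix_mult_def sum_subtractf[symmetric] field_simps)

section \<open>Minimal realizations\<close>

text \<open>Functionals in W evaluate the state along directions that no input reaches. A basis of W
  extended to the whole space gives new coordinates in which these directions can be deleted without
  changing the transfer function, so a nonzero W would contradict minimality.\<close>

lemma minimal_triple_no_uncontrollable_subspace:
  fixes A :: "real^'n^'n" and B :: "real^'m^'n" and C :: "real^'n^'d"
  assumes min: "minimal_triple A B C" and W: "subspace W"
    and WA: "\<And>w. w \<in> W \<Longrightarrow> w v* A \<in> W" and WB: "\<And>w. w \<in> W \<Longrightarrow> w v* B = 0"
    and w0: "w0 \<in> W"
  shows "w0 = 0"
proof (rule ccontr)
  assume "w0 \<noteq> 0"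
  obtain b where b: "b \<subseteq> W" "independent b" "W \<subseteq> span b"
    using basis_exists[of W] by metis
  have "b \<noteq> {}" using b(3) w0 \<open>w0 \<noteq> 0\<close> by auto
  obtain Bs where Bs: "b \<subseteq> Bs" "independent Bs" "span Bs = UNIV"
    by (rule maximal_independent_subset_extend[OF subset_UNIV b(2)]) auto
  have "finite Bs" using Bs(2) by (rule independent_imp_finite)
  have "card Bs = CARD('n)"
    using dim_span_eq_card_independent[OF Bs(2)] Bs(3) by simp
  then obtain \<phi> where \<phi>: "bij_betw \<phi> (UNIV :: 'n set) Bs"
    using finite_same_card_bij[of "UNIV :: 'n set" Bs] \<open>finite Bs\<close> by auto
  \<comment> \<open>The retained coordinates. Row i of T is the functional \<open>\<phi> i\<close>;
    the rows taken from W obey an unforced equation of their own.\<close>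
  define S where "S = {i. \<phi> i \<notin> b}"
  have "S \<noteq> UNIV" using \<open>b \<noteq> {}\<close> Bs(1) \<phi> unfolding S_def bij_betw_def by blast
  then obtain i0 where i0: "i0 \<notin> S" by blast
  define T :: "real^'n^'n" where "T = (\<chi> i. \<phi> i)"
  have "invertible T"
  proof (rule invertible_if_injective)
    fix x assume "T *v x = 0"
    then have "\<phi> i \<bullet> x = 0" for i
      by (simp add: T_def vec_eq_iff matrix_vector_mul_component)
    then have "orthogonal x y" if "y \<in> Bs" for y
      using that \<phi> by (auto simp: orthogonal_def inner_commute bij_betw_def)
    then have "orthogonal x x" using orthogonal_to_span[of x Bs] Bs(3) by blast
    then show "x = 0" by (simp add: orthogonal_def)
  qed
  define Ti where "Ti = matrix_inv T"
  have TTi: "T ** Ti = mat 1" "Ti ** T = mat 1"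
    unfolding Ti_def using \<open>invertible T\<close> by (rule matrix_inv_inverse)+
  have sp: "(u v* Ti) $ j = 0" if "u \<in> span b" "j \<in> S" for u j
    using that(1)
  proof (induction rule: span_induct)
    case base
    show ?case by (auto simp: subspace_def vector_matrix_add_ldistrib scaleR_vector_matrix_assoc)
  next
    case (step u)
    then obtain k where k: "u = \<phi> k" "k \<notin> S" using Bs(1) \<phi> by (auto simp: S_def bij_betw_def)
    have "\<phi> k v* Ti = (T ** Ti) $ k" by (simp add: matrix_mult_row T_def)
    then show ?case using k that(2) by (auto simp: TTi mat_def)
  qed
  define M where "M = T ** A ** Ti"
  \<comment> \<open>By invariance the image of a functional in b lies in the span of b again, and
    that span has no component in S.\<close>
  have M0: "M $ i $ j = 0" if "i \<notin> S" "j \<in> S" for i j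
  proof -
    have "\<phi> i \<in> b" using that by (simp add: S_def)
    then have "\<phi> i v* A \<in> span b" using WA b by blast
    moreover have "M $ i = (\<phi> i v* A) v* Ti" by (simp add: M_def matrix_mult_row T_def)
    ultimately show ?thesis using sp that by simp
  qed
  have TB0: "(T ** B) $ i = 0" if "i \<notin> S" for i
    using that WB b(1) by (auto simp: matrix_mult_row T_def S_def)
  define A' where "A' = (\<chi> i j. if i \<in> S \<and> j \<in> S then M $ i $ j else 0)"
  define C' where "C' = (\<chi> i j. if j \<in> S then (C ** Ti) $ i $ j else 0)"
  have "state_supported_on S A' (T ** B) C'"
    using TB0 by (auto simp: state_supported_on_def A'_def C'_def)
  moreover have "transfer_fun A B C z = transfer_fun A' (T ** B) C' z"
    if R: "invertible (mat z - cmat A)" and R': "invertible (mat z - cmat A')" for z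
  proof -
    \<comment> \<open>The input-to-state response of the reduced system. It turns out to solve the
      resolvent equation of the full system too, where the solution is unique.\<close>
    define X where "X = matrix_inv (mat z - cmat A') ** cmat (T ** B)"
    have RX: "(mat z - cmat A') ** X = cmat (T ** B)"
      by (simp add: X_def matrix_mul_assoc matrix_inv_inverse[OF R'])
    have ent: "((mat z - cmat Y) ** X) $ i $ l = z * X $ i $ l - (\<Sum>j\<in>UNIV. of_real (Y $ i $ j) * X $ j $ l)" for Y :: "real^'n^'n" and i l
      by (simp add: diff_matrix_mult mat_mult_nth) (simp add: matrix_matrix_mult_def cmat_nth)
    \<comment> \<open>Padding gives the reduced matrix a zero row at \<open>i0\<close>, so its
      resolvent cannot exist at z = 0. With z nonzero, the entries of X outside S vanish.\<close>
    have "z \<noteq> 0"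
    proof
      assume "z = 0"
      have "((mat z - cmat A') ** matrix_inv (mat z - cmat A')) $ i0 $ i0 = 0"
        using i0 \<open>z = 0\<close> by (simp add: matrix_matrix_mult_def A'_def cmat_nth mat_def)
      then show False unfolding matrix_inv_inverse(1)[OF R'] by (simp add: mat_def)
    qed
    have X0: "X $ i $ l = 0" if "i \<notin> S" for i l
    proof -
      have "((mat z - cmat A') ** X) $ i $ l = 0" using TB0[OF that] by (simp add: RX cmat_nth)
      then show ?thesis using that \<open>z \<noteq> 0\<close> by (simp add: ent A'_def)
    qed
    have MX: "(mat z - cmat M) ** X = cmat (T ** B)"
    proof -
      have "((mat z - cmat M) ** X) $ i $ l = cmat (T ** B) $ i $ l" for i l
      proof (cases "i \<in> S")
        case True
        have "(\<Sum>j\<in>UNIV. of_real (M $ i $ j) * X $ j $ l) = (\<Sum>j\<in>UNIV. of_real (A' $ i $ j) * X $ j $ l)"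
          using True X0 by (intro sum.cong) (auto simp: A'_def)
        then show ?thesis by (simp add: ent flip: RX)
      next
        case False
        have "of_real (M $ i $ j) * X $ j $ l = 0" for j
          using M0[OF False] X0 by (cases "j \<in> S") auto
        then have "(\<Sum>j\<in>UNIV. of_real (M $ i $ j) * X $ j $ l) = 0" by (intro sum.neutral) auto
        then show ?thesis using X0[OF False] TB0[OF False] by (simp add: ent cmat_nth)
      qed
      then show ?thesis by (simp add: vec_eq_iff)
    qed
    have "cmat Ti ** (mat z - cmat M) = (mat z - cmat A) ** cmat Ti"
    proof -
      have "Ti ** M = A ** Ti" by (simp add: M_def matrix_mul_assoc TTi)
      then have "cmat Ti ** cmat M = cmat A ** cmat Ti" by (metis cmat_mult)
      moreover have "cmat Ti ** mat z = mat z ** cmat Ti" by (simp add: vec_eq_iff mult_mat_nth mat_mult_nth)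
      ultimately show ?thesis by (simp add: diff_matrix_mult mult_diff_matrix)
    qed
    then have "(mat z - cmat A) ** (cmat Ti ** X) = cmat Ti ** ((mat z - cmat M) ** X)"
      by (simp add: matrix_mul_assoc)
    also have "\<dots> = cmat B"
      by (simp add: MX flip: cmat_mult) (simp add: matrix_mul_assoc TTi)
    finally have "cmat Ti ** X = matrix_inv (mat z - cmat A) ** cmat B"
      by (metis R matrix_inv_inverse(2) matrix_mul_assoc matrix_mul_lid)
    then have "transfer_fun A B C z = cmat (C ** Ti) ** X"
      by (simp add: transfer_fun_def matrix_mul_assoc[symmetric] cmat_mult)
    also have "\<dots> = cmat C' ** X"
    proof -
      have "of_real ((C ** Ti) $ i $ j) * X $ j $ l = of_real (C' $ i $ j) * X $ j $ l" for i j l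
        using X0 by (auto simp: C'_def)
      then show ?thesis by (simp only: matrix_matrix_mult_def[of "cmat _" X] cmat_nth)
    qed
    finally show ?thesis by (simp add: transfer_fun_def X_def matrix_mul_assoc)
  qed
  ultimately show False using min \<open>S \<noteq> UNIV\<close> unfolding minimal_triple_def by blast
qed

section \<open>Uniform lower bounds for positive definite forms\<close>

text \<open>The form attains its minimum on the compact product of K with the unit sphere, where it
  is positive; homogeneity extends the bound to all vectors.\<close>

lemma uniform_posdef_lower_bound:
  fixes A :: "'p::metric_space \<Rightarrow> real^'n^'n"
  assumes K: "compact K" and A: "continuous_on K A"
    and pos: "\<And>p x. p \<in> K \<Longrightarrow> x \<noteq> 0 \<Longrightarrow> 0 < x \<bullet> (A p *v x)"
  shows "\<exists>c>0. \<forall>p\<in>K. \<forall>x. c * (norm x)\<^sup>2 \<le> x \<bullet> (A p *v x)"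
proof (cases "K = {}")
  case False
  have ne: "K \<times> sphere (0 :: real^'n) 1 \<noteq> {}" using False by simp
  have "compact (K \<times> sphere (0 :: real^'n) 1)" using K by (intro compact_Times) auto
  moreover have "continuous_on (K \<times> sphere 0 1) (\<lambda>q. snd q \<bullet> (A (fst q) *v snd q))"
    by (intro continuous_intros continuous_on_matrix_vector continuous_on_compose2[OF A]) auto
  ultimately obtain q where q: "q \<in> K \<times> sphere (0 :: real^'n) 1"
    and le: "\<And>r. r \<in> K \<times> sphere 0 1 \<Longrightarrow> snd q \<bullet> (A (fst q) *v snd q) \<le> snd r \<bullet> (A (fst r) *v snd r)"
    using continuous_attains_inf[OF _ ne, of "\<lambda>q. snd q \<bullet> (A (fst q) *v snd q)"] by blast
  define c where "c = snd q \<bullet> (A (fst q) *v snd q)"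
  have "c * (norm x)\<^sup>2 \<le> x \<bullet> (A p *v x)" if "p \<in> K" for p x
  proof (cases "x = 0")
    case False
    define y where "y = (1 / norm x) *\<^sub>R x"
    have "c \<le> y \<bullet> (A p *v y)" using le[of "(p, y)"] that False by (simp add: c_def y_def)
    moreover have x: "x = norm x *\<^sub>R y" using False by (simp add: y_def)
    ultimately have "(norm x)\<^sup>2 * c \<le> (norm x)\<^sup>2 * (y \<bullet> (A p *v y))" by (intro mult_left_mono) auto
    also have "\<dots> = x \<bullet> (A p *v x)"
      unfolding power2_eq_square mult.assoc by (simp add: y_def matrix_vector_mult_scaleR False)
    finally show ?thesis by (simp add: mult.commute)
  qed simp
  moreover have "c > 0"
  proof -
    have "snd q \<noteq> 0" using q by (metis mem_Times_iff mem_sphere_0 norm_zero zero_neq_one)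
    then show ?thesis using q pos[of "fst q" "snd q"] by (auto simp: c_def)
  qed
  ultimately show ?thesis by blast
qed (auto intro: exI[of _ 1])

lemma posdef_lower_bound:
  fixes A :: "real^'n^'n"
  assumes "\<And>x. x \<noteq> 0 \<Longrightarrow> 0 < x \<bullet> (A *v x)"
  shows "\<exists>c>0. \<forall>x. c * (norm x)\<^sup>2 \<le> x \<bullet> (A *v x)"
  using uniform_posdef_lower_bound[of "{0::real}" "\<lambda>_. A"] assms by auto

section \<open>The Riccati equation\<close>

definition qform :: "real^'n^'n \<Rightarrow> real^'n \<Rightarrow> real" where
  "qform P x = x \<bullet> (P *v x)"

text \<open>The covariance update of the Kalman filter without its noise term, which is added
  separately so that the order properties do not involve it. Those properties assume
  \<open>C ** P ** transpose C\<close> invertible, since \<open>matrix_inv\<close> is unspecified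
  otherwise.\<close>

definition ric_step :: "real^'n^'n \<Rightarrow> real^'n^'d \<Rightarrow> real^'n^'n \<Rightarrow> real^'n^'n" where
  "ric_step E C P = E ** P ** transpose E -
     E ** P ** transpose C ** matrix_inv (C ** P ** transpose C) ** C ** P ** transpose E"

definition ric_gain :: "real^'n^'n \<Rightarrow> real^'n^'d \<Rightarrow> real^'n^'n \<Rightarrow> real^'d^'n" where
  "ric_gain E C P = E ** P ** transpose C ** matrix_inv (C ** P ** transpose C)"

lemma transpose_add: "transpose (A + B) = transpose A + transpose B" for A :: "real^'n^'m"
  by (simp add: transpose_def vec_eq_iff)

lemma transpose_diff: "transpose (A - B) = transpose A - transpose B" for A :: "real^'n^'m"
  by (simp add: transpose_def vec_eq_iff)

lemma qform_add: "qform (P + Q) x = qform P x + qform Q x"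
  by (simp add: qform_def matrix_vector_mult_add_rdistrib inner_add_right)

lemma qform_diff: "qform (P - Q) x = qform P x - qform Q x"
  by (simp add: qform_def matrix_vector_mult_diff_rdistrib inner_diff_right)

lemma qform_le_norm: "qform P x \<le> norm P * (norm x)\<^sup>2"
proof -
  have "qform P x \<le> norm x * norm (P *v x)" unfolding qform_def by (rule norm_cauchy_schwarz)
  also have "\<dots> \<le> norm x * (norm P * norm x)" by (intro mult_left_mono norm_matrix_vector_le) simp
  finally show ?thesis by (simp add: power2_eq_square mult_ac)
qed

lemma qform_scaleR: "qform P (c *\<^sub>R x) = c\<^sup>2 * qform P x"
  by (simp add: qform_def matrix_vector_mult_scaleR power2_eq_square)

lemma sym_inner:
  fixes P :: "real^'n^'n"
  assumes "transpose P = P"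
  shows "x \<bullet> (P *v y) = y \<bullet> (P *v x)"
proof -
  have "x v* P = P *v x" using transpose_matrix_vector[of P x] by (simp only: assms)
  then have "x \<bullet> (P *v y) = (P *v x) \<bullet> y" by (simp only: dot_lmul_matrix[symmetric])
  then show ?thesis by (simp only: inner_commute)
qed

text \<open>Polarization. Monotone limits, norm bounds and equality of symmetric matrices can
  thereby be checked on their forms.\<close>

lemma sym_entry_qform:
  fixes P :: "real^'n^'n"
  assumes "transpose P = P"
  shows "P $ i $ j = (qform P (axis i 1 + axis j 1) - qform P (axis i 1) - qform P (axis j 1)) / 2"
proof -
  have e: "axis k 1 \<bullet> (P *v axis l 1) = P $ k $ l" for k l
    by (simp add: matrix_vector_mult_basis column_def inner_axis')
  have "P $ j $ i = P $ i $ j" using assms by (metis transpose_def vec_lambda_beta)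
  then show ?thesis
    by (simp add: qform_def matrix_vector_right_distrib inner_add_left inner_add_right e)
qed

lemma sym_eqI:
  fixes P Q :: "real^'n^'n"
  assumes "transpose P = P" "transpose Q = Q" "\<And>x. qform P x = qform Q x"
  shows "P = Q"
proof -
  have "P $ i $ j = Q $ i $ j" for i j
    by (simp only: sym_entry_qform[OF assms(1)] sym_entry_qform[OF assms(2)] assms(3))
  then show ?thesis by (simp add: vec_eq_iff)
qed

lemma transpose_matrix_inv:
  fixes V :: "real^'n^'n"
  assumes "invertible V" "transpose V = V"
  shows "transpose (matrix_inv V) = matrix_inv V"
proof -
  have "transpose V ** transpose (matrix_inv V) = mat 1" "transpose (matrix_inv V) ** transpose V = mat 1"
    by (simp_all only: matrix_transpose_mul[symmetric] matrix_inv_inverse[OF assms(1)] transpose_mat)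
  then show ?thesis by (intro matrix_inv_unique[symmetric]) (simp_all only: assms(2))
qed

lemma transpose_congruence:
  fixes P :: "real^'n^'n" and C :: "real^'n^'d"
  assumes "transpose P = P" shows "transpose (C ** P ** transpose C) = C ** P ** transpose C"
  using assms by (simp add: matrix_transpose_mul matrix_mul_assoc)

lemma qform_congruence: "qform (C ** P ** transpose C) y = qform P (y v* C)" for C :: "real^'n^'d"
  unfolding qform_def
  by (simp add: matrix_vector_mul_assoc[symmetric] dot_lmul_matrix)

lemma invertible_congruence:
  fixes P :: "real^'n^'n" and C :: "real^'n^'d"
  assumes P: "\<And>x. x \<noteq> 0 \<Longrightarrow> 0 < qform P x" and C: "\<And>y. y v* C = 0 \<Longrightarrow> y = 0"
  shows "invertible (C ** P ** transpose C)"
proof (rule invertible_if_injective)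
  fix y assume "(C ** P ** transpose C) *v y = 0"
  then have "qform (C ** P ** transpose C) y = 0" by (simp add: qform_def)
  then have "qform P (y v* C) = 0" by (simp only: qform_congruence)
  then show "y = 0" using P[of "y v* C"] C by fastforce
qed

lemma transpose_ric_step:
  assumes "transpose P = P" "invertible (C ** P ** transpose C)"
  shows "transpose (ric_step E C P) = ric_step E C P"
  using transpose_matrix_inv[OF assms(2) transpose_congruence[OF assms(1)]] assms(1)
  by (simp add: ric_step_def transpose_diff matrix_transpose_mul matrix_mul_assoc)

lemma qform_ric_step:
  assumes "transpose P = P"
  shows "qform (ric_step E C P) x = qform P (x v* E)
    - (C *v (P *v (x v* E))) \<bullet> (matrix_inv (C ** P ** transpose C) *v (C *v (P *v (x v* E))))"
proof -
  have "x \<bullet> (E ** P ** transpose C ** W ** C ** P ** transpose E *v x)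
      = (C *v (P *v (x v* E))) \<bullet> (W *v (C *v (P *v (x v* E))))" for W
  proof -
    have "x \<bullet> (E ** P ** transpose C ** W ** C ** P ** transpose E *v x)
      = (x v* E) \<bullet> (P *v ((W *v (C *v (P *v (x v* E)))) v* C))"
      by (simp add: matrix_vector_mul_assoc[symmetric] dot_lmul_matrix)
    also have "\<dots> = ((W *v (C *v (P *v (x v* E)))) v* C) \<bullet> (P *v (x v* E))"
      by (rule sym_inner[OF assms])
    also have "\<dots> = (C *v (P *v (x v* E))) \<bullet> (W *v (C *v (P *v (x v* E))))"
      by (simp only: dot_lmul_matrix) (rule inner_commute)
    finally show ?thesis .
  qed
  then show ?thesis
    by (simp add: ric_step_def qform_diff qform_congruence) (simp add: qform_def)
qed

lemma qform_feedback:
  assumes "transpose P = P"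
  shows "qform P (x v* (E - K ** C)) = qform P (x v* E) - 2 * ((x v* K) \<bullet> (C *v (P *v (x v* E))))
    + qform (C ** P ** transpose C) (x v* K)"
proof -
  define a b where "a = x v* E" and "b = x v* K"
  have "x v* (E - K ** C) = a - b v* C"
    by (simp add: a_def b_def vector_matrix_diff_rdistrib vector_matrix_mul_assoc2)
  moreover have "qform P (a - b v* C) = qform P a - 2 * ((b v* C) \<bullet> (P *v a)) + qform P (b v* C)"
    using sym_inner[OF assms, of a "b v* C"]
    by (simp add: qform_def matrix_vector_mult_diff_distrib inner_diff_left inner_diff_right)
  ultimately show ?thesis by (simp add: qform_congruence dot_lmul_matrix flip: a_def b_def)
qed

text \<open>Completing the square: replacing the optimal gain by an arbitrary K costs exactly a
  square weighted by the innovation covariance. Optimality and monotonicity of the Riccati step are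
  read off from this identity.\<close>

lemma ric_completion:
  assumes P: "transpose P = P" and V: "invertible (C ** P ** transpose C)"
  shows "qform P (x v* (E - K ** C)) = qform (ric_step E C P) x
    + qform (C ** P ** transpose C) (x v* K - matrix_inv (C ** P ** transpose C) *v (C *v (P *v (x v* E))))"
proof -
  define V where "V = C ** P ** transpose C"
  define c where "c = C *v (P *v (x v* E))"
  define b where "b = x v* K"
  have sV: "transpose V = V" unfolding V_def by (rule transpose_congruence[OF P])
  have "V *v (matrix_inv V *v c) = c"
    using V by (simp add: matrix_vector_mul_assoc matrix_inv_inverse V_def)
  then have "qform V (b - matrix_inv V *v c) = qform V b - 2 * (b \<bullet> c) + c \<bullet> (matrix_inv V *v c)"
    using sym_inner[OF sV, of "matrix_inv V *v c" b]
    by (simp add: qform_def matrix_vector_mult_diff_distrib inner_diff_left inner_diff_right inner_commute)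
  then show ?thesis
    unfolding qform_feedback[OF P] qform_ric_step[OF P] V_def[symmetric] c_def[symmetric] b_def[symmetric] by simp
qed

lemma ric_step_le:
  assumes P: "transpose P = P" and V: "invertible (C ** P ** transpose C)" and psd: "\<And>x. 0 \<le> qform P x"
  shows "qform (ric_step E C P) x \<le> qform P (x v* (E - K ** C))"
  unfolding ric_completion[OF P V] by (simp add: qform_congruence psd)

lemma ric_step_gain:
  assumes P: "transpose P = P" and V: "invertible (C ** P ** transpose C)"
  shows "qform P (x v* (E - ric_gain E C P ** C)) = qform (ric_step E C P) x"
proof -
  define W where "W = matrix_inv (C ** P ** transpose C)"
  have W: "transpose W = W" unfolding W_def by (rule transpose_matrix_inv[OF V transpose_congruence[OF P]])
  have "x v* ric_gain E C P = W *v (C *v (P *v (x v* E)))"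
  proof -
    have "x v* ric_gain E C P = (((x v* E) v* P) v* transpose C) v* W"
      by (simp add: ric_gain_def vector_matrix_mul_assoc2 W_def)
    then show ?thesis by (metis P W transpose_matrix_vector vector_transpose_matrix)
  qed
  then show ?thesis unfolding ric_completion[OF P V] W_def by (simp add: qform_def)
qed

text \<open>The gain that is optimal for Q is admissible for P. Using it on both sides avoids any
  monotonicity of matrix inversion.\<close>

lemma ric_step_mono:
  assumes P: "transpose P = P" "invertible (C ** P ** transpose C)" "\<And>x. 0 \<le> qform P x"
    and Q: "transpose Q = Q" "invertible (C ** Q ** transpose C)"
    and le: "\<And>x. qform P x \<le> qform Q x"
  shows "qform (ric_step E C P) x \<le> qform (ric_step E C Q) x"
proof -
  have "qform (ric_step E C P) x \<le> qform P (x v* (E - ric_gain E C Q ** C))" by (rule ric_step_le[OF P])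
  also have "\<dots> \<le> qform Q (x v* (E - ric_gain E C Q ** C))" by (rule le)
  finally show ?thesis by (simp only: ric_step_gain[OF Q])
qed

lemma ric_step_nonneg:
  assumes "transpose P = P" "invertible (C ** P ** transpose C)" "\<And>x. 0 \<le> qform P x"
  shows "0 \<le> qform (ric_step E C P) x"
  by (simp only: ric_step_gain[OF assms(1,2), symmetric] assms(3))

text \<open>At a unit vector y maximizing the form, the contracted term is at most a quarter of the
  maximum, so the maximum is at most 4 s / 3; the factor 2 is a convenient bound.\<close>

lemma qform_contraction_bound:
  fixes P :: "real^'n^'n"
  assumes P: "\<And>x. qform P x \<le> qform P (x v* H) + s * (norm x)\<^sup>2" "\<And>x. 0 \<le> qform P x"
    and H: "norm H \<le> 1 / 2"
  shows "qform P x \<le> 2 * s * (norm x)\<^sup>2"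
proof -
  have "continuous_on (sphere 0 1) (qform P)"
    unfolding qform_def by (intro continuous_intros continuous_on_matrix_vector)
  moreover have "sphere (0 :: real^'n) 1 \<noteq> {}" by simp
  ultimately obtain y where y: "norm y = 1" and max: "\<And>x. norm x = 1 \<Longrightarrow> qform P x \<le> qform P y"
    using continuous_attains_sup[OF compact_sphere, of "0 :: real^'n" 1 "qform P"]
    unfolding mem_sphere_0 Ball_def Bex_def by blast
  have le: "qform P x \<le> qform P y * (norm x)\<^sup>2" for x
  proof (cases "x = 0")
    case False
    have "qform P x = (norm x)\<^sup>2 * qform P ((1 / norm x) *\<^sub>R x)"
      using False by (simp add: qform_scaleR power_divide)
    also have "\<dots> \<le> (norm x)\<^sup>2 * qform P y" using False by (intro mult_left_mono max) auto
    finally show ?thesis by (simp add: mult.commute)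
  qed (simp add: qform_def)
  have "norm (y v* H) \<le> norm H * norm y" by (rule norm_vector_matrix_le)
  then have "norm (y v* H) \<le> 1 / 2" using H y by simp
  then have "(norm (y v* H))\<^sup>2 \<le> (1 / 2)\<^sup>2" by (intro power_mono) auto
  then have "qform P (y v* H) \<le> qform P y * (1 / 4)"
    by (intro order.trans[OF le] mult_left_mono P) (simp add: power2_eq_square)
  then have "qform P y \<le> 2 * s" using P(1)[of y] P(2)[of y] y by simp
  then show ?thesis using le[of x] by (meson mult_right_mono order_trans zero_le_power2)
qed

text \<open>Only some power of the closed loop G will be contractive, so the one-step inequality is
  unrolled N times; the noise picked up on the way costs finitely many powers of G.\<close>

lemma qform_iterate_feedback:
  assumes "\<And>n x. qform (P (Suc n)) x \<le> qform (P n) (x v* G) + qform S x"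
    and "\<And>x. qform S x \<le> s * (norm x)\<^sup>2" "0 \<le> s"
  shows "qform (P (n + N)) x \<le> qform (P n) (x v* mat_pow G N) + (\<Sum>i<N. s * (norm (mat_pow G i))\<^sup>2) * (norm x)\<^sup>2"
proof (induction N arbitrary: n)
  case (Suc N)
  have "qform (P (n + Suc N)) x \<le> qform (P (Suc n)) (x v* mat_pow G N) + (\<Sum>i<N. s * (norm (mat_pow G i))\<^sup>2) * (norm x)\<^sup>2"
    using Suc[of "Suc n"] by simp
  also have "qform (P (Suc n)) (x v* mat_pow G N) \<le> qform (P n) (x v* mat_pow G (Suc N)) + qform S (x v* mat_pow G N)"
    using assms(1)[of n "x v* mat_pow G N"] by (simp add: mat_pow_Suc2 vector_matrix_mul_assoc2)
  also have "qform S (x v* mat_pow G N) \<le> s * (norm (mat_pow G N))\<^sup>2 * (norm x)\<^sup>2"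
  proof -
    have "(norm (x v* mat_pow G N))\<^sup>2 \<le> (norm (mat_pow G N) * norm x)\<^sup>2"
      by (intro power_mono norm_vector_matrix_le) simp
    then show ?thesis using assms(2)[of "x v* mat_pow G N"] mult_left_mono[OF _ assms(3)]
      by (fastforce simp: power_mult_distrib mult.assoc)
  qed
  finally show ?case by (simp add: algebra_simps)
qed simp

text \<open>The Riccati identities bound the action of the closed loop on rows, whereas the filter
  recursion acts on columns; the operator bound is the same for both.\<close>

lemma norm_matrix_vector_from_transposed:
  fixes M :: "real^'n^'m"
  assumes "\<And>x. norm (x v* M) \<le> B * norm x"
  shows "norm (M *v y) \<le> B * norm y"
proof (cases "M *v y = 0")
  case True
  have "0 \<le> B * norm (axis undefined 1 :: real^'m)" by (rule order_trans[OF norm_ge_zero assms])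
  then have "0 \<le> B" by simp
  then show ?thesis using True by simp
next
  case False
  have "(norm (M *v y))\<^sup>2 = ((M *v y) v* M) \<bullet> y"
    by (simp add: power2_norm_eq_inner dot_lmul_matrix)
  also have "\<dots> \<le> norm ((M *v y) v* M) * norm y" by (rule norm_cauchy_schwarz)
  also have "\<dots> \<le> B * norm (M *v y) * norm y" by (intro mult_right_mono assms) simp
  finally show ?thesis using False by (simp add: power2_eq_square mult_ac)
qed

text \<open>Q is a Lyapunov function: each step removes at least the fraction
  \<open>\<sigma> / \<omega>\<close> of it. The constants involve \<open>\<sigma>\<close> and
  \<open>\<omega>\<close> alone, which later makes the decay uniform in the parameter.\<close>

lemma closed_loop_decay:
  fixes F Q S :: "real^'n^'n"
  assumes \<sigma>: "0 < \<sigma>" and S: "\<And>x. \<sigma> * (norm x)\<^sup>2 \<le> qform S x"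
    and Q: "\<And>x. qform S x \<le> qform Q x" "\<And>x. qform Q x \<le> \<omega> * (norm x)\<^sup>2"
    and F: "\<And>x. qform Q (x v* F) = qform Q x - qform S x"
  shows "norm (x v* mat_pow F k) \<le> sqrt (\<omega> / \<sigma>) * sqrt (1 - \<sigma> / \<omega>) ^ k * norm x"
    and "\<sigma> \<le> \<omega>"
proof -
  have "\<sigma> * (norm (axis undefined 1 :: real^'n))\<^sup>2 \<le> \<omega> * (norm (axis undefined 1 :: real^'n))\<^sup>2"
    by (rule order_trans[OF S order_trans[OF Q]])
  then show le: "\<sigma> \<le> \<omega>" by simp
  then have \<omega>: "\<omega> > 0" using \<sigma> by simp
  have step: "qform Q (x v* F) \<le> (1 - \<sigma> / \<omega>) * qform Q x" for x
  proof -
    have "(\<sigma> / \<omega>) * qform Q x \<le> (\<sigma> / \<omega>) * (\<omega> * (norm x)\<^sup>2)"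
      using \<sigma> \<omega> by (intro mult_left_mono Q) auto
    also have "\<dots> = \<sigma> * (norm x)\<^sup>2" using \<omega> by simp
    also have "\<dots> \<le> qform S x" by (rule S)
    finally show ?thesis by (simp add: F algebra_simps)
  qed
  have nn: "0 \<le> 1 - \<sigma> / \<omega>" using le \<omega> by simp
  have "qform Q (x v* mat_pow F k) \<le> (1 - \<sigma> / \<omega>) ^ k * qform Q x"
  proof (induction k)
    case (Suc k)
    have "qform Q (x v* mat_pow F (Suc k)) \<le> (1 - \<sigma> / \<omega>) * qform Q (x v* mat_pow F k)"
      using step[of "x v* mat_pow F k"] by (simp add: mat_pow_Suc2 vector_matrix_mul_assoc2)
    also have "\<dots> \<le> (1 - \<sigma> / \<omega>) * ((1 - \<sigma> / \<omega>) ^ k * qform Q x)"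
      by (intro mult_left_mono Suc nn)
    finally show ?case by (simp add: mult.assoc)
  qed simp
  also have "\<dots> \<le> (1 - \<sigma> / \<omega>) ^ k * (\<omega> * (norm x)\<^sup>2)" by (intro mult_left_mono Q zero_le_power nn)
  finally have "\<sigma> * (norm (x v* mat_pow F k))\<^sup>2 \<le> (1 - \<sigma> / \<omega>) ^ k * (\<omega> * (norm x)\<^sup>2)"
    using order_trans[OF S Q(1), of "x v* mat_pow F k"] by linarith
  then have "(norm (x v* mat_pow F k))\<^sup>2 \<le> (\<omega> / \<sigma>) * (1 - \<sigma> / \<omega>) ^ k * (norm x)\<^sup>2"
    using \<sigma> by (simp add: field_simps)
  then have "sqrt ((norm (x v* mat_pow F k))\<^sup>2) \<le> sqrt ((\<omega> / \<sigma>) * (1 - \<sigma> / \<omega>) ^ k * (norm x)\<^sup>2)"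
    by (rule real_sqrt_le_mono)
  then show "norm (x v* mat_pow F k) \<le> sqrt (\<omega> / \<sigma>) * sqrt (1 - \<sigma> / \<omega>) ^ k * norm x"
    by (simp only: real_sqrt_mult real_sqrt_abs abs_norm_cancel) (simp only: real_sqrt_power)
qed

section \<open>Uniqueness, existence and continuity of Riccati solutions\<close>

definition ric_sol :: "real^'n^'n \<Rightarrow> real^'n^'d \<Rightarrow> real^'n^'n \<Rightarrow> real^'n^'n \<Rightarrow> bool" where
  "ric_sol E C S P \<longleftrightarrow> transpose P = P \<and> (\<forall>x. 0 \<le> qform P x) \<and>
     invertible (C ** P ** transpose C) \<and> P = ric_step E C P + S"

lemma ric_solD:
  assumes "ric_sol E C S P"
  shows "transpose P = P" "0 \<le> qform P x" "invertible (C ** P ** transpose C)" "P = ric_step E C P + S"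
  using assms unfolding ric_sol_def by blast+

lemma ric_sol_qform:
  assumes "ric_sol E C S P"
  shows "qform P x = qform (ric_step E C P) x + qform S x"
  using arg_cong[OF ric_solD(4)[OF assms], of "\<lambda>P. qform P x"] unfolding qform_add .

lemma ric_sol_ge:
  assumes "ric_sol E C S P" shows "qform S x \<le> qform P x"
  using ric_sol_qform[OF assms, of x] ric_step_nonneg[OF ric_solD(1,3,2)[OF assms], of E x] by linarith

lemma ric_sol_le_feedback:
  assumes "ric_sol E C S P" shows "qform P x \<le> qform P (x v* (E - K ** C)) + qform S x"
  using ric_sol_qform[OF assms, of x] ric_step_le[OF ric_solD(1,3,2)[OF assms], of E x K] by linarith

lemma ric_sol_gain:
  assumes "ric_sol E C S P"
  shows "qform P (x v* (E - ric_gain E C P ** C)) = qform P x - qform S x"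
  using ric_sol_qform[OF assms, of x] ric_step_gain[OF ric_solD(1,3)[OF assms], of x E] by linarith

lemma ric_sol_closed_loop_decay:
  fixes S :: "real^'n^'n"
  assumes P: "ric_sol E C S P" and S: "\<And>x. x \<noteq> 0 \<Longrightarrow> 0 < qform S x"
  shows "(\<lambda>k. x v* mat_pow (E - ric_gain E C P ** C) k) \<longlonglongrightarrow> 0"
proof -
  obtain \<sigma> where \<sigma>: "\<sigma> > 0" "\<And>x. \<sigma> * (norm x)\<^sup>2 \<le> qform S x"
    using posdef_lower_bound[of S] S unfolding qform_def by blast
  define r where "r = sqrt (1 - \<sigma> / norm P)"
  note d = closed_loop_decay[OF \<sigma> ric_sol_ge[OF P] qform_le_norm ric_sol_gain[OF P]]
  have "norm P > 0" using d(2) \<sigma>(1) by linarith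
  then have r: "0 \<le> r" "r < 1" using d(2) \<sigma>(1) by (auto simp: r_def)
  have "(\<lambda>k. sqrt (norm P / \<sigma>) * r ^ k * norm x) \<longlonglongrightarrow> sqrt (norm P / \<sigma>) * 0 * norm x"
    by (intro tendsto_intros LIMSEQ_realpow_zero r)
  then have "(\<lambda>k. sqrt (norm P / \<sigma>) * r ^ k * norm x) \<longlonglongrightarrow> 0" by simp
  then show ?thesis
    by (rule Lim_null_comparison[rotated]) (use d(1) in \<open>simp add: r_def\<close>)
qed

text \<open>Under the closed loop of Q the difference of the two forms does not decrease along the
  orbit of x, and the orbit tends to 0, where the difference vanishes. Exchanging P and Q then gives
  uniqueness.\<close>

lemma ric_sol_le:
  fixes S :: "real^'n^'n"
  assumes P: "ric_sol E C S P" and Q: "ric_sol E C S Q" and S: "\<And>x. x \<noteq> 0 \<Longrightarrow> 0 < qform S x"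
  shows "qform P x \<le> qform Q x"
proof -
  define F where "F = E - ric_gain E C Q ** C"
  have step: "qform (P - Q) x \<le> qform (P - Q) (x v* F)" for x
    using ric_sol_le_feedback[OF P, of x "ric_gain E C Q"] ric_sol_gain[OF Q, of x]
    by (simp add: F_def qform_diff)
  have "qform (P - Q) x \<le> qform (P - Q) (x v* mat_pow F k)" for k
  proof (induction k)
    case (Suc k)
    then show ?case using step[of "x v* mat_pow F k"] by (simp add: mat_pow_Suc2 vector_matrix_mul_assoc2)
  qed simp
  moreover have "(\<lambda>k. qform (P - Q) (x v* mat_pow F k)) \<longlonglongrightarrow> qform (P - Q) 0"
    unfolding qform_def F_def
    by (intro tendsto_inner tendsto_matrix_vector tendsto_const ric_sol_closed_loop_decay[OF Q S])
  ultimately have "qform (P - Q) x \<le> qform (P - Q) 0" using LIMSEQ_le_const by blast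
  then show ?thesis unfolding qform_diff by (simp add: qform_def)
qed

lemma ric_sol_unique:
  fixes S :: "real^'n^'n"
  assumes P: "ric_sol E C S P" and Q: "ric_sol E C S Q" and S: "\<And>x. x \<noteq> 0 \<Longrightarrow> 0 < qform S x"
  shows "P = Q"
proof (rule sym_eqI)
  show "qform P x = qform Q x" for x
    using ric_sol_le[OF P Q S, of x] ric_sol_le[OF Q P S, of x] by simp
qed (rule ric_solD(1)[OF P] ric_solD(1)[OF Q])+

text \<open>By polarization an entry is half a combination of form values at vectors of squared norm
  at most 4, 1 and 1; the constant 3 is generous.\<close>

lemma norm_le_of_qform_le:
  fixes P :: "real^'n^'n"
  assumes "transpose P = P" "\<And>x. 0 \<le> qform P x" "\<And>x. qform P x \<le> m * (norm x)\<^sup>2"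
  shows "norm P \<le> real CARD('n) * (real CARD('n) * (3 * m))"
proof (rule norm_le_entries)
  fix i j
  have *: "\<bar>(a - b - c) / 2\<bar> \<le> 3 * m" if "a \<le> 4 * m" "b \<le> m" "c \<le> m" "0 \<le> a" "0 \<le> b" "0 \<le> c" for a b c
    using that by (simp add: abs_le_iff)
  have m: "0 \<le> m" using order_trans[OF assms(2) assms(3)[of "axis i 1"]] by simp
  have "norm (axis i 1 + axis j 1 :: real^'n) \<le> 2" by (rule norm_triangle_le) simp
  then have "(norm (axis i 1 + axis j 1 :: real^'n))\<^sup>2 \<le> 2\<^sup>2" by (intro power_mono) auto
  then have "m * (norm (axis i 1 + axis j 1 :: real^'n))\<^sup>2 \<le> m * 4" by (intro mult_left_mono m) simp
  then have q4: "qform P (axis i 1 + axis j 1) \<le> 4 * m"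
    using assms(3)[of "axis i 1 + axis j 1"] by linarith
  have mk: "qform P (axis k 1) \<le> m" for k using assms(3)[of "axis k 1"] by simp
  show "\<bar>P $ i $ j\<bar> \<le> 3 * m"
    unfolding sym_entry_qform[OF assms(1), of i j]
    by (rule *[OF q4 mk mk assms(2) assms(2) assms(2)])
qed

text \<open>The optimal filter does no worse than the one with the fixed gain L. For fixed L and N
  the bound is continuous in E, C and S, so it bounds solutions locally in the parameter.\<close>

lemma ric_sol_bound:
  fixes S :: "real^'n^'n"
  assumes P: "ric_sol E C S P" and G: "norm (mat_pow (E - L ** C) N) \<le> 1 / 2"
  shows "qform P x \<le> 2 * (\<Sum>i<N. norm S * (norm (mat_pow (E - L ** C) i))\<^sup>2) * (norm x)\<^sup>2"
proof (rule qform_contraction_bound[OF _ _ G])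
  show "qform P x \<le> qform P (x v* mat_pow (E - L ** C) N)
      + (\<Sum>i<N. norm S * (norm (mat_pow (E - L ** C) i))\<^sup>2) * (norm x)\<^sup>2" for x
    using qform_iterate_feedback[of "\<lambda>_. P" "E - L ** C" S "norm S" 0 N x,
      OF ric_sol_le_feedback[OF P] qform_le_norm norm_ge_zero] .
qed (rule ric_solD(2)[OF P])

lemma tendsto_ric_step:
  fixes P :: "'a \<Rightarrow> real^'n^'n" and C :: "'a \<Rightarrow> real^'n^'d"
  assumes "(E \<longlongrightarrow> E') F" "(C \<longlongrightarrow> C') F" "(P \<longlongrightarrow> P') F" "invertible (C' ** P' ** transpose C')"
  shows "((\<lambda>n. ric_step (E n) (C n) (P n)) \<longlongrightarrow> ric_step E' C' P') F"
  unfolding ric_step_def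
  by (intro tendsto_diff tendsto_matrix_mult tendsto_transpose tendsto_matrix_inv assms)

lemma tendsto_qform:
  assumes "(P \<longlongrightarrow> P') F" shows "((\<lambda>n. qform (P n) x) \<longlongrightarrow> qform P' x) F"
  unfolding qform_def by (intro tendsto_inner tendsto_matrix_vector tendsto_const assms)

text \<open>Every form value is monotone and bounded, hence convergent, and polarization carries
  this to the entries.\<close>

lemma incseq_sym_matrices_convergent:
  fixes P :: "nat \<Rightarrow> real^'n^'n"
  assumes sym: "\<And>n. transpose (P n) = P n" and inc: "\<And>n x. qform (P n) x \<le> qform (P (Suc n)) x"
    and bd: "\<And>n x. qform (P n) x \<le> m * (norm x)\<^sup>2"
  shows "\<exists>P'. P \<longlonglongrightarrow> P'"
proof -
  have "convergent (\<lambda>n. qform (P n) x)" for x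
  proof (rule Bseq_monoseq_convergent)
    have i: "incseq (\<lambda>n. qform (P n) x)" by (rule incseq_SucI) (rule inc)
    then show "monoseq (\<lambda>n. qform (P n) x)" by (rule incseq_imp_monoseq)
    show "Bseq (\<lambda>n. qform (P n) x)"
    proof (rule BseqI')
      show "norm (qform (P n) x) \<le> \<bar>qform (P 0) x\<bar> + \<bar>m * (norm x)\<^sup>2\<bar>" for n
        using incseqD[OF i, of 0 n] bd[of n x] unfolding real_norm_def by linarith
    qed
  qed
  then have q: "(\<lambda>n. qform (P n) x) \<longlonglongrightarrow> lim (\<lambda>n. qform (P n) x)" for x by (simp add: convergent_LIMSEQ_iff)
  have "P \<longlonglongrightarrow> (\<chi> i j. (lim (\<lambda>n. qform (P n) (axis i 1 + axis j 1)) - lim (\<lambda>n. qform (P n) (axis i 1))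
      - lim (\<lambda>n. qform (P n) (axis j 1))) / 2)"
  proof (intro vec_tendstoI)
    fix i j
    have "(\<lambda>n. (qform (P n) (axis i 1 + axis j 1) - qform (P n) (axis i 1) - qform (P n) (axis j 1)) / 2)
      \<longlonglongrightarrow> (lim (\<lambda>n. qform (P n) (axis i 1 + axis j 1)) - lim (\<lambda>n. qform (P n) (axis i 1))
      - lim (\<lambda>n. qform (P n) (axis j 1))) / 2"
      by (intro tendsto_intros q) simp
    then show "(\<lambda>n. P n $ i $ j) \<longlonglongrightarrow> (\<chi> i j. (lim (\<lambda>n. qform (P n) (axis i 1 + axis j 1)) - lim (\<lambda>n. qform (P n) (axis i 1))
      - lim (\<lambda>n. qform (P n) (axis j 1))) / 2) $ i $ j"
      by (simp add: sym_entry_qform[OF sym])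
  qed
  then show ?thesis by blast
qed

text \<open>The iterates of the recursion increase by monotonicity of the Riccati step, and the cost
  of one stabilizing gain L bounds them, so they converge to a solution.\<close>

lemma ric_sol_exists:
  fixes S :: "real^'n^'n" and C :: "real^'n^'d"
  assumes S: "transpose S = S" "\<And>x. x \<noteq> 0 \<Longrightarrow> 0 < qform S x"
    and C: "\<And>y. y v* C = 0 \<Longrightarrow> y = 0"
    and G: "norm (mat_pow (E - L ** C) N) \<le> 1 / 2"
  shows "\<exists>P. ric_sol E C S P"
proof -
  \<comment> \<open>Started at S and not at 0: all iterates stay above S, so the innovation
    covariance remains invertible along the iteration and in the limit.\<close>
  define P where "P n = ((\<lambda>Q. ric_step E C Q + S) ^^ n) S" for n
  have P0: "P 0 = S" and PS: "P (Suc n) = ric_step E C (P n) + S" for n by (simp_all add: P_def)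
  have S0: "0 \<le> qform S x" for x using S(2)[of x] by (cases "x = 0") (auto simp: qform_def)
  have inv: "invertible (C ** Q ** transpose C)" if "\<And>x. qform S x \<le> qform Q x" for Q
    using that S(2) by (intro invertible_congruence C) (rule less_le_trans)
  have 1: "transpose (P n) = P n \<and> (\<forall>x. qform S x \<le> qform (P n) x)" for n
  proof (induction n)
    case (Suc n)
    have nn: "0 \<le> qform (P n) x" for x using Suc S0[of x] order_trans by blast
    show ?case using Suc inv[of "P n"] nn S(1)
      by (auto simp: PS transpose_add transpose_ric_step qform_add ric_step_nonneg)
  qed (simp add: P0 S)
  then have sym: "transpose (P n) = P n" and ge: "qform S x \<le> qform (P n) x" for n x by auto
  have nn: "0 \<le> qform (P n) x" for n x using order_trans[OF S0 ge] .
  note iP = inv[OF ge]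
  have inc: "qform (P n) x \<le> qform (P (Suc n)) x" for n x
  proof (induction n arbitrary: x)
    case 0
    show ?case using ge[of x 1] by (simp add: P0)
  next
    case (Suc n)
    show ?case
      unfolding PS[of "Suc n"] PS[of n] qform_add
      by (intro add_right_mono ric_step_mono[OF sym iP nn, folded PS] sym[of "Suc n", unfolded PS] iP[of "Suc n", unfolded PS] Suc[unfolded PS])
  qed
  have step: "qform (P (Suc n)) x \<le> qform (P n) (x v* (E - L ** C)) + qform S x" for n x
    by (simp add: PS qform_add ric_step_le[OF sym iP nn])
  define s where "s = (\<Sum>i<N. norm S * (norm (mat_pow (E - L ** C) i))\<^sup>2)"
  have inc': "qform (P n) x \<le> qform (P (n + k)) x" for n k x
    by (induction k) (auto intro: order_trans inc)
  have "qform (P n) x \<le> 2 * s * (norm x)\<^sup>2" for n x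
  proof (rule qform_contraction_bound[OF _ nn G])
    \<comment> \<open>Since the iterates increase, \<open>P n\<close> lies below the iterate N steps
      later. This turns the unrolled inequality into one that bounds \<open>P n\<close> by
      itself.\<close>
    show "qform (P n) x \<le> qform (P n) (x v* mat_pow (E - L ** C) N) + s * (norm x)\<^sup>2" for x
      unfolding s_def
      by (rule order_trans[OF inc' qform_iterate_feedback[where P=P and S=S and s="norm S", OF step qform_le_norm norm_ge_zero]])
  qed
  from incseq_sym_matrices_convergent[where P=P, OF sym inc this]
  obtain Q where Q: "P \<longlonglongrightarrow> Q" by blast
  have geQ: "qform S x \<le> qform Q x" for x
    by (rule LIMSEQ_le_const[OF tendsto_qform[OF Q]]) (use ge in blast)
  have "(\<lambda>n. transpose (P n)) \<longlonglongrightarrow> transpose Q" by (intro tendsto_transpose Q)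
  then have "P \<longlonglongrightarrow> transpose Q" by (simp only: sym)
  then have sQ: "transpose Q = Q" using Q by (rule LIMSEQ_unique)
  have "(\<lambda>n. P (Suc n)) \<longlonglongrightarrow> ric_step E C Q + S"
    unfolding PS by (intro tendsto_add tendsto_ric_step tendsto_const Q inv geQ)
  moreover have "(\<lambda>n. P (Suc n)) \<longlonglongrightarrow> Q" using Q by (rule LIMSEQ_Suc)
  ultimately have "Q = ric_step E C Q + S" using LIMSEQ_unique by blast
  then have "ric_sol E C S Q"
    unfolding ric_sol_def using sQ inv[OF geQ] order_trans[OF S0 geQ] by blast
  then show ?thesis by blast
qed

lemma continuous_on_mat_pow:
  "continuous_on K A \<Longrightarrow> continuous_on K (\<lambda>p. mat_pow (A p) k)"
  by (induction k) (auto simp: mat_pow_Suc intro!: continuous_on_matrix_mult)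

text \<open>Closed graph argument: limits of solutions are solutions, solutions are unique, and a
  closed graph over a compact range gives continuity. The compact range requires a bound on the
  solutions over all of K.\<close>

lemma continuous_on_ric_sol:
  fixes K :: "'p::euclidean_space set" and P :: "'p \<Rightarrow> real^'n^'n" and C :: "'p \<Rightarrow> real^'n^'d"
  assumes K: "compact K" and E: "continuous_on K E" and C: "continuous_on K C" and S: "continuous_on K S"
    and Spos: "\<And>p x. p \<in> K \<Longrightarrow> x \<noteq> 0 \<Longrightarrow> 0 < qform (S p) x"
    and Cinj: "\<And>p y. p \<in> K \<Longrightarrow> y v* C p = 0 \<Longrightarrow> y = 0"
    and G: "\<And>p. p \<in> K \<Longrightarrow> \<exists>L N. norm (mat_pow (E p - L ** C p) N) < 1 / 2"
    and P: "\<And>p. p \<in> K \<Longrightarrow> ric_sol (E p) (C p) (S p) (P p)"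
  shows "continuous_on K P"
proof -
  \<comment> \<open>The gain L and the horizon N chosen at p still contract near p because the
    inequality is strict, so the gains need not be chosen continuously.\<close>
  have local_bd: "\<exists>U B. open U \<and> p \<in> U \<and> (\<forall>q\<in>U \<inter> K. norm (P q) \<le> B)" if p: "p \<in> K" for p
  proof -
    obtain L N where LN: "norm (mat_pow (E p - L ** C p) N) < 1 / 2" using G[OF p] by blast
    define f where "f q = norm (mat_pow (E q - L ** C q) N)" for q
    define g where "g q = (\<Sum>i<N. norm (S q) * (norm (mat_pow (E q - L ** C q) i))\<^sup>2)" for q
    have cf: "continuous_on K f" and cg: "continuous_on K g"
      unfolding f_def g_def
      by (intro continuous_intros continuous_on_mat_pow continuous_on_matrix_mult E C S)+
    obtain U1 where U1: "open U1" "U1 \<inter> K = f -` {..<1/2} \<inter> K"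
      using continuous_on_open_invariant[of K f] cf open_lessThan by metis
    obtain U2 where U2: "open U2" "U2 \<inter> K = g -` {..<g p + 1} \<inter> K"
      using continuous_on_open_invariant[of K g] cg open_lessThan by metis
    have "norm (P q) \<le> real CARD('n) * (real CARD('n) * (3 * (2 * (g p + 1))))" if q: "q \<in> (U1 \<inter> U2) \<inter> K" for q
    proof (rule norm_le_of_qform_le)
      have "f q < 1 / 2" "g q < g p + 1" using U1(2) U2(2) q by blast+
      fix x
      have "qform (P q) x \<le> 2 * g q * (norm x)\<^sup>2"
        unfolding g_def using \<open>f q < 1 / 2\<close> q by (intro ric_sol_bound P) (auto simp: f_def)
      also have "\<dots> \<le> 2 * (g p + 1) * (norm x)\<^sup>2"
        using \<open>g q < g p + 1\<close> by (intro mult_right_mono) auto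
      finally show "qform (P q) x \<le> 2 * (g p + 1) * (norm x)\<^sup>2" .
    qed (use q in \<open>auto intro: ric_solD(1,2)[OF P]\<close>)
    moreover have "p \<in> U1 \<inter> U2" using U1(2) U2(2) LN p by (auto simp: f_def)
    ultimately show ?thesis using U1(1) U2(1) by (intro exI[of _ "U1 \<inter> U2"]) blast
  qed
  then obtain U B where U: "\<And>p. p \<in> K \<Longrightarrow> open (U p) \<and> p \<in> U p \<and> (\<forall>q\<in>U p \<inter> K. norm (P q) \<le> B p)" by metis
  obtain D where D: "D \<subseteq> K" "finite D" "K \<subseteq> (\<Union>p\<in>D. U p)"
    using compactE_image[OF K, of K U] U by blast
  define b where "b = (\<Sum>p\<in>D. \<bar>B p\<bar>)"
  have bd: "norm (P q) \<le> b" if q: "q \<in> K" for q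
  proof -
    obtain p where p: "p \<in> D" "q \<in> U p" using D q by blast
    then have "norm (P q) \<le> \<bar>B p\<bar>" using U[of p] D q by force
    also have "\<dots> \<le> b" unfolding b_def using p D by (intro member_le_sum) auto
    finally show ?thesis .
  qed
  have "closed ((\<lambda>p. (p, P p)) ` K)"
    unfolding closed_sequential_limits
  proof (intro allI impI, elim conjE)
    fix x l assume x: "\<forall>n. x n \<in> (\<lambda>p. (p, P p)) ` K" and l: "x \<longlonglongrightarrow> l"
    define p Q where "p n = fst (x n)" and "Q n = snd (x n)" for n
    have pK: "p n \<in> K" and Q: "Q n = P (p n)" for n using x[rule_format, of n] by (auto simp: p_def Q_def)
    have pl: "p \<longlonglongrightarrow> fst l" and Ql: "Q \<longlonglongrightarrow> snd l" unfolding p_def Q_def by (intro tendsto_fst tendsto_snd l)+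
    have lK: "fst l \<in> K" using compact_imp_closed[OF K] pK pl closed_sequentially by metis
    have cont: "(\<lambda>n. H (p n)) \<longlonglongrightarrow> H (fst l)" if "continuous_on K H" for H :: "'p \<Rightarrow> 'z::topological_space"
      by (rule continuous_on_tendsto_compose[OF that pl lK]) (simp add: pK)
    have sol: "ric_sol (E (p n)) (C (p n)) (S (p n)) (Q n)" for n unfolding Q by (rule P[OF pK])
    \<comment> \<open>The lower bound by the noise covariance survives the limit; it keeps the
      limiting innovation covariance invertible, where the Riccati step is continuous.\<close>
    have ge: "qform (S (fst l)) y \<le> qform (snd l) y" for y
      by (rule LIMSEQ_le[OF tendsto_qform[OF cont[OF S]] tendsto_qform[OF Ql]]) (use ric_sol_ge[OF sol] in blast)
    have pos: "0 < qform (snd l) y" if "y \<noteq> 0" for y using less_le_trans[OF Spos[OF lK that] ge] .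
    have inv: "invertible (C (fst l) ** snd l ** transpose (C (fst l)))"
      by (rule invertible_congruence[OF pos Cinj[OF lK]])
    have "(\<lambda>n. transpose (Q n)) \<longlonglongrightarrow> transpose (snd l)" by (intro tendsto_transpose Ql)
    then have "Q \<longlonglongrightarrow> transpose (snd l)" by (simp only: ric_solD(1)[OF sol])
    then have sl: "transpose (snd l) = snd l" using Ql by (rule LIMSEQ_unique)
    have "(\<lambda>n. ric_step (E (p n)) (C (p n)) (Q n) + S (p n)) \<longlonglongrightarrow> ric_step (E (fst l)) (C (fst l)) (snd l) + S (fst l)"
      by (intro tendsto_add tendsto_ric_step cont E C S Ql inv)
    then have "Q \<longlonglongrightarrow> ric_step (E (fst l)) (C (fst l)) (snd l) + S (fst l)"
      by (simp only: ric_solD(4)[OF sol, symmetric])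
    from LIMSEQ_unique[OF Ql this]
    have "snd l = ric_step (E (fst l)) (C (fst l)) (snd l) + S (fst l)" .
    moreover have "0 \<le> qform (snd l) y" for y using pos[of y] by (cases "y = 0") (auto simp: qform_def)
    ultimately have "ric_sol (E (fst l)) (C (fst l)) (S (fst l)) (snd l)"
      unfolding ric_sol_def using sl inv by blast
    then have "snd l = P (fst l)" using ric_sol_unique[OF _ P[OF lK] Spos[OF lK]] by blast
    then show "l \<in> (\<lambda>p. (p, P p)) ` K" using lK by (intro image_eqI[of _ _ "fst l"]) (auto simp: prod_eq_iff)
  qed
  moreover have "P \<in> K \<rightarrow> cball 0 b" using bd by simp
  ultimately show ?thesis using continuous_from_closed_graph[OF compact_cball] by blast
qed

section \<open>The state space model and its Kalman filter\<close>

definition proj_inl :: "real^('c::finite + 'k::finite)^'c" where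
  "proj_inl = (\<chi> i j. if j = Inl i then 1 else 0)"

definition proj_inr :: "real^('c::finite + 'k::finite)^'k" where
  "proj_inr = (\<chi> i j. if j = Inr i then 1 else 0)"

definition emb_inl :: "real^'c::finite^('c + 'k::finite)" where
  "emb_inl = (\<chi> i j. if i = Inl j then 1 else 0)"

definition emb_inr :: "real^'k::finite^('c::finite + 'k)" where
  "emb_inr = (\<chi> i j. if i = Inr j then 1 else 0)"

lemma block_mult_nth:
  "(proj_inl ** X) $ a $ j = X $ Inl a $ j" "(proj_inr ** X) $ b $ j = X $ Inr b $ j"
  "(Y ** emb_inl) $ i $ a = Y $ i $ Inl a" "(Y ** emb_inr) $ i $ b = Y $ i $ Inr b"
  "(Z ** proj_inl) $ i $ s = (case s of Inl a \<Rightarrow> Z $ i $ a | Inr b \<Rightarrow> 0)"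
  "(U ** proj_inr) $ i $ s = (case s of Inl a \<Rightarrow> 0 | Inr b \<Rightarrow> U $ i $ b)"
  "(emb_inl ** T) $ s $ j = (case s of Inl a \<Rightarrow> T $ a $ j | Inr b \<Rightarrow> 0)"
  "(emb_inr ** W) $ s $ j = (case s of Inl a \<Rightarrow> 0 | Inr b \<Rightarrow> W $ b $ j)"
  by (simp_all add: matrix_matrix_mult_def proj_inl_def proj_inr_def emb_inl_def emb_inr_def
      if_distrib[of "\<lambda>x. x * _"] if_distrib[of "\<lambda>x. _ * x"] cong: if_cong split: sum.splits)

lemma block_identities [simp]:
  "proj_inl ** emb_inl = mat 1" "proj_inr ** emb_inr = mat 1" "proj_inl ** emb_inr = 0" "proj_inr ** emb_inl = 0"
  by (simp_all add: vec_eq_iff block_mult_nth) (simp_all add: emb_inl_def emb_inr_def proj_inl_def proj_inr_def mat_def)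

lemma block_partition: "emb_inl ** proj_inl + emb_inr ** proj_inr = mat 1"
  by (simp add: vec_eq_iff block_mult_nth mat_def split: sum.splits)
    (simp add: emb_inl_def emb_inr_def proj_inl_def proj_inr_def)

lemma A_mat_block: "A_mat \<M> \<theta> = emb_inr ** A2 \<M> (snd \<theta>) ** proj_inr"
  by (auto simp: vec_eq_iff A_mat_def block_mult_nth split: sum.splits)

lemma B_mat_block: "B_mat \<M> \<theta> = emb_inl ** B1 \<M> (snd \<theta>) + emb_inr ** B2 \<M> (snd \<theta>)"
  by (simp add: vec_eq_iff B_mat_def block_mult_nth split: sum.splits)

lemma C_mat_block: "C_mat \<M> \<theta> = C1 \<M> (fst \<theta>) ** proj_inl + C2 \<M> (snd \<theta>) ** proj_inr"
  by (simp add: vec_eq_iff C_mat_def block_mult_nth split: sum.splits)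

lemma zero_matrix_mult [simp]: "(0 :: real^'n^'m) ** X = 0" "Y ** (0 :: real^'n^'m) = 0"
  by (simp_all add: matrix_matrix_mult_def vec_eq_iff)

lemma C_mat_injl: "C_mat \<M> \<theta> ** emb_inl = C1 \<M> (fst \<theta>)"
  by (simp add: C_mat_block matrix_mult_add_rdistrib matrix_mul_assoc[symmetric])

lemma mat_exp_A_mat:
  "proj_inl ** mat_exp (u *\<^sub>R A_mat \<M> \<theta>) = proj_inl"
  "proj_inr ** mat_exp (u *\<^sub>R A_mat \<M> \<theta>) = mat_exp (u *\<^sub>R A2 \<M> (snd \<theta>)) ** proj_inr"
  "mat_exp (u *\<^sub>R A_mat \<M> \<theta>) ** emb_inl = emb_inl"
  "mat_exp (u *\<^sub>R A_mat \<M> \<theta>) ** emb_inr = emb_inr ** mat_exp (u *\<^sub>R A2 \<M> (snd \<theta>))"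
proof -
  have 1: "proj_inl ** (u *\<^sub>R A_mat \<M> \<theta>) = 0 ** proj_inl"
    unfolding A_mat_block by (simp add: matrix_mul_assoc matrix_scalar_ac scalar_matrix_assoc[symmetric])
  show "proj_inl ** mat_exp (u *\<^sub>R A_mat \<M> \<theta>) = proj_inl" using mat_exp_intertwine[OF 1] by simp
  have 2: "proj_inr ** (u *\<^sub>R A_mat \<M> \<theta>) = (u *\<^sub>R A2 \<M> (snd \<theta>)) ** proj_inr"
    unfolding A_mat_block by (simp add: matrix_mul_assoc matrix_scalar_ac scalar_matrix_assoc[symmetric])
  show "proj_inr ** mat_exp (u *\<^sub>R A_mat \<M> \<theta>) = mat_exp (u *\<^sub>R A2 \<M> (snd \<theta>)) ** proj_inr"
    by (rule mat_exp_intertwine[OF 2])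
  have 3: "emb_inl ** 0 = (u *\<^sub>R A_mat \<M> \<theta>) ** emb_inl"
    unfolding A_mat_block by (simp add: matrix_mul_assoc[symmetric] scalar_matrix_assoc[symmetric])
  show "mat_exp (u *\<^sub>R A_mat \<M> \<theta>) ** emb_inl = emb_inl" using mat_exp_intertwine[OF 3] by simp
  have 4: "emb_inr ** (u *\<^sub>R A2 \<M> (snd \<theta>)) = (u *\<^sub>R A_mat \<M> \<theta>) ** emb_inr"
    unfolding A_mat_block by (simp add: matrix_mul_assoc[symmetric] matrix_scalar_ac scalar_matrix_assoc[symmetric])
  show "mat_exp (u *\<^sub>R A_mat \<M> \<theta>) ** emb_inr = emb_inr ** mat_exp (u *\<^sub>R A2 \<M> (snd \<theta>))"
    using mat_exp_intertwine[OF 4] by simp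
qed

lemma stable_mat_exp_tendsto_0:
  assumes "\<And>z. complex_eigenvalue A z \<Longrightarrow> Re z < 0" "h > 0"
  shows "(\<lambda>k. mat_exp ((real k * h) *\<^sub>R A)) \<longlonglongrightarrow> 0"
proof -
  obtain K a where a: "a > 0" and K: "\<And>t. t \<ge> 0 \<Longrightarrow> norm (mat_exp (t *\<^sub>R A)) \<le> K * exp (- a * t)"
    using mat_exp_decay[OF assms(1)] by blast
  have "(\<lambda>k. K * exp (- (a * h)) ^ k) \<longlonglongrightarrow> K * 0"
    using a assms(2) by (intro tendsto_intros LIMSEQ_realpow_zero) auto
  then have "(\<lambda>k. K * exp (- a * (real k * h))) \<longlonglongrightarrow> 0"
    by (simp add: exp_of_nat_mult[symmetric] mult_ac)
  then show ?thesis
    by (rule Lim_null_comparison[rotated]) (use K assms(2) in simp)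
qed

text \<open>The short-run coordinates of a fixed vector are fixed by all powers of a matrix whose
  powers tend to 0, hence they vanish: the eigenvalue 1 belongs to the integrators alone.\<close>

lemma unit_eigenspace_eAh:
  assumes "\<And>z. complex_eigenvalue (A2 \<M> (snd \<theta>)) z \<Longrightarrow> Re z < 0" "mesh \<M> > 0"
    and x: "eAh \<M> \<theta> *v x = x"
  shows "x = emb_inl *v (proj_inl *v x)"
proof -
  have "proj_inr *v x = mat_exp ((real k * mesh \<M>) *\<^sub>R A2 \<M> (snd \<theta>)) *v (proj_inr *v x)" for k
  proof (induction k)
    case (Suc k)
    have "proj_inr *v x = proj_inr *v (eAh \<M> \<theta> *v x)" by (simp only: x)
    also have "\<dots> = mat_exp (mesh \<M> *\<^sub>R A2 \<M> (snd \<theta>)) *v (proj_inr *v x)"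
      by (simp add: matrix_vector_mul_assoc eAh_def mat_exp_A_mat)
    also have "\<dots> = mat_exp (mesh \<M> *\<^sub>R A2 \<M> (snd \<theta>)) *v (mat_exp ((real k * mesh \<M>) *\<^sub>R A2 \<M> (snd \<theta>)) *v (proj_inr *v x))"
      by (simp only: Suc[symmetric])
    also have "\<dots> = (mat_exp ((mesh \<M> + real k * mesh \<M>) *\<^sub>R A2 \<M> (snd \<theta>))) *v (proj_inr *v x)"
      unfolding mat_exp_add by (simp only: matrix_vector_mul_assoc matrix_mul_assoc)
    also have "mesh \<M> + real k * mesh \<M> = real (Suc k) * mesh \<M>" by (simp add: algebra_simps)
    finally show ?case .
  qed simp
  then have "(\<lambda>k. mat_exp ((real k * mesh \<M>) *\<^sub>R A2 \<M> (snd \<theta>)) *v (proj_inr *v x)) \<longlonglongrightarrow> proj_inr *v x"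
    by simp
  moreover have "(\<lambda>k. mat_exp ((real k * mesh \<M>) *\<^sub>R A2 \<M> (snd \<theta>)) *v (proj_inr *v x)) \<longlonglongrightarrow> 0 *v (proj_inr *v x)"
    by (intro tendsto_matrix_vector tendsto_const stable_mat_exp_tendsto_0 assms)
  ultimately have "proj_inr *v x = 0 *v (proj_inr *v x)" by (rule LIMSEQ_unique)
  then have r0: "proj_inr *v x = 0" by simp
  have "x = (emb_inl ** proj_inl + emb_inr ** proj_inr) *v x" by (simp add: block_partition)
  also have "\<dots> = emb_inl *v (proj_inl *v x) + emb_inr *v (proj_inr *v x)"
    by (simp add: matrix_vector_mult_add_rdistrib matrix_vector_mul_assoc)
  also have "\<dots> = emb_inl *v (proj_inl *v x)" unfolding r0 by simp
  finally show ?thesis .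
qed

text \<open>A left inverse of C1, used as gain on the integrators, cancels their block in one step.
  What remains is block triangular with the stable matrix X on the diagonal, so powers of the closed
  loop tend to 0.\<close>

lemma detectability:
  fixes \<M> :: "('w, 's1::finite, 's2::finite, 'c::finite, 'k::finite, 'd::finite, 'e::finite, 'm::finite) coint_model"
  assumes ev: "\<And>z. complex_eigenvalue (A2 \<M> (snd \<theta>)) z \<Longrightarrow> Re z < 0" and h: "mesh \<M> > 0"
    and rank: "rank (C1 \<M> (fst \<theta>)) = CARD('c)"
  shows "\<exists>L N. norm (mat_pow (eAh \<M> \<theta> - L ** C_mat \<M> \<theta>) N) < 1 / 2"
proof -
  have "inj ((*v) (C1 \<M> (fst \<theta>)))" using rank full_rank_injective by blast
  then obtain L1 where L1: "L1 ** C1 \<M> (fst \<theta>) = mat 1"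
    using matrix_left_invertible_injective by blast
  define L where "L = (emb_inl ** L1 :: real^'d^('c+'k))"
  define G where "G = eAh \<M> \<theta> - L ** C_mat \<M> \<theta>"
  define X where "X = mat_exp (mesh \<M> *\<^sub>R A2 \<M> (snd \<theta>))"
  have "proj_inr ** G = X ** proj_inr"
    by (simp add: G_def L_def eAh_def matrix_mult_diff_ldistrib mat_exp_A_mat matrix_mul_assoc X_def)
  then have r: "proj_inr ** mat_pow G k = mat_pow X k ** proj_inr" for k by (rule mat_pow_intertwine)
  have l: "proj_inl ** G = - (L1 ** C2 \<M> (snd \<theta>)) ** proj_inr"
    by (simp add: G_def L_def eAh_def matrix_mult_diff_ldistrib mat_exp_A_mat matrix_mul_assoc C_mat_block
        matrix_add_ldistrib L1) (simp add: vec_eq_iff block_mult_nth split: sum.splits)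
  have eq: "mat_pow G (Suc k) = emb_inl ** (- (L1 ** C2 \<M> (snd \<theta>))) ** mat_pow X k ** proj_inr + emb_inr ** mat_pow X (Suc k) ** proj_inr" for k
  proof -
    have "mat_pow G (Suc k) = (emb_inl ** proj_inl + emb_inr ** proj_inr) ** mat_pow G (Suc k)" by (simp add: block_partition)
    also have "\<dots> = emb_inl ** (proj_inl ** G) ** mat_pow G k + emb_inr ** (proj_inr ** mat_pow G (Suc k))"
      by (simp only: matrix_mult_add_rdistrib mat_pow_Suc matrix_mul_assoc)
    also have "\<dots> = emb_inl ** (- (L1 ** C2 \<M> (snd \<theta>))) ** (proj_inr ** mat_pow G k) + emb_inr ** (proj_inr ** mat_pow G (Suc k))"
      by (simp only: l matrix_mul_assoc)
    finally show ?thesis by (simp only: r matrix_mul_assoc)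
  qed
  have X0: "(\<lambda>k. mat_pow X k) \<longlonglongrightarrow> 0"
    unfolding X_def mat_pow_mat_exp by (rule stable_mat_exp_tendsto_0[OF ev h])
  then have "(\<lambda>k. mat_pow X (Suc k)) \<longlonglongrightarrow> 0" by (rule LIMSEQ_Suc)
  then have "(\<lambda>k. mat_pow G (Suc k)) \<longlonglongrightarrow> emb_inl ** (- (L1 ** C2 \<M> (snd \<theta>))) ** 0 ** proj_inr + emb_inr ** 0 ** proj_inr"
    unfolding eq by (intro tendsto_add tendsto_matrix_mult tendsto_const X0)
  then have "(\<lambda>k. norm (mat_pow G (Suc k))) \<longlonglongrightarrow> 0" using tendsto_norm_zero by fastforce
  then have "\<forall>\<^sub>F k in sequentially. norm (mat_pow G (Suc k)) < 1 / 2"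
    by (rule order_tendstoD) simp
  then show ?thesis unfolding G_def eventually_sequentially by blast
qed

section \<open>Positive definiteness of the noise covariance\<close>

lemma vector_mat_exp_derivative:
  "((\<lambda>u. (w v* (mat_exp (u *\<^sub>R A) ** B)) $ j) has_field_derivative
      ((w v* A) v* (mat_exp (u *\<^sub>R A) ** B)) $ j) (at u)"
proof -
  have e: "(w v* (M ** B)) $ j = (\<Sum>i\<in>UNIV. \<Sum>k\<in>UNIV. w $ i * (M $ i $ k * B $ k $ j))" for M
    by (simp add: vector_matrix_mult_def matrix_matrix_mult_def sum_distrib_right sum_distrib_left mult_ac)
  have "((\<lambda>u. (w v* (mat_exp (u *\<^sub>R A) ** B)) $ j) has_field_derivative
      (w v* ((A ** mat_exp (u *\<^sub>R A)) ** B)) $ j) (at u)"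
    unfolding e by (intro DERIV_sum DERIV_cmult DERIV_cmult_right mat_exp_entry_derivative)
  then show ?thesis by (simp add: vector_matrix_mul_assoc2)
qed

lemma stable_invertible:
  assumes ev: "\<And>z. complex_eigenvalue A z \<Longrightarrow> Re z < 0"
  shows "invertible A"
proof (rule invertible_if_injective)
  fix x assume x: "A *v x = 0"
  show "x = 0"
  proof (rule ccontr)
    assume "x \<noteq> 0"
    define v where "v = (\<chi> i. complex_of_real (x $ i))"
    have "v \<noteq> 0" using \<open>x \<noteq> 0\<close> by (simp add: v_def vec_eq_iff)
    moreover have "cmat A *v v = 0 *s v"
    proof -
      have "(cmat A *v v) $ i = of_real ((A *v x) $ i)" for i
        by (simp add: matrix_vector_mult_def v_def cmat_nth)
      then show ?thesis by (simp add: x vec_eq_iff)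
    qed
    ultimately have "complex_eigenvalue A 0" unfolding complex_eigenvalue_def by blast
    then show False using ev by force
  qed
qed

text \<open>Differentiation removes the constant c and puts x A among the functionals whose output
  vanishes on the interval. These form an A-invariant subspace, and letting u tend to 0 shows that
  they annihilate B, so minimality makes the subspace trivial. Then x A = 0, and A is invertible by
  stability.\<close>

lemma minimal_stable_no_constant_output:
  fixes A :: "real^'n^'n" and B :: "real^'m^'n" and C :: "real^'n^'d"
  assumes min: "minimal_triple A B C" and ev: "\<And>z. complex_eigenvalue A z \<Longrightarrow> Re z < 0" and h: "h > 0"
    and const: "\<And>u. 0 < u \<Longrightarrow> u < h \<Longrightarrow> c + x v* (mat_exp (u *\<^sub>R A) ** B) = 0"
  shows "x = 0"
proof -
  define W where "W = {w. \<forall>u\<in>{0<..<h}. w v* (mat_exp (u *\<^sub>R A) ** B) = 0}"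
  have deriv0: "(w v* A) v* (mat_exp (u *\<^sub>R A) ** B) = 0"
    if c: "\<And>u. 0 < u \<Longrightarrow> u < h \<Longrightarrow> c + w v* (mat_exp (u *\<^sub>R A) ** B) = 0" and u: "u \<in> {0<..<h}" for w c u
  proof -
    have "((w v* A) v* (mat_exp (u *\<^sub>R A) ** B)) $ j = 0" for j
    proof -
      have "((\<lambda>u. - c $ j) has_field_derivative ((w v* A) v* (mat_exp (u *\<^sub>R A) ** B)) $ j) (at u)"
      proof (rule has_field_derivative_transform_within_open[OF vector_mat_exp_derivative])
        show "(w v* (mat_exp (v *\<^sub>R A) ** B)) $ j = - c $ j" if "v \<in> {0<..<h}" for v
        proof -
          have "c + w v* (mat_exp (v *\<^sub>R A) ** B) = 0" using c that by simp
          then have "c $ j + (w v* (mat_exp (v *\<^sub>R A) ** B)) $ j = 0"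
            by (metis vector_add_component zero_index)
          then show ?thesis by simp
        qed
      qed (use u in auto)
      then show ?thesis using DERIV_unique DERIV_const by blast
    qed
    then show ?thesis by (simp add: vec_eq_iff)
  qed
  have sub: "subspace W"
    by (auto simp: subspace_def W_def vector_matrix_add_ldistrib scaleR_vector_matrix_assoc)
  have WA: "w v* A \<in> W" if "w \<in> W" for w
    using deriv0[of 0 w] that by (auto simp: W_def)
  have WB: "w v* B = 0" if w: "w \<in> W" for w
  proof -
    have "continuous_on UNIV (\<lambda>u. transpose (mat_exp (u *\<^sub>R A) ** B) *v w)"
      by (intro continuous_on_matrix_vector continuous_on_transpose continuous_on_matrix_mult
          continuous_on_compose2[OF continuous_on_mat_exp[of UNIV]] continuous_intros) auto
    then have "isCont (\<lambda>u. transpose (mat_exp (u *\<^sub>R A) ** B) *v w) 0"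
      by (simp add: continuous_on_eq_continuous_at)
    then have "(\<lambda>u. w v* (mat_exp (u *\<^sub>R A) ** B)) \<midarrow>0\<rightarrow> w v* (mat_exp (0 *\<^sub>R A) ** B)"
      by (simp only: transpose_matrix_vector isCont_def)
    then have "((\<lambda>u. w v* (mat_exp (u *\<^sub>R A) ** B)) \<longlongrightarrow> w v* B) (at_right 0)"
      by (auto intro: tendsto_within_subset)
    moreover have "((\<lambda>u. w v* (mat_exp (u *\<^sub>R A) ** B)) \<longlongrightarrow> 0) (at_right 0)"
    proof (rule tendsto_eventually)
      show "\<forall>\<^sub>F u in at_right 0. w v* (mat_exp (u *\<^sub>R A) ** B) = 0"
        using w h unfolding W_def eventually_at_right_field by auto
    qed
    ultimately show ?thesis using tendsto_unique trivial_limit_at_right_real by blast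
  qed
  have "x v* A \<in> W" unfolding W_def using deriv0[OF const] by auto
  then have "x v* A = 0" using minimal_triple_no_uncontrollable_subspace[OF min sub WA WB] by blast
  then have "(x v* A) v* matrix_inv A = 0" by simp
  moreover have "A ** matrix_inv A = mat 1" using ev by (intro matrix_inv_inverse stable_invertible)
  ultimately show "x = 0" by (simp add: vector_matrix_mul_assoc2[symmetric])
qed

lemma smooth3_continuous_on:
  assumes "smooth3_on S f" shows "continuous_on S f"
proof -
  obtain U g where U: "S \<subseteq> U" "\<And>x. x \<in> S \<Longrightarrow> g x = f x" and g: "ktimes_cont_diff_on 3 U g"
    using assms unfolding smooth3_on_def by blast
  have "g differentiable (at x)" if "x \<in> S" for x
    using g U(1) that by (auto simp: numeral_3_eq_3)
  then have "continuous_on S g"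
    by (intro continuous_at_imp_continuous_on ballI differentiable_imp_continuous_within)
  then show ?thesis using U(2) by (simp cong: continuous_on_cong)
qed

text \<open>Along the segment from the identity to A every matrix has a positive form and is
  invertible up to a possible bad endpoint that the same form excludes, so the determinant keeps its
  sign.\<close>

lemma det_pos_if_posdef:
  fixes A :: "real^'n^'n"
  assumes "\<And>x. x \<noteq> 0 \<Longrightarrow> 0 < qform A x"
  shows "0 < det A"
proof (rule ccontr)
  assume "\<not> 0 < det A"
  define f where "f t = det ((1 - t) *\<^sub>R mat 1 + t *\<^sub>R A)" for t :: real
  have "continuous_on {0..1} f" unfolding f_def by (intro continuous_on_det continuous_intros)
  moreover have "f 1 \<le> 0" "0 \<le> f 0" using \<open>\<not> 0 < det A\<close> by (auto simp: f_def)
  ultimately obtain t where t: "0 \<le> t" "t \<le> 1" "f t = 0" using IVT2'[of f 1 0 0] by auto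
  have "invertible ((1 - t) *\<^sub>R mat 1 + t *\<^sub>R A)"
  proof (rule invertible_if_injective)
    fix x assume "((1 - t) *\<^sub>R mat 1 + t *\<^sub>R A) *v x = 0"
    then have "x \<bullet> (((1 - t) *\<^sub>R mat 1 + t *\<^sub>R A) *v x) = 0" by simp
    then have "(1 - t) * (x \<bullet> x) + t * qform A x = 0"
      by (simp add: matrix_vector_mult_add_rdistrib scaleR_matrix_vector_assoc[symmetric] inner_add_right qform_def)
    moreover have "(1 - t) * (x \<bullet> x) + t * qform A x > 0" if "x \<noteq> 0"
      using t assms[OF that] that
      by (cases "t = 0") (auto intro: add_nonneg_pos)
    ultimately show "x = 0" by fastforce
  qed
  then show False using t(3) by (simp add: f_def invertible_det_nz)
qed

lemma full_row_rank_injective: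
  fixes B :: "real^'m^'c"
  assumes "rank B = CARD('c)" "w v* B = 0"
  shows "w = 0"
proof -
  have "inj ((*v) (transpose B))" using assms(1) full_rank_injective[of "transpose B"] by (simp add: rank_transpose)
  moreover have "transpose B *v w = transpose B *v 0" using assms(2) by simp
  ultimately show ?thesis by (rule injD)
qed

lemma bounded_linear_qform: "bounded_linear (\<lambda>P. qform P x)"
  unfolding qform_def
  by (rule bounded_linear_compose[OF bounded_linear_inner_right
      bounded_bilinear.bounded_linear_left[OF bounded_bilinear_matrix_vector]])

lemma (in prob_space) integrable_norm_power_of_powr:
  fixes X :: "'a \<Rightarrow> 'b::euclidean_space"
  assumes "X \<in> borel_measurable M" "integrable M (\<lambda>\<omega>. norm (X \<omega>) powr (4 + \<delta>))" "\<delta> > 0" "k \<le> 4"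
  shows "integrable M (\<lambda>\<omega>. norm (X \<omega>) ^ k)"
proof (rule Bochner_Integration.integrable_bound)
  show "integrable M (\<lambda>\<omega>. 1 + norm (X \<omega>) powr (4 + \<delta>))" using assms by simp
  show "AE \<omega> in M. norm (norm (X \<omega>) ^ k) \<le> norm (1 + norm (X \<omega>) powr (4 + \<delta>))"
  proof (rule AE_I2)
    fix \<omega>
    define a where "a = norm (X \<omega>)"
    have "a ^ k \<le> 1 + a powr (4 + \<delta>)"
    proof (cases "a \<le> 1")
      case True
      then have "a ^ k \<le> 1" by (intro power_le_one) (auto simp: a_def)
      then show ?thesis using powr_ge_zero[of a "4 + \<delta>"] by linarith
    next
      case False
      then have "a ^ k = a powr real k" by (simp add: powr_realpow)
      also have "\<dots> \<le> a powr (4 + \<delta>)" using False assms by (intro powr_mono) auto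
      finally show ?thesis by simp
    qed
    then show "norm (norm (X \<omega>) ^ k) \<le> norm (1 + norm (X \<omega>) powr (4 + \<delta>))" by (simp add: a_def)
  qed
qed (use assms in measurable)

lemma (in prob_space) integrable_components:
  fixes X :: "'a \<Rightarrow> real^'m"
  assumes X: "X \<in> borel_measurable M" and "integrable M (\<lambda>\<omega>. norm (X \<omega>) ^ 2)"
  shows "integrable M (\<lambda>\<omega>. X \<omega> $ i * X \<omega> $ j)"
proof (rule Bochner_Integration.integrable_bound[OF assms(2)])
  show "AE \<omega> in M. norm (X \<omega> $ i * X \<omega> $ j) \<le> norm (norm (X \<omega>) ^ 2)"
    by (rule AE_I2) (simp add: power2_eq_square abs_mult mult_mono component_le_norm_cart)
  have "(\<lambda>\<omega>. X \<omega> $ i) \<in> borel_measurable M" for i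
    by (rule borel_measurable_continuous_on[OF _ X]) (intro continuous_intros)
  then show "(\<lambda>\<omega>. X \<omega> $ i * X \<omega> $ j) \<in> borel_measurable M" by simp
qed

text \<open>The form at x is the second moment of \<open>x \<bullet> X\<close>. If it vanished,
  \<open>x \<bullet> X\<close> would be zero almost surely and x would lie in the kernel of the
  invertible moment matrix.\<close>

lemma (in prob_space) second_moment_matrix_posdef:
  fixes X :: "'a \<Rightarrow> real^'m"
  assumes X: "X \<in> borel_measurable M" and int: "integrable M (\<lambda>\<omega>. norm (X \<omega>) ^ 2)"
    and inv: "invertible (\<chi> i j. \<integral>\<omega>. X \<omega> $ i * X \<omega> $ j \<partial>M)" and x: "x \<noteq> 0"
  shows "0 < qform (\<chi> i j. \<integral>\<omega>. X \<omega> $ i * X \<omega> $ j \<partial>M) x"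
    and "qform (\<chi> i j. \<integral>\<omega>. X \<omega> $ i * X \<omega> $ j \<partial>M) y = (\<integral>\<omega>. (y \<bullet> X \<omega>)\<^sup>2 \<partial>M)"
    and "integrable M (\<lambda>\<omega>. (y \<bullet> X \<omega>)\<^sup>2)"
proof -
  define V where "V = (\<chi> i j. \<integral>\<omega>. X \<omega> $ i * X \<omega> $ j \<partial>M)"
  note I = integrable_components[OF X int]
  have Vv: "(V *v y) $ i = (\<integral>\<omega>. X \<omega> $ i * (y \<bullet> X \<omega>) \<partial>M)" for y i
  proof -
    have "(\<integral>\<omega>. X \<omega> $ i * (y \<bullet> X \<omega>) \<partial>M) = (\<integral>\<omega>. (\<Sum>j\<in>UNIV. (X \<omega> $ i * X \<omega> $ j) * y $ j) \<partial>M)"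
      by (simp add: inner_vec_def sum_distrib_left mult_ac)
    also have "\<dots> = (\<Sum>j\<in>UNIV. (\<integral>\<omega>. X \<omega> $ i * X \<omega> $ j \<partial>M) * y $ j)"
      using I by (subst Bochner_Integration.integral_sum) auto
    finally show ?thesis by (simp add: matrix_vector_mult_def V_def)
  qed
  have sq: "(y \<bullet> X \<omega>)\<^sup>2 = (\<Sum>i\<in>UNIV. y $ i * (X \<omega> $ i * (y \<bullet> X \<omega>)))" for y \<omega>
    by (simp add: power2_eq_square inner_vec_def[of y "X \<omega>"] sum_distrib_right mult_ac)
  have I2: "integrable M (\<lambda>\<omega>. X \<omega> $ i * (y \<bullet> X \<omega>))" for i y
  proof -
    have "integrable M (\<lambda>\<omega>. \<Sum>j\<in>UNIV. y $ j * (X \<omega> $ i * X \<omega> $ j))" using I by auto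
    then show ?thesis by (simp add: inner_vec_def sum_distrib_left mult_ac)
  qed
  show int2: "integrable M (\<lambda>\<omega>. (y \<bullet> X \<omega>)\<^sup>2)" for y unfolding sq using I2 by auto
  have q: "qform V y = (\<integral>\<omega>. (y \<bullet> X \<omega>)\<^sup>2 \<partial>M)" for y
    unfolding qform_def sq using I2 by (simp add: inner_vec_def[of y "V *v y"] Vv)
  then show "qform (\<chi> i j. \<integral>\<omega>. X \<omega> $ i * X \<omega> $ j \<partial>M) y = (\<integral>\<omega>. (y \<bullet> X \<omega>)\<^sup>2 \<partial>M)" by (simp add: V_def)
  have "qform V x \<noteq> 0"
  proof
    assume "qform V x = 0"
    then have "AE \<omega> in M. (x \<bullet> X \<omega>)\<^sup>2 = 0"
      using integral_nonneg_eq_0_iff_AE[OF int2[of x]] q by simp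
    then have "(V *v x) $ i = 0" for i
      unfolding Vv by (intro integral_eq_zero_AE) auto
    then have "V *v x = V *v 0" by (simp add: vec_eq_iff)
    then show False using inj_matrix_vector_mult[OF inv[folded V_def]] x by (metis injD)
  qed
  moreover have "0 \<le> qform V x" unfolding q by simp
  ultimately show "0 < qform (\<chi> i j. \<integral>\<omega>. X \<omega> $ i * X \<omega> $ j \<partial>M) x" by (simp add: V_def)
qed

lemma model_basics:
  assumes "model_setting \<M>" "assumption_A \<M>"
  shows "prob_space (Pr \<M>)" "mesh \<M> > 0" "compact (Theta \<M>)" "true_par \<M> \<in> Theta \<M>"
proof -
  show "prob_space (Pr \<M>)" "mesh \<M> > 0" using assms(1) unfolding model_setting_def by blast+
  have A: "compact (Theta \<M>)" "true_par \<M> \<in> interior (Theta \<M>)"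
    using assms(2) unfolding assumption_A_def by blast+
  then show "compact (Theta \<M>)" "true_par \<M> \<in> Theta \<M>" using interior_subset by blast+
qed

lemma model_levy:
  assumes "model_setting \<M>" "assumption_A \<M>" "\<theta> \<in> Theta \<M>"
  shows "two_sided_levy (Pr \<M>) (Levy \<M> (snd \<theta>))"
    and "(\<integral>\<omega>. Levy \<M> (snd \<theta>) 1 \<omega> \<partial>Pr \<M>) = 0" and "invertible (SigmaL \<M> \<theta>)"
    and "\<exists>\<delta>>0. integrable (Pr \<M>) (\<lambda>\<omega>. norm (Levy \<M> (snd \<theta>) 1 \<omega>) powr (4 + \<delta>))"
proof -
  have "snd \<theta> \<in> Theta2 \<M>" using assms(3) by (auto simp: Theta_def)
  then show "two_sided_levy (Pr \<M>) (Levy \<M> (snd \<theta>))" using assms(1) unfolding model_setting_def by blast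
  have "\<forall>\<theta>\<in>Theta \<M>. (\<integral>\<omega>. Levy \<M> (snd \<theta>) 1 \<omega> \<partial>Pr \<M>) = 0 \<and> invertible (SigmaL \<M> \<theta>)"
    using assms(2) unfolding assumption_A_def by (elim conjE) assumption
  then show "(\<integral>\<omega>. Levy \<M> (snd \<theta>) 1 \<omega> \<partial>Pr \<M>) = 0" "invertible (SigmaL \<M> \<theta>)"
    using assms(3) by blast+
  have "\<exists>\<delta>>0. \<forall>\<theta>\<in>Theta \<M>. integrable (Pr \<M>) (\<lambda>\<omega>. norm (Levy \<M> (snd \<theta>) 1 \<omega>) powr (4 + \<delta>))"
    using assms(2) unfolding assumption_A_def by (elim conjE) assumption
  then show "\<exists>\<delta>>0. integrable (Pr \<M>) (\<lambda>\<omega>. norm (Levy \<M> (snd \<theta>) 1 \<omega>) powr (4 + \<delta>))"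
    using assms(3) by blast
qed

lemma model_matrices:
  fixes \<M> :: "('w, 's1::finite, 's2::finite, 'c::finite, 'k::finite, 'd::{finite,linorder},
                'e::{finite,linorder}, 'm::finite) coint_model"
  assumes "assumption_A \<M>" "\<theta> \<in> Theta \<M>"
  shows "complex_eigenvalue (A2 \<M> (snd \<theta>)) z \<Longrightarrow> Re z < 0"
    and "minimal_triple (A2 \<M> (snd \<theta>)) (B2 \<M> (snd \<theta>)) (C2 \<M> (snd \<theta>))"
    and "rank (B1 \<M> (snd \<theta>)) = CARD('c)" "rank (C1 \<M> (fst \<theta>)) = CARD('c)" "rank (C_mat \<M> \<theta>) = CARD('d)"
    and "transpose (C1perp \<M> (fst \<theta>)) ** C1 \<M> (fst \<theta>) = 0"
proof -
  have "\<forall>\<theta>\<^sub>1\<in>Theta1 \<M>. lower_triangular (C1perp \<M> \<theta>\<^sub>1) \<and>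
         transpose (C1perp \<M> \<theta>\<^sub>1) ** C1perp \<M> \<theta>\<^sub>1 = mat 1 \<and>
         transpose (C1perp \<M> \<theta>\<^sub>1) ** C1 \<M> \<theta>\<^sub>1 = 0"
    using assms(1) unfolding assumption_A_def by (elim conjE) assumption
  moreover have "fst \<theta> \<in> Theta1 \<M>" using assms(2) by (auto simp: Theta_def)
  ultimately show "transpose (C1perp \<M> (fst \<theta>)) ** C1 \<M> (fst \<theta>) = 0" by blast
  have "\<forall>\<theta>\<in>Theta \<M>. \<forall>z. complex_eigenvalue (A2 \<M> (snd \<theta>)) z \<longrightarrow> Re z < 0"
    "\<forall>\<theta>\<in>Theta \<M>. minimal_triple (A2 \<M> (snd \<theta>)) (B2 \<M> (snd \<theta>)) (C2 \<M> (snd \<theta>))"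
    "\<forall>\<theta>\<in>Theta \<M>. rank (B1 \<M> (snd \<theta>)) = CARD('c) \<and> rank (C1 \<M> (fst \<theta>)) = CARD('c)"
    "\<forall>\<theta>\<in>Theta \<M>. rank (C_mat \<M> \<theta>) = CARD('d)"
    using assms(1) unfolding assumption_A_def by - (elim conjE, assumption)+
  then show "complex_eigenvalue (A2 \<M> (snd \<theta>)) z \<Longrightarrow> Re z < 0"
    "minimal_triple (A2 \<M> (snd \<theta>)) (B2 \<M> (snd \<theta>)) (C2 \<M> (snd \<theta>))"
    "rank (B1 \<M> (snd \<theta>)) = CARD('c)" "rank (C1 \<M> (fst \<theta>)) = CARD('c)" "rank (C_mat \<M> \<theta>) = CARD('d)"
    using assms(2) by blast+
qed

lemma model_continuous:
  assumes "assumption_A \<M>"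
  shows "continuous_on (Theta \<M>) (\<lambda>\<theta>. A2 \<M> (snd \<theta>))" "continuous_on (Theta \<M>) (\<lambda>\<theta>. B1 \<M> (snd \<theta>))"
    "continuous_on (Theta \<M>) (\<lambda>\<theta>. B2 \<M> (snd \<theta>))" "continuous_on (Theta \<M>) (\<lambda>\<theta>. C1 \<M> (fst \<theta>))"
    "continuous_on (Theta \<M>) (\<lambda>\<theta>. C2 \<M> (snd \<theta>))" "continuous_on (Theta \<M>) (SigmaL \<M>)"
  using assms unfolding assumption_A_def
  by - (elim conjE, rule smooth3_continuous_on, assumption)+

lemma SigmaL_posdef:
  assumes "model_setting \<M>" "assumption_A \<M>" "\<theta> \<in> Theta \<M>"
  shows "x \<noteq> 0 \<Longrightarrow> 0 < qform (SigmaL \<M> \<theta>) x"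
    and "qform (SigmaL \<M> \<theta>) x = (\<integral>\<omega>. (x \<bullet> Levy \<M> (snd \<theta>) 1 \<omega>)\<^sup>2 \<partial>Pr \<M>)"
proof -
  interpret prob_space "Pr \<M>" using model_basics(1)[OF assms(1,2)] .
  note L = model_levy[OF assms]
  have X: "Levy \<M> (snd \<theta>) 1 \<in> borel_measurable (Pr \<M>)" using L(1) by (simp add: two_sided_levy_def)
  obtain \<delta> where \<delta>: "\<delta> > 0" "integrable (Pr \<M>) (\<lambda>\<omega>. norm (Levy \<M> (snd \<theta>) 1 \<omega>) powr (4 + \<delta>))"
    using L(4) by blast
  have int: "integrable (Pr \<M>) (\<lambda>\<omega>. norm (Levy \<M> (snd \<theta>) 1 \<omega>) ^ 2)"
    by (rule integrable_norm_power_of_powr[OF X \<delta>(2,1)]) simp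
  have eq: "SigmaL \<M> \<theta> = (\<chi> i j. \<integral>\<omega>. Levy \<M> (snd \<theta>) 1 \<omega> $ i * Levy \<M> (snd \<theta>) 1 \<omega> $ j \<partial>Pr \<M>)"
    by (simp add: SigmaL_def)
  have inv: "invertible (\<chi> i j. \<integral>\<omega>. Levy \<M> (snd \<theta>) 1 \<omega> $ i * Levy \<M> (snd \<theta>) 1 \<omega> $ j \<partial>Pr \<M>)"
    using L(3) unfolding eq .
  show "0 < qform (SigmaL \<M> \<theta>) x" if "x \<noteq> 0"
    unfolding eq by (rule second_moment_matrix_posdef(1)[OF X int inv that])
  have "axis undefined 1 \<noteq> (0 :: real^'h)" by simp
  then show "qform (SigmaL \<M> \<theta>) x = (\<integral>\<omega>. (x \<bullet> Levy \<M> (snd \<theta>) 1 \<omega>)\<^sup>2 \<partial>Pr \<M>)"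
    unfolding eq by (rule second_moment_matrix_posdef(2)[OF X int inv])
qed

lemma transpose_SigmaL: "transpose (SigmaL \<M> \<theta>) = SigmaL \<M> \<theta>"
  by (simp add: SigmaL_def transpose_def vec_eq_iff mult.commute)

lemma mat_exp_transpose_scaled: "mat_exp (u *\<^sub>R transpose A) = transpose (mat_exp (u *\<^sub>R A))"
proof -
  have "u *\<^sub>R transpose A = transpose (u *\<^sub>R A)" by (simp add: vec_eq_iff transpose_def)
  then show ?thesis by (simp only: transpose_mat_exp)
qed

text \<open>The integrand of \<open>Sigma_h\<close> written as a congruence of
  \<open>SigmaL\<close>, from which symmetry and positivity are visible.\<close>

definition Sigma_integrand ::
  "('w, 's1::finite, 's2::finite, 'c::finite, 'k::finite, 'd::finite, 'e::finite, 'm::finite) coint_model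
    \<Rightarrow> (real^'s1) \<times> (real^'s2) \<Rightarrow> real \<Rightarrow> real^('c + 'k)^('c + 'k)" where
  "Sigma_integrand \<M> \<theta> u = (mat_exp (u *\<^sub>R A_mat \<M> \<theta>) ** B_mat \<M> \<theta>) ** SigmaL \<M> \<theta> **
     transpose (mat_exp (u *\<^sub>R A_mat \<M> \<theta>) ** B_mat \<M> \<theta>)"

lemma Sigma_h_integrand: "Sigma_h \<M> \<theta> = integral {0..mesh \<M>} (Sigma_integrand \<M> \<theta>)"
  by (simp add: Sigma_h_def Sigma_integrand_def[abs_def] mat_exp_transpose_scaled matrix_transpose_mul matrix_mul_assoc)

lemma model_matrix_continuous:
  assumes "assumption_A \<M>"
  shows "continuous_on (Theta \<M>) (A_mat \<M>)" "continuous_on (Theta \<M>) (B_mat \<M>)" "continuous_on (Theta \<M>) (C_mat \<M>)"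
  unfolding A_mat_block[abs_def] B_mat_block[abs_def] C_mat_block[abs_def]
  by (intro continuous_on_add continuous_on_matrix_mult continuous_on_const model_continuous[OF assms])+

lemma continuous_on_eAh:
  assumes "assumption_A \<M>" shows "continuous_on (Theta \<M>) (eAh \<M>)"
  unfolding eAh_def[abs_def]
  by (rule continuous_on_compose2[OF continuous_on_mat_exp[of UNIV]])
    (intro continuous_on_scaleR continuous_on_const model_matrix_continuous[OF assms] subset_UNIV)+

lemma continuous_on_Sigma_integrand:
  assumes A: "assumption_A \<M>"
  shows "continuous_on (Theta \<M> \<times> S) (\<lambda>q. Sigma_integrand \<M> (fst q) (snd q))"
proof -
  have c: "continuous_on (Theta \<M> \<times> S) (\<lambda>q. f (fst q))" if "continuous_on (Theta \<M>) f" for f :: "_ \<Rightarrow> 'z::topological_space"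
    by (rule continuous_on_compose2[OF that continuous_on_fst[OF continuous_on_id]]) auto
  have "continuous_on (Theta \<M> \<times> S) (\<lambda>q. mat_exp (snd q *\<^sub>R A_mat \<M> (fst q)))"
    by (rule continuous_on_compose2[OF continuous_on_mat_exp[of UNIV]])
      (intro continuous_on_scaleR continuous_on_snd continuous_on_id c model_matrix_continuous[OF A] subset_UNIV)+
  then show ?thesis
    unfolding Sigma_integrand_def
    by (intro continuous_on_matrix_mult continuous_on_transpose c model_matrix_continuous[OF A] model_continuous(6)[OF A])
qed

lemma continuous_on_Sigma_h:
  assumes A: "assumption_A \<M>" shows "continuous_on (Theta \<M>) (Sigma_h \<M>)"
proof -
  have "continuous_on (Theta \<M>) (\<lambda>\<theta>. integral (cbox 0 (mesh \<M>)) (Sigma_integrand \<M> \<theta>))"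
    by (rule integral_continuous_on_param)
      (use continuous_on_Sigma_integrand[OF A, of "cbox 0 (mesh \<M>)"] in \<open>simp add: case_prod_unfold\<close>)
  then show ?thesis by (simp add: Sigma_h_integrand[abs_def])
qed

lemma Sigma_integrand_continuous:
  assumes A: "assumption_A \<M>" and "\<theta> \<in> Theta \<M>"
  shows "continuous_on S (Sigma_integrand \<M> \<theta>)"
proof -
  have "continuous_on S (\<lambda>u. (\<theta>, u))" by (intro continuous_on_Pair continuous_on_const continuous_on_id)
  then show ?thesis
    using continuous_on_compose2[OF continuous_on_Sigma_integrand[OF A, of S]] assms(2) by fastforce
qed

lemma transpose_Sigma_h:
  assumes A: "assumption_A \<M>" and \<theta>: "\<theta> \<in> Theta \<M>"
  shows "transpose (Sigma_h \<M> \<theta>) = Sigma_h \<M> \<theta>"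
proof -
  have "integral {0..mesh \<M>} (transpose \<circ> Sigma_integrand \<M> \<theta>) = transpose (integral {0..mesh \<M>} (Sigma_integrand \<M> \<theta>))"
    by (rule integral_linear[OF integrable_continuous_real[OF Sigma_integrand_continuous[OF A \<theta>]] bounded_linear_transpose])
  moreover have "transpose \<circ> Sigma_integrand \<M> \<theta> = Sigma_integrand \<M> \<theta>"
    by (rule ext) (simp only: o_def Sigma_integrand_def transpose_congruence[OF transpose_SigmaL])
  ultimately show ?thesis by (simp add: Sigma_h_integrand)
qed

text \<open>A zero form would make the continuous nonnegative integrand vanish on the whole
  interval. In blocks the output is then a constant from B1 plus an exponential output from B2;
  minimality removes the short-run block of x, and the row rank of B1 removes the other.\<close>

lemma Sigma_h_posdef:
  fixes \<M> :: "('w, 's1::finite, 's2::finite, 'c::finite, 'k::finite, 'd::{finite,linorder},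
                'e::{finite,linorder}, 'm::finite) coint_model"
  assumes ms: "model_setting \<M>" and A: "assumption_A \<M>" and \<theta>: "\<theta> \<in> Theta \<M>" and x: "x \<noteq> 0"
  shows "0 < qform (Sigma_h \<M> \<theta>) x"
proof -
  note b = model_basics[OF ms A] and m = model_matrices[OF A \<theta>]
  define f where "f u = qform (Sigma_integrand \<M> \<theta> u) x" for u
  have f_eq: "f u = qform (SigmaL \<M> \<theta>) (x v* (mat_exp (u *\<^sub>R A_mat \<M> \<theta>) ** B_mat \<M> \<theta>))" for u
    unfolding f_def Sigma_integrand_def by (rule qform_congruence)
  have f0: "0 \<le> f u" for u
    unfolding f_eq using SigmaL_posdef(1)[OF ms A \<theta>]
    by (metis less_eq_real_def matrix_vector_mult_0_right inner_zero_left qform_def)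
  have "qform (Sigma_h \<M> \<theta>) x = integral {0..mesh \<M>} f"
    using integral_linear[OF integrable_continuous_real[OF Sigma_integrand_continuous[OF A \<theta>]] bounded_linear_qform, of 0 "mesh \<M>" x]
    by (simp add: Sigma_h_integrand f_def[abs_def] o_def)
  moreover have "integral {0..mesh \<M>} f \<noteq> 0"
  proof
    assume "integral {0..mesh \<M>} f = 0"
    moreover have "continuous_on {0..mesh \<M>} f"
      unfolding f_def
      by (rule continuous_on_compose2[OF linear_continuous_on[OF bounded_linear_qform] Sigma_integrand_continuous[OF A \<theta>]]) (rule subset_UNIV)
    ultimately have z: "f u = 0" if "u \<in> {0..mesh \<M>}" for u
      using integral_eq_0_iff[of 0 "mesh \<M>" f] b(2) f0 that by auto
    have eB: "mat_exp (u *\<^sub>R A_mat \<M> \<theta>) ** B_mat \<M> \<theta> =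
        emb_inl ** B1 \<M> (snd \<theta>) + emb_inr ** (mat_exp (u *\<^sub>R A2 \<M> (snd \<theta>)) ** B2 \<M> (snd \<theta>))" for u
      by (simp add: B_mat_block matrix_add_ldistrib matrix_mul_assoc mat_exp_A_mat)
    have out: "(x v* emb_inl) v* B1 \<M> (snd \<theta>) + (x v* emb_inr) v* (mat_exp (u *\<^sub>R A2 \<M> (snd \<theta>)) ** B2 \<M> (snd \<theta>)) = 0"
      if "0 < u" "u < mesh \<M>" for u
    proof -
      have "x v* (mat_exp (u *\<^sub>R A_mat \<M> \<theta>) ** B_mat \<M> \<theta>) = 0"
        using z[of u] that SigmaL_posdef(1)[OF ms A \<theta>] unfolding f_eq by force
      then show ?thesis unfolding eB by (simp only: vector_matrix_add_rdistrib vector_matrix_mul_assoc2)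
    qed
    have r: "x v* emb_inr = 0"
      by (rule minimal_stable_no_constant_output[OF m(2) m(1) b(2) out])
    have "(x v* emb_inl) v* B1 \<M> (snd \<theta>) = 0"
      using out[of "mesh \<M> / 2"] b(2) by (simp add: r)
    then have l: "x v* emb_inl = 0" by (rule full_row_rank_injective[OF m(3)])
    have "x = x v* (emb_inl ** proj_inl + emb_inr ** proj_inr)" by (simp add: block_partition)
    also have "\<dots> = 0" by (simp add: vector_matrix_add_rdistrib vector_matrix_mul_assoc2 l r)
    finally show False using x by simp
  qed
  moreover have "0 \<le> integral {0..mesh \<M>} f"
    using f0 by (cases "f integrable_on {0..mesh \<M>}") (auto intro: integral_nonneg simp: not_integrable_integral)
  ultimately show ?thesis by simp
qed

section \<open>Filter covariance, gain and uniform stability on the parameter set\<close>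

lemma riccati_solution_iff:
  "pos_semidef P \<and> riccati_solution \<M> \<theta> P \<longleftrightarrow> ric_sol (eAh \<M> \<theta>) (C_mat \<M> \<theta>) (Sigma_h \<M> \<theta>) P"
proof -
  have "mat_exp (mesh \<M> *\<^sub>R transpose (A_mat \<M> \<theta>)) = transpose (eAh \<M> \<theta>)"
    by (simp only: eAh_def mat_exp_transpose_scaled)
  then show ?thesis
    unfolding pos_semidef_def riccati_solution_def ric_sol_def ric_step_def qform_def Let_def by simp
qed

lemma C_mat_injective:
  fixes \<M> :: "('w, 's1::finite, 's2::finite, 'c::finite, 'k::finite, 'd::{finite,linorder},
                'e::{finite,linorder}, 'm::finite) coint_model"
  assumes "assumption_A \<M>" "\<theta> \<in> Theta \<M>" "y v* C_mat \<M> \<theta> = 0"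
  shows "y = 0"
  using full_row_rank_injective[OF model_matrices(5)[OF assms(1,2)] assms(3)] .

text \<open>Validates the definite description in \<open>Omega\<close>: detectability provides a
  solution, and the positive definite noise covariance makes it unique.\<close>

lemma ric_sol_Omega:
  fixes \<M> :: "('w, 's1::finite, 's2::finite, 'c::finite, 'k::finite, 'd::{finite,linorder},
                'e::{finite,linorder}, 'm::finite) coint_model"
  assumes ms: "model_setting \<M>" and A: "assumption_A \<M>" and \<theta>: "\<theta> \<in> Theta \<M>"
  shows "ric_sol (eAh \<M> \<theta>) (C_mat \<M> \<theta>) (Sigma_h \<M> \<theta>) (Omega \<M> \<theta>)"
proof -
  obtain L N where "norm (mat_pow (eAh \<M> \<theta> - L ** C_mat \<M> \<theta>) N) < 1 / 2"
    using detectability[OF model_matrices(1)[OF A \<theta>] model_basics(2)[OF ms A] model_matrices(4)[OF A \<theta>]] by blast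
  then have "norm (mat_pow (eAh \<M> \<theta> - L ** C_mat \<M> \<theta>) N) \<le> 1 / 2" by simp
  from ric_sol_exists[OF transpose_Sigma_h[OF A \<theta>] Sigma_h_posdef[OF ms A \<theta>] C_mat_injective[OF A \<theta>] this]
  obtain P where P: "ric_sol (eAh \<M> \<theta>) (C_mat \<M> \<theta>) (Sigma_h \<M> \<theta>) P" by blast
  have "\<exists>!P. ric_sol (eAh \<M> \<theta>) (C_mat \<M> \<theta>) (Sigma_h \<M> \<theta>) P"
    by (rule ex1I[of _ P], rule P) (rule ric_sol_unique[OF _ P Sigma_h_posdef[OF ms A \<theta>]])
  then show ?thesis unfolding Omega_def riccati_solution_iff by (rule theI')
qed

lemma continuous_on_Omega:
  fixes \<M> :: "('w, 's1::finite, 's2::finite, 'c::finite, 'k::finite, 'd::{finite,linorder},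
                'e::{finite,linorder}, 'm::finite) coint_model"
  assumes ms: "model_setting \<M>" and A: "assumption_A \<M>"
  shows "continuous_on (Theta \<M>) (Omega \<M>)"
proof (rule continuous_on_ric_sol[OF model_basics(3)[OF ms A] continuous_on_eAh[OF A] model_matrix_continuous(3)[OF A]
      continuous_on_Sigma_h[OF A]])
  show "\<exists>L N. norm (mat_pow (eAh \<M> \<theta> - L ** C_mat \<M> \<theta>) N) < 1 / 2" if "\<theta> \<in> Theta \<M>" for \<theta>
    using detectability[OF model_matrices(1)[OF A that] model_basics(2)[OF ms A] model_matrices(4)[OF A that]] .
qed (use Sigma_h_posdef[OF ms A] C_mat_injective[OF A] ric_sol_Omega[OF ms A] in auto)

lemma Omega_posdef:
  fixes \<M> :: "('w, 's1::finite, 's2::finite, 'c::finite, 'k::finite, 'd::{finite,linorder},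
                'e::{finite,linorder}, 'm::finite) coint_model"
  assumes ms: "model_setting \<M>" and A: "assumption_A \<M>" and \<theta>: "\<theta> \<in> Theta \<M>" and x: "x \<noteq> 0"
  shows "0 < qform (Omega \<M> \<theta>) x"
  using Sigma_h_posdef[OF assms] ric_sol_ge[OF ric_sol_Omega[OF ms A \<theta>], of x] by linarith

lemma V_mat_posdef:
  fixes \<M> :: "('w, 's1::finite, 's2::finite, 'c::finite, 'k::finite, 'd::{finite,linorder},
                'e::{finite,linorder}, 'm::finite) coint_model"
  assumes ms: "model_setting \<M>" and A: "assumption_A \<M>" and \<theta>: "\<theta> \<in> Theta \<M>"
  shows "y \<noteq> 0 \<Longrightarrow> 0 < qform (V_mat \<M> \<theta>) y" "invertible (V_mat \<M> \<theta>)" "0 < det (V_mat \<M> \<theta>)"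
    "y \<noteq> 0 \<Longrightarrow> 0 < qform (matrix_inv (V_mat \<M> \<theta>)) y"
proof -
  have pos: "0 < qform (V_mat \<M> \<theta>) y" if "y \<noteq> 0" for y
    unfolding V_mat_def qform_congruence
    using Omega_posdef[OF ms A \<theta>] C_mat_injective[OF A \<theta>] that by blast
  then show "y \<noteq> 0 \<Longrightarrow> 0 < qform (V_mat \<M> \<theta>) y" .
  show "0 < det (V_mat \<M> \<theta>)" by (rule det_pos_if_posdef[OF pos])
  then show inv: "invertible (V_mat \<M> \<theta>)" by (simp add: invertible_det_nz)
  assume y: "y \<noteq> 0"
  \<comment> \<open>With y = V w the form of the inverse at y becomes the form of V at w.\<close>
  define w where "w = matrix_inv (V_mat \<M> \<theta>) *v y"
  have yw: "y = V_mat \<M> \<theta> *v w" by (simp add: w_def matrix_vector_mul_assoc matrix_inv_inverse[OF inv])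
  then have "w \<noteq> 0" using y by auto
  have "qform (matrix_inv (V_mat \<M> \<theta>)) y = y \<bullet> w" by (simp add: qform_def w_def)
  also have "\<dots> = qform (V_mat \<M> \<theta>) w" by (simp add: qform_def yw inner_commute)
  finally show "0 < qform (matrix_inv (V_mat \<M> \<theta>)) y" using pos[OF \<open>w \<noteq> 0\<close>] by simp
qed

lemma K_mat_gain: "K_mat \<M> \<theta> = ric_gain (eAh \<M> \<theta>) (C_mat \<M> \<theta>) (Omega \<M> \<theta>)"
  by (simp add: K_mat_def V_mat_def ric_gain_def)

lemma filter_continuous:
  fixes \<M> :: "('w, 's1::finite, 's2::finite, 'c::finite, 'k::finite, 'd::{finite,linorder},
                'e::{finite,linorder}, 'm::finite) coint_model"
  assumes ms: "model_setting \<M>" and A: "assumption_A \<M>"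
  shows "continuous_on (Theta \<M>) (V_mat \<M>)" "continuous_on (Theta \<M>) (\<lambda>\<theta>. matrix_inv (V_mat \<M> \<theta>))"
    "continuous_on (Theta \<M>) (K_mat \<M>)" "continuous_on (Theta \<M>) (F_mat \<M>)"
proof -
  show V: "continuous_on (Theta \<M>) (V_mat \<M>)"
    unfolding V_mat_def[abs_def]
    by (intro continuous_on_matrix_mult continuous_on_transpose model_matrix_continuous[OF A] continuous_on_Omega[OF ms A])
  then show Vi: "continuous_on (Theta \<M>) (\<lambda>\<theta>. matrix_inv (V_mat \<M> \<theta>))"
    by (rule continuous_on_matrix_inv) (rule V_mat_posdef(2)[OF ms A])
  show K: "continuous_on (Theta \<M>) (K_mat \<M>)"
    unfolding K_mat_def[abs_def]
    by (intro continuous_on_matrix_mult continuous_on_transpose model_matrix_continuous[OF A] continuous_on_Omega[OF ms A]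
        continuous_on_eAh[OF A] Vi)
  show "continuous_on (Theta \<M>) (F_mat \<M>)"
    unfolding F_mat_def[abs_def]
    by (intro continuous_on_diff continuous_on_matrix_mult model_matrix_continuous[OF A] continuous_on_eAh[OF A] K)
qed

lemma compact_norm_bound:
  fixes f :: "'p::topological_space \<Rightarrow> 'b::real_normed_vector"
  assumes "compact K" "continuous_on K f"
  shows "\<exists>B>0. \<forall>p\<in>K. norm (f p) \<le> B"
proof -
  have "bounded (f ` K)" using assms by (intro compact_imp_bounded compact_continuous_image)
  then show ?thesis unfolding bounded_pos by auto
qed

text \<open>The Lyapunov estimate involves only a lower bound of \<open>Sigma_h\<close> and an upper
  bound of \<open>Omega\<close>, and both hold uniformly by continuity on a compact set.\<close>

lemma uniform_filter_stability:
  fixes \<M> :: "('w, 's1::finite, 's2::finite, 'c::finite, 'k::finite, 'd::{finite,linorder},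
                'e::{finite,linorder}, 'm::finite) coint_model"
  assumes ms: "model_setting \<M>" and A: "assumption_A \<M>"
  shows "\<exists>B \<rho>. 0 < B \<and> 0 < \<rho> \<and> \<rho> < 1 \<and> (\<forall>\<theta>\<in>Theta \<M>. \<forall>k x. norm (mat_pow (F_mat \<M> \<theta>) k *v x) \<le> B * \<rho> ^ k * norm x)"
proof -
  obtain \<sigma> where \<sigma>: "\<sigma> > 0" "\<And>\<theta> x. \<theta> \<in> Theta \<M> \<Longrightarrow> \<sigma> * (norm x)\<^sup>2 \<le> qform (Sigma_h \<M> \<theta>) x"
    using uniform_posdef_lower_bound[OF model_basics(3)[OF ms A] continuous_on_Sigma_h[OF A]]
      Sigma_h_posdef[OF ms A] unfolding qform_def by blast
  obtain \<omega>0 where \<omega>0: "\<omega>0 > 0" "\<And>\<theta>. \<theta> \<in> Theta \<M> \<Longrightarrow> norm (Omega \<M> \<theta>) \<le> \<omega>0"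
    using compact_norm_bound[OF model_basics(3)[OF ms A] continuous_on_Omega[OF ms A]] by blast
  \<comment> \<open>Adding \<open>\<sigma>\<close> makes \<open>\<sigma> < \<omega>\<close> strict,
    so that \<open>\<rho>\<close> is positive and not merely nonnegative.\<close>
  define \<omega> where "\<omega> = \<omega>0 + \<sigma>"
  define \<rho> where "\<rho> = sqrt (1 - \<sigma> / \<omega>)"
  have \<omega>: "\<omega> > 0" "\<sigma> < \<omega>" using \<sigma> \<omega>0 by (auto simp: \<omega>_def)
  then have \<rho>: "0 < \<rho>" "\<rho> < 1" using \<sigma> by (auto simp: \<rho>_def)
  have "norm (mat_pow (F_mat \<M> \<theta>) k *v x) \<le> sqrt (\<omega> / \<sigma>) * \<rho> ^ k * norm x" if \<theta>: "\<theta> \<in> Theta \<M>" for \<theta> k x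
  proof (rule norm_matrix_vector_from_transposed)
    fix x
    note R = ric_sol_Omega[OF ms A \<theta>]
    show "norm (x v* mat_pow (F_mat \<M> \<theta>) k) \<le> sqrt (\<omega> / \<sigma>) * \<rho> ^ k * norm x"
      unfolding \<rho>_def
    proof (rule closed_loop_decay(1)[OF \<sigma>(1) \<sigma>(2)[OF \<theta>] ric_sol_ge[OF R]])
      show "qform (Omega \<M> \<theta>) x \<le> \<omega> * (norm x)\<^sup>2" for x
        using \<omega>0(2)[OF \<theta>] \<sigma>(1) by (intro order_trans[OF qform_le_norm] mult_right_mono) (auto simp: \<omega>_def)
      show "qform (Omega \<M> \<theta>) (x v* F_mat \<M> \<theta>) = qform (Omega \<M> \<theta>) x - qform (Sigma_h \<M> \<theta>) x" for x
        unfolding F_mat_def K_mat_gain by (rule ric_sol_gain[OF R])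
    qed
  qed
  moreover have "0 < sqrt (\<omega> / \<sigma>)" using \<omega> \<sigma> by simp
  ultimately show ?thesis using \<rho> by blast
qed

section \<open>Long-run behaviour of the innovations\<close>

definition longrun ::
  "('w, 's1::finite, 's2::finite, 'c::finite, 'k::finite, 'd::finite, 'e::finite, 'm::finite) coint_model
    \<Rightarrow> (real^'s1) \<times> (real^'s2) \<Rightarrow> real^'d^'d" where
  "longrun \<M> \<theta> = mat 1 - C_mat \<M> \<theta> ** (matrix_inv (mat 1 - F_mat \<M> \<theta>) ** K_mat \<M> \<theta>)"

definition trend_response ::
  "('w, 's1::finite, 's2::finite, 'c::finite, 'k::finite, 'd::finite, 'e::finite, 'm::finite) coint_model
    \<Rightarrow> (real^'s1) \<times> (real^'s2) \<Rightarrow> real^'m^'d" where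
  "trend_response \<M> \<theta> = longrun \<M> \<theta> ** (C1 \<M> (true1 \<M>) ** B1 \<M> (true2 \<M>))"

text \<open>A vector fixed by F is fixed by all powers of F, whose action decays.\<close>

lemma I_minus_F_invertible:
  fixes \<M> :: "('w, 's1::finite, 's2::finite, 'c::finite, 'k::finite, 'd::{finite,linorder},
                'e::{finite,linorder}, 'm::finite) coint_model"
  assumes ms: "model_setting \<M>" and A: "assumption_A \<M>" and \<theta>: "\<theta> \<in> Theta \<M>"
  shows "invertible (mat 1 - F_mat \<M> \<theta>)"
proof (rule invertible_if_injective)
  fix x assume "(mat 1 - F_mat \<M> \<theta>) *v x = 0"
  then have Fx: "F_mat \<M> \<theta> *v x = x" by (simp add: matrix_vector_mult_diff_rdistrib)
  have "mat_pow (F_mat \<M> \<theta>) k *v x = x" for k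
    by (induction k) (simp_all add: mat_pow_Suc2 matrix_vector_mul_assoc[symmetric] Fx)
  moreover obtain B \<rho> where B: "0 < \<rho>" "\<rho> < 1"
    "\<And>k x. norm (mat_pow (F_mat \<M> \<theta>) k *v x) \<le> B * \<rho> ^ k * norm x"
    using uniform_filter_stability[OF ms A] \<theta> by blast
  ultimately have le: "norm x \<le> B * \<rho> ^ k * norm x" for k by metis
  have "(\<lambda>k. B * \<rho> ^ k * norm x) \<longlonglongrightarrow> B * 0 * norm x"
    using B by (intro tendsto_intros LIMSEQ_realpow_zero) auto
  then have "norm x \<le> B * 0 * norm x" by (rule LIMSEQ_le_const) (use le in blast)
  then show "x = 0" by simp
qed

text \<open>Let x be the stationary filter state for a constant input w, that is (I - F) x = K w. A
  vanishing gain means w = C x; then F = E - K C gives E x = x, and fixed vectors of E are pure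
  integrator states. Reading the equations backwards gives the converse.\<close>

lemma longrun_kernel:
  fixes \<M> :: "('w, 's1::finite, 's2::finite, 'c::finite, 'k::finite, 'd::{finite,linorder},
                'e::{finite,linorder}, 'm::finite) coint_model"
  assumes ms: "model_setting \<M>" and A: "assumption_A \<M>" and \<theta>: "\<theta> \<in> Theta \<M>"
  shows "longrun \<M> \<theta> *v w = 0 \<longleftrightarrow> (\<exists>y. w = C1 \<M> (fst \<theta>) *v y)"
proof
  note inv = matrix_inv_inverse[OF I_minus_F_invertible[OF ms A \<theta>]]
  define R where "R = matrix_inv (mat 1 - F_mat \<M> \<theta>)"
  {
    assume w: "longrun \<M> \<theta> *v w = 0"
    define x where "x = R *v (K_mat \<M> \<theta> *v w)"
    have wx: "w = C_mat \<M> \<theta> *v x"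
      using w by (simp add: longrun_def x_def R_def matrix_vector_mult_diff_rdistrib matrix_vector_mul_assoc matrix_mul_assoc)
    have "(mat 1 - F_mat \<M> \<theta>) *v x = K_mat \<M> \<theta> *v w"
      by (simp add: x_def R_def matrix_vector_mul_assoc matrix_mul_assoc inv)
    also have "\<dots> = (K_mat \<M> \<theta> ** C_mat \<M> \<theta>) *v x" by (simp add: wx matrix_vector_mul_assoc)
    finally have Ex: "eAh \<M> \<theta> *v x = x"
      by (simp add: F_mat_def matrix_vector_mult_diff_rdistrib)
    have "x = emb_inl *v (proj_inl *v x)"
      by (rule unit_eigenspace_eAh[OF model_matrices(1)[OF A \<theta>] model_basics(2)[OF ms A] Ex])
    then have "w = C_mat \<M> \<theta> *v (emb_inl *v (proj_inl *v x))" using wx by simp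
    then have "w = C1 \<M> (fst \<theta>) *v (proj_inl *v x)"
      by (simp only: matrix_vector_mul_assoc matrix_mul_assoc C_mat_injl)
    then show "\<exists>y. w = C1 \<M> (fst \<theta>) *v y" by blast
  }
  {
    assume "\<exists>y. w = C1 \<M> (fst \<theta>) *v y"
    then obtain y where y: "w = C1 \<M> (fst \<theta>) *v y" by blast
    define x where "x = (emb_inl *v y :: real^('c+'k))"
    have wx: "w = C_mat \<M> \<theta> *v x" by (simp only: y x_def matrix_vector_mul_assoc C_mat_injl)
    have "eAh \<M> \<theta> *v x = x" unfolding x_def matrix_vector_mul_assoc eAh_def mat_exp_A_mat ..
    then have "(mat 1 - F_mat \<M> \<theta>) *v x = K_mat \<M> \<theta> *v w"
      by (simp add: F_mat_def matrix_vector_mult_diff_rdistrib wx matrix_vector_mul_assoc)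
    then have "R *v ((mat 1 - F_mat \<M> \<theta>) *v x) = R *v (K_mat \<M> \<theta> *v w)" by simp
    then have "x = R *v (K_mat \<M> \<theta> *v w)" by (simp add: matrix_vector_mul_assoc R_def inv)
    then have "w = C_mat \<M> \<theta> *v (R *v (K_mat \<M> \<theta> *v w))" using wx by simp
    then show "longrun \<M> \<theta> *v w = 0"
      by (simp add: longrun_def R_def matrix_vector_mult_diff_rdistrib matrix_vector_mul_assoc matrix_mul_assoc)
  }
qed

lemma matrix_eq_0_iff: "(\<forall>x. M *v x = 0) \<longleftrightarrow> M = (0 :: real^'n^'m)"
  using matrix_eq[of M 0] by simp

text \<open>At the truth the loading lies in the kernel of the gain. Elsewhere, surjectivity of B1
  turns a zero response into inclusion of the column space of the true C1 in that of
  \<open>C1 \<M> (fst \<theta>)\<close>, which \<open>C1perp\<close> annihilates; Assumption C then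
  leaves only the true long-run parameter.\<close>

lemma trend_response_eq_0:
  fixes \<M> :: "('w, 's1::finite, 's2::finite, 'c::finite, 'k::finite, 'd::{finite,linorder},
                'e::{finite,linorder}, 'm::finite) coint_model"
  assumes ms: "model_setting \<M>" and A: "assumption_A \<M>"
  shows "trend_response \<M> (true_par \<M>) = 0"
    and "assumption_C \<M> \<Longrightarrow> \<theta> \<in> Theta \<M> \<Longrightarrow> trend_response \<M> \<theta> = 0 \<Longrightarrow> fst \<theta> = true1 \<M>"
proof -
  note t0 = model_basics(4)[OF ms A]
  have "trend_response \<M> (true_par \<M>) *v x = 0" for x
  proof -
    have "\<exists>y. C1 \<M> (true1 \<M>) *v (B1 \<M> (true2 \<M>) *v x) = C1 \<M> (fst (true_par \<M>)) *v y"
      by (rule exI[of _ "B1 \<M> (true2 \<M>) *v x"]) (simp add: true_par_def)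
    then show ?thesis
      using longrun_kernel[OF ms A t0, of "C1 \<M> (true1 \<M>) *v (B1 \<M> (true2 \<M>) *v x)"]
      by (simp add: trend_response_def matrix_vector_mul_assoc matrix_mul_assoc)
  qed
  then show "trend_response \<M> (true_par \<M>) = 0" using matrix_eq_0_iff by blast
  assume C: "assumption_C \<M>" and \<theta>: "\<theta> \<in> Theta \<M>" and z: "trend_response \<M> \<theta> = 0"
  have "rank (B1 \<M> (true2 \<M>)) = CARD('c)" using model_matrices(3)[OF A t0] by (simp add: true_par_def)
  then have surj: "surj ((*v) (B1 \<M> (true2 \<M>)))" using full_rank_surjective by blast
  have "(transpose (C1perp \<M> (fst \<theta>)) ** C1 \<M> (true1 \<M>)) *v y = 0" for y
  proof -
    obtain x where x: "y = B1 \<M> (true2 \<M>) *v x" using surj by blast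
    have "longrun \<M> \<theta> *v (C1 \<M> (true1 \<M>) *v y) = trend_response \<M> \<theta> *v x"
      by (simp add: trend_response_def x matrix_vector_mul_assoc matrix_mul_assoc)
    then obtain v where "C1 \<M> (true1 \<M>) *v y = C1 \<M> (fst \<theta>) *v v"
      using longrun_kernel[OF ms A \<theta>] z by auto
    then have "(transpose (C1perp \<M> (fst \<theta>)) ** C1 \<M> (true1 \<M>)) *v y = (transpose (C1perp \<M> (fst \<theta>)) ** C1 \<M> (fst \<theta>)) *v v"
      by (metis matrix_vector_mul_assoc)
    then show ?thesis by (simp add: model_matrices(6)[OF A \<theta>])
  qed
  then have z0: "transpose (C1perp \<M> (fst \<theta>)) ** C1 \<M> (true1 \<M>) = 0" using matrix_eq_0_iff by blast
  have "fst \<theta> \<in> Theta1 \<M>" using \<theta> by (auto simp: Theta_def)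
  then obtain c where "c > 0" "c * norm (fst \<theta> - true1 \<M>) \<le> norm (transpose (C1perp \<M> (fst \<theta>)) ** C1 \<M> (true1 \<M>))"
    using C unfolding assumption_C_def by blast
  then show "fst \<theta> = true1 \<M>" unfolding z0 by (simp add: mult_le_0_iff)
qed

lemma continuous_on_longrun:
  fixes \<M> :: "('w, 's1::finite, 's2::finite, 'c::finite, 'k::finite, 'd::{finite,linorder},
                'e::{finite,linorder}, 'm::finite) coint_model"
  assumes ms: "model_setting \<M>" and A: "assumption_A \<M>"
  shows "continuous_on (Theta \<M>) (\<lambda>\<theta>. matrix_inv (mat 1 - F_mat \<M> \<theta>) ** K_mat \<M> \<theta>)"
    "continuous_on (Theta \<M>) (trend_response \<M>)"
proof -
  show G: "continuous_on (Theta \<M>) (\<lambda>\<theta>. matrix_inv (mat 1 - F_mat \<M> \<theta>) ** K_mat \<M> \<theta>)"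
    by (intro continuous_on_matrix_mult continuous_on_matrix_inv continuous_on_diff continuous_on_const
        filter_continuous[OF ms A] I_minus_F_invertible[OF ms A])
  show "continuous_on (Theta \<M>) (trend_response \<M>)"
    unfolding trend_response_def[abs_def] longrun_def[abs_def]
    by (intro continuous_on_matrix_mult[OF continuous_on_diff] continuous_on_const
       continuous_on_matrix_mult[OF model_matrix_continuous(3)[OF A] G])
qed

lemma trend_response_lower_bound:
  fixes \<M> :: "('w, 's1::finite, 's2::finite, 'c::finite, 'k::finite, 'd::{finite,linorder},
                'e::{finite,linorder}, 'm::finite) coint_model"
  assumes ms: "model_setting \<M>" and A: "assumption_A \<M>" and C: "assumption_C \<M>" and \<delta>: "\<delta> > 0"
  shows "\<exists>c>0. \<forall>\<theta>\<in>Theta \<M>. \<delta> \<le> norm (fst \<theta> - true1 \<M>) \<longrightarrow> c \<le> norm (trend_response \<M> \<theta>)"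
proof -
  \<comment> \<open>The non-strict inequality keeps the set compact, and it contains the parameters
    at distance more than \<open>\<delta>\<close>.\<close>
  define K where "K = Theta \<M> \<inter> {\<theta>. \<delta> \<le> norm (fst \<theta> - true1 \<M>)}"
  have "closed {\<theta> :: (real^'s1) \<times> (real^'s2). \<delta> \<le> norm (fst \<theta> - true1 \<M>)}"
    by (intro closed_Collect_le continuous_intros)
  then have K: "compact K" unfolding K_def by (intro compact_Int_closed model_basics(3)[OF ms A])
  have cont: "continuous_on K (\<lambda>\<theta>. norm (trend_response \<M> \<theta>))"
    unfolding K_def by (intro continuous_on_norm continuous_on_subset[OF continuous_on_longrun(2)[OF ms A]]) blast
  show ?thesis
  proof (cases "K = {}")
    case True
    then show ?thesis unfolding K_def by (intro exI[of _ 1]) auto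
  next
    case False
    obtain q where q: "q \<in> K" "\<forall>\<theta>\<in>K. norm (trend_response \<M> q) \<le> norm (trend_response \<M> \<theta>)"
      using continuous_attains_inf[OF K False cont] by blast
    have "trend_response \<M> q \<noteq> 0"
    proof
      assume "trend_response \<M> q = 0"
      then have "fst q = true1 \<M>" using trend_response_eq_0(2)[OF ms A C] q(1) by (auto simp: K_def)
      then show False using q(1) \<delta> by (simp add: K_def)
    qed
    then show ?thesis using q(2) unfolding K_def by (intro exI[of _ "norm (trend_response \<M> q)"]) auto
  qed
qed

text \<open>The convexity inequality behind the energy estimate below is
  \<open>(\<rho> b + x)\<^sup>2 \<le> \<rho> b\<^sup>2 + x\<^sup>2 / (1 - \<rho>)\<close>.\<close>

primrec envelope :: "real \<Rightarrow> real \<Rightarrow> (nat \<Rightarrow> real) \<Rightarrow> nat \<Rightarrow> real" where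
  "envelope \<rho> R \<xi> 0 = R"
| "envelope \<rho> R \<xi> (Suc k) = \<rho> * envelope \<rho> R \<xi> k + \<xi> (Suc k)"

text \<open>The current square stays on the left to carry the induction: the next step splits it
  into a share \<open>\<rho>\<close>, which is passed on, and a share \<open>1 - \<rho>\<close>,
  which joins the sum.\<close>

lemma envelope_energy:
  assumes \<rho>: "0 < \<rho>" "\<rho> < 1"
  shows "(envelope \<rho> R \<xi> n)\<^sup>2 + (1 - \<rho>) * (\<Sum>j<n. (envelope \<rho> R \<xi> j)\<^sup>2) \<le> R\<^sup>2 + (\<Sum>j=1..n. (\<xi> j)\<^sup>2) / (1 - \<rho>)"
proof (induction n)
  case (Suc n)
  define b x where "b = envelope \<rho> R \<xi> n" and "x = \<xi> (Suc n)"
  \<comment> \<open>Exactly the gap in the convexity inequality after multiplication by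
    \<open>1 - \<rho>\<close>.\<close>
  have "0 \<le> \<rho> * ((1 - \<rho>) * b - x)\<^sup>2" using \<rho> by simp
  then have "(\<rho> * b + x)\<^sup>2 * (1 - \<rho>) \<le> \<rho> * b\<^sup>2 * (1 - \<rho>) + x\<^sup>2"
    by (simp add: power2_eq_square algebra_simps)
  then have "(\<rho> * b + x)\<^sup>2 \<le> \<rho> * b\<^sup>2 + x\<^sup>2 / (1 - \<rho>)"
    using \<rho> by (simp add: field_simps)
  moreover have "b\<^sup>2 = \<rho> * b\<^sup>2 + (1 - \<rho>) * b\<^sup>2" by (simp add: algebra_simps)
  ultimately show ?case
    using Suc by (simp add: b_def[symmetric] x_def[symmetric] algebra_simps add_divide_distrib)
qed simp

text \<open>The induction carries the images under all powers of F at once. Estimating e alone would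
  multiply by B at each step and lose the decay.\<close>

lemma filter_error_envelope:
  fixes F :: "real^'n^'n"
  assumes F: "\<And>k x. norm (mat_pow F k *v x) \<le> B * \<rho> ^ k * norm x" and B: "0 < B" and \<rho>: "0 < \<rho>"
    and e: "\<And>k. e (Suc k) = F *v e k + r (Suc k)" and R: "norm (e 0) \<le> R" and r: "\<And>k. norm (r k) \<le> \<xi> k"
  shows "norm (e k) \<le> B * envelope \<rho> R \<xi> k"
proof -
  have "norm (mat_pow F i *v e k) \<le> B * \<rho> ^ i * envelope \<rho> R \<xi> k" for i
  proof (induction k arbitrary: i)
    case 0
    have "B * \<rho> ^ i * norm (e 0) \<le> B * \<rho> ^ i * R" using B \<rho> by (intro mult_left_mono R) auto
    then show ?case using F[of i "e 0"] by simp
  next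
    case (Suc k)
    have "mat_pow F i *v e (Suc k) = mat_pow F (Suc i) *v e k + mat_pow F i *v r (Suc k)"
      by (simp add: e matrix_vector_right_distrib matrix_vector_mul_assoc mat_pow_Suc2)
    also have "norm \<dots> \<le> B * \<rho> ^ Suc i * envelope \<rho> R \<xi> k + B * \<rho> ^ i * norm (r (Suc k))"
      by (intro norm_triangle_mono Suc F)
    also have "\<dots> \<le> B * \<rho> ^ Suc i * envelope \<rho> R \<xi> k + B * \<rho> ^ i * \<xi> (Suc k)"
      using B \<rho> by (intro add_left_mono mult_left_mono r) auto
    finally show ?case by (simp add: algebra_simps)
  qed
  from this[of 0] show ?thesis by simp
qed

section \<open>Splitting the innovations into a trend response and a residual\<close>

definition trend_part ::
  "('w, 's1::finite, 's2::finite, 'c::finite, 'k::finite, 'd::finite, 'e::finite, 'm::finite) coint_model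
    \<Rightarrow> nat \<Rightarrow> 'w \<Rightarrow> real^'d" where
  "trend_part \<M> k \<omega> = (C1 \<M> (true1 \<M>) ** B1 \<M> (true2 \<M>)) *v Levy \<M> (true2 \<M>) (real k * mesh \<M>) \<omega>"

definition stationary_part ::
  "('w, 's1::finite, 's2::finite, 'c::finite, 'k::finite, 'd::finite, 'e::finite, 'm::finite) coint_model
    \<Rightarrow> nat \<Rightarrow> 'w \<Rightarrow> real^'d" where
  "stationary_part \<M> k \<omega> = C1 \<M> (true1 \<M>) *v Zinit \<M> \<omega> + Yst \<M> (true2 \<M>) (real k * mesh \<M>) \<omega>"

text \<open>Depends on \<open>\<theta>\<close> through the starting value only, which allows one
  event to serve all parameters. The first trend value appears because the filter starts at time 1
  from a state unrelated to the trend.\<close>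

definition residual_energy ::
  "('w, 's1::finite, 's2::finite, 'c::finite, 'k::finite, 'd::finite, 'e::finite, 'm::finite) coint_model
    \<Rightarrow> (real^'s1) \<times> (real^'s2) \<Rightarrow> nat \<Rightarrow> 'w \<Rightarrow> real" where
  "residual_energy \<M> \<theta> n \<omega> = (norm (Xhat1 \<M> \<theta> \<omega>))\<^sup>2 + (norm (trend_part \<M> 1 \<omega>))\<^sup>2 +
     (\<Sum>k=1..n. (norm (stationary_part \<M> k \<omega>))\<^sup>2 + (norm (trend_part \<M> (Suc k) \<omega> - trend_part \<M> k \<omega>))\<^sup>2)"

lemma Yobs_decomposition: "Yobs \<M> k \<omega> = trend_part \<M> k \<omega> + stationary_part \<M> k \<omega>"
  by (simp add: Yobs_def Y_proc_def true_par_def trend_part_def stationary_part_def)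

lemma power2_sum_le: "(a + b)\<^sup>2 \<le> 2 * a\<^sup>2 + 2 * b\<^sup>2" for a b :: real
  using sum_squares_bound[of a b] by (simp add: power2_sum)

lemma norm_add_power2_le: "(norm (x + y))\<^sup>2 \<le> 2 * (norm x)\<^sup>2 + 2 * (norm y)\<^sup>2" for x :: "'a::real_normed_vector"
  by (rule order_trans[OF power_mono[OF norm_triangle_ineq norm_ge_zero] power2_sum_le])

text \<open>Subtracting from the predicted state its static response to the trend leaves a stable
  recursion driven by the stationary part and the trend increments, with no trend level left. The
  energy estimate bounds its squares with constants uniform in \<open>\<theta>\<close>.\<close>

lemma innovation_decomposition:
  fixes \<M> :: "('w, 's1::finite, 's2::finite, 'c::finite, 'k::finite, 'd::{finite,linorder},
                'e::{finite,linorder}, 'm::finite) coint_model"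
  assumes ms: "model_setting \<M>" and A: "assumption_A \<M>"
  shows "\<exists>H>0. \<forall>\<theta>\<in>Theta \<M>. \<forall>n \<omega>.
    (\<Sum>k=1..n. (norm (eps_hat \<M> \<theta> \<omega> k - longrun \<M> \<theta> *v trend_part \<M> k \<omega>))\<^sup>2) \<le> H * residual_energy \<M> \<theta> n \<omega>"
proof -
  obtain B \<rho> where B: "0 < B" and \<rho>: "0 < \<rho>" "\<rho> < 1"
    and dec: "\<And>\<theta> k x. \<theta> \<in> Theta \<M> \<Longrightarrow> norm (mat_pow (F_mat \<M> \<theta>) k *v x) \<le> B * \<rho> ^ k * norm x"
    using uniform_filter_stability[OF ms A] by blast
  note cb = compact_norm_bound[OF model_basics(3)[OF ms A]]
  obtain \<kappa>1 where \<kappa>1: "\<kappa>1 > 0" "\<And>\<theta>. \<theta> \<in> Theta \<M> \<Longrightarrow> norm (K_mat \<M> \<theta>) \<le> \<kappa>1"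
    using cb[OF filter_continuous(3)[OF ms A]] by blast
  obtain \<kappa>2 where \<kappa>2: "\<kappa>2 > 0" "\<And>\<theta>. \<theta> \<in> Theta \<M> \<Longrightarrow> norm (matrix_inv (mat 1 - F_mat \<M> \<theta>) ** K_mat \<M> \<theta>) \<le> \<kappa>2"
    using cb[OF continuous_on_longrun(1)[OF ms A]] by blast
  obtain \<gamma> where \<gamma>: "\<gamma> > 0" "\<And>\<theta>. \<theta> \<in> Theta \<M> \<Longrightarrow> norm (C_mat \<M> \<theta>) \<le> \<gamma>"
    using cb[OF model_matrix_continuous(3)[OF A]] by blast
  define \<kappa> where "\<kappa> = \<kappa>1 + \<kappa>2 + 1"
  have \<kappa>: "\<kappa> > 0" "\<kappa>1 \<le> \<kappa>" "\<kappa>2 \<le> \<kappa>" "1 \<le> \<kappa>" using \<kappa>1 \<kappa>2 by (auto simp: \<kappa>_def)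
  define c where "c = 2 * (\<gamma> * B)\<^sup>2 / (1 - \<rho>)"
  \<comment> \<open>Collects the direct contribution of the stationary part, the factor of the
    starting value and the factor of the forcing.\<close>
  define H where "H = 2 + c * (2 * \<kappa>\<^sup>2) + c * (2 * \<kappa>\<^sup>2) / (1 - \<rho>)"
  have c: "c \<ge> 0" using \<rho> by (simp add: c_def)
  have H: "H > 0" unfolding H_def using c \<rho> by (simp add: add_pos_nonneg)
  have "(\<Sum>k=1..n. (norm (eps_hat \<M> \<theta> \<omega> k - longrun \<M> \<theta> *v trend_part \<M> k \<omega>))\<^sup>2) \<le> H * residual_energy \<M> \<theta> n \<omega>"
    if \<theta>: "\<theta> \<in> Theta \<M>" for \<theta> n \<omega>
  proof -
    define W U where "W k = trend_part \<M> k \<omega>" and "U k = stationary_part \<M> k \<omega>" for k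
    define G where "G = matrix_inv (mat 1 - F_mat \<M> \<theta>) ** K_mat \<M> \<theta>"
    \<comment> \<open>Index 0 of e is time 1; the default value of \<open>Xhat\<close> at index 0
      never enters.\<close>
    define e where "e k = Xhat \<M> \<theta> \<omega> (Suc k) - G *v W (Suc k)" for k
    define r where "r k = K_mat \<M> \<theta> *v U k - G *v (W (Suc k) - W k)" for k
    define \<xi> where "\<xi> k = \<kappa> * (norm (U k) + norm (W (Suc k) - W k))" for k
    define R where "R = \<kappa> * (norm (Xhat1 \<M> \<theta> \<omega>) + norm (W 1))"
    \<comment> \<open>The fixed point equation of the static response. It cancels the trend level in
      the recursion for e and leaves only increments.\<close>
    have GF: "F_mat \<M> \<theta> ** G + K_mat \<M> \<theta> = G"
    proof -
      have "(mat 1 - F_mat \<M> \<theta>) ** G = K_mat \<M> \<theta>"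
        by (simp add: G_def matrix_mul_assoc matrix_inv_inverse[OF I_minus_F_invertible[OF ms A \<theta>]])
      then show ?thesis by (simp add: matrix_mult_diff_rdistrib algebra_simps)
    qed
    have es: "e (Suc k) = F_mat \<M> \<theta> *v e k + r (Suc k)" for k
    proof -
      have "(F_mat \<M> \<theta> ** G + K_mat \<M> \<theta>) *v W (Suc k) = G *v W (Suc k)" by (simp only: GF)
      then have "K_mat \<M> \<theta> *v W (Suc k) = G *v W (Suc k) - F_mat \<M> \<theta> *v (G *v W (Suc k))"
        by (simp add: matrix_vector_mult_add_rdistrib matrix_vector_mul_assoc algebra_simps)
      then show ?thesis
        by (simp add: e_def r_def Yobs_decomposition W_def[symmetric] U_def[symmetric]
            matrix_vector_right_distrib matrix_vector_mult_diff_distrib)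
    qed
    have nG: "norm (G *v x) \<le> \<kappa> * norm x" for x
      using \<kappa>2(2)[OF \<theta>] \<kappa>(3) by (intro order_trans[OF norm_matrix_vector_le] mult_right_mono) (auto simp: G_def)
    have nK: "norm (K_mat \<M> \<theta> *v x) \<le> \<kappa> * norm x" for x
      using \<kappa>1(2)[OF \<theta>] \<kappa>(2) by (intro order_trans[OF norm_matrix_vector_le] mult_right_mono) auto
    have rb: "norm (r k) \<le> \<xi> k" for k
      unfolding r_def \<xi>_def distrib_left by (intro order_trans[OF norm_triangle_ineq4] add_mono nG nK)
    have e0: "norm (e 0) \<le> R"
    proof -
      have "norm (e 0) \<le> norm (Xhat1 \<M> \<theta> \<omega>) + norm (G *v W 1)"
        using norm_triangle_ineq4[of "Xhat1 \<M> \<theta> \<omega>" "G *v W 1"] by (simp add: e_def)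
      moreover have "norm (Xhat1 \<M> \<theta> \<omega>) \<le> \<kappa> * norm (Xhat1 \<M> \<theta> \<omega>)"
        using \<kappa>(4) mult_right_mono[of 1 \<kappa> "norm (Xhat1 \<M> \<theta> \<omega>)"] by simp
      ultimately show ?thesis using nG[of "W 1"] by (simp add: R_def distrib_left)
    qed
    note eb = filter_error_envelope[OF dec[OF \<theta>] B \<rho>(1) es e0 rb]
    have err: "(norm (eps_hat \<M> \<theta> \<omega> (Suc k) - longrun \<M> \<theta> *v W (Suc k)))\<^sup>2
        \<le> 2 * (norm (U (Suc k)))\<^sup>2 + 2 * (\<gamma> * B)\<^sup>2 * (envelope \<rho> R \<xi> k)\<^sup>2" for k
    proof -
      have "eps_hat \<M> \<theta> \<omega> (Suc k) - longrun \<M> \<theta> *v W (Suc k) = U (Suc k) + - (C_mat \<M> \<theta> *v e k)"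
        by (simp add: eps_hat_def longrun_def G_def[symmetric] e_def Yobs_decomposition W_def[symmetric] U_def[symmetric]
            matrix_vector_mult_diff_distrib matrix_vector_mult_diff_rdistrib matrix_vector_mul_assoc)
      then have "(norm (eps_hat \<M> \<theta> \<omega> (Suc k) - longrun \<M> \<theta> *v W (Suc k)))\<^sup>2
          \<le> 2 * (norm (U (Suc k)))\<^sup>2 + 2 * (norm (C_mat \<M> \<theta> *v e k))\<^sup>2"
        using norm_add_power2_le[of "U (Suc k)" "- (C_mat \<M> \<theta> *v e k)"] by simp
      moreover have "norm (C_mat \<M> \<theta> *v e k) \<le> \<gamma> * (B * envelope \<rho> R \<xi> k)"
        using \<gamma>(2)[OF \<theta>] \<gamma>(1) eb[of k] by (intro order_trans[OF norm_matrix_vector_le] mult_mono) auto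
      then have "(norm (C_mat \<M> \<theta> *v e k))\<^sup>2 \<le> (\<gamma> * (B * envelope \<rho> R \<xi> k))\<^sup>2" by (intro power_mono) auto
      ultimately show ?thesis by (simp add: power_mult_distrib mult_ac)
    qed
    have en: "(\<Sum>j<n. (envelope \<rho> R \<xi> j)\<^sup>2) \<le> (R\<^sup>2 + (\<Sum>j=1..n. (\<xi> j)\<^sup>2) / (1 - \<rho>)) / (1 - \<rho>)"
    proof -
      have "(1 - \<rho>) * (\<Sum>j<n. (envelope \<rho> R \<xi> j)\<^sup>2) \<le> R\<^sup>2 + (\<Sum>j=1..n. (\<xi> j)\<^sup>2) / (1 - \<rho>)"
        using envelope_energy[OF \<rho>, of R \<xi> n] zero_le_power2[of "envelope \<rho> R \<xi> n"] by linarith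
      then show ?thesis using \<rho> by (simp add: pos_le_divide_eq mult.commute)
    qed
    define u where "u = (\<Sum>k=1..n. (norm (U k))\<^sup>2)"
    define w where "w = (\<Sum>k=1..n. (norm (W (Suc k) - W k))\<^sup>2)"
    define x0 where "x0 = (norm (Xhat1 \<M> \<theta> \<omega>))\<^sup>2 + (norm (W 1))\<^sup>2"
    have nn: "u \<ge> 0" "w \<ge> 0" "x0 \<ge> 0" by (auto simp: u_def w_def x0_def intro!: sum_nonneg)
    have R2: "R\<^sup>2 \<le> 2 * \<kappa>\<^sup>2 * x0"
    proof -
      have "R\<^sup>2 = \<kappa>\<^sup>2 * (norm (Xhat1 \<M> \<theta> \<omega>) + norm (W 1))\<^sup>2" by (simp add: R_def power_mult_distrib)
      also have "\<dots> \<le> \<kappa>\<^sup>2 * (2 * (norm (Xhat1 \<M> \<theta> \<omega>))\<^sup>2 + 2 * (norm (W 1))\<^sup>2)"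
        by (intro mult_left_mono power2_sum_le) simp
      finally show ?thesis by (simp add: x0_def algebra_simps)
    qed
    have \<xi>2: "(\<Sum>j=1..n. (\<xi> j)\<^sup>2) \<le> 2 * \<kappa>\<^sup>2 * (u + w)"
    proof -
      have "(\<xi> j)\<^sup>2 \<le> 2 * \<kappa>\<^sup>2 * ((norm (U j))\<^sup>2 + (norm (W (Suc j) - W j))\<^sup>2)" for j
      proof -
        have "(\<xi> j)\<^sup>2 = \<kappa>\<^sup>2 * (norm (U j) + norm (W (Suc j) - W j))\<^sup>2" by (simp add: \<xi>_def power_mult_distrib)
        also have "\<dots> \<le> \<kappa>\<^sup>2 * (2 * (norm (U j))\<^sup>2 + 2 * (norm (W (Suc j) - W j))\<^sup>2)"
          by (intro mult_left_mono power2_sum_le) simp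
        finally show ?thesis by (simp add: algebra_simps)
      qed
      then have "(\<Sum>j=1..n. (\<xi> j)\<^sup>2) \<le> (\<Sum>j=1..n. 2 * \<kappa>\<^sup>2 * ((norm (U j))\<^sup>2 + (norm (W (Suc j) - W j))\<^sup>2))"
        by (rule sum_mono)
      then show ?thesis by (simp add: u_def w_def sum_distrib_left[symmetric] sum.distrib)
    qed
    have "(\<Sum>k=1..n. (norm (eps_hat \<M> \<theta> \<omega> k - longrun \<M> \<theta> *v W k))\<^sup>2)
        = (\<Sum>k<n. (norm (eps_hat \<M> \<theta> \<omega> (Suc k) - longrun \<M> \<theta> *v W (Suc k)))\<^sup>2)"
      by (rule sum.reindex_bij_witness[of _ Suc "\<lambda>k. k - 1"]) auto
    also have "\<dots> \<le> (\<Sum>k<n. 2 * (norm (U (Suc k)))\<^sup>2 + 2 * (\<gamma> * B)\<^sup>2 * (envelope \<rho> R \<xi> k)\<^sup>2)"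
      by (intro sum_mono err)
    also have "\<dots> = 2 * u + 2 * (\<gamma> * B)\<^sup>2 * (\<Sum>k<n. (envelope \<rho> R \<xi> k)\<^sup>2)"
    proof -
      have "u = (\<Sum>k<n. (norm (U (Suc k)))\<^sup>2)"
        unfolding u_def by (rule sum.reindex_bij_witness[of _ Suc "\<lambda>k. k - 1"]) auto
      then show ?thesis by (simp add: sum.distrib sum_distrib_left)
    qed
    also have "\<dots> \<le> 2 * u + 2 * (\<gamma> * B)\<^sup>2 * ((R\<^sup>2 + (\<Sum>j=1..n. (\<xi> j)\<^sup>2) / (1 - \<rho>)) / (1 - \<rho>))"
      by (intro add_left_mono mult_left_mono en) simp
    also have "\<dots> = 2 * u + c * (R\<^sup>2 + (\<Sum>j=1..n. (\<xi> j)\<^sup>2) / (1 - \<rho>))"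
      by (simp add: c_def)
    also have "\<dots> \<le> 2 * u + c * (2 * \<kappa>\<^sup>2 * x0 + 2 * \<kappa>\<^sup>2 * (u + w) / (1 - \<rho>))"
      using \<rho> by (intro add_left_mono mult_left_mono add_mono R2 divide_right_mono \<xi>2 c) auto
    also have "\<dots> = 2 * u + (c * (2 * \<kappa>\<^sup>2)) * x0 + (c * (2 * \<kappa>\<^sup>2) / (1 - \<rho>)) * (u + w)"
      by (simp add: algebra_simps)
    also have "\<dots> \<le> H * (x0 + (u + w))"
    proof -
      define p q where "p = c * (2 * \<kappa>\<^sup>2)" and "q = p / (1 - \<rho>)"
      have pq: "0 \<le> p" "0 \<le> q" using c \<rho> by (simp_all add: p_def q_def)
      have "(2 + p + q) * (x0 + (u + w)) - (2 * u + p * x0 + q * (u + w)) = 2 * x0 + 2 * w + p * (u + w) + q * x0"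
        by (simp add: algebra_simps)
      also have "\<dots> \<ge> 0" using pq nn by simp
      finally show ?thesis unfolding H_def p_def[symmetric] q_def[symmetric] by linarith
    qed
    finally show ?thesis
      by (simp add: residual_energy_def W_def U_def u_def w_def x0_def sum.distrib)
  qed
  then show ?thesis using H by blast
qed

section \<open>Moments of Levy processes and of Levy integrals\<close>

lemma power4_sum_le: "(a + b) ^ 4 \<le> 8 * a ^ 4 + 8 * b ^ 4" for a b :: real
proof -
  have "(a + b)\<^sup>2 \<le> 2 * a\<^sup>2 + 2 * b\<^sup>2" using sum_squares_bound[of a b] by (simp add: power2_sum)
  then have "((a + b)\<^sup>2)\<^sup>2 \<le> (2 * a\<^sup>2 + 2 * b\<^sup>2)\<^sup>2" by (intro power_mono) auto
  also have "\<dots> \<le> 2 * (2 * a\<^sup>2)\<^sup>2 + 2 * (2 * b\<^sup>2)\<^sup>2"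
    using sum_squares_bound[of "2 * a\<^sup>2" "2 * b\<^sup>2"] by (simp add: power2_sum)
  finally show ?thesis by (simp add: power_mult_distrib flip: power_mult)
qed

text \<open>By Fubini some constant v makes (U + v)^4 integrable, and U differs from U + v by a
  constant. This passes the moment from the unit interval to shorter ones.\<close>

lemma (in prob_space) integrable_power4_summand:
  fixes U V :: "'a \<Rightarrow> real"
  assumes indep: "indep_var borel U borel V" and int: "integrable M (\<lambda>\<omega>. (U \<omega> + V \<omega>) ^ 4)"
  shows "integrable M (\<lambda>\<omega>. U \<omega> ^ 4)"
proof -
  have U: "U \<in> borel_measurable M" and V: "V \<in> borel_measurable M"
    using indep_var_rv1[OF indep] indep_var_rv2[OF indep] by auto
  define P Q where "P = distr M borel U" and "Q = distr M borel V"
  interpret P: prob_space P unfolding P_def by (rule prob_space_distr[OF U])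
  interpret Q: prob_space Q unfolding Q_def by (rule prob_space_distr[OF V])
  interpret PQ: pair_prob_space P Q ..
  have PQ: "distr M (borel \<Otimes>\<^sub>M borel) (\<lambda>\<omega>. (U \<omega>, V \<omega>)) = P \<Otimes>\<^sub>M Q"
    using indep_var_distribution_eq[of borel U borel V] indep by (simp add: P_def Q_def)
  have UV: "(\<lambda>\<omega>. (U \<omega>, V \<omega>)) \<in> measurable M (borel \<Otimes>\<^sub>M borel)" using U V by measurable
  have sPQ: "sets (P \<Otimes>\<^sub>M Q) = sets (borel \<Otimes>\<^sub>M borel)" by (simp add: P_def Q_def cong: sets_pair_measure_cong)
  have "(\<integral>\<^sup>+\<omega>. ennreal ((U \<omega> + V \<omega>) ^ 4) \<partial>M) < \<infinity>"
    using int by (simp add: integrable_iff_bounded)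
  also have "(\<integral>\<^sup>+\<omega>. ennreal ((U \<omega> + V \<omega>) ^ 4) \<partial>M) = (\<integral>\<^sup>+q. ennreal ((fst q + snd q) ^ 4) \<partial>(P \<Otimes>\<^sub>M Q))"
    by (subst PQ[symmetric], subst nn_integral_distr[OF UV]) simp_all
  also have "\<dots> = (\<integral>\<^sup>+v. (\<integral>\<^sup>+u. ennreal ((u + v) ^ 4) \<partial>P) \<partial>Q)"
    by (subst PQ.nn_integral_snd[symmetric]) (simp_all add: P_def Q_def split_beta')
  finally have fin: "(\<integral>\<^sup>+v. (\<integral>\<^sup>+u. ennreal ((u + v) ^ 4) \<partial>P) \<partial>Q) < \<infinity>" .
  have "AE v in Q. (\<integral>\<^sup>+u. ennreal ((u + v) ^ 4) \<partial>P) \<noteq> \<infinity>"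
  proof (rule nn_integral_PInf_AE)
    have "(\<lambda>q. ennreal ((snd q + fst q) ^ 4)) \<in> borel_measurable (borel \<Otimes>\<^sub>M P)"
      by (simp add: P_def)
    then have "(\<lambda>v. \<integral>\<^sup>+u. ennreal ((u + v) ^ 4) \<partial>P) \<in> borel_measurable borel"
      using P.borel_measurable_nn_integral_fst[of "\<lambda>q. ennreal ((snd q + fst q) ^ 4)" borel] by simp
    then show "(\<lambda>v. \<integral>\<^sup>+u. ennreal ((u + v) ^ 4) \<partial>P) \<in> borel_measurable Q" by (simp add: Q_def)
    show "(\<integral>\<^sup>+v. (\<integral>\<^sup>+u. ennreal ((u + v) ^ 4) \<partial>P) \<partial>Q) \<noteq> \<infinity>" using fin by simp
  qed
  then obtain v where v: "(\<integral>\<^sup>+u. ennreal ((u + v) ^ 4) \<partial>P) < \<infinity>"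
    using eventually_happens'[OF Q.ae_filter_bot] by (auto simp: less_top)
  have "(\<integral>\<^sup>+\<omega>. ennreal (U \<omega> ^ 4) \<partial>M) = (\<integral>\<^sup>+u. ennreal (u ^ 4) \<partial>P)"
    unfolding P_def by (subst nn_integral_distr[OF U]) simp_all
  also have "\<dots> \<le> (\<integral>\<^sup>+u. 8 * ennreal ((u + v) ^ 4) + ennreal (8 * v ^ 4) \<partial>P)"
  proof (intro nn_integral_mono)
    fix u :: real
    have "u ^ 4 \<le> 8 * (u + v) ^ 4 + 8 * v ^ 4" using power4_sum_le[of "u + v" "- v"] by simp
    then have "ennreal (u ^ 4) \<le> ennreal (8 * (u + v) ^ 4 + 8 * v ^ 4)" by (rule ennreal_leI)
    then show "ennreal (u ^ 4) \<le> 8 * ennreal ((u + v) ^ 4) + ennreal (8 * v ^ 4)"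
      by (simp add: ennreal_plus ennreal_mult')
  qed
  also have "\<dots> = 8 * (\<integral>\<^sup>+u. ennreal ((u + v) ^ 4) \<partial>P) + ennreal (8 * v ^ 4)"
  proof -
    have [measurable_cong]: "sets P = sets borel" by (simp add: P_def)
    have "emeasure P (space P) = 1" by (rule P.emeasure_space_1)
    then show ?thesis by (subst nn_integral_add) (simp_all add: nn_integral_cmult)
  qed
  also have "\<dots> < \<infinity>" using v by (simp add: ennreal_mult_less_top)
  finally have "(\<integral>\<^sup>+\<omega>. ennreal (U \<omega> ^ 4) \<partial>M) < \<infinity>" .
  then show ?thesis using U by (intro integrableI_bounded) auto
qed

definition real_levy :: "'w measure \<Rightarrow> (real \<Rightarrow> 'w \<Rightarrow> real) \<Rightarrow> bool" where
  "real_levy M x \<longleftrightarrow> two_sided_levy M x \<and> integrable M (\<lambda>\<omega>. x 1 \<omega> ^ 4) \<and> (\<integral>\<omega>. x 1 \<omega> \<partial>M) = 0"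

lemma (in prob_space) levy_increment_distr:
  assumes "two_sided_levy M x"
  shows "distr M borel (\<lambda>\<omega>. x (t + r) \<omega> - x (s + r) \<omega>) = distr M borel (\<lambda>\<omega>. x t \<omega> - x s \<omega>)"
    "x t \<in> borel_measurable M"
  using assms unfolding two_sided_levy_def by blast+

lemma (in prob_space) levy_increment_transfer:
  fixes x :: "real \<Rightarrow> 'a \<Rightarrow> 'b::euclidean_space" and f :: "'b \<Rightarrow> real"
  assumes L: "two_sided_levy M x" and f: "f \<in> borel_measurable borel" and d: "t - s = t' - s'"
  shows "integrable M (\<lambda>\<omega>. f (x t \<omega> - x s \<omega>)) \<longleftrightarrow> integrable M (\<lambda>\<omega>. f (x t' \<omega> - x s' \<omega>))"
    and "(\<integral>\<omega>. f (x t \<omega> - x s \<omega>) \<partial>M) = (\<integral>\<omega>. f (x t' \<omega> - x s' \<omega>) \<partial>M)"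
proof -
  have x: "(\<lambda>\<omega>. x t \<omega> - x s \<omega>) \<in> borel_measurable M" for t s
    using levy_increment_distr(2)[OF L] by simp
  have e: "t' + (t - t') = t" "s' + (t - t') = s" using d by auto
  have D: "distr M borel (\<lambda>\<omega>. x t \<omega> - x s \<omega>) = distr M borel (\<lambda>\<omega>. x t' \<omega> - x s' \<omega>)"
    using levy_increment_distr(1)[OF L, of t' "t - t'" s'] unfolding e .
  show "integrable M (\<lambda>\<omega>. f (x t \<omega> - x s \<omega>)) \<longleftrightarrow> integrable M (\<lambda>\<omega>. f (x t' \<omega> - x s' \<omega>))"
    using integrable_distr_eq[OF x f, of t s] integrable_distr_eq[OF x f, of t' s'] D by simp
  show "(\<integral>\<omega>. f (x t \<omega> - x s \<omega>) \<partial>M) = (\<integral>\<omega>. f (x t' \<omega> - x s' \<omega>) \<partial>M)"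
    using integral_distr[OF x f, of t s] integral_distr[OF x f, of t' s'] D by simp
qed

lemma (in prob_space) indep_vars_pair:
  assumes ind: "indep_vars (\<lambda>_. N) X I" and ij: "i \<in> I" "j \<in> I" "i \<noteq> j"
  shows "indep_var N (X i) N (X j)"
proof -
  have "indep_var N ((\<lambda>f. f i) \<circ> (\<lambda>\<omega>. restrict (\<lambda>i. X i \<omega>) {i})) N ((\<lambda>f. f j) \<circ> (\<lambda>\<omega>. restrict (\<lambda>i. X i \<omega>) {j}))"
    using ij by (intro indep_var_compose[OF indep_var_restrict[OF ind]]) auto
  then show ?thesis by (simp add: comp_def)
qed

lemma (in prob_space) levy_indep_increments:
  fixes x :: "real \<Rightarrow> 'a \<Rightarrow> real"
  assumes L: "two_sided_levy M x" and "r < s" "s < t"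
  shows "indep_var borel (\<lambda>\<omega>. x s \<omega> - x r \<omega>) borel (\<lambda>\<omega>. x t \<omega> - x s \<omega>)"
proof -
  define \<tau> :: "nat \<Rightarrow> real" where "\<tau> = (\<lambda>n. if n = 0 then r else if n = 1 then s else t)"
  have "indep_vars (\<lambda>_. borel) (\<lambda>i \<omega>. x (\<tau> (Suc i)) \<omega> - x (\<tau> i) \<omega>) {..<2}"
  proof -
    have "\<forall>i<2. \<tau> i < \<tau> (Suc i)" using assms by (auto simp: \<tau>_def less_2_cases_iff)
    then show ?thesis using L unfolding two_sided_levy_def by blast
  qed
  from indep_vars_pair[OF this, of 0 1]
  show ?thesis by (simp add: \<tau>_def)
qed

text \<open>The process vanishes at 0 only almost surely, so \<open>x t\<close> and its increment
  from 0 are exchanged under the integral.\<close>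

lemma (in prob_space) levy_at_0:
  fixes x :: "real \<Rightarrow> 'a \<Rightarrow> 'b::euclidean_space" and f :: "'b \<Rightarrow> real"
  assumes L: "two_sided_levy M x" and f: "f \<in> borel_measurable borel"
  shows "integrable M (\<lambda>\<omega>. f (x t \<omega> - x 0 \<omega>)) \<longleftrightarrow> integrable M (\<lambda>\<omega>. f (x t \<omega>))"
    "(\<integral>\<omega>. f (x t \<omega> - x 0 \<omega>) \<partial>M) = (\<integral>\<omega>. f (x t \<omega>) \<partial>M)"
proof -
  note [measurable] = f levy_increment_distr(2)[OF L]
  have "AE \<omega> in M. x 0 \<omega> = 0" using L by (simp add: two_sided_levy_def)
  then have ae: "AE \<omega> in M. f (x t \<omega> - x 0 \<omega>) = f (x t \<omega>)" by eventually_elim simp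
  have m1: "(\<lambda>\<omega>. f (x t \<omega> - x 0 \<omega>)) \<in> borel_measurable M" "(\<lambda>\<omega>. f (x t \<omega>)) \<in> borel_measurable M" by measurable
  show "integrable M (\<lambda>\<omega>. f (x t \<omega> - x 0 \<omega>)) \<longleftrightarrow> integrable M (\<lambda>\<omega>. f (x t \<omega>))"
    by (rule integrable_cong_AE[OF m1 ae])
  show "(\<integral>\<omega>. f (x t \<omega> - x 0 \<omega>) \<partial>M) = (\<integral>\<omega>. f (x t \<omega>) \<partial>M)"
    by (rule integral_cong_AE[OF m1 ae])
qed

text \<open>An increment over less than unit time is an independent summand of the unit increment;
  doubling with stationarity reaches every length, and the even power settles reversed time.\<close>

lemma (in prob_space) real_levy_integrable4:
  fixes x :: "real \<Rightarrow> 'a \<Rightarrow> real"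
  assumes RL: "real_levy M x"
  shows "integrable M (\<lambda>\<omega>. (x t \<omega> - x s \<omega>) ^ 4)"
proof -
  have L: "two_sided_levy M x" and int1: "integrable M (\<lambda>\<omega>. x 1 \<omega> ^ 4)" using RL by (auto simp: real_levy_def)
  have p4: "(\<lambda>v :: real. v ^ 4) \<in> borel_measurable borel" by simp
  note tr = levy_increment_transfer(1)[OF L p4]
  have i1: "integrable M (\<lambda>\<omega>. (x 1 \<omega> - x 0 \<omega>) ^ 4)" using levy_at_0(1)[OF L p4, of 1] int1 by simp
  have small: "integrable M (\<lambda>\<omega>. (x q \<omega> - x 0 \<omega>) ^ 4)" if "0 < q" "q \<le> 1" for q
  proof (cases "q = 1")
    case False
    then have "indep_var borel (\<lambda>\<omega>. x q \<omega> - x 0 \<omega>) borel (\<lambda>\<omega>. x 1 \<omega> - x q \<omega>)"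
      using that by (intro levy_indep_increments[OF L]) auto
    then show ?thesis by (rule integrable_power4_summand) (use i1 in simp)
  qed (use i1 in simp)
  have double: "integrable M (\<lambda>\<omega>. (x (2 * q) \<omega> - x 0 \<omega>) ^ 4)" if q: "integrable M (\<lambda>\<omega>. (x q \<omega> - x 0 \<omega>) ^ 4)" for q
  proof (rule Bochner_Integration.integrable_bound)
    have "integrable M (\<lambda>\<omega>. (x (2 * q) \<omega> - x q \<omega>) ^ 4)" using tr[of "2 * q" q q 0] q by simp
    then show "integrable M (\<lambda>\<omega>. 8 * (x (2 * q) \<omega> - x q \<omega>) ^ 4 + 8 * (x q \<omega> - x 0 \<omega>) ^ 4)" using q by simp
    show "(\<lambda>\<omega>. (x (2 * q) \<omega> - x 0 \<omega>) ^ 4) \<in> borel_measurable M" using levy_increment_distr(2)[OF L] by simp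
    show "AE \<omega> in M. norm ((x (2 * q) \<omega> - x 0 \<omega>) ^ 4) \<le> norm (8 * (x (2 * q) \<omega> - x q \<omega>) ^ 4 + 8 * (x q \<omega> - x 0 \<omega>) ^ 4)"
      using power4_sum_le[of "x (2 * q) \<omega> - x q \<omega>" "x q \<omega> - x 0 \<omega>" for \<omega>] by (intro AE_I2) simp
  qed
  have "integrable M (\<lambda>\<omega>. (x (2 ^ n * q) \<omega> - x 0 \<omega>) ^ 4)" if "0 < q" "q \<le> 1" for n q
  proof (induction n)
    case (Suc n)
    then show ?case using double[of "2 ^ n * q"] by (simp add: mult.assoc)
  qed (use small[OF that] in simp)
  then have pos: "integrable M (\<lambda>\<omega>. (x q \<omega> - x 0 \<omega>) ^ 4)" if "q > 0" for q
  proof -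
    obtain n where n: "q < 2 ^ n" using real_arch_pow[of 2 q] by auto
    then show ?thesis using \<open>\<And>q n. 0 < q \<Longrightarrow> q \<le> 1 \<Longrightarrow> integrable M (\<lambda>\<omega>. (x (2 ^ n * q) \<omega> - x 0 \<omega>) ^ 4)\<close>[of "q / 2 ^ n" n] that by simp
  qed
  consider "t > s" | "t = s" | "t < s" by linarith
  then show ?thesis
  proof cases
    case 1
    then show ?thesis using pos[of "t - s"] tr[of t s "t - s" 0] by simp
  next
    case 3
    then have "integrable M (\<lambda>\<omega>. (x s \<omega> - x t \<omega>) ^ 4)" using pos[of "s - t"] tr[of s t "s - t" 0] by simp
    moreover have "(x s \<omega> - x t \<omega>) ^ 4 = (x t \<omega> - x s \<omega>) ^ 4" for \<omega> by (simp add: power4_eq_xxxx algebra_simps)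
    ultimately show ?thesis by simp
  qed simp
qed

lemma (in prob_space) integrable_of_power4:
  fixes X :: "'a \<Rightarrow> real"
  assumes X: "X \<in> borel_measurable M" and int: "integrable M (\<lambda>\<omega>. X \<omega> ^ 4)"
  shows "integrable M (\<lambda>\<omega>. (X \<omega>)\<^sup>2)" "integrable M X"
proof -
  show int2: "integrable M (\<lambda>\<omega>. (X \<omega>)\<^sup>2)"
  proof (rule Bochner_Integration.integrable_bound)
    show "integrable M (\<lambda>\<omega>. 1 + X \<omega> ^ 4)" using int by simp
    have "y\<^sup>2 \<le> 1 + y ^ 4" for y :: real
    proof -
      have "2 * y\<^sup>2 \<le> 1 + y ^ 4" using sum_squares_bound[of 1 "y\<^sup>2"] by (simp flip: power_mult)
      then show ?thesis using zero_le_power2[of y] by linarith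
    qed
    then show "AE \<omega> in M. norm ((X \<omega>)\<^sup>2) \<le> norm (1 + X \<omega> ^ 4)" by (intro AE_I2) simp
  qed (use X in simp)
  show "integrable M X" by (rule square_integrable_imp_integrable[OF X int2])
qed

section \<open>Mean and variance of increments of arbitrary length\<close>

text \<open>Nonnegativity makes an additive function monotone. Comparing the value at
  \<open>real (Suc n) * t\<close> with the values at neighbouring integers bounds
  \<open>real (Suc n)\<close> times the defect by \<open>2 * g 1\<close> for all large n, so the
  defect is 0.\<close>

lemma additive_nonneg_linear:
  fixes g :: "real \<Rightarrow> real"
  assumes add: "\<And>s t. 0 < s \<Longrightarrow> 0 < t \<Longrightarrow> g (s + t) = g s + g t" and nn: "\<And>t. 0 < t \<Longrightarrow> 0 \<le> g t"
    and t: "0 < t"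
  shows "g t = t * g 1"
proof -
  have mono: "g s \<le> g t" if "0 < s" "s \<le> t" for s t
    using add[of s "t - s"] nn[of "t - s"] that by (cases "s = t") auto
  have mult: "g (real (Suc n) * s) = real (Suc n) * g s" if "0 < s" for n s
  proof (induction n)
    case (Suc n)
    have "g (real (Suc n) * s + s) = real (Suc n) * g s + g s"
      using add[of "real (Suc n) * s" s] that Suc by simp
    moreover have "real (Suc n) * s + s = real (Suc (Suc n)) * s" by (simp add: algebra_simps)
    ultimately show ?case by (simp add: algebra_simps)
  qed simp
  have g1: "0 \<le> g 1" by (rule nn) simp
  have bd: "\<bar>real (Suc n) * (g t - t * g 1)\<bar> \<le> 2 * g 1" if n: "1 < real (Suc n) * t" for n
  proof -
    define k where "k = nat \<lfloor>real (Suc n) * t\<rfloor>"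
    have k1: "1 \<le> k" using n by (simp add: k_def le_nat_iff le_floor_iff)
    then obtain l where l: "k = Suc l" by (cases k) auto
    have kle: "real k \<le> real (Suc n) * t" and klt: "real (Suc n) * t \<le> real k + 1"
      using n unfolding k_def by linarith+
    have "g (real k * 1) \<le> g (real (Suc n) * t)" using k1 kle by (intro mono) auto
    then have lo: "real k * g 1 \<le> real (Suc n) * g t" using mult[of 1 l] mult[OF t, of n] l by simp
    have "g (real (Suc n) * t) \<le> g (real (Suc k) * 1)" using n klt by (intro mono) auto
    then have hi: "real (Suc n) * g t \<le> real (Suc k) * g 1" using mult[of 1 k] mult[OF t, of n] by simp
    have a: "real k * g 1 \<le> real (Suc n) * t * g 1" using kle g1 by (intro mult_right_mono)
    have b: "real (Suc n) * t * g 1 \<le> (real k + 1) * g 1" using klt g1 by (intro mult_right_mono)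
    have "real (Suc k) * g 1 = real k * g 1 + g 1" "(real k + 1) * g 1 = real k * g 1 + g 1" by (simp_all add: algebra_simps)
    then have "\<bar>real (Suc n) * g t - real (Suc n) * t * g 1\<bar> \<le> 2 * g 1" using lo hi a b g1 by linarith
    then show ?thesis by (simp add: right_diff_distrib mult.assoc)
  qed
  show ?thesis
  proof (rule ccontr)
    assume "g t \<noteq> t * g 1"
    define d where "d = \<bar>g t - t * g 1\<bar>"
    have d: "d > 0" using \<open>g t \<noteq> t * g 1\<close> by (simp add: d_def)
    obtain n where n: "max (1 / t) (2 * g 1 / d) < real n" using reals_Archimedean2 by blast
    have "1 < real (Suc n) * t" using n t by (simp add: field_simps)
    moreover have "2 * g 1 < real (Suc n) * d" using n d by (simp add: field_simps)
    ultimately show False using bd[of n] by (simp add: abs_mult d_def)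
  qed
qed

text \<open>The function vanishes at 1 / m, hence it has a period shorter than
  \<open>\<epsilon>\<close> and is bounded everywhere; multiples of a nonzero value would be
  unbounded.\<close>

lemma additive_bounded_zero:
  fixes f :: "real \<Rightarrow> real"
  assumes add: "\<And>s t. f (s + t) = f s + f t" and f1: "f 1 = 0"
    and eps: "0 < \<epsilon>" and bd: "\<And>t. 0 < t \<Longrightarrow> t < \<epsilon> \<Longrightarrow> \<bar>f t\<bar> \<le> B"
  shows "f t = 0"
proof -
  have f0: "f 0 = 0" using add[of 0 0] by simp
  have neg: "f (- t) = - f t" for t using add[of t "- t"] f0 by simp
  have mult: "f (real n * t) = real n * f t" for n t
    by (induction n) (simp_all add: f0 add algebra_simps)
  have multi: "f (of_int k * t) = of_int k * f t" for k t
    by (cases k rule: int_cases2) (simp_all add: mult neg)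
  obtain m where m: "1 / \<epsilon> < real m" using reals_Archimedean2 by blast
  have m0: "0 < real m" using m eps by (meson less_trans zero_less_divide_1_iff)
  have m1: "1 / real m < \<epsilon>" using m m0 eps by (simp add: field_simps)
  have "real m * f (1 / real m) = 0" using mult[of m "1 / real m"] f1 m0 by simp
  then have fm: "f (1 / real m) = 0" using m0 by simp
  have all: "\<bar>f s\<bar> \<le> B" for s
  proof -
    define k where "k = \<lceil>s * real m\<rceil> - 1"
    define r where "r = s - of_int k * (1 / real m)"
    have "of_int k < s * real m" "s * real m \<le> of_int k + 1" unfolding k_def by linarith+
    moreover have "r = (s * real m - of_int k) / real m" using m0 by (simp add: r_def field_simps)
    ultimately have "0 < r" "r \<le> 1 / real m" using m0 by (simp_all add: divide_right_mono)
    moreover have "f s = f r" using add[of r "of_int k * (1 / real m)"] multi[of k "1 / real m"] fm by (simp add: r_def)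
    ultimately show ?thesis using bd[of r] m1 by simp
  qed
  show ?thesis
  proof (rule ccontr)
    assume "f t \<noteq> 0"
    obtain n where "B / \<bar>f t\<bar> < real n" using reals_Archimedean2 by blast
    then have "B < real n * \<bar>f t\<bar>" using \<open>f t \<noteq> 0\<close> by (simp add: field_simps)
    then show False using all[of "real n * t"] by (simp add: mult abs_mult)
  qed
qed

text \<open>The mean f of the increment over [0, t] is additive and vanishes at 1, but additivity
  alone does not make it linear; right continuity of the paths supplies the missing boundedness near
  0. The variance is additive and nonnegative, hence linear.\<close>

lemma (in prob_space) real_levy_moments:
  fixes x :: "real \<Rightarrow> 'a \<Rightarrow> real"
  assumes RL: "real_levy M x"
  shows "integrable M (\<lambda>\<omega>. x t \<omega> - x s \<omega>)" "integrable M (\<lambda>\<omega>. (x t \<omega> - x s \<omega>)\<^sup>2)"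
    "(\<integral>\<omega>. x t \<omega> - x s \<omega> \<partial>M) = 0"
    "(\<integral>\<omega>. (x t \<omega> - x s \<omega>)\<^sup>2 \<partial>M) = \<bar>t - s\<bar> * (\<integral>\<omega>. (x 1 \<omega>)\<^sup>2 \<partial>M)"
proof -
  have L: "two_sided_levy M x" using RL by (simp add: real_levy_def)
  note [measurable] = levy_increment_distr(2)[OF L]
  have incr: "(\<lambda>\<omega>. x t \<omega> - x s \<omega>) \<in> borel_measurable M" for t s by measurable
  have int1: "integrable M (\<lambda>\<omega>. x t \<omega> - x s \<omega>)" and int2: "integrable M (\<lambda>\<omega>. (x t \<omega> - x s \<omega>)\<^sup>2)" for t s
    by (rule integrable_of_power4[OF incr real_levy_integrable4[OF RL]])+
  show "integrable M (\<lambda>\<omega>. x t \<omega> - x s \<omega>)" "integrable M (\<lambda>\<omega>. (x t \<omega> - x s \<omega>)\<^sup>2)" by (rule int1 int2)+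
  have id: "(\<lambda>v :: real. v) \<in> borel_measurable borel" and sq: "(\<lambda>v :: real. (v - c)\<^sup>2) \<in> borel_measurable borel" for c :: real
    by simp_all
  define f where "f t = (\<integral>\<omega>. x t \<omega> - x 0 \<omega> \<partial>M)" for t
  have fd: "(\<integral>\<omega>. x t \<omega> - x s \<omega> \<partial>M) = f (t - s)" for t s
    unfolding f_def using levy_increment_transfer(2)[OF L id, of t s "t - s" 0] by simp
  have f1: "f 1 = 0" unfolding f_def using levy_at_0(2)[OF L id, of 1] RL by (simp add: real_levy_def)
  have f_add: "f (s + t) = f s + f t" for s t
  proof -
    have "f (s + t) = (\<integral>\<omega>. (x (s + t) \<omega> - x s \<omega>) + (x s \<omega> - x 0 \<omega>) \<partial>M)" by (simp add: f_def)
    also have "\<dots> = f t + f s" by (subst Bochner_Integration.integral_add[OF int1 int1]) (simp add: fd)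
    finally show ?thesis by simp
  qed
  \<comment> \<open>Centred at \<open>f t\<close>, as f is not yet known to vanish and uncentred
    second moments would not be additive.\<close>
  define g where "g t = (\<integral>\<omega>. (x t \<omega> - x 0 \<omega> - f t)\<^sup>2 \<partial>M)" for t
  have intc: "integrable M (\<lambda>\<omega>. (x t \<omega> - x s \<omega> - c)\<^sup>2)" for t s c
  proof -
    have "integrable M (\<lambda>\<omega>. (x t \<omega> - x s \<omega>)\<^sup>2 - 2 * c * (x t \<omega> - x s \<omega>) + c\<^sup>2)" using int1 int2 by auto
    also have "(\<lambda>\<omega>. (x t \<omega> - x s \<omega>)\<^sup>2 - 2 * c * (x t \<omega> - x s \<omega>) + c\<^sup>2) = (\<lambda>\<omega>. (x t \<omega> - x s \<omega> - c)\<^sup>2)"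
      by (rule ext) (simp add: power2_eq_square algebra_simps)
    finally show ?thesis .
  qed
  have g_add: "g (s + t) = g s + g t" if st: "0 < s" "0 < t" for s t
  proof -
    define P Q where "P \<omega> = x s \<omega> - x 0 \<omega> - f s" and "Q \<omega> = x (s + t) \<omega> - x s \<omega> - f t" for \<omega>
    have "indep_var borel ((\<lambda>v. v - f s) \<circ> (\<lambda>\<omega>. x s \<omega> - x 0 \<omega>)) borel ((\<lambda>v. v - f t) \<circ> (\<lambda>\<omega>. x (s + t) \<omega> - x s \<omega>))"
      by (rule indep_var_compose[OF levy_indep_increments[OF L]]) (use st in auto)
    then have ind: "indep_var borel P borel Q" by (simp add: P_def[abs_def] Q_def[abs_def] comp_def)
    have iP: "integrable M P" and iQ: "integrable M Q" using int1 by (auto simp: P_def[abs_def] Q_def[abs_def])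
    have "(\<integral>\<omega>. P \<omega> \<partial>M) = 0" using int1 by (simp add: P_def fd prob_space)
    then have PQ: "(\<integral>\<omega>. P \<omega> * Q \<omega> \<partial>M) = 0" using indep_var_lebesgue_integral[OF ind iP iQ] by simp
    have iPQ: "integrable M (\<lambda>\<omega>. P \<omega> * Q \<omega>)" by (rule indep_var_integrable[OF ind iP iQ])
    have iP2: "integrable M (\<lambda>\<omega>. (P \<omega>)\<^sup>2)" and iQ2: "integrable M (\<lambda>\<omega>. (Q \<omega>)\<^sup>2)"
      unfolding P_def Q_def by (rule intc)+
    have "g (s + t) = (\<integral>\<omega>. (P \<omega>)\<^sup>2 + (Q \<omega>)\<^sup>2 + 2 * (P \<omega> * Q \<omega>) \<partial>M)"
      unfolding g_def f_add P_def Q_def by (intro Bochner_Integration.integral_cong refl) (simp add: power2_eq_square algebra_simps)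
    also have "\<dots> = (\<integral>\<omega>. (P \<omega>)\<^sup>2 \<partial>M) + (\<integral>\<omega>. (Q \<omega>)\<^sup>2 \<partial>M)"
      using iP2 iQ2 iPQ PQ by simp
    also have "(\<integral>\<omega>. (Q \<omega>)\<^sup>2 \<partial>M) = g t"
      unfolding g_def Q_def using levy_increment_transfer(2)[OF L sq, of "s + t" s t 0 "f t"] by simp
    finally show ?thesis by (simp add: g_def P_def)
  qed
  have g_lin: "g t = t * g 1" if "0 < t" for t
    by (rule additive_nonneg_linear[OF g_add _ that]) (simp_all add: g_def)
  \<comment> \<open>Otherwise |f| exceeds 1/2 along times decreasing to 0, where the increments tend
    to 0 almost surely and their variances tend to 0.\<close>
  have small: "\<exists>\<epsilon>>0. \<forall>t. 0 < t \<longrightarrow> t < \<epsilon> \<longrightarrow> \<bar>f t\<bar> \<le> 1 / 2"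
  proof (rule ccontr)
    assume "\<not> ?thesis"
    then have "\<exists>t. 0 < t \<and> t < 1 / real (Suc n) \<and> 1 / 2 < \<bar>f t\<bar>" for n
      by (metis not_le of_nat_0_less_iff zero_less_Suc zero_less_divide_1_iff)
    then obtain \<tau> where \<tau>: "\<And>n. 0 < \<tau> n" "\<And>n. \<tau> n < 1 / real (Suc n)" "\<And>n. 1 / 2 < \<bar>f (\<tau> n)\<bar>" by metis
    have \<tau>0: "\<tau> \<longlonglongrightarrow> 0"
      by (rule tendsto_sandwich[OF always_eventually always_eventually tendsto_const LIMSEQ_inverse_real_of_nat])
        (use \<tau>(1,2) in \<open>auto simp: inverse_eq_divide intro: less_imp_le\<close>)
    have "\<tau> n \<noteq> 0" for n using \<tau>(1)[of n] by simp
    then have "filterlim \<tau> (at_right 0) sequentially"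
      unfolding filterlim_at using \<tau>0 \<tau>(1) by auto
    then have conv: "AE \<omega> in M. (\<lambda>n. x (\<tau> n) \<omega> - x 0 \<omega>) \<longlonglongrightarrow> 0"
    proof -
      have "AE \<omega> in M. cadlag (\<lambda>t. x t \<omega>)" using L by (simp add: two_sided_levy_def)
      then show ?thesis
      proof eventually_elim
        case (elim \<omega>)
        then have "((\<lambda>t. x t \<omega>) \<longlongrightarrow> x 0 \<omega>) (at_right 0)" unfolding cadlag_def by blast
        then have "(\<lambda>n. x (\<tau> n) \<omega>) \<longlonglongrightarrow> x 0 \<omega>"
          using \<open>filterlim \<tau> (at_right 0) sequentially\<close> by (rule filterlim_compose)
        then show ?case by (simp add: LIM_zero_iff)
      qed
    qed
    have "(\<lambda>n. \<integral>\<omega>. min 1 \<bar>x (\<tau> n) \<omega> - x 0 \<omega>\<bar> \<partial>M) \<longlonglongrightarrow> (\<integral>\<omega>. 0 \<partial>M)"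
    proof (rule integral_dominated_convergence[where w="\<lambda>_. 1"])
      show "AE \<omega> in M. (\<lambda>n. min 1 \<bar>x (\<tau> n) \<omega> - x 0 \<omega>\<bar>) \<longlonglongrightarrow> 0"
        using conv
      proof eventually_elim
        case (elim \<omega>)
        have "(\<lambda>n. min 1 \<bar>x (\<tau> n) \<omega> - x 0 \<omega>\<bar>) \<longlonglongrightarrow> min 1 \<bar>0\<bar>"
          by (intro tendsto_intros elim)
        then show ?case by simp
      qed
    qed auto
    moreover have "(\<lambda>n. 2 * (\<tau> n * g 1)) \<longlonglongrightarrow> 2 * (0 * g 1)" by (intro tendsto_intros \<tau>0)
    ultimately have lim: "(\<lambda>n. (\<integral>\<omega>. min 1 \<bar>x (\<tau> n) \<omega> - x 0 \<omega>\<bar> \<partial>M) + 1 / 8 + 2 * (\<tau> n * g 1)) \<longlonglongrightarrow> (\<integral>\<omega>. 0 \<partial>M) + 1 / 8 + 2 * (0 * g 1)"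
      by (intro tendsto_add tendsto_const)
    have "1 / 2 \<le> (\<integral>\<omega>. min 1 \<bar>x (\<tau> n) \<omega> - x 0 \<omega>\<bar> \<partial>M) + 1 / 8 + 2 * (\<tau> n * g 1)" for n
    proof -
      define X where "X \<omega> = x (\<tau> n) \<omega> - x 0 \<omega>" for \<omega>
      have iX: "integrable M (\<lambda>\<omega>. min 1 \<bar>X \<omega>\<bar>)"
        by (rule Bochner_Integration.integrable_bound[of _ "\<lambda>_. 1 :: real"]) (auto simp: X_def)
      have iX2: "integrable M (\<lambda>\<omega>. (X \<omega> - f (\<tau> n))\<^sup>2)" unfolding X_def by (rule intc)
      have "(1 / 2 :: real) = (\<integral>\<omega>. 1 / 2 \<partial>M)" by (simp add: prob_space)
      also have "\<dots> \<le> (\<integral>\<omega>. min 1 \<bar>X \<omega>\<bar> + 1 / 8 + 2 * (X \<omega> - f (\<tau> n))\<^sup>2 \<partial>M)"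
      proof (rule integral_mono)
        fix \<omega>
        \<comment> \<open>The elementary bound |y| \<le> 1/8 + 2 y^2 replaces a first absolute
          moment by the variance, and the truncation at 1 permits dominated convergence. In the
          limit 1/2 \<le> 1/8 would follow.\<close>
        have "\<bar>X \<omega> - f (\<tau> n)\<bar> \<le> 1 / 8 + 2 * (X \<omega> - f (\<tau> n))\<^sup>2"
          using zero_le_power2[of "4 * \<bar>X \<omega> - f (\<tau> n)\<bar> - 1"] by (simp add: power2_diff power_mult_distrib)
        moreover have "1 / 2 < \<bar>f (\<tau> n)\<bar>" by (rule \<tau>(3))
        ultimately show "1 / 2 \<le> min 1 \<bar>X \<omega>\<bar> + 1 / 8 + 2 * (X \<omega> - f (\<tau> n))\<^sup>2"
          using zero_le_power2[of "X \<omega> - f (\<tau> n)"] by (auto simp: min_def)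
      qed (use iX iX2 in auto)
      also have "\<dots> = (\<integral>\<omega>. min 1 \<bar>X \<omega>\<bar> \<partial>M) + 1 / 8 + 2 * g (\<tau> n)"
        using iX iX2 by (simp add: prob_space g_def X_def)
      finally show ?thesis unfolding g_lin[OF \<tau>(1)] X_def .
    qed
    then have "1 / 2 \<le> (\<integral>\<omega>. 0 \<partial>M) + 1 / 8 + 2 * (0 * g 1)" by (intro LIMSEQ_le_const[OF lim]) blast
    then show False by simp
  qed
  then obtain \<epsilon> where "\<epsilon> > 0" "\<And>t. 0 < t \<Longrightarrow> t < \<epsilon> \<Longrightarrow> \<bar>f t\<bar> \<le> 1 / 2" by blast
  then have f0: "f t = 0" for t by (rule additive_bounded_zero[OF f_add f1])
  then show "(\<integral>\<omega>. x t \<omega> - x s \<omega> \<partial>M) = 0" by (simp add: fd)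
  have g1: "g 1 = (\<integral>\<omega>. (x 1 \<omega>)\<^sup>2 \<partial>M)"
    unfolding g_def using levy_at_0(2)[OF L sq[of 0], of 1] by (simp add: f0)
  have pos: "(\<integral>\<omega>. (x t \<omega> - x s \<omega>)\<^sup>2 \<partial>M) = (t - s) * (\<integral>\<omega>. (x 1 \<omega>)\<^sup>2 \<partial>M)" if "s < t" for s t
    using levy_increment_transfer(2)[OF L sq[of 0], of t s "t - s" 0] g_lin[of "t - s"] that g1
    by (simp add: g_def f0)
  consider "s < t" | "s = t" | "t < s" by linarith
  then show "(\<integral>\<omega>. (x t \<omega> - x s \<omega>)\<^sup>2 \<partial>M) = \<bar>t - s\<bar> * (\<integral>\<omega>. (x 1 \<omega>)\<^sup>2 \<partial>M)"
  proof cases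
    case 3
    then show ?thesis using pos[of t s] by (simp add: power2_commute)
  qed (use pos in auto)
qed

section \<open>Vector-valued processes through their projections\<close>

lemma two_sided_levy_inner:
  fixes X :: "real \<Rightarrow> 'w \<Rightarrow> 'b::euclidean_space"
  assumes ps: "prob_space M" and L: "two_sided_levy M X"
  shows "two_sided_levy M (\<lambda>t \<omega>. v \<bullet> X t \<omega>)"
proof -
  interpret prob_space M by (rule ps)
  have X: "X t \<in> borel_measurable M" for t by (rule levy_increment_distr(2)[OF L])
  note [measurable] = X
  have lin: "v \<bullet> a - v \<bullet> b = v \<bullet> (a - b)" for a b by (simp add: inner_diff_right)
  have m: "(\<lambda>y. v \<bullet> y) \<in> borel_measurable borel" by simp
  have XD: "(\<lambda>\<omega>. X t \<omega> - X s \<omega>) \<in> borel_measurable M" for s t by measurable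
  have D: "distr M borel (\<lambda>\<omega>. v \<bullet> (X t \<omega> - X s \<omega>)) = distr (distr M borel (\<lambda>\<omega>. X t \<omega> - X s \<omega>)) borel (\<lambda>y. v \<bullet> y)" for s t
    by (subst distr_distr[OF m XD]) (simp add: comp_def)
  have "AE \<omega> in M. X 0 \<omega> = 0" "AE \<omega> in M. cadlag (\<lambda>t. X t \<omega>)" using L by (simp_all add: two_sided_levy_def)
  then have "AE \<omega> in M. v \<bullet> X 0 \<omega> = 0" "AE \<omega> in M. cadlag (\<lambda>t. v \<bullet> X t \<omega>)"
  proof -
    assume a: "AE \<omega> in M. X 0 \<omega> = 0" and b: "AE \<omega> in M. cadlag (\<lambda>t. X t \<omega>)"
    show "AE \<omega> in M. v \<bullet> X 0 \<omega> = 0" using a by eventually_elim simp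
    show "AE \<omega> in M. cadlag (\<lambda>t. v \<bullet> X t \<omega>)"
      using b
    proof eventually_elim
      case (elim \<omega>)
      show ?case
        unfolding cadlag_def
      proof (intro allI conjI)
        fix t
        obtain l where l: "((\<lambda>t. X t \<omega>) \<longlongrightarrow> X t \<omega>) (at_right t)" "((\<lambda>t. X t \<omega>) \<longlongrightarrow> l) (at_left t)"
          using elim unfolding cadlag_def by blast
        show "((\<lambda>t. v \<bullet> X t \<omega>) \<longlongrightarrow> v \<bullet> X t \<omega>) (at_right t)" by (intro tendsto_inner tendsto_const l)
        have "((\<lambda>t. v \<bullet> X t \<omega>) \<longlongrightarrow> v \<bullet> l) (at_left t)" by (intro tendsto_inner tendsto_const l)
        then show "\<exists>l. ((\<lambda>t. v \<bullet> X t \<omega>) \<longlongrightarrow> l) (at_left t)" by blast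
      qed
    qed
  qed
  moreover have "distr M borel (\<lambda>\<omega>. v \<bullet> X (t + r) \<omega> - v \<bullet> X (s + r) \<omega>) = distr M borel (\<lambda>\<omega>. v \<bullet> X t \<omega> - v \<bullet> X s \<omega>)" for s t r
    unfolding lin D levy_increment_distr(1)[OF L] ..
  moreover have "indep_vars (\<lambda>_. borel) (\<lambda>i \<omega>. v \<bullet> X (\<tau> (Suc i)) \<omega> - v \<bullet> X (\<tau> i) \<omega>) {..<n}"
    if "\<forall>i<n. \<tau> i < \<tau> (Suc i)" for n and \<tau> :: "nat \<Rightarrow> real"
  proof -
    have "indep_vars (\<lambda>_. borel) (\<lambda>i \<omega>. X (\<tau> (Suc i)) \<omega> - X (\<tau> i) \<omega>) {..<n}"
      using L that unfolding two_sided_levy_def by blast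
    then have "indep_vars (\<lambda>_. borel) (\<lambda>i \<omega>. v \<bullet> (X (\<tau> (Suc i)) \<omega> - X (\<tau> i) \<omega>)) {..<n}"
      by (rule indep_vars_compose2) simp
    then show ?thesis by (simp only: lin)
  qed
  ultimately show ?thesis unfolding two_sided_levy_def by simp
qed

definition vec_levy :: "'w measure \<Rightarrow> (real \<Rightarrow> 'w \<Rightarrow> real^'m) \<Rightarrow> bool" where
  "vec_levy M X \<longleftrightarrow> two_sided_levy M X \<and> integrable M (\<lambda>\<omega>. norm (X 1 \<omega>) ^ 4) \<and> (\<integral>\<omega>. X 1 \<omega> \<partial>M) = 0"

lemma (in prob_space) vec_levy_inner:
  assumes V: "vec_levy M X"
  shows "real_levy M (\<lambda>t \<omega>. v \<bullet> X t \<omega>)"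
proof -
  have L: "two_sided_levy M X" and i4: "integrable M (\<lambda>\<omega>. norm (X 1 \<omega>) ^ 4)" and m: "(\<integral>\<omega>. X 1 \<omega> \<partial>M) = 0"
    using V by (auto simp: vec_levy_def)
  note [measurable] = levy_increment_distr(2)[OF L]
  have mn: "(\<lambda>\<omega>. norm (X 1 \<omega>)) \<in> borel_measurable M" by measurable
  have "integrable M (\<lambda>\<omega>. norm (X 1 \<omega>))" by (rule integrable_of_power4(2)[OF mn i4])
  then have iX: "integrable M (X 1)" by (rule integrable_norm_cancel) measurable
  have "integrable M (\<lambda>\<omega>. (v \<bullet> X 1 \<omega>) ^ 4)"
  proof (rule Bochner_Integration.integrable_bound)
    show "integrable M (\<lambda>\<omega>. norm v ^ 4 * norm (X 1 \<omega>) ^ 4)" using i4 by simp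
    have "\<bar>v \<bullet> y\<bar> ^ 4 \<le> (norm v * norm y) ^ 4" for y by (intro power_mono Cauchy_Schwarz_ineq2) simp
    then show "AE \<omega> in M. norm ((v \<bullet> X 1 \<omega>) ^ 4) \<le> norm (norm v ^ 4 * norm (X 1 \<omega>) ^ 4)"
      by (intro AE_I2) (simp add: power_abs power_mult_distrib)
  qed measurable
  moreover have "(\<integral>\<omega>. v \<bullet> X 1 \<omega> \<partial>M) = 0" using iX m by simp
  ultimately show ?thesis using two_sided_levy_inner[OF prob_space_axioms L] by (simp add: real_levy_def)
qed

section \<open>Second moments of stochastic integrals\<close>

text \<open>Stated as the combination of distances that polarization produces for the covariance of
  two increments, so overlapping intervals need no case analysis there.\<close>

lemma measure_Int_half_open:
  fixes a b a' b' :: real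
  assumes "a \<le> b" "a' \<le> b'"
  shows "measure lborel ({a<..b} \<inter> {a'<..b'}) = (\<bar>b - a'\<bar> + \<bar>a - b'\<bar> - \<bar>b - b'\<bar> - \<bar>a - a'\<bar>) / 2"
proof -
  have "{a<..b} \<inter> {a'<..b'} = {max a a'<..min b b'}" by auto
  then show ?thesis using assms
    by (cases "max a a' \<le> min b b'") (auto simp: max_def min_def split: if_splits)
qed

text \<open>Polarization reduces the product of two increments to the squares of four increments,
  whose means are proportional to their lengths.\<close>

lemma (in prob_space) real_levy_covariance:
  fixes x :: "real \<Rightarrow> 'a \<Rightarrow> real"
  assumes RL: "real_levy M x" and ab: "a \<le> b" "a' \<le> b'"
  shows "integrable M (\<lambda>\<omega>. (x b \<omega> - x a \<omega>) * (x b' \<omega> - x a' \<omega>))"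
    "(\<integral>\<omega>. (x b \<omega> - x a \<omega>) * (x b' \<omega> - x a' \<omega>) \<partial>M) = (\<integral>\<omega>. (x 1 \<omega>)\<^sup>2 \<partial>M) * measure lborel ({a<..b} \<inter> {a'<..b'})"
proof -
  note m = real_levy_moments[OF RL]
  have eq: "(x b \<omega> - x a \<omega>) * (x b' \<omega> - x a' \<omega>) = ((x b \<omega> - x a' \<omega>)\<^sup>2 + (x a \<omega> - x b' \<omega>)\<^sup>2
      - (x b \<omega> - x b' \<omega>)\<^sup>2 - (x a \<omega> - x a' \<omega>)\<^sup>2) / 2" for \<omega>
    by (simp add: power2_eq_square algebra_simps)
  show "integrable M (\<lambda>\<omega>. (x b \<omega> - x a \<omega>) * (x b' \<omega> - x a' \<omega>))" unfolding eq using m(2) by simp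
  have "(\<integral>\<omega>. (x b \<omega> - x a \<omega>) * (x b' \<omega> - x a' \<omega>) \<partial>M) = ((\<integral>\<omega>. (x b \<omega> - x a' \<omega>)\<^sup>2 \<partial>M) + (\<integral>\<omega>. (x a \<omega> - x b' \<omega>)\<^sup>2 \<partial>M)
      - (\<integral>\<omega>. (x b \<omega> - x b' \<omega>)\<^sup>2 \<partial>M) - (\<integral>\<omega>. (x a \<omega> - x a' \<omega>)\<^sup>2 \<partial>M)) / 2"
    unfolding eq using m(2) by simp
  also have "\<dots> = (\<integral>\<omega>. (x 1 \<omega>)\<^sup>2 \<partial>M) * ((\<bar>b - a'\<bar> + \<bar>a - b'\<bar> - \<bar>b - b'\<bar> - \<bar>a - a'\<bar>) / 2)"
    unfolding m(4) by (simp add: algebra_simps)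
  finally show "(\<integral>\<omega>. (x b \<omega> - x a \<omega>) * (x b' \<omega> - x a' \<omega>) \<partial>M) = (\<integral>\<omega>. (x 1 \<omega>)\<^sup>2 \<partial>M) * measure lborel ({a<..b} \<inter> {a'<..b'})"
    unfolding measure_Int_half_open[OF ab] .
qed

lemma (in prob_space) real_levy_isometry:
  fixes x :: "real \<Rightarrow> 'a \<Rightarrow> real" and g a b :: "nat \<Rightarrow> real"
  assumes RL: "real_levy M x" and ab: "\<And>i. i < n \<Longrightarrow> a i \<le> b i"
  shows "integrable M (\<lambda>\<omega>. (\<Sum>i<n. g i * (x (b i) \<omega> - x (a i) \<omega>))\<^sup>2)"
    "integrable lborel (\<lambda>u. (\<Sum>i<n. g i * indicator {a i<..b i} u)\<^sup>2)"
    "(\<integral>\<omega>. (\<Sum>i<n. g i * (x (b i) \<omega> - x (a i) \<omega>))\<^sup>2 \<partial>M) =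
      (\<integral>\<omega>. (x 1 \<omega>)\<^sup>2 \<partial>M) * (\<integral>u. (\<Sum>i<n. g i * indicator {a i<..b i} u)\<^sup>2 \<partial>lborel)"
proof -
  have sq: "(\<Sum>i<n. g i * y i)\<^sup>2 = (\<Sum>i<n. \<Sum>j<n. g i * g j * (y i * y j))" for y :: "nat \<Rightarrow> real"
    by (simp add: power2_eq_square sum_product mult_ac)
  note c = real_levy_covariance[OF RL ab ab]
  have i1: "integrable lborel (\<lambda>u. indicator {a i<..b i} u * indicator {a j<..b j} u :: real)"
    and e1: "(\<integral>u. indicator {a i<..b i} u * indicator {a j<..b j} u \<partial>lborel) = measure lborel ({a i<..b i} \<inter> {a j<..b j})" for i j
  proof -
    have "emeasure lborel ({a i<..b i} \<inter> {a j<..b j}) \<le> emeasure lborel {a i<..b i}" by (intro emeasure_mono) auto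
    also have "\<dots> < \<infinity>" by (cases "a i \<le> b i") auto
    finally have "emeasure lborel ({a i<..b i} \<inter> {a j<..b j}) < \<infinity>" .
    then show "integrable lborel (\<lambda>u. indicator {a i<..b i} u * indicator {a j<..b j} u :: real)"
      by (simp add: indicator_inter_arith[symmetric])
    show "(\<integral>u. indicator {a i<..b i} u * indicator {a j<..b j} u \<partial>lborel) = measure lborel ({a i<..b i} \<inter> {a j<..b j})"
      by (simp add: indicator_inter_arith[symmetric])
  qed
  show "integrable M (\<lambda>\<omega>. (\<Sum>i<n. g i * (x (b i) \<omega> - x (a i) \<omega>))\<^sup>2)"
    unfolding sq by (intro Bochner_Integration.integrable_sum integrable_mult_right c) auto
  show "integrable lborel (\<lambda>u. (\<Sum>i<n. g i * indicator {a i<..b i} u)\<^sup>2)"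
    unfolding sq by (intro Bochner_Integration.integrable_sum integrable_mult_right i1)
  have "(\<integral>\<omega>. (\<Sum>i<n. g i * (x (b i) \<omega> - x (a i) \<omega>))\<^sup>2 \<partial>M)
      = (\<Sum>i<n. \<Sum>j<n. g i * g j * (\<integral>\<omega>. (x (b i) \<omega> - x (a i) \<omega>) * (x (b j) \<omega> - x (a j) \<omega>) \<partial>M))"
    unfolding sq
    by (subst Bochner_Integration.integral_sum, (intro Bochner_Integration.integrable_sum integrable_mult_right c; simp))
      (intro sum.cong refl, subst Bochner_Integration.integral_sum, auto intro!: integrable_mult_right c)
  also have "\<dots> = (\<integral>\<omega>. (x 1 \<omega>)\<^sup>2 \<partial>M) * (\<Sum>i<n. \<Sum>j<n. g i * g j * measure lborel ({a i<..b i} \<inter> {a j<..b j}))"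
    by (simp add: c sum_distrib_left mult_ac)
  also have "(\<Sum>i<n. \<Sum>j<n. g i * g j * measure lborel ({a i<..b i} \<inter> {a j<..b j}))
      = (\<integral>u. (\<Sum>i<n. g i * indicator {a i<..b i} u)\<^sup>2 \<partial>lborel)"
    unfolding sq
    by (subst Bochner_Integration.integral_sum, (intro Bochner_Integration.integrable_sum integrable_mult_right i1))
      (intro sum.cong refl, subst Bochner_Integration.integral_sum, auto intro!: integrable_mult_right i1 simp: e1)
  finally show "(\<integral>\<omega>. (\<Sum>i<n. g i * (x (b i) \<omega> - x (a i) \<omega>))\<^sup>2 \<partial>M) =
      (\<integral>\<omega>. (x 1 \<omega>)\<^sup>2 \<partial>M) * (\<integral>u. (\<Sum>i<n. g i * indicator {a i<..b i} u)\<^sup>2 \<partial>lborel)" .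
qed

lemma sum_list_case3: "(\<Sum>(a, b, G)\<leftarrow>gs. f a b G) = (\<Sum>i<length gs. f (fst (gs ! i)) (fst (snd (gs ! i))) (snd (snd (gs ! i))))"
  by (simp add: sum_list_sum_nth case_prod_unfold atLeast0LessThan)

lemma norm_matrix_power2: "(norm G)\<^sup>2 = (\<Sum>r\<in>UNIV. \<Sum>p\<in>UNIV. (G $ r $ p)\<^sup>2)" for G :: "real^'m^'d"
  by (simp add: norm_vec_def L2_set_def sum_nonneg)

text \<open>The components of X may be correlated, so Cauchy-Schwarz separates them at the cost of a
  factor equal to their number. An upper bound is all that is required.\<close>

lemma (in prob_space) step_integral_second_moment:
  fixes X :: "real \<Rightarrow> 'a \<Rightarrow> real^'m" and gs :: "(real \<times> real \<times> (real^'m^'d)) list"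
  assumes V: "vec_levy M X" and gs: "\<forall>(a, b, G)\<in>set gs. a \<le> b"
  shows "(\<integral>\<^sup>+\<omega>. ennreal ((norm (step_integral X gs \<omega>))\<^sup>2) \<partial>M)
    \<le> ennreal (real CARD('m) * (\<Sum>p\<in>UNIV. \<integral>\<omega>. (X 1 \<omega> $ p)\<^sup>2 \<partial>M)) * (\<integral>\<^sup>+u. ennreal ((norm (step_fun gs u))\<^sup>2) \<partial>lborel)"
proof -
  define n where "n = length gs"
  define a b G where "a i = fst (gs ! i)" and "b i = fst (snd (gs ! i))" and "G i = snd (snd (gs ! i))" for i
  have ab: "a i \<le> b i" if "i < n" for i
    using bspec[OF gs nth_mem[of i gs]] that by (simp add: case_prod_unfold a_def b_def n_def)
  have comp: "(\<lambda>t \<omega>. axis p 1 \<bullet> X t \<omega>) = (\<lambda>t \<omega>. X t \<omega> $ p)" for p by (simp add: inner_axis')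
  have RL: "real_levy M (\<lambda>t \<omega>. X t \<omega> $ p)" for p using vec_levy_inner[OF V, of "axis p 1"] unfolding comp .
  define Z where "Z r p \<omega> = (\<Sum>i<n. G i $ r $ p * (X (b i) \<omega> $ p - X (a i) \<omega> $ p))" for r p \<omega>
  define F where "F r p u = (\<Sum>i<n. G i $ r $ p * indicator {a i<..b i} u)" for r p and u :: real
  have iso: "integrable M (\<lambda>\<omega>. (Z r p \<omega>)\<^sup>2)" "integrable lborel (\<lambda>u. (F r p u)\<^sup>2)"
    "(\<integral>\<omega>. (Z r p \<omega>)\<^sup>2 \<partial>M) = (\<integral>\<omega>. (X 1 \<omega> $ p)\<^sup>2 \<partial>M) * (\<integral>u. (F r p u)\<^sup>2 \<partial>lborel)" for r p
    unfolding Z_def F_def by (rule real_levy_isometry[OF RL ab]; assumption)+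
  define S where "S = (\<Sum>p\<in>UNIV. \<integral>\<omega>. (X 1 \<omega> $ p)\<^sup>2 \<partial>M)"
  have Sp: "(\<integral>\<omega>. (X 1 \<omega> $ p)\<^sup>2 \<partial>M) \<le> S" for p unfolding S_def by (rule member_le_sum) auto
  have SI: "step_integral X gs \<omega> $ r = (\<Sum>p\<in>UNIV. Z r p \<omega>)" for r \<omega>
    by (simp add: step_integral_def sum_list_case3 Z_def n_def a_def b_def G_def matrix_vector_mult_def sum.swap[of _ UNIV])
  have SF: "step_fun gs u $ r $ p = F r p u" for r p u
    by (simp add: step_fun_def sum_list_case3 F_def n_def a_def b_def G_def mult.commute)
  have nSI: "(norm (step_integral X gs \<omega>))\<^sup>2 \<le> (\<Sum>r\<in>UNIV. \<Sum>p\<in>UNIV. (Z r p \<omega>)\<^sup>2) * real CARD('m)" for \<omega>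
  proof -
    have "(norm (step_integral X gs \<omega>))\<^sup>2 = (\<Sum>r\<in>UNIV. (\<Sum>p\<in>UNIV. Z r p \<omega>)\<^sup>2)"
      by (simp add: norm_vec_def L2_set_def sum_nonneg SI)
    also have "\<dots> \<le> (\<Sum>r\<in>UNIV. (\<Sum>p\<in>UNIV. (Z r p \<omega>)\<^sup>2) * real CARD('m))"
      by (intro sum_mono sum_squared_le_sum_of_squares)
    finally show ?thesis by (simp add: sum_distrib_right)
  qed
  have nSF: "(norm (step_fun gs u))\<^sup>2 = (\<Sum>r\<in>UNIV. \<Sum>p\<in>UNIV. (F r p u)\<^sup>2)" for u
    by (simp add: norm_matrix_power2 SF)
  have iF: "integrable lborel (\<lambda>u. (norm (step_fun gs u))\<^sup>2)"
    unfolding nSF by (intro Bochner_Integration.integrable_sum iso(2))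
  have iZ: "integrable M (\<lambda>\<omega>. (\<Sum>r\<in>UNIV. \<Sum>p\<in>UNIV. (Z r p \<omega>)\<^sup>2) * real CARD('m))"
    by (intro integrable_mult_left Bochner_Integration.integrable_sum iso(1))
  have "(\<integral>\<^sup>+\<omega>. ennreal ((norm (step_integral X gs \<omega>))\<^sup>2) \<partial>M)
      \<le> (\<integral>\<^sup>+\<omega>. ennreal ((\<Sum>r\<in>UNIV. \<Sum>p\<in>UNIV. (Z r p \<omega>)\<^sup>2) * real CARD('m)) \<partial>M)"
    by (intro nn_integral_mono ennreal_leI nSI)
  also have "\<dots> = ennreal (\<integral>\<omega>. (\<Sum>r\<in>UNIV. \<Sum>p\<in>UNIV. (Z r p \<omega>)\<^sup>2) * real CARD('m) \<partial>M)"
    using iZ by (intro nn_integral_eq_integral) (auto intro!: sum_nonneg mult_nonneg_nonneg)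
  also have "(\<integral>\<omega>. (\<Sum>r\<in>UNIV. \<Sum>p\<in>UNIV. (Z r p \<omega>)\<^sup>2) * real CARD('m) \<partial>M)
      = (\<Sum>r\<in>UNIV. \<Sum>p\<in>UNIV. (\<integral>\<omega>. (X 1 \<omega> $ p)\<^sup>2 \<partial>M) * (\<integral>u. (F r p u)\<^sup>2 \<partial>lborel)) * real CARD('m)"
    using iso(1) by (simp add: Bochner_Integration.integral_sum Bochner_Integration.integrable_sum iso(3))
  also have "\<dots> \<le> (\<Sum>r\<in>UNIV. \<Sum>p\<in>UNIV. S * (\<integral>u. (F r p u)\<^sup>2 \<partial>lborel)) * real CARD('m)"
    by (intro mult_right_mono sum_mono Sp) auto
  also have "\<dots> = real CARD('m) * S * (\<integral>u. (norm (step_fun gs u))\<^sup>2 \<partial>lborel)"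
    unfolding nSF using iso(2) by (simp add: Bochner_Integration.integral_sum Bochner_Integration.integrable_sum sum_distrib_left mult_ac)
  finally have "(\<integral>\<^sup>+\<omega>. ennreal ((norm (step_integral X gs \<omega>))\<^sup>2) \<partial>M)
      \<le> ennreal (real CARD('m) * S * (\<integral>u. (norm (step_fun gs u))\<^sup>2 \<partial>lborel))" by (simp add: ennreal_leI)
  also have "\<dots> = ennreal (real CARD('m) * S) * ennreal (\<integral>u. (norm (step_fun gs u))\<^sup>2 \<partial>lborel)"
    by (intro ennreal_mult mult_nonneg_nonneg) (auto simp: S_def intro!: sum_nonneg)
  also have "ennreal (\<integral>u. (norm (step_fun gs u))\<^sup>2 \<partial>lborel) = (\<integral>\<^sup>+u. ennreal ((norm (step_fun gs u))\<^sup>2) \<partial>lborel)"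
    using iF by (intro nn_integral_eq_integral[symmetric]) auto
  finally show ?thesis by (simp add: S_def)
qed

lemma ennreal_norm_split: "ennreal ((norm x)\<^sup>2) \<le> 2 * ennreal ((norm (x - y))\<^sup>2) + 2 * ennreal ((norm y)\<^sup>2)"
  for x y :: "'b::real_normed_vector"
proof -
  have "(norm x)\<^sup>2 \<le> 2 * (norm (x - y))\<^sup>2 + 2 * (norm y)\<^sup>2" using norm_add_power2_le[of "x - y" y] by simp
  then have "ennreal ((norm x)\<^sup>2) \<le> ennreal (2 * (norm (x - y))\<^sup>2 + 2 * (norm y)\<^sup>2)" by (rule ennreal_leI)
  then show ?thesis by (simp add: ennreal_mult)
qed

lemma nn_integral_norm_split:
  fixes f g :: "'a \<Rightarrow> 'b::{real_normed_vector, second_countable_topology}"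
  assumes [measurable]: "f \<in> borel_measurable M" "g \<in> borel_measurable M"
  shows "(\<integral>\<^sup>+\<omega>. ennreal ((norm (f \<omega>))\<^sup>2) \<partial>M)
    \<le> 2 * (\<integral>\<^sup>+\<omega>. ennreal ((norm (f \<omega> - g \<omega>))\<^sup>2) \<partial>M) + 2 * (\<integral>\<^sup>+\<omega>. ennreal ((norm (g \<omega>))\<^sup>2) \<partial>M)"
proof -
  have "(\<integral>\<^sup>+\<omega>. ennreal ((norm (f \<omega>))\<^sup>2) \<partial>M) \<le> (\<integral>\<^sup>+\<omega>. 2 * ennreal ((norm (f \<omega> - g \<omega>))\<^sup>2) + 2 * ennreal ((norm (g \<omega>))\<^sup>2) \<partial>M)"
    by (intro nn_integral_mono ennreal_norm_split)
  also have "\<dots> = 2 * (\<integral>\<^sup>+\<omega>. ennreal ((norm (f \<omega> - g \<omega>))\<^sup>2) \<partial>M) + 2 * (\<integral>\<^sup>+\<omega>. ennreal ((norm (g \<omega>))\<^sup>2) \<partial>M)"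
    by (subst nn_integral_add) (simp_all add: nn_integral_cmult)
  finally show ?thesis .
qed

text \<open>The bound for step functions is carried to the limit, with a factor 2 for each of the
  two comparisons with the approximating sequence.\<close>

lemma (in prob_space) levy_integral_second_moment:
  fixes X :: "real \<Rightarrow> 'a \<Rightarrow> real^'m" and f :: "real \<Rightarrow> real^'m^'d"
  assumes V: "vec_levy M X" and I: "has_levy_integral M X f I" and f: "f \<in> borel_measurable borel"
  shows "(\<integral>\<^sup>+\<omega>. ennreal ((norm (I \<omega>))\<^sup>2) \<partial>M)
    \<le> 4 * ennreal (real CARD('m) * (\<Sum>p\<in>UNIV. \<integral>\<omega>. (X 1 \<omega> $ p)\<^sup>2 \<partial>M)) * (\<integral>\<^sup>+u. ennreal ((norm (f u))\<^sup>2) \<partial>lborel)"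
proof -
  define K where "K = ennreal (real CARD('m) * (\<Sum>p\<in>UNIV. \<integral>\<omega>. (X 1 \<omega> $ p)\<^sup>2 \<partial>M))"
  define \<Phi> where "\<Phi> = (\<integral>\<^sup>+u. ennreal ((norm (f u))\<^sup>2) \<partial>lborel)"
  obtain gs where Im: "I \<in> borel_measurable M" and gs: "\<And>n. \<forall>(a, b, G)\<in>set (gs n). a \<le> b"
    and l1: "(\<lambda>n. \<integral>\<^sup>+u. ennreal ((norm (f u - step_fun (gs n) u))\<^sup>2) \<partial>lborel) \<longlonglongrightarrow> 0"
    and l2: "(\<lambda>n. \<integral>\<^sup>+\<omega>. ennreal ((norm (I \<omega> - step_integral X (gs n) \<omega>))\<^sup>2) \<partial>M) \<longlonglongrightarrow> 0"
    using I unfolding has_levy_integral_def by blast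
  have Xm: "X t \<in> borel_measurable M" for t using V levy_increment_distr(2) by (auto simp: vec_levy_def)
  have SIm: "step_integral X (gs n) \<in> borel_measurable M" for n
  proof -
    have "(\<lambda>\<omega>. G *v (X b \<omega> - X a \<omega>)) \<in> borel_measurable M" for G :: "real^'m^'d" and a b
      by (rule borel_measurable_continuous_on[where f="(*v) G"])
        (use Xm in \<open>auto intro!: linear_continuous_on matrix_vector_mul_bounded_linear\<close>)
    then show ?thesis unfolding step_integral_def[abs_def] sum_list_case3 by (intro borel_measurable_sum)
  qed
  have SFm: "step_fun (gs n) \<in> borel_measurable lborel" for n
    unfolding step_fun_def[abs_def] sum_list_case3 by (intro borel_measurable_sum) measurable
  have fm: "f \<in> borel_measurable lborel" using f by simp
  have bound: "(\<integral>\<^sup>+\<omega>. ennreal ((norm (I \<omega>))\<^sup>2) \<partial>M)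
      \<le> 2 * (\<integral>\<^sup>+\<omega>. ennreal ((norm (I \<omega> - step_integral X (gs n) \<omega>))\<^sup>2) \<partial>M)
        + 4 * K * (\<integral>\<^sup>+u. ennreal ((norm (f u - step_fun (gs n) u))\<^sup>2) \<partial>lborel) + 4 * K * \<Phi>" for n
  proof -
    have "(\<integral>\<^sup>+\<omega>. ennreal ((norm (step_integral X (gs n) \<omega>))\<^sup>2) \<partial>M) \<le> K * (\<integral>\<^sup>+u. ennreal ((norm (step_fun (gs n) u))\<^sup>2) \<partial>lborel)"
      unfolding K_def by (rule step_integral_second_moment[OF V gs])
    also have "\<dots> \<le> K * (2 * (\<integral>\<^sup>+u. ennreal ((norm (step_fun (gs n) u - f u))\<^sup>2) \<partial>lborel) + 2 * \<Phi>)"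
      unfolding \<Phi>_def by (intro mult_left_mono nn_integral_norm_split SFm fm) simp
    finally have SI2: "2 * (\<integral>\<^sup>+\<omega>. ennreal ((norm (step_integral X (gs n) \<omega>))\<^sup>2) \<partial>M)
      \<le> 2 * (K * (2 * (\<integral>\<^sup>+u. ennreal ((norm (step_fun (gs n) u - f u))\<^sup>2) \<partial>lborel) + 2 * \<Phi>))"
      by (rule mult_left_mono) simp
    have "2 * (K * (2 * d + 2 * \<Phi>)) = 4 * K * d + 4 * K * \<Phi>" for d
    proof -
      have "2 * (K * (2 * d)) = 4 * K * d" for d by (simp add: mult.assoc[symmetric]) (simp add: mult_ac)
      then show ?thesis by (simp add: distrib_left)
    qed
    note SI3 = SI2[unfolded this norm_minus_commute[of "step_fun (gs n) _"]]
    have "(\<integral>\<^sup>+\<omega>. ennreal ((norm (I \<omega>))\<^sup>2) \<partial>M)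
      \<le> 2 * (\<integral>\<^sup>+\<omega>. ennreal ((norm (I \<omega> - step_integral X (gs n) \<omega>))\<^sup>2) \<partial>M)
        + 2 * (\<integral>\<^sup>+\<omega>. ennreal ((norm (step_integral X (gs n) \<omega>))\<^sup>2) \<partial>M)"
      by (rule nn_integral_norm_split[OF Im SIm])
    also have "\<dots> \<le> 2 * (\<integral>\<^sup>+\<omega>. ennreal ((norm (I \<omega> - step_integral X (gs n) \<omega>))\<^sup>2) \<partial>M)
        + (4 * K * (\<integral>\<^sup>+u. ennreal ((norm (f u - step_fun (gs n) u))\<^sup>2) \<partial>lborel) + 4 * K * \<Phi>)"
      by (intro add_left_mono SI3)
    finally show ?thesis by (simp only: add.assoc)
  qed
  \<comment> \<open>Passing the limit through multiplication in the extended nonnegative reals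
    requires a finite constant.\<close>
  have Kf: "4 * K < \<top>" by (simp add: K_def ennreal_mult_less_top)
  have "(\<lambda>n. 2 * (\<integral>\<^sup>+\<omega>. ennreal ((norm (I \<omega> - step_integral X (gs n) \<omega>))\<^sup>2) \<partial>M)
        + 4 * K * (\<integral>\<^sup>+u. ennreal ((norm (f u - step_fun (gs n) u))\<^sup>2) \<partial>lborel) + 4 * K * \<Phi>) \<longlonglongrightarrow> 2 * 0 + 4 * K * 0 + 4 * K * \<Phi>"
    using Kf by (intro tendsto_add tendsto_const ennreal_tendsto_cmult l1 l2) auto
  then have "(\<integral>\<^sup>+\<omega>. ennreal ((norm (I \<omega>))\<^sup>2) \<partial>M) \<le> 2 * 0 + 4 * K * 0 + 4 * K * \<Phi>"
    by (rule LIMSEQ_le_const) (use bound in blast)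
  then show ?thesis by (simp add: K_def \<Phi>_def)
qed

lemma nn_integral_exp_half_line:
  fixes a t :: real
  assumes "a > 0"
  shows "(\<integral>\<^sup>+u. indicator {..t} u * ennreal (exp (- a * (t - u))) \<partial>lborel) = ennreal (1 / a)"
proof -
  interpret prob_space "density lborel (exponential_density a)" using assms by (rule prob_space_exponential_density)
  have one: "(\<integral>\<^sup>+u. ennreal (exponential_density a u) \<partial>lborel) = 1"
    using emeasure_space_1 by (simp add: emeasure_density)
  have "(\<integral>\<^sup>+u. indicator {..t} u * ennreal (exp (- a * (t - u))) \<partial>lborel)
      = (\<integral>\<^sup>+u. indicator {..t} (t + (-1) * u) * ennreal (exp (- a * (t - (t + (-1) * u)))) \<partial>lborel)"
    by (subst nn_integral_real_affine[where c="-1" and t=t]) simp_all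
  also have "\<dots> = (\<integral>\<^sup>+u. ennreal (1 / a) * ennreal (exponential_density a u) \<partial>lborel)"
    using assms by (intro nn_integral_cong) (auto simp: exponential_density_def indicator_def ennreal_mult[symmetric] mult.commute)
  also have "\<dots> = ennreal (1 / a)" by (simp add: nn_integral_cmult one)
  finally show ?thesis .
qed

text \<open>The constant does not depend on t, which bounds the second moments of the stationary
  part uniformly in time.\<close>

lemma nn_integral_mat_exp_kernel:
  fixes A :: "real^'k^'k" and B :: "real^'m^'k" and C :: "real^'k^'d"
  assumes ev: "\<And>z. complex_eigenvalue A z \<Longrightarrow> Re z < 0"
  shows "\<exists>K. \<forall>t. (\<lambda>u. indicator {..t} u *\<^sub>R (C ** mat_exp ((t - u) *\<^sub>R A) ** B)) \<in> borel_measurable borel \<and>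
    (\<integral>\<^sup>+u. ennreal ((norm (indicator {..t} u *\<^sub>R (C ** mat_exp ((t - u) *\<^sub>R A) ** B)))\<^sup>2) \<partial>lborel) \<le> ennreal K"
proof -
  obtain K a where a: "a > 0" and K: "\<And>s. s \<ge> 0 \<Longrightarrow> norm (mat_exp (s *\<^sub>R A)) \<le> K * exp (- a * s)"
    using mat_exp_decay[OF ev] by blast
  define c where "c = norm C * K * norm B"
  have le: "ennreal ((norm (indicator {..t} u *\<^sub>R (C ** mat_exp ((t - u) *\<^sub>R A) ** B)))\<^sup>2)
      \<le> ennreal (c\<^sup>2) * (indicator {..t} u * ennreal (exp (- (2 * a) * (t - u))))" for t u
  proof (cases "u \<le> t")
    case True
    have "norm (C ** mat_exp ((t - u) *\<^sub>R A) ** B) \<le> norm C * norm (mat_exp ((t - u) *\<^sub>R A)) * norm B"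
      by (intro order_trans[OF norm_matrix_mult_le] mult_right_mono norm_matrix_mult_le) simp
    also have "\<dots> \<le> norm C * (K * exp (- a * (t - u))) * norm B"
      using True by (intro mult_right_mono mult_left_mono K) auto
    also have "\<dots> = c * exp (- a * (t - u))" by (simp add: c_def)
    finally have "(norm (C ** mat_exp ((t - u) *\<^sub>R A) ** B))\<^sup>2 \<le> (c * exp (- a * (t - u)))\<^sup>2" by (intro power_mono) auto
    also have "\<dots> = c\<^sup>2 * exp (- (2 * a) * (t - u))" by (simp add: power_mult_distrib exp_double[symmetric] algebra_simps)
    finally show ?thesis using True by (simp add: ennreal_mult[symmetric] ennreal_leI)
  qed simp
  show ?thesis
  proof (intro exI[of _ "c\<^sup>2 * (1 / (2 * a))"] allI conjI)
    fix t :: real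
    have "continuous_on UNIV (\<lambda>u. C ** mat_exp ((t - u) *\<^sub>R A) ** B)"
      by (intro continuous_on_matrix_mult continuous_on_const continuous_on_compose2[OF continuous_on_mat_exp[of UNIV]]
          continuous_intros subset_UNIV)
    then show "(\<lambda>u. indicator {..t} u *\<^sub>R (C ** mat_exp ((t - u) *\<^sub>R A) ** B)) \<in> borel_measurable borel"
      by (intro borel_measurable_scaleR borel_measurable_continuous_onI borel_measurable_indicator) auto
    have "(\<integral>\<^sup>+u. ennreal ((norm (indicator {..t} u *\<^sub>R (C ** mat_exp ((t - u) *\<^sub>R A) ** B)))\<^sup>2) \<partial>lborel)
      \<le> (\<integral>\<^sup>+u. ennreal (c\<^sup>2) * (indicator {..t} u * ennreal (exp (- (2 * a) * (t - u)))) \<partial>lborel)"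
      by (intro nn_integral_mono le)
    also have "\<dots> = ennreal (c\<^sup>2) * ennreal (1 / (2 * a))"
      using a by (subst nn_integral_cmult) (simp_all only: nn_integral_exp_half_line, measurable)
    also have "\<dots> = ennreal (c\<^sup>2 * (1 / (2 * a)))" using a by (simp add: ennreal_mult[symmetric])
    finally show "(\<integral>\<^sup>+u. ennreal ((norm (indicator {..t} u *\<^sub>R (C ** mat_exp ((t - u) *\<^sub>R A) ** B)))\<^sup>2) \<partial>lborel)
      \<le> ennreal (c\<^sup>2 * (1 / (2 * a)))" .
  qed
qed

section \<open>Divergence of the trend energy\<close>

text \<open>Chebyshev's inequality; pairwise independence removes the cross terms of the variance,
  which leaves an explicit rate in J.\<close>

lemma (in prob_space) independent_mean_deviation:
  fixes \<zeta> :: "nat \<Rightarrow> 'a \<Rightarrow> real"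
  assumes meas: "\<And>j. \<zeta> j \<in> borel_measurable M" and int: "\<And>j. integrable M (\<lambda>\<omega>. (\<zeta> j \<omega>)\<^sup>2)"
    and mean: "\<And>j. (\<integral>\<omega>. \<zeta> j \<omega> \<partial>M) = g" and m: "\<And>j. (\<integral>\<omega>. (\<zeta> j \<omega>)\<^sup>2 \<partial>M) \<le> m"
    and ind: "\<And>i j. i < J \<Longrightarrow> j < J \<Longrightarrow> i \<noteq> j \<Longrightarrow> indep_var borel (\<zeta> i) borel (\<zeta> j)"
    and J: "0 < J" and \<tau>: "0 < \<tau>"
  shows "prob {\<omega> \<in> space M. \<tau> \<le> \<bar>(\<Sum>j<J. \<zeta> j \<omega>) / real J - g\<bar>} \<le> m / (real J * \<tau>\<^sup>2)"
proof -
  define \<eta> where "\<eta> j \<omega> = \<zeta> j \<omega> - g" for j \<omega>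
  define f where "f \<omega> = (\<Sum>j<J. \<zeta> j \<omega>) / real J" for \<omega>
  have i\<zeta>: "integrable M (\<zeta> j)" for j by (rule square_integrable_imp_integrable[OF meas int])
  have i\<eta>: "integrable M (\<eta> j)" for j using i\<zeta> by (simp add: \<eta>_def[abs_def])
  have m\<eta>: "(\<integral>\<omega>. \<eta> j \<omega> \<partial>M) = 0" for j using i\<zeta> by (simp add: \<eta>_def mean prob_space)
  have i2: "integrable M (\<lambda>\<omega>. \<eta> j \<omega> * \<eta> j \<omega>)" and e2: "(\<integral>\<omega>. \<eta> j \<omega> * \<eta> j \<omega> \<partial>M) \<le> m" for j
  proof -
    have eq: "\<eta> j \<omega> * \<eta> j \<omega> = (\<zeta> j \<omega>)\<^sup>2 - 2 * g * \<zeta> j \<omega> + g\<^sup>2" for \<omega>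
      by (simp add: \<eta>_def power2_eq_square algebra_simps)
    show "integrable M (\<lambda>\<omega>. \<eta> j \<omega> * \<eta> j \<omega>)" unfolding eq using int i\<zeta> by simp
    have "(\<integral>\<omega>. \<eta> j \<omega> * \<eta> j \<omega> \<partial>M) = (\<integral>\<omega>. (\<zeta> j \<omega>)\<^sup>2 \<partial>M) - g\<^sup>2"
      unfolding eq using int i\<zeta> by (simp add: mean prob_space power2_eq_square)
    then show "(\<integral>\<omega>. \<eta> j \<omega> * \<eta> j \<omega> \<partial>M) \<le> m" using m[of j] zero_le_power2[of g] by linarith
  qed
  have cross: "integrable M (\<lambda>\<omega>. \<eta> i \<omega> * \<eta> j \<omega>)" "(\<integral>\<omega>. \<eta> i \<omega> * \<eta> j \<omega> \<partial>M) = 0" if "i < J" "j < J" "i \<noteq> j" for i j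
  proof -
    have "indep_var borel ((\<lambda>v. v - g) \<circ> \<zeta> i) borel ((\<lambda>v. v - g) \<circ> \<zeta> j)"
      by (rule indep_var_compose[OF ind[OF that]]) auto
    then have ij: "indep_var borel (\<eta> i) borel (\<eta> j)" by (simp add: \<eta>_def[abs_def] comp_def)
    show "integrable M (\<lambda>\<omega>. \<eta> i \<omega> * \<eta> j \<omega>)" by (rule indep_var_integrable[OF ij i\<eta> i\<eta>])
    show "(\<integral>\<omega>. \<eta> i \<omega> * \<eta> j \<omega> \<partial>M) = 0" using indep_var_lebesgue_integral[OF ij i\<eta> i\<eta>] by (simp add: m\<eta>)
  qed
  have i\<eta>\<eta>: "integrable M (\<lambda>\<omega>. \<eta> i \<omega> * \<eta> j \<omega>)" if "i < J" "j < J" for i j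
    using cross(1)[OF that] i2[of i] by (cases "i = j") auto
  have fg: "(f \<omega> - g)\<^sup>2 = (\<Sum>i<J. \<Sum>j<J. \<eta> i \<omega> * \<eta> j \<omega>) / (real J)\<^sup>2" for \<omega>
  proof -
    have "f \<omega> - g = (\<Sum>j<J. \<eta> j \<omega>) / real J" using J by (simp add: f_def \<eta>_def sum_subtractf diff_divide_distrib)
    then show ?thesis by (simp add: power_divide power2_eq_square sum_product)
  qed
  have ifg: "integrable M (\<lambda>\<omega>. (f \<omega> - g)\<^sup>2)"
    unfolding fg by (intro integrable_divide Bochner_Integration.integrable_sum i\<eta>\<eta>) auto
  have "(\<integral>\<omega>. (f \<omega> - g)\<^sup>2 \<partial>M) = (\<Sum>i<J. \<Sum>j<J. (\<integral>\<omega>. \<eta> i \<omega> * \<eta> j \<omega> \<partial>M)) / (real J)\<^sup>2"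
  proof -
    have "(\<integral>\<omega>. (\<Sum>i<J. \<Sum>j<J. \<eta> i \<omega> * \<eta> j \<omega>) \<partial>M) = (\<Sum>i<J. \<integral>\<omega>. (\<Sum>j<J. \<eta> i \<omega> * \<eta> j \<omega>) \<partial>M)"
      by (intro Bochner_Integration.integral_sum Bochner_Integration.integrable_sum i\<eta>\<eta>) auto
    also have "\<dots> = (\<Sum>i<J. \<Sum>j<J. (\<integral>\<omega>. \<eta> i \<omega> * \<eta> j \<omega> \<partial>M))"
      by (intro sum.cong refl Bochner_Integration.integral_sum i\<eta>\<eta>) auto
    finally show ?thesis unfolding fg integral_divide_zero by simp
  qed
  also have "(\<Sum>i<J. \<Sum>j<J. (\<integral>\<omega>. \<eta> i \<omega> * \<eta> j \<omega> \<partial>M)) = (\<Sum>i<J. (\<integral>\<omega>. \<eta> i \<omega> * \<eta> i \<omega> \<partial>M))"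
  proof (rule sum.cong[OF refl])
    fix i assume i: "i \<in> {..<J}"
    have "(\<Sum>j<J. (\<integral>\<omega>. \<eta> i \<omega> * \<eta> j \<omega> \<partial>M)) = (\<Sum>j<J. if j = i then (\<integral>\<omega>. \<eta> i \<omega> * \<eta> i \<omega> \<partial>M) else 0)"
      using i cross(2)[of i] by (intro sum.cong) auto
    then show "(\<Sum>j<J. (\<integral>\<omega>. \<eta> i \<omega> * \<eta> j \<omega> \<partial>M)) = (\<integral>\<omega>. \<eta> i \<omega> * \<eta> i \<omega> \<partial>M)" using i by simp
  qed
  also have "\<dots> \<le> (\<Sum>i<J. m)" by (intro sum_mono e2)
  finally have var: "(\<integral>\<omega>. (f \<omega> - g)\<^sup>2 \<partial>M) \<le> m / real J"
    using J by (simp add: power2_eq_square divide_right_mono)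
  have fm: "f \<in> borel_measurable M" unfolding f_def[abs_def] using meas by measurable
  have if1: "integrable M f" unfolding f_def[abs_def] using i\<zeta> by simp
  have Ef: "(\<integral>\<omega>. f \<omega> \<partial>M) = g" unfolding f_def using i\<zeta> J by (simp add: mean)
  have if2: "integrable M (\<lambda>\<omega>. f \<omega> ^ 2)"
  proof -
    have "integrable M (\<lambda>\<omega>. (f \<omega> - g)\<^sup>2 + 2 * g * f \<omega> - g\<^sup>2)" using ifg if1 by simp
    also have "(\<lambda>\<omega>. (f \<omega> - g)\<^sup>2 + 2 * g * f \<omega> - g\<^sup>2) = (\<lambda>\<omega>. f \<omega> ^ 2)"
      by (rule ext) (simp add: power2_eq_square algebra_simps)
    finally show ?thesis .
  qed
  have "prob {\<omega> \<in> space M. \<tau> \<le> \<bar>f \<omega> - g\<bar>} \<le> (\<integral>\<omega>. (f \<omega> - g)\<^sup>2 \<partial>M) / \<tau>\<^sup>2"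
    using Chebyshev_inequality[OF fm if2 \<tau>] by (simp add: Ef)
  also have "\<dots> \<le> (m / real J) / \<tau>\<^sup>2" by (intro divide_right_mono var) simp
  finally show ?thesis by (simp add: f_def)
qed

text \<open>Closeness of the finitely many entries of the sample second moments controls the form at
  every v, with error at most \<open>\<tau>\<close> times the squared sum of the
  \<open>\<bar>v $ p\<bar>\<close>. Applied to the rows of N this serves all matrices at once, so
  the good event will not depend on the parameter.\<close>

lemma quadratic_sample_bound:
  fixes D :: "nat \<Rightarrow> real^'m" and N :: "real^'m^'d" and g :: "'m \<Rightarrow> 'm \<Rightarrow> real"
  assumes g: "\<And>v. \<mu> * (norm v)\<^sup>2 \<le> (\<Sum>p\<in>UNIV. \<Sum>q\<in>UNIV. v $ p * v $ q * g p q)"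
    and dev: "\<And>p q. \<bar>(\<Sum>j<J. D j $ p * D j $ q) / real J - g p q\<bar> \<le> \<tau>" and J: "0 < J"
  shows "real J * (\<mu> - real CARD('m) * \<tau>) * (norm N)\<^sup>2 \<le> (\<Sum>j<J. (norm (N *v D j))\<^sup>2)"
proof -
  have \<tau>: "0 \<le> \<tau>" using order_trans[OF abs_ge_zero dev] .
  define G where "G p q = (\<Sum>j<J. D j $ p * D j $ q) / real J" for p q
  have row: "real J * (\<mu> - real CARD('m) * \<tau>) * (norm v)\<^sup>2 \<le> (\<Sum>j<J. (v \<bullet> D j)\<^sup>2)" for v :: "real^'m"
  proof -
    have "(\<Sum>j<J. (v \<bullet> D j)\<^sup>2) = (\<Sum>j<J. \<Sum>p\<in>UNIV. \<Sum>q\<in>UNIV. v $ p * v $ q * (D j $ p * D j $ q))"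
      by (simp add: power2_eq_square inner_vec_def sum_product mult_ac)
    also have "\<dots> = (\<Sum>p\<in>UNIV. \<Sum>q\<in>UNIV. v $ p * v $ q * (\<Sum>j<J. D j $ p * D j $ q))"
      by (subst sum.swap, intro sum.cong refl, subst sum.swap) (simp add: sum_distrib_left)
    also have "\<dots> = real J * (\<Sum>p\<in>UNIV. \<Sum>q\<in>UNIV. v $ p * v $ q * G p q)"
    proof -
      have "(\<Sum>j<J. D j $ p * D j $ q) = real J * G p q" for p q using J by (simp add: G_def)
      then show ?thesis by (simp add: sum_distrib_left mult_ac)
    qed
    finally have eq: "(\<Sum>j<J. (v \<bullet> D j)\<^sup>2) = real J * (\<Sum>p\<in>UNIV. \<Sum>q\<in>UNIV. v $ p * v $ q * G p q)" .
    have "(\<Sum>p\<in>UNIV. \<Sum>q\<in>UNIV. v $ p * v $ q * g p q) - (\<Sum>p\<in>UNIV. \<Sum>q\<in>UNIV. v $ p * v $ q * G p q)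
        = (\<Sum>p\<in>UNIV. \<Sum>q\<in>UNIV. v $ p * v $ q * (g p q - G p q))"
      by (simp add: sum_subtractf right_diff_distrib)
    also have "\<dots> \<le> (\<Sum>p\<in>UNIV. \<Sum>q\<in>UNIV. \<bar>v $ p\<bar> * \<bar>v $ q\<bar> * \<tau>)"
    proof (intro sum_mono)
      fix p q
      have "v $ p * v $ q * (g p q - G p q) \<le> \<bar>v $ p * v $ q * (g p q - G p q)\<bar>" by simp
      also have "\<dots> = \<bar>v $ p\<bar> * \<bar>v $ q\<bar> * \<bar>G p q - g p q\<bar>" by (simp add: abs_mult abs_minus_commute)
      also have "\<dots> \<le> \<bar>v $ p\<bar> * \<bar>v $ q\<bar> * \<tau>" unfolding G_def by (intro mult_left_mono dev) simp
      finally show "v $ p * v $ q * (g p q - G p q) \<le> \<bar>v $ p\<bar> * \<bar>v $ q\<bar> * \<tau>" .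
    qed
    also have "\<dots> = (\<Sum>p\<in>UNIV. \<bar>v $ p\<bar>)\<^sup>2 * \<tau>"
      unfolding power2_eq_square sum_product by (simp add: sum_distrib_right)
    also have "\<dots> \<le> ((\<Sum>p\<in>UNIV. \<bar>v $ p\<bar>\<^sup>2) * real CARD('m)) * \<tau>"
      by (intro mult_right_mono sum_squared_le_sum_of_squares \<tau>)
    also have "(\<Sum>p\<in>UNIV. \<bar>v $ p\<bar>\<^sup>2) = (norm v)\<^sup>2" by (simp add: norm_vec_def L2_set_def sum_nonneg)
    finally have "\<mu> * (norm v)\<^sup>2 - (norm v)\<^sup>2 * real CARD('m) * \<tau> \<le> (\<Sum>p\<in>UNIV. \<Sum>q\<in>UNIV. v $ p * v $ q * G p q)"
      using g[of v] by linarith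
    then have "(\<mu> - real CARD('m) * \<tau>) * (norm v)\<^sup>2 \<le> (\<Sum>p\<in>UNIV. \<Sum>q\<in>UNIV. v $ p * v $ q * G p q)"
      by (simp add: algebra_simps)
    then show ?thesis unfolding eq mult.assoc using J by (intro mult_left_mono) auto
  qed
  have "real J * (\<mu> - real CARD('m) * \<tau>) * (norm N)\<^sup>2 = (\<Sum>i\<in>UNIV. real J * (\<mu> - real CARD('m) * \<tau>) * (norm (N $ i))\<^sup>2)"
    by (simp add: norm_vec_def[of N] L2_set_def sum_nonneg sum_distrib_left)
  also have "\<dots> \<le> (\<Sum>i\<in>UNIV. \<Sum>j<J. (N $ i \<bullet> D j)\<^sup>2)" by (intro sum_mono row)
  also have "\<dots> = (\<Sum>j<J. (norm (N *v D j))\<^sup>2)"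
    by (subst sum.swap) (simp add: norm_vec_def L2_set_def sum_nonneg matrix_vector_mul_component)
  finally show ?thesis .
qed

text \<open>Differencing at lag \<open>b\<close> removes the unknown starting level of a block.\<close>

lemma block_differences_energy:
  fixes x :: "nat \<Rightarrow> 'b::real_normed_vector"
  assumes n: "b * Suc J \<le> n"
  shows "(\<Sum>r<b. \<Sum>j<J. (norm (x (b * Suc j + r + 1) - x (b * j + r + 1)))\<^sup>2) \<le> 4 * (\<Sum>k=1..n. (norm (x k))\<^sup>2)"
proof -
  define d where "d k = (norm (x (k + b + 1) - x (k + 1)))\<^sup>2" for k
  have "(\<Sum>r<b. \<Sum>j<J. (norm (x (b * Suc j + r + 1) - x (b * j + r + 1)))\<^sup>2) = (\<Sum>j<J. \<Sum>r<b. d (j * b + r))"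
    by (subst sum.swap) (simp add: d_def algebra_simps)
  also have "\<dots> = (\<Sum>j<J. sum d {j * b..<j * b + b})"
    by (intro sum.cong refl sum.reindex_bij_witness[of _ "\<lambda>k. k - j * b" "\<lambda>r. j * b + r" for j]) auto
  also have "\<dots> = sum d {..<J * b}" by (rule sum.nat_group)
  also have "\<dots> \<le> (\<Sum>k<J * b. 2 * (norm (x (k + b + 1)))\<^sup>2 + 2 * (norm (x (k + 1)))\<^sup>2)"
    unfolding d_def using norm_add_power2_le[of "x (k + b + 1)" "- x (k + 1)" for k] by (intro sum_mono) simp
  also have "\<dots> = 2 * (\<Sum>k<J * b. (norm (x (k + b + 1)))\<^sup>2) + 2 * (\<Sum>k<J * b. (norm (x (k + 1)))\<^sup>2)"
    by (simp add: sum.distrib sum_distrib_left)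
  also have "(\<Sum>k<J * b. (norm (x (k + b + 1)))\<^sup>2) = (\<Sum>k\<in>(\<lambda>k. k + b + 1) ` {..<J * b}. (norm (x k))\<^sup>2)"
    by (subst sum.reindex) (auto simp: inj_on_def)
  also have "\<dots> \<le> (\<Sum>k=1..n. (norm (x k))\<^sup>2)" using n by (intro sum_mono2) (auto simp: mult.commute)
  also have "(\<Sum>k<J * b. (norm (x (k + 1)))\<^sup>2) = (\<Sum>k\<in>(\<lambda>k. k + 1) ` {..<J * b}. (norm (x k))\<^sup>2)"
    by (subst sum.reindex) (auto simp: inj_on_def)
  also have "\<dots> \<le> (\<Sum>k=1..n. (norm (x k))\<^sup>2)" using n by (intro sum_mono2) (auto simp: mult.commute)
  finally show ?thesis by simp
qed

text \<open>For each residue r modulo b the increments at lag b are independent and of equal length,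
  so the weak law applies to their second moments. The good event asks for this at finitely many
  residues and pairs of coordinates.\<close>

lemma (in prob_space) trend_energy_diverges:
  fixes X :: "real \<Rightarrow> 'a \<Rightarrow> real^'m"
  assumes V: "vec_levy M X" and h: "0 < h"
    and \<mu>: "0 < \<mu>" "\<And>v. \<mu> * (norm v)\<^sup>2 \<le> (\<integral>\<omega>. (v \<bullet> X 1 \<omega>)\<^sup>2 \<partial>M)"
  shows "\<exists>G N. (\<forall>n. G n \<in> events) \<and> (\<lambda>n. prob (G n)) \<longlonglongrightarrow> 1 \<and>
    (\<forall>n\<ge>N. \<forall>\<omega>\<in>G n. \<forall>B :: real^'m^'d. \<kappa> * (norm B)\<^sup>2 * real n \<le> (\<Sum>k=1..n. (norm (B *v X (real k * h) \<omega>))\<^sup>2))"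
proof -
  have L: "two_sided_levy M X" using V by (simp add: vec_levy_def)
  note [measurable] = levy_increment_distr(2)[OF L]
  \<comment> \<open>The 16 is made of 4 for passing from levels to differences, 2 for the inaccuracy
    of the sample moments and 2 for the observations outside the J blocks. The maximum with 0 keeps
    b positive for any \<open>\<kappa>\<close>.\<close>
  obtain b :: nat where b: "max 0 (16 * \<kappa> / (h * \<mu>)) < real b" using reals_Archimedean2 by blast
  then have b0: "0 < b" by simp
  define H where "H = real b * h"
  have H: "0 < H" using b0 h by (simp add: H_def)
  \<comment> \<open>Chosen so that the error term of the sample bound uses up half of
    \<open>H * \<mu>\<close>.\<close>
  define \<tau> where "\<tau> = H * \<mu> / (2 * real CARD('m))"
  have \<tau>: "0 < \<tau>" using H \<mu> by (simp add: \<tau>_def)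
  define g where "g p q = (\<integral>\<omega>. (X H \<omega> - X 0 \<omega>) $ p * (X H \<omega> - X 0 \<omega>) $ q \<partial>M)" for p q
  \<comment> \<open>The shift by 1 starts the sampling times at h, to match sums from k = 1.\<close>
  define t where "t r j = real (b * j + r + 1) * h" for r j
  define D where "D r j \<omega> = X (t r (Suc j)) \<omega> - X (t r j) \<omega>" for r j \<omega>
  have tH: "t r (Suc j) - t r j = H - 0" for r j by (simp add: t_def H_def algebra_simps)
  have pq: "(\<lambda>v :: real^'m. v $ p * v $ q) \<in> borel_measurable borel" for p q
    by (intro borel_measurable_continuous_onI continuous_intros)
  have sq: "(\<lambda>v :: real^'m. (v $ p * v $ q)\<^sup>2) \<in> borel_measurable borel" for p q using pq by measurable
  have comp: "(\<lambda>t \<omega>. axis p 1 \<bullet> X t \<omega>) = (\<lambda>t \<omega>. X t \<omega> $ p)" for p by (simp add: inner_axis')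
  have RL: "real_levy M (\<lambda>t \<omega>. X t \<omega> $ p)" for p using vec_levy_inner[OF V, of "axis p 1"] unfolding comp .
  define m4 where "m4 = (\<Sum>p\<in>UNIV. \<Sum>q\<in>UNIV. \<integral>\<omega>. ((X H \<omega> - X 0 \<omega>) $ p * (X H \<omega> - X 0 \<omega>) $ q)\<^sup>2 \<partial>M)"
  have XH: "(\<lambda>\<omega>. X H \<omega> - X 0 \<omega>) \<in> borel_measurable M" by measurable
  have i4: "integrable M (\<lambda>\<omega>. ((X H \<omega> - X 0 \<omega>) $ p * (X H \<omega> - X 0 \<omega>) $ q)\<^sup>2)" for p q
  proof (rule Bochner_Integration.integrable_bound)
    show "integrable M (\<lambda>\<omega>. (X H \<omega> $ p - X 0 \<omega> $ p) ^ 4 + (X H \<omega> $ q - X 0 \<omega> $ q) ^ 4)"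
      by (intro Bochner_Integration.integrable_add real_levy_integrable4[OF RL])
    have "(y * z)\<^sup>2 \<le> y ^ 4 + z ^ 4" for y z :: real
    proof -
      have "2 * (y\<^sup>2 * z\<^sup>2) \<le> (y\<^sup>2)\<^sup>2 + (z\<^sup>2)\<^sup>2" using sum_squares_bound[of "y\<^sup>2" "z\<^sup>2"] by simp
      moreover have "0 \<le> y\<^sup>2 * z\<^sup>2" by simp
      ultimately have "y\<^sup>2 * z\<^sup>2 \<le> (y\<^sup>2)\<^sup>2 + (z\<^sup>2)\<^sup>2" by linarith
      then show ?thesis by (simp add: power_mult_distrib flip: power_mult)
    qed
    then show "AE \<omega> in M. norm (((X H \<omega> - X 0 \<omega>) $ p * (X H \<omega> - X 0 \<omega>) $ q)\<^sup>2)
        \<le> norm ((X H \<omega> $ p - X 0 \<omega> $ p) ^ 4 + (X H \<omega> $ q - X 0 \<omega> $ q) ^ 4)" by (intro AE_I2) simp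
    from measurable_compose[OF XH sq]
    show "(\<lambda>\<omega>. ((X H \<omega> - X 0 \<omega>) $ p * (X H \<omega> - X 0 \<omega>) $ q)\<^sup>2) \<in> borel_measurable M" .
  qed
  have DM: "D r j \<in> borel_measurable M" for r j unfolding D_def[abs_def] by measurable
  have \<zeta>m: "(\<lambda>\<omega>. D r j \<omega> $ p * D r j \<omega> $ q) \<in> borel_measurable M" for r j p q
    using measurable_compose[OF DM pq] .
  have \<zeta>2: "integrable M (\<lambda>\<omega>. (D r j \<omega> $ p * D r j \<omega> $ q)\<^sup>2)" for r j p q
    using levy_increment_transfer(1)[OF L sq tH] i4 unfolding D_def by blast
  have \<zeta>e: "(\<integral>\<omega>. D r j \<omega> $ p * D r j \<omega> $ q \<partial>M) = g p q" for r j p q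
    using levy_increment_transfer(2)[OF L pq tH] unfolding D_def g_def by blast
  have \<zeta>4: "(\<integral>\<omega>. (D r j \<omega> $ p * D r j \<omega> $ q)\<^sup>2 \<partial>M) \<le> m4" for r j p q
  proof -
    have "(\<integral>\<omega>. (D r j \<omega> $ p * D r j \<omega> $ q)\<^sup>2 \<partial>M) = (\<integral>\<omega>. ((X H \<omega> - X 0 \<omega>) $ p * (X H \<omega> - X 0 \<omega>) $ q)\<^sup>2 \<partial>M)"
      using levy_increment_transfer(2)[OF L sq tH] unfolding D_def by blast
    also have "\<dots> \<le> (\<Sum>q\<in>UNIV. \<integral>\<omega>. ((X H \<omega> - X 0 \<omega>) $ p * (X H \<omega> - X 0 \<omega>) $ q)\<^sup>2 \<partial>M)"
      by (rule member_le_sum) auto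
    also have "\<dots> \<le> m4" unfolding m4_def
      by (rule member_le_sum[of p UNIV "\<lambda>p. \<Sum>q\<in>UNIV. \<integral>\<omega>. ((X H \<omega> - X 0 \<omega>) $ p * (X H \<omega> - X 0 \<omega>) $ q)\<^sup>2 \<partial>M"])
        (auto intro!: sum_nonneg)
    finally show ?thesis .
  qed
  have ind: "indep_var borel (\<lambda>\<omega>. D r i \<omega> $ p * D r i \<omega> $ q) borel (\<lambda>\<omega>. D r j \<omega> $ p * D r j \<omega> $ q)"
    if "i < J" "j < J" "i \<noteq> j" for r i j p q J
  proof -
    have "\<forall>i<J. t r i < t r (Suc i)" using b0 h by (simp add: t_def)
    then have "indep_vars (\<lambda>_. borel) (\<lambda>i \<omega>. X (t r (Suc i)) \<omega> - X (t r i) \<omega>) {..<J}"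
      using L unfolding two_sided_levy_def by blast
    then have "indep_vars (\<lambda>_. borel) (\<lambda>i. D r i) {..<J}" by (simp only: D_def[abs_def])
    then have "indep_vars (\<lambda>_. borel) (\<lambda>i \<omega>. D r i \<omega> $ p * D r i \<omega> $ q) {..<J}"
      by (rule indep_vars_compose2) (rule pq)
    then show ?thesis by (rule indep_vars_pair) (use that in auto)
  qed
  define bad where "bad r p q J = {\<omega> \<in> space M. \<tau> \<le> \<bar>(\<Sum>j<J. D r j \<omega> $ p * D r j \<omega> $ q) / real J - g p q\<bar>}" for r p q J
  have bad_prob: "prob (bad r p q J) \<le> m4 / (real J * \<tau>\<^sup>2)" if "0 < J" for r p q J
    unfolding bad_def by (rule independent_mean_deviation[OF \<zeta>m \<zeta>2 \<zeta>e \<zeta>4 ind that \<tau>])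
  have bad_ev: "bad r p q J \<in> events" for r p q J unfolding bad_def using \<zeta>m by measurable
  \<comment> \<open>One block is held back because the last difference reaches one lag
    further.\<close>
  define J where "J n = n div b - 1" for n
  define I where "I = {..<b} \<times> (UNIV :: 'm set) \<times> (UNIV :: 'm set)"
  have fI: "finite I" by (simp add: I_def)
  define G where "G n = space M - (\<Union>(r, p, q)\<in>I. bad r p q (J n))" for n
  have bad_UN: "(\<Union>(r, p, q)\<in>I. bad r p q (J n)) \<in> events" for n
    by (intro sets.finite_UN fI) (simp add: bad_ev case_prod_unfold)
  then have G_ev: "G n \<in> events" for n unfolding G_def by (rule sets.compl_sets)
  \<comment> \<open>Fewer than 2 b observations lie outside the J blocks, and from n = 4 b on these
    blocks hold at least as many.\<close>
  have bJ: "b * Suc (J n) \<le> n" "real n \<le> 2 * (real b * real (J n))" "0 < J n" if n: "4 * b \<le> n" for n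
  proof -
    have d: "4 \<le> n div b" using div_le_mono[OF n, of b] b0 by simp
    have e: "b * (n div b) + n mod b = n" by (rule mult_div_mod_eq)
    have S: "Suc (J n) = n div b" using d by (simp add: J_def)
    show "b * Suc (J n) \<le> n" unfolding S using e by linarith
    show "0 < J n" using d by (simp add: J_def)
    have "n < b * Suc (J n) + b" unfolding S using e mod_less_divisor[OF b0, of n] by linarith
    moreover have "b * 2 \<le> b * J n" using d by (intro mult_left_mono) (auto simp: J_def)
    ultimately have "n \<le> 2 * (b * J n)" unfolding mult_Suc_right by linarith
    then have "real n \<le> real (2 * (b * J n))" by (rule of_nat_mono)
    then show "real n \<le> 2 * (real b * real (J n))" by simp
  qed
  have prob_ge: "1 - real (card I) * (m4 / (real (J n) * \<tau>\<^sup>2)) \<le> prob (G n)" if n: "4 * b \<le> n" for n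
  proof -
    have "prob (\<Union>(r, p, q)\<in>I. bad r p q (J n)) \<le> (\<Sum>(r, p, q)\<in>I. prob (bad r p q (J n)))"
      using finite_measure_subadditive_finite[OF fI, of "\<lambda>(r, p, q). bad r p q (J n)"] bad_ev
      by (simp add: case_prod_unfold image_subset_iff)
    also have "\<dots> \<le> (\<Sum>_\<in>I. m4 / (real (J n) * \<tau>\<^sup>2))"
      using bad_prob[OF bJ(3)[OF n]] by (intro sum_mono) (simp add: case_prod_unfold)
    finally have "prob (\<Union>(r, p, q)\<in>I. bad r p q (J n)) \<le> real (card I) * (m4 / (real (J n) * \<tau>\<^sup>2))" by simp
    moreover have "prob (G n) = 1 - prob (\<Union>(r, p, q)\<in>I. bad r p q (J n))"
      unfolding G_def by (rule prob_compl[OF bad_UN])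
    ultimately show ?thesis by linarith
  qed
  have "filterlim J at_top sequentially"
  proof (rule filterlim_at_top[THEN iffD2, rule_format])
    fix Z
    show "\<forall>\<^sub>F n in sequentially. Z \<le> J n"
      using eventually_ge_at_top[of "b * (Z + 1)"]
    proof eventually_elim
      case (elim n)
      have "Z + 1 \<le> n div b" using div_le_mono[OF elim, of b] b0 by simp
      then show ?case by (simp add: J_def)
    qed
  qed
  then have "filterlim (\<lambda>n. real (J n)) at_top sequentially" by (rule filterlim_compose[OF filterlim_real_sequentially])
  then have "filterlim (\<lambda>n. \<tau>\<^sup>2 * real (J n)) at_top sequentially" using \<tau> by (intro filterlim_tendsto_pos_mult_at_top[OF tendsto_const]) auto
  then have "(\<lambda>n. m4 / (\<tau>\<^sup>2 * real (J n))) \<longlonglongrightarrow> 0" by (rule tendsto_divide_0[OF tendsto_const filterlim_at_top_imp_at_infinity])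
  then have lim: "(\<lambda>n. 1 - real (card I) * (m4 / (real (J n) * \<tau>\<^sup>2))) \<longlonglongrightarrow> 1 - real (card I) * 0"
    by (intro tendsto_intros) (simp add: mult.commute)
  have G_lim: "(\<lambda>n. prob (G n)) \<longlonglongrightarrow> 1"
  proof (rule tendsto_sandwich[where h="\<lambda>_. 1"])
    show "\<forall>\<^sub>F n in sequentially. 1 - real (card I) * (m4 / (real (J n) * \<tau>\<^sup>2)) \<le> prob (G n)"
      using eventually_ge_at_top[of "4 * b"] by eventually_elim (rule prob_ge)
    show "(\<lambda>n. 1 - real (card I) * (m4 / (real (J n) * \<tau>\<^sup>2))) \<longlonglongrightarrow> 1" using lim by simp
  qed simp_all
  \<comment> \<open>The variance is linear in time, so the lower bound \<open>\<mu>\<close> at time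
    1 becomes \<open>H * \<mu>\<close> at lag H.\<close>
  have gq: "(H * \<mu>) * (norm v)\<^sup>2 \<le> (\<Sum>p\<in>UNIV. \<Sum>q\<in>UNIV. v $ p * v $ q * g p q)" for v
  proof -
    have i2: "integrable M (\<lambda>\<omega>. (X H \<omega> - X 0 \<omega>) $ p * (X H \<omega> - X 0 \<omega>) $ q)" for p q
      by (rule square_integrable_imp_integrable[OF measurable_compose[OF XH pq] i4])
    have "H * \<mu> * (norm v)\<^sup>2 \<le> H * (\<integral>\<omega>. (v \<bullet> X 1 \<omega>)\<^sup>2 \<partial>M)"
      unfolding mult.assoc using H by (intro mult_left_mono \<mu>) simp
    also have "\<dots> = (\<integral>\<omega>. (v \<bullet> X H \<omega> - v \<bullet> X 0 \<omega>)\<^sup>2 \<partial>M)"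
      using real_levy_moments(4)[OF vec_levy_inner[OF V], of v H 0] H by simp
    also have "\<dots> = (\<integral>\<omega>. (\<Sum>p\<in>UNIV. \<Sum>q\<in>UNIV. v $ p * v $ q * ((X H \<omega> - X 0 \<omega>) $ p * (X H \<omega> - X 0 \<omega>) $ q)) \<partial>M)"
      by (intro Bochner_Integration.integral_cong refl, subst inner_diff_right[symmetric])
        (simp add: power2_eq_square inner_vec_def sum_product mult_ac)
    also have "\<dots> = (\<Sum>p\<in>UNIV. \<Sum>q\<in>UNIV. v $ p * v $ q * g p q)"
      unfolding g_def using i2
      by (subst Bochner_Integration.integral_sum, (intro Bochner_Integration.integrable_sum integrable_mult_right; simp))
        (intro sum.cong refl, subst Bochner_Integration.integral_sum, auto intro!: integrable_mult_right)
    finally show ?thesis .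
  qed
  have "\<kappa> * (norm B)\<^sup>2 * real n \<le> (\<Sum>k=1..n. (norm (B *v X (real k * h) \<omega>))\<^sup>2)"
    if n: "4 * b \<le> n" and \<omega>: "\<omega> \<in> G n" for n \<omega> and B :: "real^'m^'d"
  proof -
    have half: "H * \<mu> - real CARD('m) * \<tau> = H * \<mu> / 2" by (simp add: \<tau>_def)
    have "real (J n) * (H * \<mu> / 2) * (norm B)\<^sup>2 \<le> (\<Sum>j<J n. (norm (B *v D r j \<omega>))\<^sup>2)" if r: "r < b" for r
      unfolding half[symmetric]
    proof (rule quadratic_sample_bound[OF gq _ bJ(3)[OF n]])
      fix p q
      have "\<omega> \<notin> bad r p q (J n)" "\<omega> \<in> space M" using \<omega> r by (auto simp: G_def I_def)
      then show "\<bar>(\<Sum>j<J n. D r j \<omega> $ p * D r j \<omega> $ q) / real (J n) - g p q\<bar> \<le> \<tau>" by (simp add: bad_def)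
    qed
    then have "(\<Sum>r<b. real (J n) * (H * \<mu> / 2) * (norm B)\<^sup>2) \<le> (\<Sum>r<b. \<Sum>j<J n. (norm (B *v D r j \<omega>))\<^sup>2)"
      by (intro sum_mono) auto
    also have "\<dots> = (\<Sum>r<b. \<Sum>j<J n. (norm (B *v X (real (b * Suc j + r + 1) * h) \<omega> - B *v X (real (b * j + r + 1) * h) \<omega>))\<^sup>2)"
      by (simp only: D_def t_def matrix_vector_mult_diff_distrib)
    also have "\<dots> \<le> 4 * (\<Sum>k=1..n. (norm (B *v X (real k * h) \<omega>))\<^sup>2)"
      by (rule block_differences_energy[OF bJ(1)[OF n]])
    finally have le: "real b * real (J n) * (H * \<mu> / 2) * (norm B)\<^sup>2 \<le> 4 * (\<Sum>k=1..n. (norm (B *v X (real k * h) \<omega>))\<^sup>2)"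
      by (simp add: mult.assoc)
    have "16 * \<kappa> \<le> H * \<mu>" using b h \<mu>(1) by (simp add: H_def field_simps)
    then have "\<kappa> * real n \<le> (H * \<mu> / 16) * real n" by (intro mult_right_mono) auto
    also have "\<dots> \<le> (H * \<mu> / 16) * (2 * (real b * real (J n)))" using H \<mu> by (intro mult_left_mono bJ(2)[OF n]) simp
    finally have "\<kappa> * real n * (norm B)\<^sup>2 \<le> (H * \<mu> / 16) * (2 * (real b * real (J n))) * (norm B)\<^sup>2"
      by (intro mult_right_mono) auto
    moreover have "(H * \<mu> / 16) * (2 * (real b * real (J n))) * (norm B)\<^sup>2 = (real b * real (J n) * (H * \<mu> / 2) * (norm B)\<^sup>2) / 4"
      by simp
    ultimately show ?thesis using le by (simp add: mult_ac)
  qed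
  then show ?thesis using G_ev G_lim by blast
qed

section \<open>Measurability and second moments of the components of the observations\<close>

lemma borel_measurable_matrix_vector:
  fixes A :: "real^'n^'m"
  assumes "f \<in> borel_measurable M" shows "(\<lambda>\<omega>. A *v f \<omega>) \<in> borel_measurable M"
  by (rule borel_measurable_continuous_on[OF linear_continuous_on[OF matrix_vector_mul_bounded_linear] assms])

lemma nn_integral_matrix_vector_le:
  fixes A :: "real^'n^'m"
  assumes "f \<in> borel_measurable M"
  shows "(\<integral>\<^sup>+\<omega>. ennreal ((norm (A *v f \<omega>))\<^sup>2) \<partial>M) \<le> ennreal ((norm A)\<^sup>2) * (\<integral>\<^sup>+\<omega>. ennreal ((norm (f \<omega>))\<^sup>2) \<partial>M)"
proof -
  have "(norm (A *v y))\<^sup>2 \<le> (norm A)\<^sup>2 * (norm y)\<^sup>2" for y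
    using power_mono[OF norm_matrix_vector_le norm_ge_zero, of A y 2] by (simp add: power_mult_distrib)
  then have "(\<integral>\<^sup>+\<omega>. ennreal ((norm (A *v f \<omega>))\<^sup>2) \<partial>M) \<le> (\<integral>\<^sup>+\<omega>. ennreal ((norm A)\<^sup>2) * ennreal ((norm (f \<omega>))\<^sup>2) \<partial>M)"
    by (intro nn_integral_mono) (simp add: ennreal_mult[symmetric] ennreal_leI)
  also have "\<dots> = ennreal ((norm A)\<^sup>2) * (\<integral>\<^sup>+\<omega>. ennreal ((norm (f \<omega>))\<^sup>2) \<partial>M)"
    using assms by (intro nn_integral_cmult) measurable
  finally show ?thesis .
qed

lemma (in prob_space) vec_levy_increment_second_moment:
  fixes X :: "real \<Rightarrow> 'a \<Rightarrow> real^'m"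
  assumes V: "vec_levy M X"
  shows "(\<integral>\<^sup>+\<omega>. ennreal ((norm (X t \<omega> - X s \<omega>))\<^sup>2) \<partial>M) = ennreal (\<bar>t - s\<bar> * (\<Sum>p\<in>UNIV. \<integral>\<omega>. (X 1 \<omega> $ p)\<^sup>2 \<partial>M))"
proof -
  have comp: "(\<lambda>t \<omega>. axis p 1 \<bullet> X t \<omega>) = (\<lambda>t \<omega>. X t \<omega> $ p)" for p by (simp add: inner_axis')
  have RL: "real_levy M (\<lambda>t \<omega>. X t \<omega> $ p)" for p using vec_levy_inner[OF V, of "axis p 1"] unfolding comp .
  have n: "(norm (X t \<omega> - X s \<omega>))\<^sup>2 = (\<Sum>p\<in>UNIV. (X t \<omega> $ p - X s \<omega> $ p)\<^sup>2)" for \<omega>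
    by (simp add: norm_vec_def L2_set_def sum_nonneg)
  have "(\<integral>\<^sup>+\<omega>. ennreal ((norm (X t \<omega> - X s \<omega>))\<^sup>2) \<partial>M) = ennreal (\<integral>\<omega>. (\<Sum>p\<in>UNIV. (X t \<omega> $ p - X s \<omega> $ p)\<^sup>2) \<partial>M)"
    unfolding n by (intro nn_integral_eq_integral Bochner_Integration.integrable_sum real_levy_moments(2)[OF RL]) (auto intro!: sum_nonneg)
  also have "(\<integral>\<omega>. (\<Sum>p\<in>UNIV. (X t \<omega> $ p - X s \<omega> $ p)\<^sup>2) \<partial>M) = (\<Sum>p\<in>UNIV. \<integral>\<omega>. (X t \<omega> $ p - X s \<omega> $ p)\<^sup>2 \<partial>M)"
    by (intro Bochner_Integration.integral_sum real_levy_moments(2)[OF RL])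
  also have "\<dots> = \<bar>t - s\<bar> * (\<Sum>p\<in>UNIV. \<integral>\<omega>. (X 1 \<omega> $ p)\<^sup>2 \<partial>M)"
    by (simp add: real_levy_moments(4)[OF RL] sum_distrib_left)
  finally show ?thesis .
qed

text \<open>The lower bound is positive definiteness of \<open>SigmaL\<close> at the true parameter,
  rewritten in terms of second moments of projections.\<close>

lemma true_levy:
  assumes ms: "model_setting \<M>" and A: "assumption_A \<M>"
  shows "vec_levy (Pr \<M>) (Levy \<M> (true2 \<M>))"
    and "\<exists>\<mu>>0. \<forall>v. \<mu> * (norm v)\<^sup>2 \<le> (\<integral>\<omega>. (v \<bullet> Levy \<M> (true2 \<M>) 1 \<omega>)\<^sup>2 \<partial>Pr \<M>)"
proof -
  interpret prob_space "Pr \<M>" by (rule model_basics(1)[OF ms A])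
  note t0 = model_basics(4)[OF ms A]
  have st: "snd (true_par \<M>) = true2 \<M>" by (simp add: true_par_def)
  note L = model_levy[OF ms A t0, unfolded st]
  obtain \<delta> where \<delta>: "\<delta> > 0" "integrable (Pr \<M>) (\<lambda>\<omega>. norm (Levy \<M> (true2 \<M>) 1 \<omega>) powr (4 + \<delta>))" using L(4) by blast
  have "integrable (Pr \<M>) (\<lambda>\<omega>. norm (Levy \<M> (true2 \<M>) 1 \<omega>) ^ 4)"
    by (rule integrable_norm_power_of_powr[OF levy_increment_distr(2)[OF L(1)] \<delta>(2,1)]) simp
  then show "vec_levy (Pr \<M>) (Levy \<M> (true2 \<M>))" using L(1,2) by (simp add: vec_levy_def)
  obtain \<mu> where "\<mu> > 0" "\<forall>v. \<mu> * (norm v)\<^sup>2 \<le> v \<bullet> (SigmaL \<M> (true_par \<M>) *v v)"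
    using posdef_lower_bound[of "SigmaL \<M> (true_par \<M>)"] SigmaL_posdef(1)[OF ms A t0] unfolding qform_def by blast
  then show "\<exists>\<mu>>0. \<forall>v. \<mu> * (norm v)\<^sup>2 \<le> (\<integral>\<omega>. (v \<bullet> Levy \<M> (true2 \<M>) 1 \<omega>)\<^sup>2 \<partial>Pr \<M>)"
    using SigmaL_posdef(2)[OF ms A t0] unfolding qform_def st by auto
qed

lemma true_stationary:
  assumes ms: "model_setting \<M>" and A: "assumption_A \<M>"
  shows "has_levy_integral (Pr \<M>) (Levy \<M> (true2 \<M>))
        (\<lambda>u. indicator {..t} u *\<^sub>R (C2 \<M> (true2 \<M>) ** mat_exp ((t - u) *\<^sub>R A2 \<M> (true2 \<M>)) ** B2 \<M> (true2 \<M>)))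
        (Yst \<M> (true2 \<M>) t)"
    and "Zinit \<M> \<in> borel_measurable (Pr \<M>)" "integrable (Pr \<M>) (\<lambda>\<omega>. (norm (Zinit \<M> \<omega>))\<^sup>2)"
proof -
  have "true2 \<M> \<in> Theta2 \<M>" using model_basics(4)[OF ms A] by (simp add: Theta_def true_par_def)
  then show "has_levy_integral (Pr \<M>) (Levy \<M> (true2 \<M>))
        (\<lambda>u. indicator {..t} u *\<^sub>R (C2 \<M> (true2 \<M>) ** mat_exp ((t - u) *\<^sub>R A2 \<M> (true2 \<M>)) ** B2 \<M> (true2 \<M>)))
        (Yst \<M> (true2 \<M>) t)"
    using ms unfolding model_setting_def by blast
  show "Zinit \<M> \<in> borel_measurable (Pr \<M>)" using ms unfolding model_setting_def by blast
  show "integrable (Pr \<M>) (\<lambda>\<omega>. (norm (Zinit \<M> \<omega>))\<^sup>2)"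
    using A unfolding assumption_A_def by (elim conjE) assumption
qed

lemma measurable_parts:
  assumes ms: "model_setting \<M>" and A: "assumption_A \<M>"
  shows "trend_part \<M> k \<in> borel_measurable (Pr \<M>)" "stationary_part \<M> k \<in> borel_measurable (Pr \<M>)"
    "Yobs \<M> k \<in> borel_measurable (Pr \<M>)"
proof -
  interpret prob_space "Pr \<M>" by (rule model_basics(1)[OF ms A])
  have X: "Levy \<M> (true2 \<M>) t \<in> borel_measurable (Pr \<M>)" for t
    using true_levy(1)[OF ms A] levy_increment_distr(2) unfolding vec_levy_def by blast
  have Y: "Yst \<M> (true2 \<M>) t \<in> borel_measurable (Pr \<M>)" for t
    using true_stationary(1)[OF ms A] unfolding has_levy_integral_def by blast
  show t: "trend_part \<M> k \<in> borel_measurable (Pr \<M>)"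
    unfolding trend_part_def[abs_def] by (intro borel_measurable_matrix_vector X)
  show s: "stationary_part \<M> k \<in> borel_measurable (Pr \<M>)"
    unfolding stationary_part_def[abs_def]
    by (intro borel_measurable_add borel_measurable_matrix_vector true_stationary(2)[OF ms A] Y)
  show "Yobs \<M> k \<in> borel_measurable (Pr \<M>)"
    using borel_measurable_add[OF t s] by (simp add: Yobs_decomposition[abs_def])
qed

text \<open>No growth in k appears: the trend enters through increments of fixed length and its
  first value, and the kernel of the stationary part has an integral bounded in time.\<close>

lemma second_moment_bounds:
  fixes \<M> :: "('w, 's1::finite, 's2::finite, 'c::finite, 'k::finite, 'd::{finite,linorder},
                'e::{finite,linorder}, 'm::finite) coint_model"
  assumes ms: "model_setting \<M>" and A: "assumption_A \<M>"
  shows "\<exists>c. \<forall>k. (\<integral>\<^sup>+\<omega>. ennreal ((norm (stationary_part \<M> k \<omega>))\<^sup>2) \<partial>Pr \<M>) \<le> ennreal c"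
    and "\<exists>c. \<forall>k. (\<integral>\<^sup>+\<omega>. ennreal ((norm (trend_part \<M> (Suc k) \<omega> - trend_part \<M> k \<omega>))\<^sup>2) \<partial>Pr \<M>) \<le> ennreal c"
    and "(\<integral>\<^sup>+\<omega>. ennreal ((norm (trend_part \<M> 1 \<omega>))\<^sup>2) \<partial>Pr \<M>) < \<infinity>"
proof -
  interpret prob_space "Pr \<M>" by (rule model_basics(1)[OF ms A])
  note V = true_levy(1)[OF ms A] and mp = measurable_parts[OF ms A]
  define X where "X = Levy \<M> (true2 \<M>)"
  define S where "S = (\<Sum>p\<in>UNIV. \<integral>\<omega>. (X 1 \<omega> $ p)\<^sup>2 \<partial>Pr \<M>)"
  define T where "T = C1 \<M> (true1 \<M>) ** B1 \<M> (true2 \<M>)"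
  have S0: "0 \<le> S" unfolding S_def by (intro sum_nonneg) simp
  have L: "two_sided_levy (Pr \<M>) X" using V by (simp add: vec_levy_def X_def)
  have Xm: "(\<lambda>\<omega>. X t \<omega> - X s \<omega>) \<in> borel_measurable (Pr \<M>)" for t s
    using levy_increment_distr(2)[OF L] by simp
  have inc: "(\<integral>\<^sup>+\<omega>. ennreal ((norm (T *v (X t \<omega> - X s \<omega>)))\<^sup>2) \<partial>Pr \<M>) \<le> ennreal ((norm T)\<^sup>2 * (\<bar>t - s\<bar> * S))" for t s
    using nn_integral_matrix_vector_le[OF Xm, of T t s] vec_levy_increment_second_moment[OF V, of t s] S0
    unfolding X_def[symmetric] S_def[symmetric] by (simp add: ennreal_mult)
  have "(\<integral>\<^sup>+\<omega>. ennreal ((norm (trend_part \<M> (Suc k) \<omega> - trend_part \<M> k \<omega>))\<^sup>2) \<partial>Pr \<M>) \<le> ennreal ((norm T)\<^sup>2 * (mesh \<M> * S))" for k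
  proof -
    have "\<bar>real (Suc k) * mesh \<M> - real k * mesh \<M>\<bar> = mesh \<M>"
      using model_basics(2)[OF ms A] by (simp add: algebra_simps)
    then show ?thesis
      using inc[of "real (Suc k) * mesh \<M>" "real k * mesh \<M>"]
      by (simp add: trend_part_def X_def T_def matrix_vector_mult_diff_distrib)
  qed
  then show "\<exists>c. \<forall>k. (\<integral>\<^sup>+\<omega>. ennreal ((norm (trend_part \<M> (Suc k) \<omega> - trend_part \<M> k \<omega>))\<^sup>2) \<partial>Pr \<M>) \<le> ennreal c" by blast
  \<comment> \<open>Up to a null set the first trend value is an increment from time 0.\<close>
  have "AE \<omega> in Pr \<M>. X 0 \<omega> = 0" using L by (simp add: two_sided_levy_def)
  then have "AE \<omega> in Pr \<M>. ennreal ((norm (trend_part \<M> 1 \<omega>))\<^sup>2) = ennreal ((norm (T *v (X (mesh \<M>) \<omega> - X 0 \<omega>)))\<^sup>2)"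
    by eventually_elim (simp add: trend_part_def X_def T_def)
  then have "(\<integral>\<^sup>+\<omega>. ennreal ((norm (trend_part \<M> 1 \<omega>))\<^sup>2) \<partial>Pr \<M>) = (\<integral>\<^sup>+\<omega>. ennreal ((norm (T *v (X (mesh \<M>) \<omega> - X 0 \<omega>)))\<^sup>2) \<partial>Pr \<M>)"
    by (rule nn_integral_cong_AE)
  also have "\<dots> < \<infinity>" by (rule le_less_trans[OF inc]) simp
  finally show "(\<integral>\<^sup>+\<omega>. ennreal ((norm (trend_part \<M> 1 \<omega>))\<^sup>2) \<partial>Pr \<M>) < \<infinity>" .
  have ev: "\<And>z. complex_eigenvalue (A2 \<M> (true2 \<M>)) z \<Longrightarrow> Re z < 0"
    using model_matrices(1)[OF A model_basics(4)[OF ms A]] by (simp add: true_par_def)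
  obtain K where K: "\<And>t. (\<lambda>u. indicator {..t} u *\<^sub>R (C2 \<M> (true2 \<M>) ** mat_exp ((t - u) *\<^sub>R A2 \<M> (true2 \<M>)) ** B2 \<M> (true2 \<M>))) \<in> borel_measurable borel"
    "\<And>t. (\<integral>\<^sup>+u. ennreal ((norm (indicator {..t} u *\<^sub>R (C2 \<M> (true2 \<M>) ** mat_exp ((t - u) *\<^sub>R A2 \<M> (true2 \<M>)) ** B2 \<M> (true2 \<M>))))\<^sup>2) \<partial>lborel) \<le> ennreal K"
    using nn_integral_mat_exp_kernel[OF ev, where C="C2 \<M> (true2 \<M>)" and B="B2 \<M> (true2 \<M>)"] by blast
  have Yst: "(\<integral>\<^sup>+\<omega>. ennreal ((norm (Yst \<M> (true2 \<M>) t \<omega>))\<^sup>2) \<partial>Pr \<M>) \<le> 4 * ennreal (real CARD('m) * S) * ennreal K" for t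
    unfolding S_def X_def
    by (rule order_trans[OF levy_integral_second_moment[OF V true_stationary(1)[OF ms A] K(1)] mult_left_mono[OF K(2)]]) simp
  have Ystm: "Yst \<M> (true2 \<M>) t \<in> borel_measurable (Pr \<M>)" for t
    using true_stationary(1)[OF ms A] unfolding has_levy_integral_def by blast
  define c where "c = 2 * (ennreal ((norm (C1 \<M> (true1 \<M>)))\<^sup>2) * ennreal (\<integral>\<omega>. (norm (Zinit \<M> \<omega>))\<^sup>2 \<partial>Pr \<M>))
    + 2 * (4 * ennreal (real CARD('m) * S) * ennreal K)"
  have "(\<integral>\<^sup>+\<omega>. ennreal ((norm (stationary_part \<M> k \<omega>))\<^sup>2) \<partial>Pr \<M>) \<le> c" for k
  proof -
    have "(\<integral>\<^sup>+\<omega>. ennreal ((norm (Zinit \<M> \<omega>))\<^sup>2) \<partial>Pr \<M>) = ennreal (\<integral>\<omega>. (norm (Zinit \<M> \<omega>))\<^sup>2 \<partial>Pr \<M>)"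
      by (rule nn_integral_eq_integral[OF true_stationary(3)[OF ms A]]) simp
    then have z: "(\<integral>\<^sup>+\<omega>. ennreal ((norm (C1 \<M> (true1 \<M>) *v Zinit \<M> \<omega>))\<^sup>2) \<partial>Pr \<M>)
        \<le> ennreal ((norm (C1 \<M> (true1 \<M>)))\<^sup>2) * ennreal (\<integral>\<omega>. (norm (Zinit \<M> \<omega>))\<^sup>2 \<partial>Pr \<M>)"
      using nn_integral_matrix_vector_le[OF true_stationary(2)[OF ms A], of "C1 \<M> (true1 \<M>)"] by simp
    have "(\<integral>\<^sup>+\<omega>. ennreal ((norm (stationary_part \<M> k \<omega>))\<^sup>2) \<partial>Pr \<M>)
       \<le> 2 * (\<integral>\<^sup>+\<omega>. ennreal ((norm (stationary_part \<M> k \<omega> - Yst \<M> (true2 \<M>) (real k * mesh \<M>) \<omega>))\<^sup>2) \<partial>Pr \<M>)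
         + 2 * (\<integral>\<^sup>+\<omega>. ennreal ((norm (Yst \<M> (true2 \<M>) (real k * mesh \<M>) \<omega>))\<^sup>2) \<partial>Pr \<M>)"
      by (rule nn_integral_norm_split[OF mp(2) Ystm])
    also have "\<dots> \<le> c" unfolding c_def
      by (intro add_mono mult_left_mono Yst) (simp_all add: stationary_part_def z)
    finally show ?thesis .
  qed
  moreover have "c = ennreal (enn2real c)" by (simp add: c_def ennreal_mult_less_top less_top)
  ultimately show "\<exists>c. \<forall>k. (\<integral>\<^sup>+\<omega>. ennreal ((norm (stationary_part \<M> k \<omega>))\<^sup>2) \<partial>Pr \<M>) \<le> ennreal c" by metis
qed

section \<open>Separation of the likelihoods\<close>

text \<open>The supremum over \<open>\<theta>\<close> is taken in [0, \<infinity>], the form in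
  which Assumption B grants measurability and a finite mean.\<close>

definition residual_envelope ::
  "('w, 's1::finite, 's2::finite, 'c::finite, 'k::finite, 'd::finite, 'e::finite, 'm::finite) coint_model
    \<Rightarrow> nat \<Rightarrow> 'w \<Rightarrow> ennreal" where
  "residual_envelope \<M> n \<omega> = (\<Squnion>\<theta>\<in>Theta \<M>. ennreal ((norm (Xhat1 \<M> \<theta> \<omega>))\<^sup>2)) + ennreal ((norm (trend_part \<M> 1 \<omega>))\<^sup>2)
     + (\<Sum>k=1..n. ennreal ((norm (stationary_part \<M> k \<omega>))\<^sup>2) + ennreal ((norm (trend_part \<M> (Suc k) \<omega> - trend_part \<M> k \<omega>))\<^sup>2))"

lemma residual_energy_le_envelope:
  assumes "\<theta> \<in> Theta \<M>"
  shows "ennreal (residual_energy \<M> \<theta> n \<omega>) \<le> residual_envelope \<M> n \<omega>"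
proof -
  have "ennreal (residual_energy \<M> \<theta> n \<omega>) = ennreal ((norm (Xhat1 \<M> \<theta> \<omega>))\<^sup>2) + ennreal ((norm (trend_part \<M> 1 \<omega>))\<^sup>2)
     + (\<Sum>k=1..n. ennreal ((norm (stationary_part \<M> k \<omega>))\<^sup>2) + ennreal ((norm (trend_part \<M> (Suc k) \<omega> - trend_part \<M> k \<omega>))\<^sup>2))"
    unfolding residual_energy_def by (simp add: ennreal_plus sum_nonneg flip: sum_ennreal)
  also have "\<dots> \<le> residual_envelope \<M> n \<omega>"
    unfolding residual_envelope_def by (intro add_right_mono SUP_upper assms)
  finally show ?thesis .
qed

text \<open>Each time step contributes a bounded mean, and n \<ge> 1 lets the starting values be
  absorbed into the linear bound.\<close>

lemma residual_envelope_mean: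
  fixes \<M> :: "('w, 's1::finite, 's2::finite, 'c::finite, 'k::finite, 'd::{finite,linorder},
                'e::{finite,linorder}, 'm::finite) coint_model"
  assumes ms: "model_setting \<M>" and A: "assumption_A \<M>" and B: "assumption_B \<M>"
  shows "residual_envelope \<M> n \<in> borel_measurable (Pr \<M>)"
    and "\<exists>c. \<forall>n\<ge>1. (\<integral>\<^sup>+\<omega>. residual_envelope \<M> n \<omega> \<partial>Pr \<M>) \<le> ennreal (c * real n)"
proof -
  note mp = measurable_parts[OF ms A]
  have "finite_mean_sup_sq (Pr \<M>) (Theta \<M>) (Xhat1 \<M>)" using B unfolding assumption_B_def by (elim conjE) assumption
  then have sm: "(\<lambda>\<omega>. \<Squnion>\<theta>\<in>Theta \<M>. ennreal ((norm (Xhat1 \<M> \<theta> \<omega>))\<^sup>2)) \<in> borel_measurable (Pr \<M>)"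
    and sf: "(\<integral>\<^sup>+\<omega>. (\<Squnion>\<theta>\<in>Theta \<M>. ennreal ((norm (Xhat1 \<M> \<theta> \<omega>))\<^sup>2)) \<partial>Pr \<M>) < \<infinity>"
    unfolding finite_mean_sup_sq_def by blast+
  have tm: "(\<lambda>\<omega>. ennreal ((norm (trend_part \<M> 1 \<omega>))\<^sup>2)) \<in> borel_measurable (Pr \<M>)"
    and pm: "(\<lambda>\<omega>. ennreal ((norm (stationary_part \<M> k \<omega>))\<^sup>2)) \<in> borel_measurable (Pr \<M>)"
    and dm: "(\<lambda>\<omega>. ennreal ((norm (trend_part \<M> (Suc k) \<omega> - trend_part \<M> k \<omega>))\<^sup>2)) \<in> borel_measurable (Pr \<M>)" for k
    using mp by measurable
  show "residual_envelope \<M> n \<in> borel_measurable (Pr \<M>)"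
    unfolding residual_envelope_def[abs_def] by (intro borel_measurable_add borel_measurable_sum sm tm pm dm)
  obtain c1 where c1: "\<And>k. (\<integral>\<^sup>+\<omega>. ennreal ((norm (stationary_part \<M> k \<omega>))\<^sup>2) \<partial>Pr \<M>) \<le> ennreal c1"
    using second_moment_bounds(1)[OF ms A] by blast
  obtain c2 where c2: "\<And>k. (\<integral>\<^sup>+\<omega>. ennreal ((norm (trend_part \<M> (Suc k) \<omega> - trend_part \<M> k \<omega>))\<^sup>2) \<partial>Pr \<M>) \<le> ennreal c2"
    using second_moment_bounds(2)[OF ms A] by blast
  define s where "s = enn2real ((\<integral>\<^sup>+\<omega>. (\<Squnion>\<theta>\<in>Theta \<M>. ennreal ((norm (Xhat1 \<M> \<theta> \<omega>))\<^sup>2)) \<partial>Pr \<M>)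
     + (\<integral>\<^sup>+\<omega>. ennreal ((norm (trend_part \<M> 1 \<omega>))\<^sup>2) \<partial>Pr \<M>))"
  have s: "(\<integral>\<^sup>+\<omega>. (\<Squnion>\<theta>\<in>Theta \<M>. ennreal ((norm (Xhat1 \<M> \<theta> \<omega>))\<^sup>2)) \<partial>Pr \<M>)
     + (\<integral>\<^sup>+\<omega>. ennreal ((norm (trend_part \<M> 1 \<omega>))\<^sup>2) \<partial>Pr \<M>) = ennreal s"
    unfolding s_def using sf second_moment_bounds(3)[OF ms A] by (simp add: less_top)
  have "(\<integral>\<^sup>+\<omega>. residual_envelope \<M> n \<omega> \<partial>Pr \<M>) \<le> ennreal ((s + (max 0 c1 + max 0 c2)) * real n)" if n: "1 \<le> n" for n
  proof -
    have "(\<integral>\<^sup>+\<omega>. residual_envelope \<M> n \<omega> \<partial>Pr \<M>) = ennreal s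
      + (\<Sum>k=1..n. (\<integral>\<^sup>+\<omega>. ennreal ((norm (stationary_part \<M> k \<omega>))\<^sup>2) \<partial>Pr \<M>)
         + (\<integral>\<^sup>+\<omega>. ennreal ((norm (trend_part \<M> (Suc k) \<omega> - trend_part \<M> k \<omega>))\<^sup>2) \<partial>Pr \<M>))"
      unfolding residual_envelope_def s[symmetric]
      by (subst nn_integral_add[OF borel_measurable_add[OF sm tm] borel_measurable_sum[OF borel_measurable_add[OF pm dm]]],
          subst nn_integral_add[OF sm tm], subst nn_integral_sum[OF borel_measurable_add[OF pm dm]],
          subst nn_integral_add[OF pm dm], rule refl)
    also have "\<dots> \<le> ennreal s + (\<Sum>k=1..n. ennreal (max 0 c1) + ennreal (max 0 c2))"
      using c1 c2 by (intro add_left_mono sum_mono add_mono) (simp_all add: ennreal_max_0)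
    also have "\<dots> = ennreal (s + real n * (max 0 c1 + max 0 c2))"
      by (simp add: s_def ennreal_mult ennreal_plus ennreal_of_nat_eq_real_of_nat)
    also have "\<dots> \<le> ennreal ((s + (max 0 c1 + max 0 c2)) * real n)"
    proof (rule ennreal_leI)
      have "s * 1 \<le> s * real n" using n by (intro mult_left_mono) (auto simp: s_def)
      then show "s + real n * (max 0 c1 + max 0 c2) \<le> (s + (max 0 c1 + max 0 c2)) * real n" by (simp add: algebra_simps)
    qed
    finally show ?thesis .
  qed
  then show "\<exists>c. \<forall>n\<ge>1. (\<integral>\<^sup>+\<omega>. residual_envelope \<M> n \<omega> \<partial>Pr \<M>) \<le> ennreal (c * real n)" by blast
qed

text \<open>Reduces the likelihood to the innovation energy: u and v bound the inverse of V from
  below and above, l bounds the log determinant, and the constant with pi cancels in the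
  comparison.\<close>

lemma likelihood_bounds:
  fixes \<M> :: "('w, 's1::finite, 's2::finite, 'c::finite, 'k::finite, 'd::{finite,linorder},
                'e::{finite,linorder}, 'm::finite) coint_model"
  assumes ms: "model_setting \<M>" and A: "assumption_A \<M>"
  shows "\<exists>l u v. 0 < u \<and> 0 < v \<and> (\<forall>\<theta>\<in>Theta \<M>. \<forall>n\<ge>1. \<forall>\<omega>.
    u * (\<Sum>k=1..n. (norm (eps_hat \<M> \<theta> \<omega> k))\<^sup>2) / real n \<le> Lhat \<M> n \<theta> \<omega> - real CARD('d) * ln (2 * pi) + l \<and>
    Lhat \<M> n \<theta> \<omega> - real CARD('d) * ln (2 * pi) - l \<le> v * (\<Sum>k=1..n. (norm (eps_hat \<M> \<theta> \<omega> k))\<^sup>2) / real n)"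
proof -
  note cpt = model_basics(3)[OF ms A] and V = V_mat_posdef[OF ms A]
  obtain u where u: "u > 0" "\<And>\<theta> y. \<theta> \<in> Theta \<M> \<Longrightarrow> u * (norm y)\<^sup>2 \<le> qform (matrix_inv (V_mat \<M> \<theta>)) y"
    using uniform_posdef_lower_bound[OF cpt filter_continuous(2)[OF ms A]] V(4) unfolding qform_def by blast
  obtain v where v: "v > 0" "\<And>\<theta>. \<theta> \<in> Theta \<M> \<Longrightarrow> norm (matrix_inv (V_mat \<M> \<theta>)) \<le> v"
    using compact_norm_bound[OF cpt filter_continuous(2)[OF ms A]] by blast
  have "continuous_on (Theta \<M>) (\<lambda>\<theta>. ln (det (V_mat \<M> \<theta>)))"
    by (intro continuous_on_ln continuous_on_det filter_continuous(1)[OF ms A]) (use V(3) in force)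
  from compact_norm_bound[OF cpt this] obtain l where l: "\<And>\<theta>. \<theta> \<in> Theta \<M> \<Longrightarrow> \<bar>ln (det (V_mat \<M> \<theta>))\<bar> \<le> l" by auto
  have "u * (\<Sum>k=1..n. (norm (eps_hat \<M> \<theta> \<omega> k))\<^sup>2) / real n \<le> Lhat \<M> n \<theta> \<omega> - real CARD('d) * ln (2 * pi) + l \<and>
    Lhat \<M> n \<theta> \<omega> - real CARD('d) * ln (2 * pi) - l \<le> v * (\<Sum>k=1..n. (norm (eps_hat \<M> \<theta> \<omega> k))\<^sup>2) / real n"
    if \<theta>: "\<theta> \<in> Theta \<M>" and n: "1 \<le> n" for \<theta> n \<omega>
  proof -
    define Q where "Q = (\<Sum>k=1..n. qform (matrix_inv (V_mat \<M> \<theta>)) (eps_hat \<M> \<theta> \<omega> k))"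
    define S where "S = (\<Sum>k=1..n. (norm (eps_hat \<M> \<theta> \<omega> k))\<^sup>2)"
    have L: "Lhat \<M> n \<theta> \<omega> = real CARD('d) * ln (2 * pi) + ln (det (V_mat \<M> \<theta>)) + Q / real n"
      using n unfolding Lhat_def Q_def qform_def by (simp add: sum.distrib field_simps)
    have "qform (matrix_inv (V_mat \<M> \<theta>)) y \<le> v * (norm y)\<^sup>2" for y
      by (rule order_trans[OF qform_le_norm mult_right_mono[OF v(2)[OF \<theta>]]]) simp
    then have "u * S \<le> Q" "Q \<le> v * S" unfolding Q_def S_def sum_distrib_left by (auto intro!: sum_mono u(2)[OF \<theta>])
    then have "u * S / real n \<le> Q / real n" "Q / real n \<le> v * S / real n" by (simp_all add: divide_right_mono)
    then show ?thesis using l[OF \<theta>] unfolding L S_def by linarith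
  qed
  then show ?thesis using u(1) v(1) by blast
qed

text \<open>The decomposition is used both ways: a large trend response forces large innovations,
  while at the truth the response is zero and the residual is all there is.\<close>

lemma innovation_energy_bounds:
  fixes \<M> :: "('w, 's1::finite, 's2::finite, 'c::finite, 'k::finite, 'd::{finite,linorder},
                'e::{finite,linorder}, 'm::finite) coint_model"
  assumes ms: "model_setting \<M>" and A: "assumption_A \<M>"
  shows "\<exists>H>0. (\<forall>\<theta>\<in>Theta \<M>. \<forall>n \<omega>. (\<Sum>k=1..n. (norm (trend_response \<M> \<theta> *v Levy \<M> (true2 \<M>) (real k * mesh \<M>) \<omega>))\<^sup>2)
       \<le> 2 * (\<Sum>k=1..n. (norm (eps_hat \<M> \<theta> \<omega> k))\<^sup>2) + 2 * (H * residual_energy \<M> \<theta> n \<omega>)) \<and>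
     (\<forall>n \<omega>. (\<Sum>k=1..n. (norm (eps_hat \<M> (true_par \<M>) \<omega> k))\<^sup>2) \<le> H * residual_energy \<M> (true_par \<M>) n \<omega>)"
proof -
  obtain H where H: "H > 0" "\<And>\<theta> n \<omega>. \<theta> \<in> Theta \<M> \<Longrightarrow>
    (\<Sum>k=1..n. (norm (eps_hat \<M> \<theta> \<omega> k - longrun \<M> \<theta> *v trend_part \<M> k \<omega>))\<^sup>2) \<le> H * residual_energy \<M> \<theta> n \<omega>"
    using innovation_decomposition[OF ms A] by blast
  have tr: "longrun \<M> \<theta> *v trend_part \<M> k \<omega> = trend_response \<M> \<theta> *v Levy \<M> (true2 \<M>) (real k * mesh \<M>) \<omega>" for \<theta> k \<omega>
    by (simp add: trend_part_def trend_response_def matrix_vector_mul_assoc)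
  have "(\<Sum>k=1..n. (norm (trend_response \<M> \<theta> *v Levy \<M> (true2 \<M>) (real k * mesh \<M>) \<omega>))\<^sup>2)
       \<le> 2 * (\<Sum>k=1..n. (norm (eps_hat \<M> \<theta> \<omega> k))\<^sup>2) + 2 * (H * residual_energy \<M> \<theta> n \<omega>)"
    if \<theta>: "\<theta> \<in> Theta \<M>" for \<theta> n \<omega>
  proof -
    have "(norm (longrun \<M> \<theta> *v trend_part \<M> k \<omega>))\<^sup>2
       \<le> 2 * (norm (eps_hat \<M> \<theta> \<omega> k))\<^sup>2 + 2 * (norm (eps_hat \<M> \<theta> \<omega> k - longrun \<M> \<theta> *v trend_part \<M> k \<omega>))\<^sup>2" for k
      using norm_add_power2_le[of "eps_hat \<M> \<theta> \<omega> k" "- (eps_hat \<M> \<theta> \<omega> k - longrun \<M> \<theta> *v trend_part \<M> k \<omega>)"]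
      by (simp add: norm_minus_commute)
    then have "(\<Sum>k=1..n. (norm (longrun \<M> \<theta> *v trend_part \<M> k \<omega>))\<^sup>2)
       \<le> (\<Sum>k=1..n. 2 * (norm (eps_hat \<M> \<theta> \<omega> k))\<^sup>2 + 2 * (norm (eps_hat \<M> \<theta> \<omega> k - longrun \<M> \<theta> *v trend_part \<M> k \<omega>))\<^sup>2)"
      by (intro sum_mono)
    also have "\<dots> = 2 * (\<Sum>k=1..n. (norm (eps_hat \<M> \<theta> \<omega> k))\<^sup>2)
       + 2 * (\<Sum>k=1..n. (norm (eps_hat \<M> \<theta> \<omega> k - longrun \<M> \<theta> *v trend_part \<M> k \<omega>))\<^sup>2)"
      by (simp add: sum.distrib sum_distrib_left)
    finally show ?thesis using H(2)[OF \<theta>, of \<omega> n] unfolding tr by linarith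
  qed
  moreover have "(\<Sum>k=1..n. (norm (eps_hat \<M> (true_par \<M>) \<omega> k))\<^sup>2) \<le> H * residual_energy \<M> (true_par \<M>) n \<omega>" for n \<omega>
    using H(2)[OF model_basics(4)[OF ms A], of \<omega> n] unfolding tr trend_response_eq_0(1)[OF ms A] by simp
  ultimately show ?thesis using H(1) by blast
qed

text \<open>Isolates what holds path by path, so that only the probabilities of the energy bounds
  remain. The quantifier order matters: \<open>\<kappa>\<close> is chosen after K and uniformly in
  \<open>\<theta>\<close>, n and the path.\<close>

lemma likelihood_gap:
  fixes \<M> :: "('w, 's1::finite, 's2::finite, 'c::finite, 'k::finite, 'd::{finite,linorder},
                'e::{finite,linorder}, 'm::finite) coint_model"
  assumes ms: "model_setting \<M>" and A: "assumption_A \<M>" and C: "assumption_C \<M>" and \<delta>: "\<delta> > 0" and K: "0 < K"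
  shows "\<exists>\<kappa>. \<forall>\<theta>\<in>Theta \<M>. \<forall>n\<ge>1. \<forall>\<omega>. \<delta> \<le> norm (fst \<theta> - true1 \<M>) \<longrightarrow>
      residual_energy \<M> \<theta> n \<omega> \<le> K * real n \<longrightarrow> residual_energy \<M> (true_par \<M>) n \<omega> \<le> K * real n \<longrightarrow>
      \<kappa> * (norm (trend_response \<M> \<theta>))\<^sup>2 * real n
        \<le> (\<Sum>k=1..n. (norm (trend_response \<M> \<theta> *v Levy \<M> (true2 \<M>) (real k * mesh \<M>) \<omega>))\<^sup>2) \<longrightarrow>
      Lhat \<M> n (true_par \<M>) \<omega> + 1 \<le> Lhat \<M> n \<theta> \<omega>"
proof -
  obtain l u v where uv: "0 < u" "0 < v" and
    lo: "\<And>\<theta> n \<omega>. \<theta> \<in> Theta \<M> \<Longrightarrow> 1 \<le> n \<Longrightarrow> u * (\<Sum>k=1..n. (norm (eps_hat \<M> \<theta> \<omega> k))\<^sup>2) / real n \<le> Lhat \<M> n \<theta> \<omega> - real CARD('d) * ln (2 * pi) + l" and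
    up: "\<And>\<theta> n \<omega>. \<theta> \<in> Theta \<M> \<Longrightarrow> 1 \<le> n \<Longrightarrow> Lhat \<M> n \<theta> \<omega> - real CARD('d) * ln (2 * pi) - l \<le> v * (\<Sum>k=1..n. (norm (eps_hat \<M> \<theta> \<omega> k))\<^sup>2) / real n"
    using likelihood_bounds[OF ms A] by blast
  obtain H where H: "0 < H" and
    e1: "\<And>\<theta> n \<omega>. \<theta> \<in> Theta \<M> \<Longrightarrow> (\<Sum>k=1..n. (norm (trend_response \<M> \<theta> *v Levy \<M> (true2 \<M>) (real k * mesh \<M>) \<omega>))\<^sup>2)
       \<le> 2 * (\<Sum>k=1..n. (norm (eps_hat \<M> \<theta> \<omega> k))\<^sup>2) + 2 * (H * residual_energy \<M> \<theta> n \<omega>)" and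
    e0: "\<And>n \<omega>. (\<Sum>k=1..n. (norm (eps_hat \<M> (true_par \<M>) \<omega> k))\<^sup>2) \<le> H * residual_energy \<M> (true_par \<M>) n \<omega>"
    using innovation_energy_bounds[OF ms A] by blast
  obtain c where c: "0 < c" "\<And>\<theta>. \<theta> \<in> Theta \<M> \<Longrightarrow> \<delta> \<le> norm (fst \<theta> - true1 \<M>) \<Longrightarrow> c \<le> norm (trend_response \<M> \<theta>)"
    using trend_response_lower_bound[OF ms A C \<delta>] by blast
  \<comment> \<open>The margin 1, twice the log determinant bound, and the residual losses at
    \<open>\<theta>\<close> with weight u and at the truth with weight v.\<close>
  define g where "g = 1 + 2 * \<bar>l\<bar> + (u + v) * H * K"
  have g: "0 < g" unfolding g_def using uv H K by (intro add_pos_pos add_pos_nonneg) auto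
  \<comment> \<open>With the response at least c, this leaves innovation energy at least
    \<open>g / u - H * K\<close> per observation; the 2 compensates the splitting of the
    square.\<close>
  define \<kappa> where "\<kappa> = 2 * g / (u * c\<^sup>2)"
  have \<kappa>: "0 < \<kappa>" "\<kappa> * c\<^sup>2 = 2 * g / u" using g uv c(1) by (auto simp: \<kappa>_def)
  have "Lhat \<M> n (true_par \<M>) \<omega> + 1 \<le> Lhat \<M> n \<theta> \<omega>"
    if \<theta>: "\<theta> \<in> Theta \<M>" and n: "1 \<le> n" and far: "\<delta> \<le> norm (fst \<theta> - true1 \<M>)"
      and r1: "residual_energy \<M> \<theta> n \<omega> \<le> K * real n" and r0: "residual_energy \<M> (true_par \<M>) n \<omega> \<le> K * real n"
      and tr: "\<kappa> * (norm (trend_response \<M> \<theta>))\<^sup>2 * real n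
        \<le> (\<Sum>k=1..n. (norm (trend_response \<M> \<theta> *v Levy \<M> (true2 \<M>) (real k * mesh \<M>) \<omega>))\<^sup>2)" for \<theta> n \<omega>
  proof -
    define S1 where "S1 = (\<Sum>k=1..n. (norm (eps_hat \<M> \<theta> \<omega> k))\<^sup>2)"
    define S0 where "S0 = (\<Sum>k=1..n. (norm (eps_hat \<M> (true_par \<M>) \<omega> k))\<^sup>2)"
    have n0: "0 < real n" using n by simp
    have "\<kappa> * c\<^sup>2 * real n \<le> \<kappa> * (norm (trend_response \<M> \<theta>))\<^sup>2 * real n"
      using c \<theta> far \<kappa>(1) by (intro mult_right_mono mult_left_mono power_mono) auto
    also have "\<dots> \<le> 2 * S1 + 2 * (H * residual_energy \<M> \<theta> n \<omega>)"
      unfolding S1_def by (rule order_trans[OF tr e1[OF \<theta>]])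
    also have "\<dots> \<le> 2 * S1 + 2 * (H * (K * real n))" using r1 H by (intro add_left_mono mult_left_mono) auto
    finally have "g / u * real n - H * K * real n \<le> S1" unfolding \<kappa>(2) by simp
    then have "u * (g / u * real n - H * K * real n) / real n \<le> u * S1 / real n"
      using uv(1) by (intro divide_right_mono mult_left_mono) auto
    moreover have "u * (g / u * real n - H * K * real n) / real n = g - u * H * K"
      using uv(1) n0 by (simp add: field_simps)
    ultimately have lower: "g - u * H * K \<le> u * S1 / real n" by simp
    have "S0 \<le> H * (K * real n)" unfolding S0_def using e0 r0 H by (meson mult_left_mono less_imp_le order_trans)
    then have "v * S0 / real n \<le> v * (H * (K * real n)) / real n"
      using uv(2) by (intro divide_right_mono mult_left_mono) auto
    then have "v * S0 / real n \<le> v * H * K" using n0 by simp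
    then show ?thesis
      using lower lo[OF \<theta> n, of \<omega>] up[OF model_basics(4)[OF ms A] n, of \<omega>]
      unfolding S0_def[symmetric] S1_def[symmetric] g_def by (simp add: algebra_simps)
  qed
  then show ?thesis by blast
qed

section \<open>Measurability of the likelihood and of its infimum\<close>

lemma measurable_Lhat:
  fixes \<M> :: "('w, 's1::finite, 's2::finite, 'c::finite, 'k::finite, 'd::{finite,linorder},
                'e::{finite,linorder}, 'm::finite) coint_model"
  assumes ms: "model_setting \<M>" and A: "assumption_A \<M>" and \<theta>: "\<theta> \<in> Theta \<M>"
  shows "Lhat \<M> n \<theta> \<in> borel_measurable (Pr \<M>)"
proof -
  have X: "(\<lambda>\<omega>. Xhat \<M> \<theta> \<omega> (Suc k)) \<in> borel_measurable (Pr \<M>)" for k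
  proof (induction k)
    case 0
    show ?case using ms \<theta> unfolding model_setting_def by simp
  next
    case (Suc k)
    then show ?case unfolding Xhat.simps
      by (intro borel_measurable_add borel_measurable_matrix_vector measurable_parts(3)[OF ms A])
  qed
  have e: "(\<lambda>\<omega>. eps_hat \<M> \<theta> \<omega> k) \<in> borel_measurable (Pr \<M>)" for k
  proof -
    have "(\<lambda>\<omega>. Xhat \<M> \<theta> \<omega> k) \<in> borel_measurable (Pr \<M>)" using X by (cases k) simp_all
    then show ?thesis unfolding eps_hat_def
      by (intro borel_measurable_diff borel_measurable_matrix_vector measurable_parts(3)[OF ms A])
  qed
  show ?thesis unfolding Lhat_def[abs_def]
    by (intro borel_measurable_times borel_measurable_const borel_measurable_sum borel_measurable_add
        borel_measurable_inner borel_measurable_matrix_vector e)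
qed

text \<open>Serves to replace the uncountable infimum by a countable one. Continuity of the starting
  value comes from its differentiability in Assumption B.\<close>

lemma continuous_on_Lhat:
  fixes \<M> :: "('w, 's1::finite, 's2::finite, 'c::finite, 'k::finite, 'd::{finite,linorder},
                'e::{finite,linorder}, 'm::finite) coint_model"
  assumes ms: "model_setting \<M>" and A: "assumption_A \<M>" and B: "assumption_B \<M>" and \<omega>: "\<omega> \<in> space (Pr \<M>)"
  shows "continuous_on (Theta \<M>) (\<lambda>\<theta>. Lhat \<M> n \<theta> \<omega>)"
proof -
  note fc = filter_continuous[OF ms A]
  note mv = continuous_on_matrix_vector
  have X: "continuous_on (Theta \<M>) (\<lambda>\<theta>. Xhat \<M> \<theta> \<omega> (Suc k))" for k
  proof (induction k)
    case 0
    obtain U where "Theta \<M> \<subseteq> U" "\<forall>\<theta>\<in>U. (\<lambda>\<eta>. Xhat1 \<M> \<eta> \<omega>) differentiable (at \<theta>)"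
      using B \<omega> unfolding assumption_B_def by meson
    then have "(\<lambda>\<eta>. Xhat1 \<M> \<eta> \<omega>) differentiable_on Theta \<M>"
      unfolding differentiable_on_def by (meson differentiable_at_withinI subsetD)
    then show ?case by (simp add: differentiable_imp_continuous_on)
  next
    case (Suc k)
    then show ?case unfolding Xhat.simps by (intro continuous_on_add mv fc continuous_on_const)
  qed
  have e: "continuous_on (Theta \<M>) (\<lambda>\<theta>. eps_hat \<M> \<theta> \<omega> k)" for k
  proof -
    have "continuous_on (Theta \<M>) (\<lambda>\<theta>. Xhat \<M> \<theta> \<omega> k)" using X by (cases k) simp_all
    then show ?thesis unfolding eps_hat_def
      by (intro continuous_on_diff mv model_matrix_continuous[OF A] continuous_on_const)
  qed
  have "continuous_on (Theta \<M>) (\<lambda>\<theta>. ln (det (V_mat \<M> \<theta>)))"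
    by (intro continuous_on_ln continuous_on_det fc) (use V_mat_posdef(3)[OF ms A] in force)
  then show ?thesis unfolding Lhat_def
    by (intro continuous_on_mult_left continuous_on_sum continuous_on_add continuous_on_const continuous_on_inner mv e fc)
qed

text \<open>By continuity the infimum over S equals that over a countable dense subset; extended
  reals also give the empty infimum a value.\<close>

lemma borel_measurable_INF_continuous:
  fixes f :: "'p::{metric_space,second_countable_topology} \<Rightarrow> 'w \<Rightarrow> real"
  assumes cont: "\<And>\<omega>. \<omega> \<in> space M \<Longrightarrow> continuous_on S (\<lambda>p. f p \<omega>)"
    and meas: "\<And>p. p \<in> S \<Longrightarrow> f p \<in> borel_measurable M"
  shows "(\<lambda>\<omega>. INF p\<in>S. ereal (f p \<omega>)) \<in> borel_measurable M"
proof -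
  obtain T where T: "countable T" "T \<subseteq> S" "S \<subseteq> closure T" using separable[of S] by blast
  have "(INF p\<in>S. ereal (f p \<omega>)) = (INF p\<in>T. ereal (f p \<omega>))" if \<omega>: "\<omega> \<in> space M" for \<omega>
  proof (rule antisym)
    show "(INF p\<in>S. ereal (f p \<omega>)) \<le> (INF p\<in>T. ereal (f p \<omega>))" by (rule INF_superset_mono[OF T(2)]) simp
    show "(INF p\<in>T. ereal (f p \<omega>)) \<le> (INF p\<in>S. ereal (f p \<omega>))"
    proof (rule INF_greatest)
      fix p assume p: "p \<in> S"
      then obtain t where t: "\<And>n. t n \<in> T" "t \<longlonglongrightarrow> p" using T(3) closure_sequential by (metis subsetD)
      have "(\<lambda>n. f (t n) \<omega>) \<longlonglongrightarrow> f p \<omega>"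
        using cont[OF \<omega>] t T(2) p unfolding continuous_on_sequentially comp_def by blast
      then have "(\<lambda>n. ereal (f (t n) \<omega>)) \<longlonglongrightarrow> ereal (f p \<omega>)" by (rule tendsto_ereal)
      then show "(INF p\<in>T. ereal (f p \<omega>)) \<le> ereal (f p \<omega>)"
        by (rule LIMSEQ_le_const) (auto intro!: INF_lower t(1))
    qed
  qed
  then have "(\<lambda>\<omega>. INF p\<in>S. ereal (f p \<omega>)) \<in> borel_measurable M \<longleftrightarrow> (\<lambda>\<omega>. INF p\<in>T. ereal (f p \<omega>)) \<in> borel_measurable M"
    by (rule measurable_cong)
  also have \<dots> by (intro borel_measurable_INF T(1) borel_measurable_ereal meas) (use T(2) in blast)
  finally show ?thesis .
qed

text \<open>Markov's inequality for the envelope. The exceptional set is defined by the envelope, so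
  it is measurable and the same for all \<open>\<theta>\<close>.\<close>

lemma residual_energy_bounded_in_probability:
  fixes \<M> :: "('w, 's1::finite, 's2::finite, 'c::finite, 'k::finite, 'd::{finite,linorder},
                'e::{finite,linorder}, 'm::finite) coint_model"
  assumes ms: "model_setting \<M>" and A: "assumption_A \<M>" and B: "assumption_B \<M>" and \<epsilon>: "0 < \<epsilon>"
  shows "\<exists>K>0. \<exists>D. (\<forall>n\<ge>1. D n \<in> sets (Pr \<M>) \<and> measure (Pr \<M>) (D n) \<le> \<epsilon> \<and>
    (\<forall>\<omega>\<in>space (Pr \<M>) - D n. \<forall>\<theta>\<in>Theta \<M>. residual_energy \<M> \<theta> n \<omega> \<le> K * real n))"
proof -
  interpret prob_space "Pr \<M>" by (rule model_basics(1)[OF ms A])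
  note env = residual_envelope_mean[OF ms A B]
  obtain c where c: "\<And>n. 1 \<le> n \<Longrightarrow> (\<integral>\<^sup>+\<omega>. residual_envelope \<M> n \<omega> \<partial>Pr \<M>) \<le> ennreal (c * real n)" using env(2) by blast
  \<comment> \<open>The added 1 keeps K positive, and \<open>\<bar>c\<bar> / K\<close> is still at
    most \<open>\<epsilon>\<close>.\<close>
  define K where "K = (\<bar>c\<bar> + 1) / \<epsilon>"
  have K: "0 < K" "\<bar>c\<bar> / K \<le> \<epsilon>" using \<epsilon> by (auto simp: K_def field_simps)
  define D where "D n = {\<omega>\<in>space (Pr \<M>). 1 \<le> ennreal (1 / (K * real n)) * residual_envelope \<M> n \<omega>}" for n
  have "D n \<in> events \<and> prob (D n) \<le> \<epsilon> \<and>
    (\<forall>\<omega>\<in>space (Pr \<M>) - D n. \<forall>\<theta>\<in>Theta \<M>. residual_energy \<M> \<theta> n \<omega> \<le> K * real n)" if n: "1 \<le> n" for n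
  proof (intro conjI ballI)
    have n0: "0 < K * real n" using K n by simp
    note [measurable] = env(1)
    show "D n \<in> events" unfolding D_def by measurable
    have "emeasure (Pr \<M>) (D n) \<le> ennreal (1 / (K * real n)) * (\<integral>\<^sup>+\<omega>. residual_envelope \<M> n \<omega> * indicator (space (Pr \<M>)) \<omega> \<partial>Pr \<M>)"
      unfolding D_def by (rule nn_integral_Markov_inequality) simp_all
    also have "(\<integral>\<^sup>+\<omega>. residual_envelope \<M> n \<omega> * indicator (space (Pr \<M>)) \<omega> \<partial>Pr \<M>) = (\<integral>\<^sup>+\<omega>. residual_envelope \<M> n \<omega> \<partial>Pr \<M>)"
      by (intro nn_integral_cong) simp
    also have "ennreal (1 / (K * real n)) * \<dots> \<le> ennreal (1 / (K * real n)) * ennreal (\<bar>c\<bar> * real n)"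
      using n by (intro mult_left_mono order_trans[OF c[OF n]] ennreal_leI mult_right_mono) auto
    also have "\<dots> = ennreal (\<bar>c\<bar> / K)" using n n0 by (simp add: ennreal_mult[symmetric])
    finally have "emeasure (Pr \<M>) (D n) \<le> ennreal \<epsilon>" using K(2) by (meson ennreal_leI order_trans)
    then show "prob (D n) \<le> \<epsilon>" using \<epsilon> by (simp add: emeasure_eq_measure)
    fix \<omega> \<theta> assume \<omega>: "\<omega> \<in> space (Pr \<M>) - D n" and \<theta>: "\<theta> \<in> Theta \<M>"
    have "ennreal (1 / (K * real n) * residual_energy \<M> \<theta> n \<omega>) = ennreal (1 / (K * real n)) * ennreal (residual_energy \<M> \<theta> n \<omega>)"
      using n0 by (intro ennreal_mult'') (simp add: residual_energy_def sum_nonneg)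
    also have "\<dots> \<le> ennreal (1 / (K * real n)) * residual_envelope \<M> n \<omega>"
      by (intro mult_left_mono residual_energy_le_envelope[OF \<theta>]) simp
    also have "\<dots> < ennreal 1" using \<omega> unfolding D_def by (simp add: not_le)
    finally have "1 / (K * real n) * residual_energy \<M> \<theta> n \<omega> < 1" by (simp add: ennreal_less_iff residual_energy_def sum_nonneg)
    then show "residual_energy \<M> \<theta> n \<omega> \<le> K * real n" using n0 by (simp add: field_simps)
  qed
  then show ?thesis using K(1) by blast
qed

theorem theorem3p1:
  fixes \<M> :: "('w, 's1::finite, 's2::finite, 'c::finite, 'k::finite, 'd::{finite,linorder},
                'e::{finite,linorder}, 'm::finite) coint_model"
    and \<delta> :: real
  assumes "model_setting \<M>"
    and "assumption_A \<M>"
    and "assumption_B \<M>"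
    and "assumption_C \<M>"
    and "assumption_D \<M>"
    and "\<delta> > 0"
  shows "(\<lambda>n. measure (Pr \<M>) {\<omega> \<in> space (Pr \<M>).
            (INF \<theta>\<in>Bbar \<M> \<delta> \<times> Theta2 \<M>. ereal (Lhat \<M> n \<theta> \<omega>))
              - ereal (Lhat \<M> n (true_par \<M>) \<omega>) > 0}) \<longlonglongrightarrow> 1"
proof -
  note ms = assms(1) and A = assms(2) and B = assms(3) and C = assms(4) and \<delta> = assms(6)
  interpret prob_space "Pr \<M>" by (rule model_basics(1)[OF ms A])
  define S where "S = Bbar \<M> \<delta> \<times> Theta2 \<M>"
  define E where "E n = {\<omega> \<in> space (Pr \<M>). (INF \<theta>\<in>S. ereal (Lhat \<M> n \<theta> \<omega>)) - ereal (Lhat \<M> n (true_par \<M>) \<omega>) > 0}" for n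
  have S: "\<theta> \<in> Theta \<M>" "\<delta> \<le> norm (fst \<theta> - true1 \<M>)" if "\<theta> \<in> S" for \<theta>
    using that by (auto simp: S_def Bbar_def Theta_def)
  have E: "E n \<in> events" for n
  proof -
    have [measurable]: "(\<lambda>\<omega>. INF \<theta>\<in>S. ereal (Lhat \<M> n \<theta> \<omega>)) \<in> borel_measurable (Pr \<M>)"
      by (rule borel_measurable_INF_continuous[OF continuous_on_subset[OF continuous_on_Lhat[OF ms A B]] measurable_Lhat[OF ms A]])
        (use S in blast)+
    have [measurable]: "Lhat \<M> n (true_par \<M>) \<in> borel_measurable (Pr \<M>)"
      by (rule measurable_Lhat[OF ms A model_basics(4)[OF ms A]])
    show ?thesis unfolding E_def by measurable
  qed
  obtain \<mu> where \<mu>: "0 < \<mu>" "\<And>v. \<mu> * (norm v)\<^sup>2 \<le> (\<integral>\<omega>. (v \<bullet> Levy \<M> (true2 \<M>) 1 \<omega>)\<^sup>2 \<partial>Pr \<M>)"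
    using true_levy(2)[OF ms A] by blast
  \<comment> \<open>K comes from the residual energy, \<open>\<kappa>\<close> from K, and only then
    the event with enough trend energy. Each of the two exceptional events is allotted half of
    \<open>\<epsilon>\<close>.\<close>
  have lim: "\<exists>n0. \<forall>n\<ge>n0. 1 - \<epsilon> < prob (E n)" if \<epsilon>: "0 < \<epsilon>" for \<epsilon>
  proof -
    obtain K D where K: "0 < K" and "\<forall>n\<ge>1. D n \<in> events \<and> prob (D n) \<le> \<epsilon> / 2 \<and>
        (\<forall>\<omega>\<in>space (Pr \<M>) - D n. \<forall>\<theta>\<in>Theta \<M>. residual_energy \<M> \<theta> n \<omega> \<le> K * real n)"
      using residual_energy_bounded_in_probability[OF ms A B half_gt_zero[OF \<epsilon>]] by (elim exE conjE) (rule that)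
    then have D: "\<And>n. 1 \<le> n \<Longrightarrow> D n \<in> events" "\<And>n. 1 \<le> n \<Longrightarrow> prob (D n) \<le> \<epsilon> / 2"
      "\<And>n \<omega> \<theta>. 1 \<le> n \<Longrightarrow> \<omega> \<in> space (Pr \<M>) - D n \<Longrightarrow> \<theta> \<in> Theta \<M> \<Longrightarrow> residual_energy \<M> \<theta> n \<omega> \<le> K * real n"
      by blast+
    obtain \<kappa> where gap: "\<And>\<theta> n \<omega>. \<theta> \<in> Theta \<M> \<Longrightarrow> 1 \<le> n \<Longrightarrow> \<delta> \<le> norm (fst \<theta> - true1 \<M>) \<Longrightarrow>
      residual_energy \<M> \<theta> n \<omega> \<le> K * real n \<Longrightarrow> residual_energy \<M> (true_par \<M>) n \<omega> \<le> K * real n \<Longrightarrow>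
      \<kappa> * (norm (trend_response \<M> \<theta>))\<^sup>2 * real n
        \<le> (\<Sum>k=1..n. (norm (trend_response \<M> \<theta> *v Levy \<M> (true2 \<M>) (real k * mesh \<M>) \<omega>))\<^sup>2) \<Longrightarrow>
      Lhat \<M> n (true_par \<M>) \<omega> + 1 \<le> Lhat \<M> n \<theta> \<omega>"
      using likelihood_gap[OF ms A C \<delta> K] by blast
    obtain G N where "(\<forall>n. G n \<in> events) \<and> (\<lambda>n. prob (G n)) \<longlonglongrightarrow> 1 \<and>
        (\<forall>n\<ge>N. \<forall>\<omega>\<in>G n. \<forall>P :: (real^'m, 'd) vec. \<kappa> * (norm P)\<^sup>2 * real n
          \<le> (\<Sum>k=1..n. (norm (P *v Levy \<M> (true2 \<M>) (real k * mesh \<M>) \<omega>))\<^sup>2))"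
      using trend_energy_diverges[OF true_levy(1)[OF ms A] model_basics(2)[OF ms A] \<mu>, where \<kappa>=\<kappa> and 'd='d] by (elim exE) (rule that)
    then have G: "\<And>n. G n \<in> events" "(\<lambda>n. prob (G n)) \<longlonglongrightarrow> 1"
      and div: "\<And>n \<omega> (P :: (real^'m, 'd) vec). N \<le> n \<Longrightarrow> \<omega> \<in> G n \<Longrightarrow>
        \<kappa> * (norm P)\<^sup>2 * real n \<le> (\<Sum>k=1..n. (norm (P *v Levy \<M> (true2 \<M>) (real k * mesh \<M>) \<omega>))\<^sup>2)"
      by blast+
    have "\<forall>\<^sub>F n in sequentially. 1 - \<epsilon> / 2 < prob (G n)" by (rule order_tendstoD(1)[OF G(2)]) (use \<epsilon> in simp)
    then obtain N' where N': "\<And>n. N' \<le> n \<Longrightarrow> 1 - \<epsilon> / 2 < prob (G n)" unfolding eventually_sequentially by blast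
    have "1 - \<epsilon> < prob (E n)" if n: "max (max N N') 1 \<le> n" for n
    proof -
      have n': "1 \<le> n" "N \<le> n" "N' \<le> n" using n by auto
      have "\<omega> \<in> E n" if \<omega>: "\<omega> \<in> G n - D n" for \<omega>
      proof -
        have sp: "\<omega> \<in> space (Pr \<M>) - D n" using \<omega> sets.sets_into_space[OF G(1)] by blast
        \<comment> \<open>The margin 1 survives the infimum, which need not be attained; strict
          inequality for each \<open>\<theta>\<close> would not.\<close>
        have "ereal (Lhat \<M> n (true_par \<M>) \<omega> + 1) \<le> (INF \<theta>\<in>S. ereal (Lhat \<M> n \<theta> \<omega>))"
        proof (rule INF_greatest)
          fix \<theta> assume "\<theta> \<in> S"
          then show "ereal (Lhat \<M> n (true_par \<M>) \<omega> + 1) \<le> ereal (Lhat \<M> n \<theta> \<omega>)"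
            using gap[OF S(1) n'(1) S(2) D(3)[OF n'(1) sp S(1)] D(3)[OF n'(1) sp model_basics(4)[OF ms A]] div[OF n'(2)]] \<omega>
            by simp
        qed
        \<comment> \<open>The infimum is real or, over the empty set, \<infinity>; the lower bound
          excludes minus infinity.\<close>
        then have "0 < (INF \<theta>\<in>S. ereal (Lhat \<M> n \<theta> \<omega>)) - ereal (Lhat \<M> n (true_par \<M>) \<omega>)"
          by (cases "INF \<theta>\<in>S. ereal (Lhat \<M> n \<theta> \<omega>)") auto
        then show ?thesis using sp by (simp add: E_def)
      qed
      then have "G n \<subseteq> E n \<union> D n" by blast
      then have "prob (G n) \<le> prob (E n \<union> D n)" using E D(1)[OF n'(1)] by (intro finite_measure_mono) auto
      also have "\<dots> \<le> prob (E n) + prob (D n)" by (rule measure_Un_le[OF E D(1)[OF n'(1)]])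
      finally show ?thesis using N'[OF n'(3)] D(2)[OF n'(1)] by simp
    qed
    then show ?thesis by blast
  qed
  have "(\<lambda>n. prob (E n)) \<longlonglongrightarrow> 1"
  proof (rule LIMSEQ_I)
    fix r :: real assume "0 < r"
    then obtain n0 where "\<And>n. n0 \<le> n \<Longrightarrow> 1 - r < prob (E n)" using lim by blast
    moreover have "prob (E n) \<le> 1" for n by (rule prob_le_1)
    ultimately have "norm (prob (E n) - 1) < r" if "n0 \<le> n" for n
      using \<open>0 < r\<close> that by (simp add: abs_less_iff) (smt (verit))
    then show "\<exists>n0. \<forall>n\<ge>n0. norm (prob (E n) - 1) < r" by blast
  qed
  then show ?thesis unfolding E_def S_def .
qed

end
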